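(* Let $n\geq1$, let $F:[0,+\infty)\rightarrow\mathbb R$ be a continuous function bounded from below and let $\omega\subset\mathbb R^n$ be a measurable set. Assume that the sequence $\mathcal M^F=(M^F_k)_{k\geq0}$ defined by $M^F_k=\sup_{r\geq0}r^ke^{-F(r)}$ is a quasi-analytic sequence of positive real numbers (in particular every $M_k^F$ is finite). Then, for all positive times $T>0$, the diffusive equation $(E_F)$ associated with $F$ and $\omega$ is cost-uniformly approximately null-controllable from the control support $\omega$ in time $T$ if and only if $\omega$ is thick.
   Context: $L^2(\mathbb R^n)$ is the space of complex-valued square-integrable functions and $\mathbf 1_\omega$ is the characteristic function of $\omega$. $F(|D_x|)$ is the Fourier multiplier with symbol $F(|\xi|)$, where $|\cdot|$ is the Euclidean norm, and $(e^{-tF(|D_x|)})_{t\ge0}$ is the semigroup of Fourier multipliers with symbols $e^{-tF(|\xi|)}$. The control system $(E_F)$ is $$\partial_tf(t,x)+F(|D_x|)f(t,x)=h(t,x)\mathbf 1_\omega(x),\quad t>0,\ x\in\mathbb R^n,\qquad f(0,\cdot)=f_0\in L^2(\mathbb R^n),$$ with mild solution $f(t)=e^{-tF(|D_x|)}f_0+\int_0^te^{-(t-s)F(|D_x|)}\mathbf 1_\omega h(s)\,ds$. Cost-uniform approximate null-controllability: $(E_F)$ is approximately null-controllable with uniform cost (cost-uniformly approximately null-controllable) from $\omega$ in time $T>0$ if for all $\varepsilon>0$ there exists $C_{\varepsilon,T}>0$ such that for all $f_0\in L^2(\mathbb R^n)$ there exists a control $h\in L^2((0,T)\times\omega)$ such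 that the mild solution satisfies $\Vert f(T,\cdot)\Vert_{L^2(\mathbb R^n)}\le\varepsilon\Vert f_0\Vert_{L^2(\mathbb R^n)}$ and $\int_0^T\Vert h(t,\cdot)\Vert^2_{L^2(\omega)}\,dt\le C_{\varepsilon,T}\Vert f_0\Vert^2_{L^2(\mathbb R^n)}$. Quasi-analytic sequence: a sequence $\mathcal M=(M_k)_{k\ge0}$ of positive real numbers is quasi-analytic if for all real $a<b$, any function $f$ in the class $$\mathcal C_{\mathcal M}([a,b])=\{f\in C^\infty([a,b],\mathbb C):\forall k\ge0,\forall x\in[a,b],\ |f^{(k)}(x)|\le M_k\}$$ for which there exists $x_0\in[a,b]$ with $f^{(k)}(x_0)=0$ for all $k\ge0$ is identically zero. Thickness: given $\gamma\in(0,1)$ and $L>0$, a set $\omega\subset\mathbb R^n$ is $\gamma$-thick at scale $L$ if it is measurable and $\operatorname{Leb}(\omega\cap(x+[0,L]^n))\geq\gamma L^n$ for all $x\in\mathbb R^n$, where $\operatorname{Leb}$ is Lebesgue measure. It is thick if it is $\gamma$-thick at scale $L$ for some $\gamma\in(0,1)$ and $L>0$. *)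

theory Defs
  imports "HOL-Analysis.Analysis"
begin

section \<open>The Hilbert space of square-integrable functions\<close>

definition square_integrable :: "'a measure \<Rightarrow> ('a \<Rightarrow> complex) \<Rightarrow> bool" where
  "square_integrable M f \<longleftrightarrow>
     f \<in> borel_measurable M \<and> integrable M (\<lambda>x. (cmod (f x))\<^sup>2)"

lemma square_integrable_zero: "square_integrable M (\<lambda>x. 0)"
  by (simp add: square_integrable_def)

lemma square_integrable_inner:
  assumes "square_integrable M f" "square_integrable M g"
  shows "integrable M (\<lambda>x. f x \<bullet> g x)"
proof (rule Bochner_Integration.integrable_bound)
  show "integrable M (\<lambda>x. (cmod (f x))\<^sup>2 + (cmod (g x))\<^sup>2)"
    using assms by (auto simp: square_integrable_def)
  show "(\<lambda>x. f x \<bullet> g x) \<in> borel_measurable M"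
    using assms by (auto simp: square_integrable_def)
  have "\<bar>a \<bullet> b\<bar> \<le> (cmod a)\<^sup>2 + (cmod b)\<^sup>2" for a b :: complex
  proof -
    have "\<bar>a \<bullet> b\<bar> \<le> cmod a * cmod b" by (rule Cauchy_Schwarz_ineq2)
    also have "\<dots> \<le> 2 * (cmod a * cmod b)" by simp
    also have "\<dots> \<le> (cmod a)\<^sup>2 + (cmod b)\<^sup>2"
      using sum_squares_bound[of "cmod a" "cmod b"] by simp
    finally show ?thesis .
  qed
  then show "AE x in M. norm (f x \<bullet> g x) \<le> norm ((cmod (f x))\<^sup>2 + (cmod (g x))\<^sup>2)"
    by (intro AE_I2) (smt (verit) real_norm_def zero_le_power2)
qed

lemma square_integrable_add:
  assumes "square_integrable M f" "square_integrable M g"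
  shows "square_integrable M (\<lambda>x. f x + g x)"
proof -
  have "(cmod (f x + g x))\<^sup>2 = (cmod (f x))\<^sup>2 + 2 * (f x \<bullet> g x) + (cmod (g x))\<^sup>2" for x
    by (simp add: power2_norm_eq_inner inner_add_left inner_add_right inner_commute)
  then show ?thesis
    using assms square_integrable_inner[OF assms] by (auto simp: square_integrable_def)
qed

lemma square_integrable_scaleR:
  assumes "square_integrable M f"
  shows "square_integrable M (\<lambda>x. c *\<^sub>R f x)"
  using assms by (auto simp: square_integrable_def power_mult_distrib)

lemma square_integrable_diff:
  assumes "square_integrable M f" "square_integrable M g"
  shows "square_integrable M (\<lambda>x. f x - g x)"
  using square_integrable_add[OF assms(1) square_integrable_scaleR[OF assms(2), of "-1"]] by simp

definition L2_rel :: "('a::euclidean_space \<Rightarrow> complex) \<Rightarrow> ('a \<Rightarrow> complex) \<Rightarrow> bool" where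
  "L2_rel f g \<longleftrightarrow> square_integrable lebesgue f \<and> square_integrable lebesgue g \<and>
     (AE x in lebesgue. f x = g x)"

lemma part_equivp_L2_rel: "part_equivp L2_rel"
proof (rule part_equivpI)
  show "\<exists>f. L2_rel f f"
    using square_integrable_zero by (auto simp: L2_rel_def intro!: exI[of _ "\<lambda>_. 0"])
  show "symp L2_rel"
    by (rule sympI) (auto simp: L2_rel_def)
  show "transp L2_rel"
    by (rule transpI) (auto simp: L2_rel_def)
qed

quotient_type (overloaded) 'a L2 = "'a::euclidean_space \<Rightarrow> complex" / partial: L2_rel
  by (rule part_equivp_L2_rel)

instantiation L2 :: (euclidean_space) real_inner
begin

lift_definition zero_L2 :: "'a L2" is "\<lambda>_. 0"
  by (simp add: L2_rel_def square_integrable_zero)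

lift_definition plus_L2 :: "'a L2 \<Rightarrow> 'a L2 \<Rightarrow> 'a L2" is "\<lambda>f g x. f x + g x"
  by (auto simp: L2_rel_def square_integrable_add)

lift_definition minus_L2 :: "'a L2 \<Rightarrow> 'a L2 \<Rightarrow> 'a L2" is "\<lambda>f g x. f x - g x"
  by (auto simp: L2_rel_def square_integrable_diff)

lift_definition uminus_L2 :: "'a L2 \<Rightarrow> 'a L2" is "\<lambda>f x. - f x"
  using square_integrable_scaleR[where c="-1"] by (auto simp: L2_rel_def)

lift_definition scaleR_L2 :: "real \<Rightarrow> 'a L2 \<Rightarrow> 'a L2" is "\<lambda>c f x. c *\<^sub>R f x"
  by (auto simp: L2_rel_def square_integrable_scaleR)

lift_definition norm_L2 :: "'a L2 \<Rightarrow> real"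
  is "\<lambda>f. sqrt (LINT x|lebesgue. (cmod (f x))\<^sup>2)"
  by (auto simp: L2_rel_def square_integrable_def intro!: integral_cong_AE)

text \<open>The real part of the Hermitian inner product, \<open>z \<bullet> w = Re (z * cnj w)\<close> on \<open>complex\<close>.\<close>

lift_definition inner_L2 :: "'a L2 \<Rightarrow> 'a L2 \<Rightarrow> real"
  is "\<lambda>f g. LINT x|lebesgue. f x \<bullet> g x"
  by (auto simp: L2_rel_def square_integrable_def intro!: integral_cong_AE)

definition sgn_L2 :: "'a L2 \<Rightarrow> 'a L2" where
  "sgn_L2 f = inverse (norm f) *\<^sub>R f"

definition dist_L2 :: "'a L2 \<Rightarrow> 'a L2 \<Rightarrow> real" where
  "dist_L2 f g = norm (f - g)"

definition uniformity_L2 :: "('a L2 \<times> 'a L2) filter" where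
  "uniformity_L2 = (INF e\<in>{0<..}. principal {(f, g). dist f g < e})"

definition open_L2 :: "'a L2 set \<Rightarrow> bool" where
  "open_L2 U \<longleftrightarrow> (\<forall>f\<in>U. eventually (\<lambda>(f', g). f' = f \<longrightarrow> g \<in> U) uniformity)"

instance
proof
  fix f g h :: "'a L2" and a b :: real
  show "f + g + h = f + (g + h)"
    by transfer (auto simp: L2_rel_def square_integrable_add add.assoc)
  show "f + g = g + f"
    by transfer (auto simp: L2_rel_def square_integrable_add add.commute)
  show "0 + f = f"
    by transfer (auto simp: L2_rel_def)
  show "- f + f = 0"
    by transfer (auto simp: L2_rel_def square_integrable_zero)
  show "f - g = f + - g"
    by transfer (auto simp: L2_rel_def square_integrable_diff)
  show "a *\<^sub>R (f + g) = a *\<^sub>R f + a *\<^sub>R g"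
    by transfer (auto simp: L2_rel_def square_integrable_scaleR square_integrable_add
        scaleR_add_right)
  show "(a + b) *\<^sub>R f = a *\<^sub>R f + b *\<^sub>R f"
    by transfer (auto simp: L2_rel_def square_integrable_scaleR square_integrable_add
        scaleR_add_left)
  show "a *\<^sub>R b *\<^sub>R f = (a * b) *\<^sub>R f"
    by transfer (auto simp: L2_rel_def square_integrable_scaleR)
  show "1 *\<^sub>R f = f"
    by transfer (auto simp: L2_rel_def)
  show "sgn f = inverse (norm f) *\<^sub>R f" by (rule sgn_L2_def)
  show "dist f g = norm (f - g)" by (rule dist_L2_def)
  show "uniformity = (INF e\<in>{0<..}. principal {(f, g::'a L2). dist f g < e})"
    by (rule uniformity_L2_def)
  show "open U \<longleftrightarrow> (\<forall>f\<in>U. eventually (\<lambda>(f', g). f' = f \<longrightarrow> g \<in> U) uniformity)"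
    for U :: "'a L2 set"
    by (rule open_L2_def)
  show "f \<bullet> g = g \<bullet> f"
    by transfer (simp add: inner_commute)
  show "(f + g) \<bullet> h = f \<bullet> h + g \<bullet> h"
    by transfer (simp add: L2_rel_def inner_add_left square_integrable_inner)
  show "(a *\<^sub>R f) \<bullet> g = a * (f \<bullet> g)"
    by transfer simp
  show "0 \<le> f \<bullet> f"
    by transfer simp
  show "f \<bullet> f = 0 \<longleftrightarrow> f = 0"
  proof transfer
    fix f :: "'a \<Rightarrow> complex" assume f: "L2_rel f f"
    then have "(LINT x|lebesgue. f x \<bullet> f x) = 0 \<longleftrightarrow> (AE x in lebesgue. f x \<bullet> f x = 0)"
      by (intro integral_nonneg_eq_0_iff_AE square_integrable_inner) (auto simp: L2_rel_def)
    then show "(LINT x|lebesgue. f x \<bullet> f x) = 0 \<longleftrightarrow> L2_rel f (\<lambda>_. 0)"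
      using f by (simp add: L2_rel_def square_integrable_zero)
  qed
  show "norm f = sqrt (f \<bullet> f)"
    by transfer (simp add: power2_norm_eq_inner)
qed

end

text \<open>The class of \<open>f\<close>; the junk value \<open>0\<close> if \<open>f\<close> is not square-integrable.\<close>

definition to_L2 :: "('a::euclidean_space \<Rightarrow> complex) \<Rightarrow> 'a L2" where
  "to_L2 f = (if square_integrable lebesgue f then abs_L2 f else 0)"

lemma square_integrable_rep_L2: "square_integrable lebesgue (rep_L2 F)"
  using Quotient_rep_reflp[OF Quotient_L2, of F] by (simp add: L2_rel_def)

lemma to_L2_rep_L2: "to_L2 (rep_L2 F) = F"
  using Quotient_abs_rep[OF Quotient_L2] by (simp add: to_L2_def square_integrable_rep_L2)

lemma norm_to_L2:
  assumes "square_integrable lebesgue f"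
  shows "norm (to_L2 f) = sqrt (LINT x|lebesgue. (cmod (f x))\<^sup>2)"
  using assms by (simp add: to_L2_def norm_L2.abs_eq L2_rel_def)

lemma to_L2_diff:
  assumes "square_integrable lebesgue f" "square_integrable lebesgue g"
  shows "to_L2 (\<lambda>x. f x - g x) = to_L2 f - to_L2 g"
  using assms by (simp add: to_L2_def minus_L2.abs_eq L2_rel_def square_integrable_diff)

lemma to_L2_add:
  assumes "square_integrable lebesgue f" "square_integrable lebesgue g"
  shows "to_L2 (\<lambda>x. f x + g x) = to_L2 f + to_L2 g"
  using assms by (simp add: to_L2_def plus_L2.abs_eq L2_rel_def square_integrable_add)

lemma to_L2_scaleR:
  assumes "square_integrable lebesgue f"
  shows "to_L2 (\<lambda>x. c *\<^sub>R f x) = c *\<^sub>R to_L2 f"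
  using assms by (simp add: to_L2_def scaleR_L2.abs_eq L2_rel_def square_integrable_scaleR)

lemma nn_integral_norm_to_L2:
  assumes "square_integrable lebesgue f"
  shows "(\<integral>\<^sup>+x. ennreal ((cmod (f x))\<^sup>2) \<partial>lebesgue) = ennreal ((norm (to_L2 f))\<^sup>2)"
  using assms
  by (subst nn_integral_eq_integral) (auto simp: square_integrable_def norm_to_L2)

lemma square_integrableI_nn:
  assumes "f \<in> borel_measurable M" "(\<integral>\<^sup>+x. ennreal ((cmod (f x))\<^sup>2) \<partial>M) < \<infinity>"
  shows "square_integrable M f"
  using assms by (auto simp: square_integrable_def intro!: integrableI_nonneg)

lemma to_L2_tendsto_nn:
  assumes s: "\<And>i. square_integrable lebesgue (s i)" and f: "square_integrable lebesgue f"
    and lim: "(\<lambda>i. \<integral>\<^sup>+x. ennreal ((cmod (s i x - f x))\<^sup>2) \<partial>lebesgue) \<longlonglongrightarrow> 0"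
  shows "(\<lambda>i. to_L2 (s i)) \<longlonglongrightarrow> to_L2 f"
proof -
  have "(\<lambda>i. ennreal ((norm (to_L2 (s i) - to_L2 f))\<^sup>2)) \<longlonglongrightarrow> ennreal 0"
    using lim nn_integral_norm_to_L2[OF square_integrable_diff[OF s f]]
    by (simp add: to_L2_diff s f)
  then have "(\<lambda>i. (norm (to_L2 (s i) - to_L2 f))\<^sup>2) \<longlonglongrightarrow> 0"
    by (subst (asm) tendsto_ennreal_iff) auto
  then have "(\<lambda>i. sqrt ((norm (to_L2 (s i) - to_L2 f))\<^sup>2)) \<longlonglongrightarrow> sqrt 0"
    by (rule tendsto_real_sqrt)
  then show ?thesis
    by (simp add: LIM_zero_iff tendsto_norm_zero_iff)
qed

subsection \<open>Completeness\<close>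

lemma summable_of_nn_suminf:
  fixes d :: "nat \<Rightarrow> complex"
  assumes "(\<Sum>k. ennreal (4 ^ k * (cmod (d k))\<^sup>2)) < \<infinity>"
  shows "summable d"
proof (rule summable_norm_cancel)
  have sm: "summable (\<lambda>k. 4 ^ k * (cmod (d k))\<^sup>2)"
    using assms by (intro summable_suminf_not_top) auto
  then obtain C where C: "\<And>k. norm (4 ^ k * (cmod (d k))\<^sup>2) \<le> C"
    using convergent_imp_bounded[OF summable_LIMSEQ_zero[OF sm]] by (auto simp: bounded_iff)
  have four: "((2::real) ^ k)\<^sup>2 = 4 ^ k" for k :: nat
    by (simp add: power2_eq_square flip: power_mult_distrib)
  have le: "cmod (d k) \<le> sqrt C * (1/2) ^ k" for k
  proof -
    have "(2 ^ k * cmod (d k))\<^sup>2 \<le> C"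
      using C[of k] four[of k] by (simp add: power_mult_distrib)
    then have "2 ^ k * cmod (d k) \<le> sqrt C" by (rule real_le_rsqrt)
    then show ?thesis by (simp add: field_simps power_divide)
  qed
  show "summable (\<lambda>k. norm (d k))"
    by (rule summable_comparison_test'[where N=0 and g="\<lambda>k. sqrt C * (1/2) ^ k"])
      (use le in \<open>auto intro!: summable_mult summable_geometric\<close>)
qed

instance L2 :: (euclidean_space) banach
proof
  fix X :: "nat \<Rightarrow> 'a L2"
  assume X: "Cauchy X"
  have "\<exists>r. \<forall>k. (\<forall>m\<ge>r k. \<forall>n\<ge>r k. norm (X m - X n) < (1/4) ^ k) \<and> (0 < k \<longrightarrow> r (k - 1) < r k)"
  proof -
    have 1: "\<exists>N. \<forall>m\<ge>N. \<forall>n\<ge>N. norm (X m - X n) < (1/4::real) ^ k" for k :: nat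
      using CauchyD[OF X, of "(1/4) ^ k"] by auto
    then obtain N where N: "\<And>k m n. m \<ge> N k \<Longrightarrow> n \<ge> N k \<Longrightarrow> norm (X m - X n) < (1/4::real) ^ k"
      by metis
    define r where "r k = (\<Sum>j\<le>k. Suc (N j))" for k
    have "r k \<ge> N k" for k by (cases k) (auto simp: r_def)
    moreover have "0 < k \<Longrightarrow> r (k - 1) < r k" for k by (cases k) (auto simp: r_def)
    ultimately show ?thesis using N by (intro exI[of _ r]) (meson order_trans)
  qed
  then obtain r where r: "\<And>k m n. m \<ge> r k \<Longrightarrow> n \<ge> r k \<Longrightarrow> norm (X m - X n) < (1/4::real) ^ k"
    and rr: "\<And>k. 0 < k \<Longrightarrow> r (k - 1) < r k" by metis
  have smono: "strict_mono r"
    using rr[of "Suc _"] by (auto simp: strict_mono_Suc_iff)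
  define f where "f k = rep_L2 (X (r k))" for k
  have f: "square_integrable lebesgue (f k)" for k
    by (simp add: f_def square_integrable_rep_L2)
  have fm [measurable]: "f k \<in> borel_measurable lebesgue" for k
    using f by (simp add: square_integrable_def)
  have to_f: "to_L2 (f k) = X (r k)" for k by (simp add: f_def to_L2_rep_L2)
  define d where "d k x = f (Suc k) x - f k x" for k x
  have d: "(\<integral>\<^sup>+x. ennreal ((cmod (f m x - f k x))\<^sup>2) \<partial>lebesgue) \<le> ennreal ((1/16) ^ k)" if "k \<le> m" for k m
  proof -
    have "norm (X (r m) - X (r k)) \<le> (1/4) ^ k"
      using r[of k "r m" "r k"] that smono by (simp add: strict_mono_less_eq less_imp_le)
    then have "(norm (X (r m) - X (r k)))\<^sup>2 \<le> ((1/4) ^ k)\<^sup>2"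
      by (intro power_mono) auto
    also have "\<dots> = ((1/4)\<^sup>2) ^ k" by (simp only: power_mult[symmetric] mult.commute)
    also have "\<dots> = (1/16) ^ k" by (simp add: power2_eq_square)
    finally show ?thesis
      using nn_integral_norm_to_L2[OF square_integrable_diff[OF f f], of m k]
      by (simp add: to_L2_diff f to_f ennreal_leI)
  qed
  have "(\<integral>\<^sup>+x. (\<Sum>k. ennreal (4 ^ k * (cmod (d k x))\<^sup>2)) \<partial>lebesgue)
      = (\<Sum>k. \<integral>\<^sup>+x. ennreal (4 ^ k * (cmod (d k x))\<^sup>2) \<partial>lebesgue)"
    unfolding d_def by (rule nn_integral_suminf) measurable
  also have "\<dots> = (\<Sum>k. ennreal (4 ^ k) * (\<integral>\<^sup>+x. ennreal ((cmod (d k x))\<^sup>2) \<partial>lebesgue))"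
    unfolding d_def by (subst nn_integral_cmult[symmetric]) (auto simp: ennreal_mult)
  also have "\<dots> \<le> (\<Sum>k. ennreal (4 ^ k) * ennreal ((1/16) ^ k))"
    unfolding d_def by (intro suminf_le mult_left_mono d) auto
  also have "\<dots> = (\<Sum>k. ennreal ((1/4) ^ k))"
    by (simp add: ennreal_mult[symmetric] power_mult_distrib[symmetric])
  also have "\<dots> < \<infinity>"
    by (subst suminf_ennreal2) (auto intro!: summable_geometric)
  finally have "(\<integral>\<^sup>+x. (\<Sum>k. ennreal (4 ^ k * (cmod (d k x))\<^sup>2)) \<partial>lebesgue) < \<infinity>" .
  then have "AE x in lebesgue. (\<Sum>k. ennreal (4 ^ k * (cmod (d k x))\<^sup>2)) \<noteq> \<infinity>"
    unfolding d_def by (intro nn_integral_noteq_infinite) auto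
  then have ae: "AE x in lebesgue. convergent (\<lambda>k. f k x)"
  proof eventually_elim
    case (elim x)
    then have "summable (\<lambda>k. d k x)"
      by (intro summable_of_nn_suminf) (auto simp: less_top)
    then have "convergent (\<lambda>n. f 0 x + (\<Sum>k<n. d k x))"
      by (simp add: summable_iff_convergent convergent_add_const_iff)
    moreover have "(\<Sum>k<n. d k x) = f n x - f 0 x" for n
      unfolding d_def by (rule sum_lessThan_telescope)
    ultimately show ?case by simp
  qed
  define g where "g x = lim (\<lambda>k. f k x)" for x
  have gm [measurable]: "g \<in> borel_measurable lebesgue"
    unfolding g_def by (rule borel_measurable_lim_metric) measurable
  have bound: "(\<integral>\<^sup>+x. ennreal ((cmod (g x - f k x))\<^sup>2) \<partial>lebesgue) \<le> ennreal ((1/16) ^ k)" for k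
  proof -
    have "(\<integral>\<^sup>+x. ennreal ((cmod (g x - f k x))\<^sup>2) \<partial>lebesgue)
        = (\<integral>\<^sup>+x. liminf (\<lambda>m. ennreal ((cmod (f m x - f k x))\<^sup>2)) \<partial>lebesgue)"
    proof (rule nn_integral_cong_AE, use ae in eventually_elim)
      case (elim x)
      then have "(\<lambda>m. f m x) \<longlonglongrightarrow> g x" by (simp add: g_def convergent_LIMSEQ_iff)
      then have "(\<lambda>m. ennreal ((cmod (f m x - f k x))\<^sup>2)) \<longlonglongrightarrow> ennreal ((cmod (g x - f k x))\<^sup>2)"
        by (intro tendsto_intros)
      then show ?case by (rule lim_imp_Liminf[OF sequentially_bot, symmetric])
    qed
    also have "\<dots> \<le> liminf (\<lambda>m. \<integral>\<^sup>+x. ennreal ((cmod (f m x - f k x))\<^sup>2) \<partial>lebesgue)"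
      by (rule nn_integral_liminf) measurable
    also have "\<dots> \<le> liminf (\<lambda>m::nat. ennreal ((1/16) ^ k))"
      by (intro Liminf_mono eventually_sequentiallyI[of k] d)
    finally show ?thesis by (simp add: Liminf_const)
  qed
  have "square_integrable lebesgue (\<lambda>x. g x - f 0 x)"
    using bound[of 0] by (intro square_integrableI_nn) (auto simp: less_top[symmetric] top_unique)
  from square_integrable_add[OF this f[of 0]] have g: "square_integrable lebesgue g" by simp
  have "(\<lambda>k. \<integral>\<^sup>+x. ennreal ((cmod (f k x - g x))\<^sup>2) \<partial>lebesgue) \<longlonglongrightarrow> 0"
  proof (rule tendsto_sandwich[OF _ _ tendsto_const])
    show "(\<lambda>k. ennreal ((1/16) ^ k)) \<longlonglongrightarrow> 0"
      using tendsto_ennrealI[OF LIMSEQ_realpow_zero[of "1/16"]] by simp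
    show "\<forall>\<^sub>F k in sequentially. (\<integral>\<^sup>+x. ennreal ((cmod (f k x - g x))\<^sup>2) \<partial>lebesgue) \<le> ennreal ((1/16) ^ k)"
      using bound by (simp add: norm_minus_commute)
  qed simp
  then have "(\<lambda>k. X (r k)) \<longlonglongrightarrow> to_L2 g"
    using to_L2_tendsto_nn[OF f g] by (simp add: to_f)
  then have "X \<longlonglongrightarrow> to_L2 g"
    using Cauchy_converges_subseq[OF X smono] by (simp add: o_def)
  then show "convergent X" by (auto simp: convergent_def)
qed

subsection \<open>Separability\<close>

lemma countable_rational_span:
  fixes G :: "'a::real_normed_vector set"
  assumes "countable G"
  obtains D where "countable D" "G \<subseteq> D" "subspace (closure D)"
proof
  define \<sigma> :: "(real \<times> 'a) list \<Rightarrow> 'a" where "\<sigma> xs = (\<Sum>(q, g)\<leftarrow>xs. q *\<^sub>R g)" for xs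
  define D where "D = \<sigma> ` lists (\<rat> \<times> G)"
  show "countable D"
    unfolding D_def using assms countable_rat by blast
  show "G \<subseteq> D"
  proof
    fix g assume "g \<in> G"
    then show "g \<in> D" by (auto simp: D_def \<sigma>_def intro!: image_eqI[of _ _ "[(1, g)]"])
  qed
  have D_add: "x + y \<in> D" if "x \<in> D" "y \<in> D" for x y
  proof -
    obtain xs ys where "xs \<in> lists (\<rat> \<times> G)" "ys \<in> lists (\<rat> \<times> G)" "x = \<sigma> xs" "y = \<sigma> ys"
      using \<open>x \<in> D\<close> \<open>y \<in> D\<close> by (auto simp: D_def)
    then show ?thesis
      unfolding D_def by (intro image_eqI[of _ _ "xs @ ys"]) (auto simp: \<sigma>_def)
  qed
  have D_scale: "c *\<^sub>R x \<in> D" if "c \<in> \<rat>" "x \<in> D" for c x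
  proof -
    obtain xs where xs: "xs \<in> lists (\<rat> \<times> G)" "x = \<sigma> xs"
      using \<open>x \<in> D\<close> by (auto simp: D_def)
    have "c *\<^sub>R \<sigma> xs = \<sigma> (map (\<lambda>(q, g). (c * q, g)) xs)"
      by (induction xs) (auto simp: \<sigma>_def scaleR_add_right)
    moreover have "map (\<lambda>(q, g). (c * q, g)) xs \<in> lists (\<rat> \<times> G)"
      using xs(1) \<open>c \<in> \<rat>\<close> by (induction xs) auto
    ultimately show ?thesis using xs(2) by (auto simp: D_def)
  qed
  show "subspace (closure D)"
    unfolding subspace_def
  proof (intro conjI ballI allI)
    have "\<sigma> [] \<in> D" unfolding D_def by (rule imageI) simp
    then show "0 \<in> closure D" using closure_subset by (force simp: \<sigma>_def)
  next
    fix x y assume "x \<in> closure D" "y \<in> closure D"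
    then obtain a b where "\<And>n. a n \<in> D" "a \<longlonglongrightarrow> x" "\<And>n. b n \<in> D" "b \<longlonglongrightarrow> y"
      by (auto simp: closure_sequential)
    then have "\<And>n. a n + b n \<in> D" "(\<lambda>n. a n + b n) \<longlonglongrightarrow> x + y"
      by (auto intro: D_add tendsto_add)
    then show "x + y \<in> closure D"
      unfolding closure_sequential by (intro exI[of _ "\<lambda>n. a n + b n"]) simp
  next
    fix c :: real and x assume "x \<in> closure D"
    then obtain a where a: "\<And>n. a n \<in> D" "a \<longlonglongrightarrow> x"
      by (auto simp: closure_sequential)
    have "c \<in> closure \<rat>" by (simp add: Rats_closure_real)
    then obtain q where q: "\<And>n. q n \<in> \<rat>" "q \<longlonglongrightarrow> c"
      unfolding closure_sequential by blast
    have "\<And>n. q n *\<^sub>R a n \<in> D" "(\<lambda>n. q n *\<^sub>R a n) \<longlonglongrightarrow> c *\<^sub>R x"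
      using a q by (auto intro: D_scale tendsto_scaleR)
    then show "c *\<^sub>R x \<in> closure D"
      unfolding closure_sequential by (intro exI[of _ "\<lambda>n. q n *\<^sub>R a n"]) simp
  qed
qed

lemma square_integrable_indicator:
  assumes "S \<in> lmeasurable"
  shows "square_integrable lebesgue (\<lambda>x. indicator S x *\<^sub>R (u::complex))"
proof -
  have "(\<lambda>x. (cmod (indicator S x *\<^sub>R u))\<^sup>2) = (\<lambda>x. indicator S x *\<^sub>R (cmod u)\<^sup>2)"
    by (auto simp: fun_eq_iff indicator_def)
  then show ?thesis
    using assms by (auto simp: square_integrable_def fmeasurable_def intro!: borel_measurable_indicator)
qed

lemma to_L2_indicator_tendsto:
  fixes S :: "'a::euclidean_space set"
  assumes S: "S \<in> lmeasurable" and T: "\<And>n. T n \<in> lmeasurable"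
    and lim: "(\<lambda>n. emeasure lebesgue (T n - S \<union> (S - T n))) \<longlonglongrightarrow> 0"
  shows "(\<lambda>n. to_L2 (\<lambda>x. indicator (T n) x *\<^sub>R (u::complex))) \<longlonglongrightarrow> to_L2 (\<lambda>x. indicator S x *\<^sub>R u)"
proof (rule to_L2_tendsto_nn)
  have "(\<integral>\<^sup>+x. ennreal ((cmod (indicator (T n) x *\<^sub>R u - indicator S x *\<^sub>R u))\<^sup>2) \<partial>lebesgue)
      = ennreal ((cmod u)\<^sup>2) * emeasure lebesgue (T n - S \<union> (S - T n))" for n
  proof -
    have "ennreal ((cmod (indicator (T n) x *\<^sub>R u - indicator S x *\<^sub>R u))\<^sup>2)
        = ennreal ((cmod u)\<^sup>2) * indicator (T n - S \<union> (S - T n)) x" for x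
      by (auto simp: indicator_def)
    then show ?thesis
      using S T by (subst nn_integral_cmult_indicator[symmetric]) auto
  qed
  then show "(\<lambda>n. \<integral>\<^sup>+x. ennreal ((cmod (indicator (T n) x *\<^sub>R u - indicator S x *\<^sub>R u))\<^sup>2) \<partial>lebesgue) \<longlonglongrightarrow> 0"
    using ennreal_tendsto_cmult[OF _ lim, of "ennreal ((cmod u)\<^sup>2)"] by simp
qed (use S T square_integrable_indicator in auto)

lemma L2_separable: "\<exists>D :: 'a::euclidean_space L2 set. countable D \<and> closure D = UNIV"
proof -
  obtain B :: "'a set set" where B: "countable B" "topological_basis B"
    using ex_countable_basis by blast
  define G where "G = (\<lambda>(\<F>, u). to_L2 (\<lambda>x. indicator (\<Union>\<F>) x *\<^sub>R u)) `
    ({\<F>. finite \<F> \<and> \<F> \<subseteq> B} \<times> {1, \<i>})"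
  have "countable G"
    unfolding G_def using countable_Collect_finite_subset[OF B(1)] by (auto simp: conj_commute)
  then obtain D where D: "countable D" "G \<subseteq> D" "subspace (closure D)"
    by (rule countable_rational_span)
  have closed: "y \<in> closure D" if "\<And>n. x n \<in> closure D" "x \<longlonglongrightarrow> y" for x :: "nat \<Rightarrow> 'a L2" and y
    using closed_sequentially[OF closed_closure] that by blast
  have op: "to_L2 (\<lambda>x. indicator U x *\<^sub>R u) \<in> closure D"
    if U: "open U" "U \<in> lmeasurable" and u: "u \<in> {1, \<i>}" for U u
  proof (cases "U = {}")
    case True
    have "to_L2 (\<lambda>x. indicator (\<Union>{}) x *\<^sub>R u) \<in> G"
      unfolding G_def using u by (intro image_eqI[of _ _ "({}, u)"]) auto
    then show ?thesis using True D(2) closure_subset by auto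
  next
    case False
    obtain B' where B': "B' \<subseteq> B" "\<Union>B' = U"
      using B(2) U(1) by (auto simp: topological_basis_def)
    have "B' \<noteq> {}" "countable B'"
      using False B' B(1) by (auto intro: countable_subset)
    define V where "V n = \<Union>(from_nat_into B' ` {..n::nat})" for n
    have inB': "from_nat_into B' n \<in> B'" for n
      using \<open>B' \<noteq> {}\<close> by (rule from_nat_into)
    have VU: "V n \<subseteq> U" for n
      using inB' B'(2) by (auto simp: V_def)
    have "open (from_nat_into B' k)" for k
      using topological_basis_open[OF B(2)] inB' B'(1) by blast
    then have "open (V n)" for n
      unfolding V_def by (intro open_UN) simp
    then have V: "V n \<in> lmeasurable" for n
      using VU fmeasurableI2[OF U(2)] by auto
    have "(\<Union>n. V n) = \<Union>(range (from_nat_into B'))"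
      unfolding V_def by blast
    also have "\<dots> = U"
      using B'(2) range_from_nat_into[OF \<open>B' \<noteq> {}\<close> \<open>countable B'\<close>] by simp
    finally have UV: "(\<Union>n. V n) = U" .
    have "(\<lambda>n. emeasure lebesgue (U - V n)) \<longlonglongrightarrow> emeasure lebesgue (\<Inter>n. U - V n)"
    proof (rule Lim_emeasure_decseq)
      show "decseq (\<lambda>n. U - V n)"
        by (rule decseq_SucI) (auto simp: V_def)
      show "range (\<lambda>n. U - V n) \<subseteq> sets lebesgue"
        using U V by auto
      show "emeasure lebesgue (U - V n) \<noteq> \<infinity>" for n
        using fmeasurable.Diff[OF U(2) V[of n]] by (auto simp: fmeasurable_def)
    qed
    moreover have "(\<Inter>n. U - V n) = {}" using UV by auto
    moreover have "V n - U \<union> (U - V n) = U - V n" for n using VU by auto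
    ultimately have "(\<lambda>n. emeasure lebesgue (V n - U \<union> (U - V n))) \<longlonglongrightarrow> 0"
      by (simp only: emeasure_empty)
    from to_L2_indicator_tendsto[OF U(2) V this]
    have lim: "(\<lambda>n. to_L2 (\<lambda>x. indicator (V n) x *\<^sub>R u)) \<longlonglongrightarrow> to_L2 (\<lambda>x. indicator U x *\<^sub>R u)" .
    have "to_L2 (\<lambda>x. indicator (V n) x *\<^sub>R u) \<in> G" for n
      unfolding G_def V_def using u inB' B'(1)
      by (intro image_eqI[of _ _ "(from_nat_into B' ` {..n}, u)"]) auto
    then show ?thesis
      using D(2) closure_subset by (intro closed[OF _ lim]) blast
  qed
  have meas1: "to_L2 (\<lambda>x. indicator S x *\<^sub>R u) \<in> closure D"
    if S: "S \<in> lmeasurable" and u: "u \<in> {1, \<i>}" for S u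
  proof -
    have "\<exists>T. open T \<and> S \<subseteq> T \<and> T - S \<in> lmeasurable \<and> emeasure lebesgue (T - S) < ennreal (1 / Suc n)"
      for n
      using sets_lebesgue_outer_open[of S "1 / Suc n"] S by (metis fmeasurableD of_nat_0_less_iff zero_less_Suc zero_less_divide_1_iff)
    then obtain T where T: "\<And>n. open (T n)" "\<And>n. S \<subseteq> T n" "\<And>n. T n - S \<in> lmeasurable"
      "\<And>n. emeasure lebesgue (T n - S) < ennreal (1 / Suc n)" by metis
    have Tm: "T n \<in> lmeasurable" for n
    proof -
      have "T n = S \<union> (T n - S)" using T(2) by auto
      then show ?thesis using fmeasurable.Un[OF S T(3)[of n]] by simp
    qed
    have "(\<lambda>n. emeasure lebesgue (T n - S)) \<longlonglongrightarrow> 0"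
    proof (rule tendsto_sandwich[OF _ _ tendsto_const])
      show "(\<lambda>n. ennreal (1 / Suc n)) \<longlonglongrightarrow> 0"
        using tendsto_ennrealI[OF LIMSEQ_Suc[OF lim_1_over_n]] by simp
      show "\<forall>\<^sub>F n in sequentially. emeasure lebesgue (T n - S) \<le> ennreal (1 / Suc n)"
        using T(4) by (intro always_eventually allI less_imp_le)
    qed simp
    moreover have "T n - S \<union> (S - T n) = T n - S" for n using T(2)[of n] by blast
    ultimately have "(\<lambda>n. emeasure lebesgue (T n - S \<union> (S - T n))) \<longlonglongrightarrow> 0"
      by (simp only:)
    from closed[OF op[OF T(1) Tm u] to_L2_indicator_tendsto[OF S Tm this]] show ?thesis .
  qed
  have meas: "to_L2 (\<lambda>x. indicator S x *\<^sub>R u) \<in> closure D" if S: "S \<in> lmeasurable" for S u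
  proof -
    have "(\<lambda>x. indicator S x *\<^sub>R u)
        = (\<lambda>x. Re u *\<^sub>R (indicator S x *\<^sub>R 1) + Im u *\<^sub>R (indicator S x *\<^sub>R \<i>))"
      by (auto simp: fun_eq_iff indicator_def complex_eq_iff)
    then have "to_L2 (\<lambda>x. indicator S x *\<^sub>R u)
        = Re u *\<^sub>R to_L2 (\<lambda>x. indicator S x *\<^sub>R 1) + Im u *\<^sub>R to_L2 (\<lambda>x. indicator S x *\<^sub>R \<i>)"
      using square_integrable_indicator[OF S]
      by (simp only: to_L2_add to_L2_scaleR square_integrable_scaleR)
    then show ?thesis
      using D(3) meas1[OF S] by (auto intro!: subspace_add subspace_mul)
  qed
  have sums: "square_integrable lebesgue (\<lambda>x. \<Sum>y\<in>Y. indicator (A y) x *\<^sub>R y)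
      \<and> to_L2 (\<lambda>x. \<Sum>y\<in>Y. indicator (A y) x *\<^sub>R y) \<in> closure D"
    if "finite Y" "\<And>y. y \<in> Y \<Longrightarrow> A y \<in> lmeasurable" for Y :: "complex set" and A :: "complex \<Rightarrow> 'a set"
    using that
  proof (induction Y rule: finite_induct)
    case empty
    have "to_L2 (\<lambda>x::'a. 0) = 0"
      using to_L2_scaleR[OF square_integrable_zero, of 0] by simp
    then show ?case using subspace_0[OF D(3)] by (simp add: square_integrable_zero)
  next
    case (insert y Y)
    have A: "A y \<in> lmeasurable" using insert.prems by simp
    note IH = insert.IH[OF insert.prems[OF insertI2]]
    show ?case
      unfolding sum.insert[OF insert.hyps]
      using IH to_L2_add[OF square_integrable_indicator[OF A] conjunct1[OF IH]]
      by (simp only: square_integrable_add[OF square_integrable_indicator[OF A]]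
          subspace_add[OF D(3)] meas[OF A] simp_thms)
  qed
  have "F \<in> closure D" for F
  proof -
    define f where "f = rep_L2 F"
    have f: "square_integrable lebesgue f" by (simp add: f_def square_integrable_rep_L2)
    then have fm [measurable]: "f \<in> borel_measurable lebesgue" by (simp add: square_integrable_def)
    obtain s where s: "\<And>i. simple_function lebesgue (s i)" "\<And>x. (\<lambda>i. s i x) \<longlonglongrightarrow> f x"
      "\<And>i x. cmod (s i x) \<le> 2 * cmod (f x)"
      using borel_measurable_implies_sequence_metric[OF fm, of 0] by (auto simp: dist_norm)
    have sm [measurable]: "s i \<in> borel_measurable lebesgue" for i
      using s(1) by (rule borel_measurable_simple_function)
    have sf: "(cmod (s i x))\<^sup>2 \<le> 4 * (cmod (f x))\<^sup>2" for i x
      using power_mono[OF s(3)[of i x], of 2] by (simp add: power_mult_distrib)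
    have s2: "square_integrable lebesgue (s i)" for i
      unfolding square_integrable_def
    proof
      show "integrable lebesgue (\<lambda>x. (cmod (s i x))\<^sup>2)"
      proof (rule Bochner_Integration.integrable_bound)
        show "integrable lebesgue (\<lambda>x. 4 * (cmod (f x))\<^sup>2)"
          using f by (simp add: square_integrable_def)
      qed (use sf in auto)
    qed simp
    have "to_L2 (s i) \<in> closure D" for i
    proof -
      define Y where "Y = range (s i) - {0}"
      have Y: "finite Y" using simple_functionD(1)[OF s(1)[of i]] by (simp add: Y_def)
      have A: "s i -` {y} \<in> lmeasurable" if "y \<in> Y" for y
      proof -
        have "{x \<in> space lebesgue. (cmod y)\<^sup>2 \<le> (cmod (s i x))\<^sup>2} \<in> lmeasurable"
        proof (rule fmeasurableI)
          show "emeasure lebesgue {x \<in> space lebesgue. (cmod y)\<^sup>2 \<le> (cmod (s i x))\<^sup>2} < \<infinity>"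
          proof -
            have "emeasure lebesgue {x \<in> space lebesgue. 1 \<le> ennreal (1 / (cmod y)\<^sup>2) * ennreal ((cmod (s i x))\<^sup>2)}
              \<le> ennreal (1 / (cmod y)\<^sup>2) * (\<integral>\<^sup>+x. ennreal ((cmod (s i x))\<^sup>2) * indicator (space lebesgue) x \<partial>lebesgue)"
              using nn_integral_Markov_inequality[where M=lebesgue and A="space lebesgue"
                and u="\<lambda>x. ennreal ((cmod (s i x))\<^sup>2)" and c="ennreal (1 / (cmod y)\<^sup>2)"]
              by simp
            also have "\<dots> < \<infinity>"
              by (simp add: nn_integral_norm_to_L2[OF s2] ennreal_mult[symmetric])
            also have "{x \<in> space lebesgue. 1 \<le> ennreal (1 / (cmod y)\<^sup>2) * ennreal ((cmod (s i x))\<^sup>2)}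
              = {x \<in> space lebesgue. (cmod y)\<^sup>2 \<le> (cmod (s i x))\<^sup>2}"
              using that by (auto simp: Y_def ennreal_mult[symmetric] field_simps simp flip: ennreal_1)
            finally show ?thesis .
          qed
        qed measurable
        moreover have "s i -` {y} \<in> sets lebesgue"
          using simple_functionD(2)[OF s(1)[of i], of "{y}"] by simp
        ultimately show ?thesis by - (rule fmeasurableI2, assumption, force, assumption)
      qed
      have "s i = (\<lambda>x. \<Sum>y\<in>Y. indicator (s i -` {y}) x *\<^sub>R y)"
      proof
        fix x
        have "(\<Sum>y\<in>Y. indicator (s i -` {y}) x *\<^sub>R y) = (\<Sum>y\<in>Y. if y = s i x then y else 0)"
          by (rule sum.cong) (auto simp: indicator_def)
        also have "\<dots> = s i x" using Y by (auto simp: Y_def)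
        finally show "s i x = (\<Sum>y\<in>Y. indicator (s i -` {y}) x *\<^sub>R y)" by simp
      qed
      then show ?thesis
        using sums[of Y "\<lambda>y. s i -` {y}", OF Y A] by (metis (lifting))
    qed
    moreover have "(\<lambda>i. to_L2 (s i)) \<longlonglongrightarrow> to_L2 f"
    proof (rule to_L2_tendsto_nn[OF s2 f])
      have "(\<lambda>i. \<integral>\<^sup>+x. ennreal ((cmod (s i x - f x))\<^sup>2) \<partial>lebesgue) \<longlonglongrightarrow> (\<integral>\<^sup>+x. 0 \<partial>(lebesgue :: 'a measure))"
      proof (rule nn_integral_dominated_convergence[where w="\<lambda>x. ennreal (9 * (cmod (f x))\<^sup>2)"])
        show "(\<integral>\<^sup>+x. ennreal (9 * (cmod (f x))\<^sup>2) \<partial>lebesgue) < \<infinity>"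
          by (simp add: ennreal_mult nn_integral_cmult nn_integral_norm_to_L2[OF f] ennreal_mult_less_top)
        show "AE x in lebesgue. ennreal ((cmod (s i x - f x))\<^sup>2) \<le> ennreal (9 * (cmod (f x))\<^sup>2)" for i
        proof (intro AE_I2 ennreal_leI)
          fix x
          have "cmod (s i x - f x) \<le> 3 * cmod (f x)"
            using norm_triangle_ineq4[of "s i x" "f x"] s(3)[of i x] by simp
          from power_mono[OF this, of 2] show "(cmod (s i x - f x))\<^sup>2 \<le> 9 * (cmod (f x))\<^sup>2"
            by (simp add: power_mult_distrib)
        qed
        show "AE x in lebesgue. (\<lambda>i. ennreal ((cmod (s i x - f x))\<^sup>2)) \<longlonglongrightarrow> 0"
        proof (rule AE_I2)
          fix x
          have "(\<lambda>i. ennreal ((cmod (s i x - f x))\<^sup>2)) \<longlonglongrightarrow> ennreal ((cmod (f x - f x))\<^sup>2)"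
            using s(2) by (intro tendsto_intros)
          then show "(\<lambda>i. ennreal ((cmod (s i x - f x))\<^sup>2)) \<longlonglongrightarrow> 0" by simp
        qed
      qed auto
      then show "(\<lambda>i. \<integral>\<^sup>+x. ennreal ((cmod (s i x - f x))\<^sup>2) \<partial>lebesgue) \<longlonglongrightarrow> 0" by simp
    qed
    ultimately have "to_L2 f \<in> closure D" by (rule closed)
    then show ?thesis by (simp add: f_def to_L2_rep_L2)
  qed
  then show ?thesis using D(1) by blast
qed

instance L2 :: (euclidean_space) second_countable_topology
proof
  obtain D :: "'a L2 set" where D: "countable D" "closure D = UNIV"
    using L2_separable by blast
  define B where "B = (\<lambda>(d, n). ball d (1 / Suc n)) ` (D \<times> (UNIV :: nat set))"
  have "topological_basis B"
  proof (rule topological_basisI)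
    fix U :: "'a L2 set" and x assume U: "open U" "x \<in> U"
    then obtain e where e: "e > 0" "ball x e \<subseteq> U" by (meson open_contains_ball)
    obtain n where n: "1 / Suc n < e / 2"
      using nat_approx_posE[of "e / 2"] e(1) by auto
    have "x \<in> closure D" using D(2) by simp
    then obtain d where d: "d \<in> D" "dist d x < 1 / Suc n"
      unfolding closure_approachable by (metis of_nat_0_less_iff zero_less_Suc zero_less_divide_1_iff)
    have "ball d (1 / Suc n) \<subseteq> ball x e"
    proof
      fix y assume "y \<in> ball d (1 / Suc n)"
      then show "y \<in> ball x e"
        using d(2) n dist_triangle[of x y d] by (simp add: dist_commute)
    qed
    then show "\<exists>B'\<in>B. x \<in> B' \<and> B' \<subseteq> U"
      using d e(2) by (intro bexI[of _ "ball d (1 / Suc n)"]) (auto simp: B_def)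
  qed (auto simp: B_def)
  moreover have "countable B" using D(1) by (simp add: B_def)
  ultimately show "\<exists>B::'a L2 set set. countable B \<and> open = generate_topology B"
    using topological_basis_imp_subbasis by blast
qed


section \<open>Fourier multipliers and the control system\<close>

text \<open>
  The Fourier--Plancherel transform with kernel \<open>exp (- \<i> (x \<bullet> \<xi>))\<close> and no normalising factor:
  the limit in \<open>L\<^sup>2\<close> of the Fourier integrals of the truncations of \<open>f\<close> to balls, which are
  integrable.  Multipliers do not depend on the choice of normalising factor.
\<close>

definition fourier_L2 :: "'a::euclidean_space L2 \<Rightarrow> 'a L2" where
  "fourier_L2 f = lim (\<lambda>R::nat. to_L2 (\<lambda>\<xi>.
     LINT x|lebesgue. indicator (cball 0 (real R)) x *\<^sub>R (cis (- (x \<bullet> \<xi>)) * rep_L2 f x)))"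

text \<open>Only used for bounded measurable symbols \<open>m\<close>.\<close>

definition fourier_multiplier :: "('a::euclidean_space \<Rightarrow> real) \<Rightarrow> 'a L2 \<Rightarrow> 'a L2" where
  "fourier_multiplier m f = inv fourier_L2 (to_L2 (\<lambda>\<xi>. m \<xi> *\<^sub>R rep_L2 (fourier_L2 f) \<xi>))"

definition diffusion_semigroup :: "(real \<Rightarrow> real) \<Rightarrow> real \<Rightarrow> 'a::euclidean_space L2 \<Rightarrow> 'a L2" where
  "diffusion_semigroup F t = fourier_multiplier (\<lambda>\<xi>. exp (- t * F (norm \<xi>)))"

text \<open>
  The integral is the Bochner integral in \<open>L\<^sup>2\<close>.  A square-integrable \<open>h\<close> on
  \<open>{0<..<t} \<times> \<omega>\<close> has square-integrable sections \<open>h (s, _)\<close> on \<open>\<omega>\<close> for almost every \<open>s\<close>; the junk value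
  of \<open>to_L2\<close> only occurs on a null set of times.
\<close>

definition mild_solution :: "(real \<Rightarrow> real) \<Rightarrow> 'a::euclidean_space set \<Rightarrow> 'a L2 \<Rightarrow>
    (real \<times> 'a \<Rightarrow> complex) \<Rightarrow> real \<Rightarrow> 'a L2" where
  "mild_solution F \<omega> f0 h t = diffusion_semigroup F t f0 +
     (LINT s|lebesgue_on {0<..<t}.
        diffusion_semigroup F (t - s) (to_L2 (\<lambda>x. indicator \<omega> x *\<^sub>R h (s, x))))"

definition cost_uniformly_approx_null_controllable ::
    "(real \<Rightarrow> real) \<Rightarrow> 'a::euclidean_space set \<Rightarrow> real \<Rightarrow> bool" where
  "cost_uniformly_approx_null_controllable F \<omega> T \<longleftrightarrow>
     (\<forall>\<epsilon>>0. \<exists>C>0. \<forall>f0 :: 'a L2. \<exists>h.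
        square_integrable (lebesgue_on ({0<..<T} \<times> \<omega>)) h \<and>
        norm (mild_solution F \<omega> f0 h T) \<le> \<epsilon> * norm f0 \<and>
        (LINT t|lebesgue_on {0<..<T}. LINT x|lebesgue_on \<omega>. (cmod (h (t, x)))\<^sup>2)
          \<le> C * (norm f0)\<^sup>2)"

section \<open>Quasi-analytic sequences and thick sets\<close>

text \<open>The \<open>k\<close>-th derivative relative to \<open>S\<close>, one-sided at the end points of an interval \<open>S\<close>.\<close>

primrec deriv_within :: "nat \<Rightarrow> real set \<Rightarrow> (real \<Rightarrow> complex) \<Rightarrow> real \<Rightarrow> complex" where
  "deriv_within 0 S f = f"
| "deriv_within (Suc k) S f = (\<lambda>x. vector_derivative (deriv_within k S f) (at x within S))"

definition denjoy_carleman_class :: "(nat \<Rightarrow> real) \<Rightarrow> real \<Rightarrow> real \<Rightarrow> (real \<Rightarrow> complex) set" where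
  "denjoy_carleman_class M a b = {f.
     (\<forall>k. \<forall>x\<in>{a..b}. deriv_within k {a..b} f differentiable (at x within {a..b})) \<and>
     (\<forall>k. \<forall>x\<in>{a..b}. cmod (deriv_within k {a..b} f x) \<le> M k)}"

definition quasi_analytic :: "(nat \<Rightarrow> real) \<Rightarrow> bool" where
  "quasi_analytic M \<longleftrightarrow> (\<forall>k. 0 < M k) \<and>
     (\<forall>a b. a < b \<longrightarrow> (\<forall>f \<in> denjoy_carleman_class M a b.
        (\<exists>x0\<in>{a..b}. \<forall>k. deriv_within k {a..b} f x0 = 0) \<longrightarrow> (\<forall>x\<in>{a..b}. f x = 0)))"

definition thick_at_scale :: "real \<Rightarrow> real \<Rightarrow> (real ^ 'n) set \<Rightarrow> bool" where
  "thick_at_scale \<gamma> L \<omega> \<longleftrightarrow> \<omega> \<in> sets lebesgue \<and>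
     (\<forall>x. \<gamma> * L ^ CARD('n) \<le> measure lebesgue (\<omega> \<inter> (+) x ` {y. \<forall>i. y $ i \<in> {0..L}}))"

definition thick :: "(real ^ 'n) set \<Rightarrow> bool" where
  "thick \<omega> \<longleftrightarrow> (\<exists>\<gamma>\<in>{0<..<1}. \<exists>L>0. thick_at_scale \<gamma> L \<omega>)"

end

theory Submission
  imports Defs "HOL-Probability.Probability" "HOL-Complex_Analysis.Great_Picard"
begin

text \<open>
  Write \<open>S t\<close> for the operator \<open>exp (- t F(|D|))\<close> and \<open>M\<^sub>k(t)\<close> for the supremum of
  \<open>r\<^sup>k exp (- t F(r))\<close> over \<open>r \<ge> 0\<close> (the constant \<open>moment\<close>), so that \<open>M\<^sub>k(1)\<close> is the sequence
  which is assumed to be quasi-analytic.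

  Thickness gives controllability through an uncertainty principle (\<open>uncertainty_principle\<close>): for all
  \<open>t\<close> and \<open>\<epsilon>\<close> there is a constant \<open>C\<close> such that \<open>S t z\<close> has squared norm at most \<open>C\<close> times its
  squared norm over \<open>\<omega>\<close> plus \<open>\<epsilon>\<close> times the squared norm of \<open>z\<close>. The function \<open>w = S t z\<close> is smooth, and
  its \<open>k\<close>-th derivative along a coordinate axis has norm at most \<open>M\<^sub>k(t)\<close> times the norm of \<open>z\<close>. On a
  segment of length \<open>L\<close> parallel to an axis, consider a set which meets the segment in length at least
  \<open>\<gamma>\<close>. If the value of \<open>w\<close> at the starting point of the segment were not controlled by the integral of
  \<open>|w|\<^sup>2\<close> over this set, then a compactness argument would produce a limit function in a quasi-analytic
  class which is 1 in absolute value at the starting point but has infinitely many zeros in the segment.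
  By Rolle's theorem all its derivatives vanish at an accumulation point of the zeros, so it vanishes
  identically, which is a contradiction (\<open>one_dimensional_inequality\<close>). Integration over all segments in
  one direction bounds the mass of \<open>w\<close> on an enlargement of the set by its mass on the set
  (\<open>enlarge_step\<close>). The enlargement consists of the starting points of the segments which meet the set in
  length at least \<open>\<gamma>\<close>. With a suitable threshold in place of \<open>\<gamma>\<close>, enlarging a thick set once along every axis yields the whole
  space (\<open>enlarges_thick_eq_UNIV\<close>), and this proves the uncertainty principle.

  The argument needs quasi-analyticity of \<open>M(t)\<close> for all \<open>t > 0\<close>, whereas only \<open>t = 1\<close> is given. The case of
  large \<open>t\<close> is immediate. For \<open>t / 2 < s \<le> t\<close>, the product \<open>M\<^sub>i(s) M\<^sub>j(s)\<close> is bounded by a multiple of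
  \<open>M\<^sub>i\<^sub>+\<^sub>j(t)\<close> when \<open>i\<close> and \<open>j\<close> differ by at most 1 and are large. Hence the convolution square of a flat
  function of class \<open>M(s)\<close> is a flat function of class \<open>M(t)\<close>, so it vanishes, and by Titchmarsh's theorem the
  function itself vanishes (\<open>Titchmarsh_square\<close>, \<open>flat_unique_halving\<close>). Iteration gives all \<open>t\<close>
  (\<open>flat_unique_moment\<close>).

  The control is constant in time on the first half of the time interval and zero on the second half.
  With \<open>K\<close> the integral of \<open>S (T - s)\<close> over \<open>0 < s < T/2\<close>, its profile is \<open>- 1\<^sub>\<omega> K y\<close>, where \<open>y\<close> solves
  \<open>K 1\<^sub>\<omega> K y + \<alpha> y = S T f\<^sub>0\<close>, so that the final state is \<open>\<alpha> y\<close>. The range of \<open>K\<close> is contained in that of \<open>S (T/2)\<close>.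
  The uncertainty principle therefore applies to \<open>K y\<close>, and it bounds both the final state and the cost
  (\<open>observability_imp_controllable\<close>).

  Conversely, controllability implies by duality an observability inequality
  (\<open>controllable_imp_observable\<close>). It is tested on the translates of one function whose Fourier transform
  is the indicator of the unit ball. Their evolutions are bounded, uniformly in time, and concentrated near
  the centre of translation. So \<open>\<omega>\<close> has at least a fixed measure in every ball of some fixed radius
  (\<open>controllable_imp_ball_lower_bound\<close>), which is thickness.
\<close>

section \<open>Gaussians and the Plancherel identity for integrable functions\<close>

text \<open>
  Lebesgue measure on a Euclidean space is the image of the product measure under the
  coordinate map, so integrals of tensor products factorise.
\<close>

lemma integral_prod_Basis:
  fixes f :: "'a::euclidean_space \<Rightarrow> real \<Rightarrow> complex"
  assumes f: "\<And>b. b \<in> Basis \<Longrightarrow> integrable lborel (f b)"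
  shows "integrable lborel (\<lambda>x::'a. \<Prod>b\<in>Basis. f b (x \<bullet> b))"
    and "(LINT x|lborel. (\<Prod>b\<in>Basis. f b (x \<bullet> b))) = (\<Prod>b\<in>(Basis::'a set). (LINT x|lborel. f b x))"
proof -
  interpret product_sigma_finite "\<lambda>_::'a. lborel :: real measure" ..
  have [measurable]: "b \<in> Basis \<Longrightarrow> f b \<in> borel_measurable borel" for b
    using f[of b] by (simp add: borel_measurable_integrable)
  have *: "(\<Prod>b\<in>Basis. f b ((\<Sum>c\<in>Basis. y c *\<^sub>R c) \<bullet> b)) = (\<Prod>b\<in>(Basis::'a set). f b (y b))" for y
    by (intro prod.cong refl) (simp add: inner_sum_left inner_Basis if_distrib cong: if_cong)
  have m: "(\<lambda>x::'a. \<Prod>b\<in>Basis. f b (x \<bullet> b)) \<in> borel_measurable borel"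
    by measurable
  have I: "integrable (Pi\<^sub>M Basis (\<lambda>_. lborel)) (\<lambda>y. \<Prod>b\<in>(Basis::'a set). f b (y b))"
    by (rule product_integrable_prod) (use f in auto)
  show "integrable lborel (\<lambda>x::'a. \<Prod>b\<in>Basis. f b (x \<bullet> b))"
    unfolding lborel_eq[where 'a='a] by (subst integrable_distr_eq[OF _ m]) (auto simp: * I)
  show "(LINT x|lborel. (\<Prod>b\<in>Basis. f b (x \<bullet> b))) = (\<Prod>b\<in>(Basis::'a set). (LINT x|lborel. f b x))"
    unfolding lborel_eq[where 'a='a]
    by (subst integral_distr[OF _ m]) (auto simp: * intro!: product_integral_prod f)
qed

lemma cis_measurable [measurable]: "cis \<in> borel_measurable borel"
  by (intro borel_measurable_continuous_onI continuous_intros)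

lemma normal_density_fourier:
  assumes "\<sigma> > 0"
  shows "integrable lborel (\<lambda>x. complex_of_real (normal_density 0 \<sigma> x) * cis (t * x))"
    and "(LINT x|lborel. complex_of_real (normal_density 0 \<sigma> x) * cis (t * x)) = complex_of_real (exp (- (\<sigma> * t)\<^sup>2 / 2))"
proof -
  have int: "integrable lborel (\<lambda>x. complex_of_real (normal_density 0 \<sigma> x) * cis (t * x))" if "\<sigma> > 0"
    for \<sigma> t :: real
  proof (rule Bochner_Integration.integrable_bound)
    show "integrable lborel (normal_density 0 \<sigma>)" using that by (rule integrable_normal_density)
  qed (auto simp: norm_mult)
  show "integrable lborel (\<lambda>x. complex_of_real (normal_density 0 \<sigma> x) * cis (t * x))"
    using int assms by blast
  have 1: "(LINT x|lborel. complex_of_real (std_normal_density x) * cis (s * x)) = complex_of_real (exp (- s\<^sup>2 / 2))" for s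
    using fun_cong[OF char_std_normal_distribution, of s]
    unfolding char_def
    by (subst (asm) integral_density) (auto simp: cis_conv_exp scaleR_conv_of_real mult_ac)
  have eq: "complex_of_real (normal_density 0 \<sigma> (0 + \<sigma> * x)) * cis (t * (0 + \<sigma> * x))
      = complex_of_real (1 / \<sigma>) * (complex_of_real (std_normal_density x) * cis ((\<sigma> * t) * x))" for x
  proof -
    have "normal_density 0 \<sigma> (0 + \<sigma> * x) = 1 / \<sigma> * std_normal_density x"
      using assms by (simp add: normal_density_def real_sqrt_mult power_mult_distrib)
    then show ?thesis by (simp add: mult_ac)
  qed
  have "(LINT x|lborel. complex_of_real (normal_density 0 \<sigma> x) * cis (t * x))
     = \<bar>\<sigma>\<bar> *\<^sub>R (LINT x|lborel. complex_of_real (normal_density 0 \<sigma> (0 + \<sigma> * x)) * cis (t * (0 + \<sigma> * x)))"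
    using assms by (intro lborel_integral_real_affine) simp
  also have "\<dots> = complex_of_real (exp (- (\<sigma> * t)\<^sup>2 / 2))"
    unfolding eq using assms 1[of "\<sigma> * t"] by (simp add: scaleR_conv_of_real)
  finally show "(LINT x|lborel. complex_of_real (normal_density 0 \<sigma> x) * cis (t * x)) = complex_of_real (exp (- (\<sigma> * t)\<^sup>2 / 2))" .
qed

definition gauss :: "real \<Rightarrow> 'a::euclidean_space \<Rightarrow> real" where
  "gauss \<sigma> x = (\<Prod>b\<in>Basis. normal_density 0 \<sigma> (x \<bullet> b))"

lemma gauss_nonneg [simp]: "0 \<le> gauss \<sigma> x"
  by (simp add: gauss_def prod_nonneg)

lemma gauss_measurable [measurable]: "gauss \<sigma> \<in> borel_measurable borel"
  unfolding gauss_def by measurable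

lemma gauss_eq:
  "gauss \<sigma> (x::'a::euclidean_space) = (1 / sqrt (2 * pi * \<sigma>\<^sup>2)) ^ DIM('a) * exp (- (norm x)\<^sup>2 / (2 * \<sigma>\<^sup>2))"
proof -
  have "(norm x)\<^sup>2 = (\<Sum>b\<in>Basis. (x \<bullet> b)\<^sup>2)"
    by (subst power2_norm_eq_inner, subst euclidean_inner) (simp add: power2_eq_square)
  then show ?thesis
    by (simp add: gauss_def normal_density_def prod_dividef exp_sum[symmetric] sum_divide_distrib
        power_divide sum_negf[symmetric])
qed

lemma cis_sum: "finite A \<Longrightarrow> cis (\<Sum>a\<in>A. f a) = (\<Prod>a\<in>A. cis (f a))"
  by (induction A rule: finite_induct) (auto simp: cis_mult[symmetric])

lemma gauss_fourier:
  assumes "\<sigma> > 0"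
  shows "integrable lborel (\<lambda>x. complex_of_real (gauss \<sigma> x) * cis (z \<bullet> x))"
    and "(LINT x|lborel. complex_of_real (gauss \<sigma> x) * cis (z \<bullet> x)) = complex_of_real (exp (- (\<sigma> * norm z)\<^sup>2 / 2))"
proof -
  have eq: "complex_of_real (gauss \<sigma> x) * cis (z \<bullet> x) =
     (\<Prod>b\<in>Basis. (\<lambda>y. complex_of_real (normal_density 0 \<sigma> y) * cis ((z \<bullet> b) * y)) (x \<bullet> b))" for x
    by (simp add: gauss_def prod.distrib euclidean_inner[of z x] cis_sum)
  show "integrable lborel (\<lambda>x. complex_of_real (gauss \<sigma> x) * cis (z \<bullet> x))"
    unfolding eq by (rule integral_prod_Basis) (use normal_density_fourier[OF assms] in auto)
  have "(LINT x|lborel. complex_of_real (gauss \<sigma> x) * cis (z \<bullet> x)) = (\<Prod>b\<in>Basis. complex_of_real (exp (- (\<sigma> * (z \<bullet> b))\<^sup>2 / 2)))"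
    unfolding eq by (subst integral_prod_Basis) (use normal_density_fourier[OF assms] in auto)
  also have "(norm z)\<^sup>2 = (\<Sum>b\<in>Basis. (z \<bullet> b)\<^sup>2)"
    by (subst power2_norm_eq_inner, subst euclidean_inner) (simp add: power2_eq_square)
  then have "(\<Prod>b\<in>Basis. complex_of_real (exp (- (\<sigma> * (z \<bullet> b))\<^sup>2 / 2))) = complex_of_real (exp (- (\<sigma> * norm z)\<^sup>2 / 2))"
    by (simp add: exp_sum[symmetric] sum_divide_distrib power_mult_distrib sum_distrib_left sum_negf[symmetric] flip: of_real_prod)
  finally show "(LINT x|lborel. complex_of_real (gauss \<sigma> x) * cis (z \<bullet> x)) = complex_of_real (exp (- (\<sigma> * norm z)\<^sup>2 / 2))" .
qed

lemma gauss_integrable: "\<sigma> > 0 \<Longrightarrow> integrable lborel (gauss \<sigma> :: 'a::euclidean_space \<Rightarrow> real)"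
  and gauss_integral: "\<sigma> > 0 \<Longrightarrow> (LINT x|lborel. gauss \<sigma> (x::'a)) = 1"
proof -
  assume "\<sigma> > 0"
  from gauss_fourier[OF this, of "0::'a"]
  show "integrable lborel (gauss \<sigma> :: 'a \<Rightarrow> real)" and "(LINT x|lborel. gauss \<sigma> (x::'a)) = 1"
    using integrable_Re[of lborel "\<lambda>x. complex_of_real (gauss \<sigma> (x::'a))"] by simp_all
qed

lemma norm_integral_le_nn_integral:
  fixes f :: "'a \<Rightarrow> 'b::{banach, second_countable_topology}"
  shows "ennreal (norm (LINT x|M. f x)) \<le> (\<integral>\<^sup>+x. ennreal (norm (f x)) \<partial>M)"
  by (cases "integrable M f") (auto simp: integral_norm_bound_ennreal not_integrable_integral_eq)

lemma nn_integral_lborel_translate: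
  fixes h :: "'a::euclidean_space \<Rightarrow> ennreal"
  assumes [measurable]: "h \<in> borel_measurable borel"
  shows "(\<integral>\<^sup>+y. h (a + y) \<partial>lborel) = (\<integral>\<^sup>+y. h y \<partial>lborel)"
proof -
  have "(\<integral>\<^sup>+y. h y \<partial>lborel) = (\<integral>\<^sup>+y. h y \<partial>distr lborel borel ((+) a))"
    by (simp add: lborel_distr_plus)
  also have "\<dots> = (\<integral>\<^sup>+y. h (a + y) \<partial>lborel)"
    by (subst nn_integral_distr) auto
  finally show ?thesis ..
qed

lemma integral_lborel_affine:
  fixes h :: "'a::euclidean_space \<Rightarrow> 'b::{banach, second_countable_topology}"
  assumes [measurable]: "h \<in> borel_measurable borel" and "\<delta> > 0"
  shows "(LINT y|lborel. h y) = (LINT y|lborel. \<delta> ^ DIM('a) *\<^sub>R h (a + \<delta> *\<^sub>R y))"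
  using assms
  by (subst lborel_affine[of \<delta> a]) (auto simp: integral_density integral_distr)

lemma bounded_kernel_Fubini:
  fixes f :: "'a::euclidean_space \<Rightarrow> complex" and g :: "'b::euclidean_space \<Rightarrow> complex"
  assumes f: "integrable lborel f" and g: "integrable lborel g"
    and k [measurable]: "k \<in> borel_measurable borel" and bd: "\<And>p. norm (k p) \<le> 1"
  shows "(LINT y|lborel. (LINT x|lborel. k (x, y) * f x) * g y) = (LINT x|lborel. f x * (LINT y|lborel. k (x, y) * g y))"
proof -
  have [measurable]: "f \<in> borel_measurable borel" "g \<in> borel_measurable borel"
    using f g by auto
  have [measurable]: "k \<in> borel_measurable (borel \<Otimes>\<^sub>M borel)"
    using k by (simp add: borel_prod)
  have int: "integrable (lborel \<Otimes>\<^sub>M lborel) (\<lambda>(x, y). k (x, y) * f x * g y)"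
  proof (rule Bochner_Integration.integrable_bound)
    show "integrable (lborel \<Otimes>\<^sub>M lborel) (\<lambda>(x, y). f x * g y)"
    proof (rule lborel_pair.Fubini_integrable)
      show "integrable lborel (\<lambda>x. LINT y|lborel. norm (case (x, y) of (x, y) \<Rightarrow> f x * g y))"
        using f g by (auto simp: norm_mult)
      show "AE x in lborel. integrable lborel (\<lambda>y. case (x, y) of (x, y) \<Rightarrow> f x * g y)"
        using g by auto
    qed measurable
    show "AE x in lborel \<Otimes>\<^sub>M lborel. norm (case x of (x, y) \<Rightarrow> k (x, y) * f x * g y) \<le> norm (case x of (x, y) \<Rightarrow> f x * g y)"
      using bd by (intro AE_I2) (auto simp: norm_mult mult_left_le_one_le mult_right_mono)
  qed measurable
  have "(LINT y|lborel. (LINT x|lborel. k (x, y) * f x) * g y) = (LINT y|lborel. LINT x|lborel. k (x, y) * f x * g y)"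
    by (intro Bochner_Integration.integral_cong refl) simp
  also have "\<dots> = (LINT x|lborel. LINT y|lborel. k (x, y) * f x * g y)"
    using lborel_pair.Fubini_integral[of "\<lambda>x y. k (x, y) * f x * g y"] int by simp
  also have "\<dots> = (LINT x|lborel. f x * (LINT y|lborel. k (x, y) * g y))"
    by (intro Bochner_Integration.integral_cong refl, subst integral_mult_right_zero[symmetric])
      (simp add: mult_ac)
  finally show ?thesis .
qed

lemma bounded_kernel_measurable:
  fixes f :: "'a::euclidean_space \<Rightarrow> complex" and k :: "'a \<times> 'b::euclidean_space \<Rightarrow> complex"
  assumes f: "integrable lborel f" and k [measurable]: "k \<in> borel_measurable borel"
  shows "(\<lambda>y. LINT x|lborel. k (x, y) * f x) \<in> borel_measurable borel"
proof -
  have [measurable]: "f \<in> borel_measurable borel" using f by auto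
  have [measurable]: "k \<in> borel_measurable (borel \<Otimes>\<^sub>M borel)"
    using k by (simp add: borel_prod)
  show ?thesis by measurable
qed

text \<open>
  The inequality also holds if the product is not integrable, because then the left-hand side is 0.
\<close>

lemma norm_bounded_kernel_le:
  fixes f :: "'a::euclidean_space \<Rightarrow> complex"
  assumes f: "integrable lborel f" and bd: "\<And>p. norm (k p) \<le> 1"
  shows "norm (LINT x|lborel. k x * f x) \<le> (LINT x|lborel. norm (f x))"
proof (cases "integrable lborel (\<lambda>x. k x * f x)")
  case True
  show ?thesis
  proof (intro order_trans[OF integral_norm_bound integral_mono])
    show "norm (k x * f x) \<le> norm (f x)" for x
      using bd[of x] by (simp add: norm_mult mult_left_le_one_le)
  qed (use f True in auto)
qed (simp add: not_integrable_integral_eq)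

definition ft :: "('a::euclidean_space \<Rightarrow> complex) \<Rightarrow> 'a \<Rightarrow> complex" where
  "ft f \<xi> = (LINT x|lborel. cis (- (x \<bullet> \<xi>)) * f x)"

lemma fourier_kernel_measurable [measurable]:
  "(\<lambda>p::'a::euclidean_space \<times> 'a. cis (- (fst p \<bullet> snd p))) \<in> borel_measurable borel"
  "(\<lambda>p::'a::euclidean_space \<times> 'a. cis (fst p \<bullet> snd p)) \<in> borel_measurable borel"
  by (intro borel_measurable_continuous_onI continuous_intros)+

lemma cnj_measurable [measurable]: "cnj \<in> borel_measurable borel"
  by (intro borel_measurable_continuous_onI continuous_intros)

lemma ft_measurable: "integrable lborel f \<Longrightarrow> ft f \<in> borel_measurable borel"
  using bounded_kernel_measurable[OF _ fourier_kernel_measurable(1), of f] by (simp add: ft_def[abs_def])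

lemma norm_ft_le: "integrable lborel f \<Longrightarrow> norm (ft f \<xi>) \<le> (LINT x|lborel. norm (f x))"
  unfolding ft_def by (rule norm_bounded_kernel_le) auto

lemma integrable_cis_mult:
  assumes "integrable lborel (f :: 'a::euclidean_space \<Rightarrow> complex)"
  shows "integrable lborel (\<lambda>x. cis (x \<bullet> \<xi>) * f x)" "integrable lborel (\<lambda>x. cis (- (x \<bullet> \<xi>)) * f x)"
  by (rule Bochner_Integration.integrable_bound[OF assms], use assms in \<open>auto simp: norm_mult\<close>)+

lemma cnj_ft: "cnj (ft f \<xi>) = (LINT x|lborel. cis (x \<bullet> \<xi>) * cnj (f x))"
  unfolding ft_def by (subst Bochner_Integration.integral_cnj[symmetric]) (simp add: cis_cnj)

text \<open>
  Up to a constant factor, \<open>gweight \<delta>\<close> is the Fourier transform of \<open>gauss \<delta>\<close>. It is the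
  convergence factor in the proof of Plancherel's identity.
\<close>

definition gweight :: "real \<Rightarrow> 'a::euclidean_space \<Rightarrow> real" where
  "gweight \<delta> \<xi> = exp (- (\<delta> * norm \<xi>)\<^sup>2 / 2)"

lemma gweight_gauss:
  assumes "\<delta> > 0"
  shows "gweight \<delta> (\<xi>::'a::euclidean_space) = (sqrt (2 * pi) / \<delta>) ^ DIM('a) * gauss (1 / \<delta>) \<xi>"
  using assms by (simp add: gweight_def gauss_eq power_divide real_sqrt_divide power_mult_distrib field_simps)

lemma gauss_gweight:
  assumes "\<delta> > 0"
  shows "gauss \<delta> (z::'a::euclidean_space) = (1 / (sqrt (2 * pi) * \<delta>)) ^ DIM('a) * exp (- (1 / \<delta> * norm z)\<^sup>2 / 2)"
  using assms by (simp add: gauss_eq real_sqrt_mult power_divide power_mult_distrib field_simps)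

lemma gweight_fourier:
  assumes "\<delta> > 0"
  shows "integrable lborel (\<lambda>x. complex_of_real (gweight \<delta> (x::'a::euclidean_space)) * cis (z \<bullet> x))"
    and "(LINT x|lborel. complex_of_real (gweight \<delta> x) * cis (z \<bullet> x)) = complex_of_real ((2 * pi) ^ DIM('a) * gauss \<delta> z)"
proof -
  have eq: "complex_of_real (gweight \<delta> x) * cis (z \<bullet> x) =
    complex_of_real ((sqrt (2 * pi) / \<delta>) ^ DIM('a)) * (complex_of_real (gauss (1 / \<delta>) x) * cis (z \<bullet> x))" for x
    using assms by (simp add: gweight_gauss)
  show "integrable lborel (\<lambda>x. complex_of_real (gweight \<delta> (x::'a::euclidean_space)) * cis (z \<bullet> x))"
    unfolding eq using gauss_fourier(1)[of "1/\<delta>" z] assms by simp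
  have *: "(sqrt (2 * pi) / \<delta>) ^ DIM('a) = (2 * pi) ^ DIM('a) * (1 / (sqrt (2 * pi) * \<delta>)) ^ DIM('a)"
  proof -
    have "sqrt (2 * pi) / \<delta> = 2 * pi * (1 / (sqrt (2 * pi) * \<delta>))"
      using assms by (simp add: field_simps)
    then show ?thesis by (simp only: power_mult_distrib)
  qed
  show "(LINT x|lborel. complex_of_real (gweight \<delta> x) * cis (z \<bullet> x)) = complex_of_real ((2 * pi) ^ DIM('a) * gauss \<delta> z)"
    unfolding eq integral_mult_right_zero
    using gauss_fourier(2)[of "1/\<delta>" z] assms
    by (simp only: gauss_gweight[of \<delta> z] * zero_less_divide_1_iff of_real_mult mult.assoc)
qed

lemma gweight_measurable [measurable]: "gweight \<delta> \<in> borel_measurable borel"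
  unfolding gweight_def by measurable

lemma gweight_integrable: "\<delta> > 0 \<Longrightarrow> integrable lborel (gweight \<delta> :: 'a::euclidean_space \<Rightarrow> real)"
  using gweight_fourier(1)[of \<delta> "0::'a"] integrable_Re[of lborel "\<lambda>x. complex_of_real (gweight \<delta> (x::'a))"] by simp

text \<open>
  Writing the square as a product of two Fourier integrals and exchanging the order of
  integration turns the weight into its own Fourier transform, a Gaussian of width \<open>\<delta>\<close>.
\<close>

lemma gauss_regularised:
  fixes f :: "'a::euclidean_space \<Rightarrow> complex"
  assumes f: "integrable lborel f" and \<delta>: "\<delta> > 0"
  shows "(LINT \<xi>|lborel. complex_of_real (gweight \<delta> \<xi> * (cmod (ft f \<xi>))\<^sup>2)) =
    complex_of_real ((2 * pi) ^ DIM('a)) * (LINT x|lborel. f x * (LINT y|lborel. cnj (f y) * complex_of_real (gauss \<delta> (y - x))))"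
proof -
  have [measurable]: "f \<in> borel_measurable borel" "ft f \<in> borel_measurable borel"
    using f by (auto intro: ft_measurable)
  have W: "integrable lborel (gweight \<delta> :: 'a \<Rightarrow> real)"
    using \<delta> by (rule gweight_integrable)
  have w: "integrable lborel (\<lambda>\<xi>::'a. complex_of_real (gweight \<delta> \<xi>))"
    using W by (rule integrable_bounded_linear[OF bounded_linear_of_real])
  have g: "integrable lborel (\<lambda>\<xi>. complex_of_real (gweight \<delta> \<xi>) * cnj (ft f \<xi>))"
  proof (rule Bochner_Integration.integrable_bound)
    show "integrable lborel (\<lambda>\<xi>::'a. gweight \<delta> \<xi> * (LINT x|lborel. norm (f x)))"
      using W by simp
    show "AE \<xi> in lborel. norm (complex_of_real (gweight \<delta> \<xi>) * cnj (ft f \<xi>)) \<le> norm (gweight \<delta> \<xi> * (LINT x|lborel. norm (f x)))"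
      using norm_ft_le[OF f] by (intro AE_I2) (auto simp: norm_mult gweight_def intro: order_trans)
  qed measurable
  have "(LINT \<xi>|lborel. complex_of_real (gweight \<delta> \<xi> * (cmod (ft f \<xi>))\<^sup>2))
      = (LINT \<xi>|lborel. ft f \<xi> * (complex_of_real (gweight \<delta> \<xi>) * cnj (ft f \<xi>)))"
    by (intro Bochner_Integration.integral_cong refl) (simp add: complex_norm_square[symmetric] mult_ac)
  also have "\<dots> = (LINT x|lborel. f x * (LINT \<xi>|lborel. cis (- (x \<bullet> \<xi>)) * (complex_of_real (gweight \<delta> \<xi>) * cnj (ft f \<xi>))))"
    using bounded_kernel_Fubini[OF f g fourier_kernel_measurable(1)] by (simp add: ft_def)
  also have "\<dots> = (LINT x|lborel. f x * (complex_of_real ((2 * pi) ^ DIM('a)) * (LINT y|lborel. cnj (f y) * complex_of_real (gauss \<delta> (y - x)))))"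
  proof (intro Bochner_Integration.integral_cong refl arg_cong2[where f="(*)"])
    fix x :: 'a
    have "(LINT \<xi>|lborel. cis (- (x \<bullet> \<xi>)) * (complex_of_real (gweight \<delta> \<xi>) * cnj (ft f \<xi>)))
      = (LINT \<xi>|lborel. (LINT y|lborel. cis (y \<bullet> \<xi>) * cnj (f y)) * (cis (- (x \<bullet> \<xi>)) * complex_of_real (gweight \<delta> \<xi>)))"
      by (simp add: cnj_ft mult_ac)
    also have "\<dots> = (LINT y|lborel. cnj (f y) * (LINT \<xi>|lborel. cis (y \<bullet> \<xi>) * (cis (- (x \<bullet> \<xi>)) * complex_of_real (gweight \<delta> \<xi>))))"
      using bounded_kernel_Fubini[of "\<lambda>y. cnj (f y)" "\<lambda>\<xi>. cis (- (x \<bullet> \<xi>)) * complex_of_real (gweight \<delta> \<xi>)",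
          OF _ _ fourier_kernel_measurable(2)] f integrable_cis_mult(2)[OF w, of x]
      by (simp add: inner_commute)
    also have "\<dots> = (LINT y|lborel. cnj (f y) * complex_of_real ((2 * pi) ^ DIM('a) * gauss \<delta> (y - x)))"
    proof (intro Bochner_Integration.integral_cong refl arg_cong2[where f="(*)"])
      fix y
      have "cis (y \<bullet> \<xi>) * (cis (- (x \<bullet> \<xi>)) * complex_of_real (gweight \<delta> \<xi>)) = complex_of_real (gweight \<delta> \<xi>) * cis ((y - x) \<bullet> \<xi>)" for \<xi>
        by (simp only: mult.assoc[symmetric] cis_mult inner_diff_left) (simp add: mult.commute)
      then show "(LINT \<xi>|lborel. cis (y \<bullet> \<xi>) * (cis (- (x \<bullet> \<xi>)) * complex_of_real (gweight \<delta> \<xi>))) = complex_of_real ((2 * pi) ^ DIM('a) * gauss \<delta> (y - x))"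
        using gweight_fourier(2)[OF \<delta>, of "y - x"] by (simp only:)
    qed
    also have "\<dots> = complex_of_real ((2 * pi) ^ DIM('a)) * (LINT y|lborel. cnj (f y) * complex_of_real (gauss \<delta> (y - x)))"
      by (subst integral_mult_right_zero[symmetric]) (simp add: mult_ac)
    finally show "(LINT \<xi>|lborel. cis (- (x \<bullet> \<xi>)) * (complex_of_real (gweight \<delta> \<xi>) * cnj (ft f \<xi>)))
      = complex_of_real ((2 * pi) ^ DIM('a)) * (LINT y|lborel. cnj (f y) * complex_of_real (gauss \<delta> (y - x)))" .
  qed
  also have "\<dots> = complex_of_real ((2 * pi) ^ DIM('a)) * (LINT x|lborel. f x * (LINT y|lborel. cnj (f y) * complex_of_real (gauss \<delta> (y - x))))"
    by (subst integral_mult_right_zero[symmetric]) (simp add: mult_ac)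
  finally show ?thesis .
qed

lemma nn_integral_gauss_translate:
  fixes x y :: "'a::euclidean_space"
  assumes "\<delta> > 0"
  shows "(\<integral>\<^sup>+y. ennreal (gauss \<delta> (y - x)) \<partial>lborel) = 1" "(\<integral>\<^sup>+x. ennreal (gauss \<delta> (y - x)) \<partial>lborel) = 1"
proof -
  have 1: "(\<integral>\<^sup>+y. ennreal (gauss \<delta> (y - x)) \<partial>lborel) = 1" for x :: 'a
  proof -
    have "(\<integral>\<^sup>+y. ennreal (gauss \<delta> (y - x)) \<partial>lborel) = (\<integral>\<^sup>+y. ennreal (gauss \<delta> (y::'a)) \<partial>lborel)"
      using nn_integral_lborel_translate[of "\<lambda>y. ennreal (gauss \<delta> y)" "- x"] by simp
    also have "\<dots> = 1"
      using gauss_integrable[OF assms, where 'a='a] gauss_integral[OF assms, where 'a='a]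
      by (simp add: nn_integral_eq_integral)
    finally show ?thesis .
  qed
  show "(\<integral>\<^sup>+y. ennreal (gauss \<delta> (y - x)) \<partial>lborel) = 1" by (rule 1)
  have "gauss \<delta> (y - x) = gauss \<delta> (x - y)" for x
    by (simp add: gauss_eq norm_minus_commute)
  then show "(\<integral>\<^sup>+x. ennreal (gauss \<delta> (y - x)) \<partial>lborel) = 1" using 1[of y] by simp
qed

lemma nn_integral_gweight_ft:
  fixes f :: "'a::euclidean_space \<Rightarrow> complex"
  assumes f: "integrable lborel f" and \<delta>: "\<delta> > 0"
  shows "(\<integral>\<^sup>+\<xi>. ennreal (gweight \<delta> \<xi> * (cmod (ft f \<xi>))\<^sup>2) \<partial>lborel)
     = ennreal (LINT \<xi>|lborel. gweight \<delta> \<xi> * (cmod (ft f \<xi>))\<^sup>2)"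
proof (rule nn_integral_eq_integral)
  have [measurable]: "f \<in> borel_measurable borel" "ft f \<in> borel_measurable borel"
    using f by (auto intro: ft_measurable)
  show "integrable lborel (\<lambda>\<xi>. gweight \<delta> \<xi> * (cmod (ft f \<xi>))\<^sup>2)"
  proof (rule Bochner_Integration.integrable_bound)
    show "integrable lborel (\<lambda>\<xi>::'a. gweight \<delta> \<xi> * (LINT x|lborel. norm (f x))\<^sup>2)"
      using gweight_integrable[OF \<delta>, where 'a='a] by simp
    show "AE \<xi> in lborel. norm (gweight \<delta> \<xi> * (cmod (ft f \<xi>))\<^sup>2) \<le> norm (gweight \<delta> \<xi> * (LINT x|lborel. norm (f x))\<^sup>2)"
      using norm_ft_le[OF f] by (intro AE_I2) (auto simp: norm_mult gweight_def intro!: power_mono)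
  qed measurable
qed (auto simp: gweight_def)

lemma gweight_ft_LIMSEQ:
  fixes f :: "'a::euclidean_space \<Rightarrow> complex"
  assumes f: "integrable lborel f"
  shows "(\<lambda>k. \<integral>\<^sup>+\<xi>. ennreal (gweight (1 / Suc k) \<xi> * (cmod (ft f \<xi>))\<^sup>2) \<partial>lborel) \<longlonglongrightarrow> (\<integral>\<^sup>+\<xi>. ennreal ((cmod (ft f \<xi>))\<^sup>2) \<partial>lborel)"
proof (rule nn_integral_LIMSEQ)
  show "incseq (\<lambda>k \<xi>. ennreal (gweight (1 / Suc k) \<xi> * (cmod (ft f \<xi>))\<^sup>2))"
  proof (intro incseq_SucI le_funI ennreal_leI mult_right_mono)
    fix k :: nat and \<xi> :: 'a
    have "(1 / real (Suc (Suc k)) * norm \<xi>)\<^sup>2 \<le> (1 / real (Suc k) * norm \<xi>)\<^sup>2"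
      by (intro power_mono mult_right_mono) (auto simp: field_simps)
    then show "gweight (1 / real (Suc k)) \<xi> \<le> gweight (1 / real (Suc (Suc k))) \<xi>"
      unfolding gweight_def by simp
  qed simp
  show "(\<lambda>k. ennreal (gweight (1 / real (Suc k)) x * (cmod (ft f x))\<^sup>2)) \<longlonglongrightarrow> ennreal ((cmod (ft f x))\<^sup>2)" for x
  proof (rule tendsto_ennrealI)
    have "(\<lambda>k. exp (- (1 / real (Suc k) * norm x)\<^sup>2 / 2) * (cmod (ft f x))\<^sup>2) \<longlonglongrightarrow> exp (- (0 * norm x)\<^sup>2 / 2) * (cmod (ft f x))\<^sup>2"
      by (intro tendsto_intros LIMSEQ_Suc[OF lim_1_over_n]) auto
    then show "(\<lambda>k. gweight (1 / real (Suc k)) x * (cmod (ft f x))\<^sup>2) \<longlonglongrightarrow> (cmod (ft f x))\<^sup>2"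
      by (simp add: gweight_def)
  qed
  have [measurable]: "ft f \<in> borel_measurable borel"
    using f by (auto intro: ft_measurable)
  show "(\<lambda>\<xi>. ennreal (gweight (1 / real (Suc k)) \<xi> * (cmod (ft f \<xi>))\<^sup>2)) \<in> borel_measurable lborel" for k
    by measurable
qed

text \<open>
  Half of Plancherel's identity. Gaussians have integral 1 in each of the two variables, so by
  \<open>2|f(x)||f(y)| \<le> |f(x)|\<^sup>2 + |f(y)|\<^sup>2\<close> (Schur's test) the quadratic form in \<open>gauss_regularised\<close> is at most
  the squared norm of \<open>f\<close>, for every \<open>\<delta>\<close>. The weight tends to 1 as \<open>\<delta>\<close> tends to 0.
\<close>

lemma ft_L2_le:
  fixes f :: "'a::euclidean_space \<Rightarrow> complex"
  assumes f: "integrable lborel f"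
  shows "(\<integral>\<^sup>+\<xi>. ennreal ((cmod (ft f \<xi>))\<^sup>2) \<partial>lborel) \<le> ennreal ((2 * pi) ^ DIM('a)) * (\<integral>\<^sup>+x. ennreal ((cmod (f x))\<^sup>2) \<partial>lborel)"
proof (rule LIMSEQ_le_const2[OF gweight_ft_LIMSEQ[OF f]], intro exI allI impI)
  fix k :: nat
  define \<delta> where "\<delta> = 1 / real (Suc k)"
  have \<delta>: "\<delta> > 0" by (simp add: \<delta>_def)
  have [measurable]: "f \<in> borel_measurable borel" using f by auto
  let ?N = "\<integral>\<^sup>+x. ennreal ((cmod (f x))\<^sup>2) \<partial>lborel"
  let ?R = "LINT x|lborel. f x * (LINT y|lborel. cnj (f y) * complex_of_real (gauss \<delta> (y - x)))"
  have half: "(\<integral>\<^sup>+x. ennreal ((1/2) * (cmod (f x))\<^sup>2) \<partial>lborel) = ennreal (1/2) * ?N"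
    by (subst nn_integral_cmult[symmetric]) (auto simp del: ennreal_half simp flip: ennreal_mult)
  have gm: "(\<lambda>y. ennreal (gauss \<delta> (y - x))) \<in> borel_measurable lborel" "(\<lambda>y. ennreal (gauss \<delta> (x - y))) \<in> borel_measurable lborel" for x :: 'a
    by measurable
  have "complex_of_real (LINT \<xi>|lborel. gweight \<delta> \<xi> * (cmod (ft f \<xi>))\<^sup>2) = complex_of_real ((2 * pi) ^ DIM('a)) * ?R"
    using gauss_regularised[OF f \<delta>] by (simp only: integral_complex_of_real)
  then have "norm (complex_of_real (LINT \<xi>|lborel. gweight \<delta> \<xi> * (cmod (ft f \<xi>))\<^sup>2)) = norm (complex_of_real ((2 * pi) ^ DIM('a))) * norm ?R"
    by (simp only: norm_mult)
  also have "norm (complex_of_real ((2 * pi) ^ DIM('a))) = (2 * pi) ^ DIM('a)"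
    unfolding norm_of_real by simp
  finally have "(LINT \<xi>|lborel. gweight \<delta> \<xi> * (cmod (ft f \<xi>))\<^sup>2) \<le> (2 * pi) ^ DIM('a) * norm ?R"
    unfolding norm_of_real by linarith
  then have "(\<integral>\<^sup>+\<xi>. ennreal (gweight \<delta> \<xi> * (cmod (ft f \<xi>))\<^sup>2) \<partial>lborel) \<le> ennreal ((2 * pi) ^ DIM('a)) * ennreal (norm ?R)"
    unfolding nn_integral_gweight_ft[OF f \<delta>] by (simp add: ennreal_mult[symmetric] ennreal_leI)
  also have "ennreal (norm ?R) \<le> (\<integral>\<^sup>+x. ennreal (norm (f x * (LINT y|lborel. cnj (f y) * complex_of_real (gauss \<delta> (y - x))))) \<partial>lborel)"
    by (rule norm_integral_le_nn_integral)
  also have "\<dots> \<le> (\<integral>\<^sup>+x. \<integral>\<^sup>+y. ennreal ((1/2) * (cmod (f x))\<^sup>2) * ennreal (gauss \<delta> (y - x)) + ennreal ((1/2) * (cmod (f y))\<^sup>2) * ennreal (gauss \<delta> (y - x)) \<partial>lborel \<partial>lborel)"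
  proof (intro nn_integral_mono)
    fix x
    have "ennreal (norm (f x * (LINT y|lborel. cnj (f y) * complex_of_real (gauss \<delta> (y - x)))))
      \<le> ennreal (norm (f x)) * (\<integral>\<^sup>+y. ennreal (norm (cnj (f y) * complex_of_real (gauss \<delta> (y - x)))) \<partial>lborel)"
      by (simp only: norm_mult[of "f x"] ennreal_mult norm_ge_zero) (intro mult_left_mono norm_integral_le_nn_integral, simp)
    also have "\<dots> = (\<integral>\<^sup>+y. ennreal (norm (f x)) * ennreal (norm (cnj (f y) * complex_of_real (gauss \<delta> (y - x)))) \<partial>lborel)"
      by (subst nn_integral_cmult) auto
    also have "\<dots> \<le> (\<integral>\<^sup>+y. ennreal ((1/2) * (cmod (f x))\<^sup>2) * ennreal (gauss \<delta> (y - x)) + ennreal ((1/2) * (cmod (f y))\<^sup>2) * ennreal (gauss \<delta> (y - x)) \<partial>lborel)"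
    proof (intro nn_integral_mono)
      fix y
      have "norm (f x) * norm (f y) \<le> (1/2) * (cmod (f x))\<^sup>2 + (1/2) * (cmod (f y))\<^sup>2"
        using sum_squares_bound[of "norm (f x)" "norm (f y)"] by simp
      from mult_right_mono[OF this, of "gauss \<delta> (y - x)"]
      have "norm (f x) * (norm (f y) * gauss \<delta> (y - x)) \<le> (1/2) * (cmod (f x))\<^sup>2 * gauss \<delta> (y - x) + (1/2) * (cmod (f y))\<^sup>2 * gauss \<delta> (y - x)"
        by (simp add: algebra_simps)
      from ennreal_leI[OF this]
      show "ennreal (norm (f x)) * ennreal (norm (cnj (f y) * complex_of_real (gauss \<delta> (y - x)))) \<le>
        ennreal ((1/2) * (cmod (f x))\<^sup>2) * ennreal (gauss \<delta> (y - x)) + ennreal ((1/2) * (cmod (f y))\<^sup>2) * ennreal (gauss \<delta> (y - x))"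
        by (simp add: ennreal_mult[symmetric] norm_mult flip: ennreal_plus)
    qed
    finally show "ennreal (norm (f x * (LINT y|lborel. cnj (f y) * complex_of_real (gauss \<delta> (y - x)))))
      \<le> (\<integral>\<^sup>+y. ennreal ((1/2) * (cmod (f x))\<^sup>2) * ennreal (gauss \<delta> (y - x)) + ennreal ((1/2) * (cmod (f y))\<^sup>2) * ennreal (gauss \<delta> (y - x)) \<partial>lborel)" .
  qed
  also have "\<dots> = (\<integral>\<^sup>+x. \<integral>\<^sup>+y. ennreal ((1/2) * (cmod (f x))\<^sup>2) * ennreal (gauss \<delta> (y - x)) \<partial>lborel \<partial>lborel)
      + (\<integral>\<^sup>+x. \<integral>\<^sup>+y. ennreal ((1/2) * (cmod (f y))\<^sup>2) * ennreal (gauss \<delta> (y - x)) \<partial>lborel \<partial>lborel)"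
    by (subst nn_integral_add[symmetric]) (auto simp: nn_integral_add)
  also have "(\<integral>\<^sup>+x. \<integral>\<^sup>+y. ennreal ((1/2) * (cmod (f x))\<^sup>2) * ennreal (gauss \<delta> (y - x)) \<partial>lborel \<partial>lborel) = ennreal (1/2) * ?N"
    using \<delta> by (simp only: nn_integral_gauss_translate mult_1_right half nn_integral_cmult measurable_completion gm)
  also have "(\<integral>\<^sup>+x. \<integral>\<^sup>+y. ennreal ((1/2) * (cmod (f y))\<^sup>2) * ennreal (gauss \<delta> (y - x)) \<partial>lborel \<partial>lborel)
     = (\<integral>\<^sup>+y. \<integral>\<^sup>+x. ennreal ((1/2) * (cmod (f y))\<^sup>2) * ennreal (gauss \<delta> (y - x)) \<partial>lborel \<partial>lborel)"
    by (rule lborel_pair.Fubini') measurable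
  also have "\<dots> = ennreal (1/2) * ?N"
    using \<delta> by (simp only: nn_integral_gauss_translate mult_1_right half nn_integral_cmult measurable_completion gm)
  also have "ennreal (1/2) * ?N + ennreal (1/2) * ?N = ?N"
  proof -
    have "ennreal (1/2) + ennreal (1/2) = 1" by (subst ennreal_plus[symmetric]) auto
    then show ?thesis by (simp only: distrib_right[symmetric] mult_1_left)
  qed
  finally show "(\<integral>\<^sup>+\<xi>. ennreal (gweight (1 / real (Suc k)) \<xi> * (cmod (ft f \<xi>))\<^sup>2) \<partial>lborel) \<le> ennreal ((2 * pi) ^ DIM('a)) * ?N"
    unfolding \<delta>_def by (simp add: mult_left_mono)
qed

lemma gauss_scale:
  assumes "\<delta> > 0"
  shows "\<delta> ^ DIM('a) * gauss \<delta> (\<delta> *\<^sub>R z) = gauss 1 (z::'a::euclidean_space)"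
  using assms by (simp add: gauss_eq real_sqrt_mult power_mult_distrib power_divide)

text \<open>
  For bounded continuous \<open>f\<close> the Gaussian averages of \<open>f\<close> converge to \<open>f\<close>
  pointwise and boundedly, so the quadratic form in \<open>gauss_regularised\<close> converges to the squared norm.
  Such functions are dense, which suffices for the extension to all of \<open>L\<^sup>2\<close>.
\<close>

lemma ft_Plancherel_bounded_continuous:
  fixes f :: "'a::euclidean_space \<Rightarrow> complex"
  assumes f: "integrable lborel f" and cont: "continuous_on UNIV f" and bd: "\<And>x. norm (f x) \<le> B"
  shows "(\<integral>\<^sup>+\<xi>. ennreal ((cmod (ft f \<xi>))\<^sup>2) \<partial>lborel) = ennreal ((2 * pi) ^ DIM('a)) * (\<integral>\<^sup>+x. ennreal ((cmod (f x))\<^sup>2) \<partial>lborel)"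
proof -
  have [measurable]: "f \<in> borel_measurable borel" using f by auto
  have B: "B \<ge> 0" using bd[of 0] norm_ge_zero order_trans by blast
  define d where "d k = 1 / real (Suc k)" for k
  have d: "d k > 0" for k by (simp add: d_def)
  have d0: "d \<longlonglongrightarrow> 0" unfolding d_def by (rule LIMSEQ_Suc[OF lim_1_over_n])
  have f2: "integrable lborel (\<lambda>x. (cmod (f x))\<^sup>2)"
  proof (rule Bochner_Integration.integrable_bound)
    show "integrable lborel (\<lambda>x. B * norm (f x))" using f by simp
    show "AE x in lborel. norm ((cmod (f x))\<^sup>2) \<le> norm (B * norm (f x))"
      using bd B by (intro AE_I2) (auto simp: power2_eq_square intro!: mult_right_mono)
  qed measurable
  define g where "g k x = (LINT z|lborel. cnj (f (x + d k *\<^sub>R z)) * complex_of_real (gauss 1 z))" for k x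
  have g: "(LINT y|lborel. cnj (f y) * complex_of_real (gauss (d k) (y - x))) = g k x" for k x
  proof -
    have "(LINT y|lborel. cnj (f y) * complex_of_real (gauss (d k) (y - x)))
      = (LINT z|lborel. d k ^ DIM('a) *\<^sub>R (cnj (f (x + d k *\<^sub>R z)) * complex_of_real (gauss (d k) (x + d k *\<^sub>R z - x))))"
      by (rule integral_lborel_affine[OF _ d]) measurable
    also have "\<dots> = g k x"
      unfolding g_def gauss_scale[OF d[of k], symmetric]
      by (intro Bochner_Integration.integral_cong refl) (simp add: scaleR_conv_of_real)
    finally show ?thesis .
  qed
  have gint: "integrable lborel (\<lambda>z::'a. B * gauss 1 z)"
    using gauss_integrable[of 1, where 'a='a] by simp
  have "(\<lambda>k. LINT x|lborel. f x * g k x) \<longlonglongrightarrow> (LINT x|lborel. f x * cnj (f x))"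
  proof (rule integral_dominated_convergence[where w="\<lambda>x. norm (f x) * B"])
    show "AE x in lborel. (\<lambda>k. f x * g k x) \<longlonglongrightarrow> f x * cnj (f x)"
    proof (intro AE_I2 tendsto_intros)
      fix x
      have "(\<lambda>k. g k x) \<longlonglongrightarrow> (LINT z|lborel. cnj (f x) * complex_of_real (gauss 1 (z::'a)))"
        unfolding g_def
      proof (rule integral_dominated_convergence[OF _ _ gint])
        show "AE z in lborel. (\<lambda>k. cnj (f (x + d k *\<^sub>R z)) * complex_of_real (gauss 1 z)) \<longlonglongrightarrow> cnj (f x) * complex_of_real (gauss 1 z)"
        proof (intro AE_I2 tendsto_intros)
          fix z
          have "(\<lambda>k. x + d k *\<^sub>R z) \<longlonglongrightarrow> x + 0 *\<^sub>R z"
            by (intro tendsto_intros d0)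
          then show "(\<lambda>k. f (x + d k *\<^sub>R z)) \<longlonglongrightarrow> f x"
            using continuous_on_tendsto_compose[OF cont, of "\<lambda>k. x + d k *\<^sub>R z" x sequentially] by simp
        qed
        show "AE z in lborel. norm (cnj (f (x + d k *\<^sub>R z)) * complex_of_real (gauss 1 z)) \<le> B * gauss 1 z" for k
          using bd by (intro AE_I2) (auto simp: norm_mult intro!: mult_right_mono)
      qed measurable
      also have "(LINT z|lborel. cnj (f x) * complex_of_real (gauss 1 (z::'a))) = cnj (f x)"
        using gauss_integral[of 1, where 'a='a] by simp
      finally show "(\<lambda>k. g k x) \<longlonglongrightarrow> cnj (f x)" .
    qed
    show "AE x in lborel. norm (f x * g k x) \<le> norm (f x) * B" for k
    proof (intro AE_I2)
      fix x
      have "norm (g k x) \<le> (LINT z|lborel. B * gauss 1 (z::'a))"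
        unfolding g_def
      proof (rule order_trans[OF integral_norm_bound integral_mono])
        show "integrable lborel (\<lambda>z. cmod (cnj (f (x + d k *\<^sub>R z)) * complex_of_real (gauss 1 z)))"
          by (rule Bochner_Integration.integrable_bound[OF gint]) (use bd B in \<open>auto simp: norm_mult intro!: mult_right_mono\<close>)
      qed (use bd gint in \<open>auto simp: norm_mult intro!: mult_right_mono\<close>)
      also have "\<dots> = B" using gauss_integral[of 1, where 'a='a] by simp
      finally show "norm (f x * g k x) \<le> norm (f x) * B" by (simp add: norm_mult mult_left_mono)
    qed
    show "integrable lborel (\<lambda>x. norm (f x) * B)" using f by simp
    show "(\<lambda>x. f x * g k x) \<in> borel_measurable lborel" for k
      unfolding g[symmetric] by measurable
  qed measurable
  then have "(\<lambda>k. complex_of_real ((2 * pi) ^ DIM('a)) * (LINT x|lborel. f x * g k x)) \<longlonglongrightarrow> complex_of_real ((2 * pi) ^ DIM('a)) * (LINT x|lborel. f x * cnj (f x))"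
    by (intro tendsto_intros)
  then have "(\<lambda>k. complex_of_real (LINT \<xi>|lborel. gweight (d k) \<xi> * (cmod (ft f \<xi>))\<^sup>2)) \<longlonglongrightarrow> complex_of_real ((2 * pi) ^ DIM('a)) * (LINT x|lborel. f x * cnj (f x))"
    using gauss_regularised[OF f d] unfolding g by (simp only: integral_complex_of_real)
  also have "complex_of_real ((2 * pi) ^ DIM('a)) * (LINT x|lborel. f x * cnj (f x)) = complex_of_real ((2 * pi) ^ DIM('a) * (LINT x|lborel. (cmod (f x))\<^sup>2))"
    by (simp add: complex_norm_square[symmetric] flip: of_real_power)
  finally have "(\<lambda>k. LINT \<xi>|lborel. gweight (d k) \<xi> * (cmod (ft f \<xi>))\<^sup>2) \<longlonglongrightarrow> (2 * pi) ^ DIM('a) * (LINT x|lborel. (cmod (f x))\<^sup>2)"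
    by (simp only: tendsto_of_real_iff)
  then have "(\<lambda>k. \<integral>\<^sup>+\<xi>. ennreal (gweight (d k) \<xi> * (cmod (ft f \<xi>))\<^sup>2) \<partial>lborel) \<longlonglongrightarrow> ennreal ((2 * pi) ^ DIM('a) * (LINT x|lborel. (cmod (f x))\<^sup>2))"
    unfolding nn_integral_gweight_ft[OF f d] by (rule tendsto_ennrealI)
  from LIMSEQ_unique[OF gweight_ft_LIMSEQ[OF f] this[unfolded d_def]]
  have "(\<integral>\<^sup>+\<xi>. ennreal ((cmod (ft f \<xi>))\<^sup>2) \<partial>lborel) = ennreal ((2 * pi) ^ DIM('a) * (LINT x|lborel. (cmod (f x))\<^sup>2))" .
  also have "\<dots> = ennreal ((2 * pi) ^ DIM('a)) * ennreal (LINT x|lborel. (cmod (f x))\<^sup>2)"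
    by (rule ennreal_mult) auto
  finally show ?thesis by (subst nn_integral_eq_integral[OF f2]) auto
qed

section \<open>The Fourier transform on square-integrable functions\<close>

lemma borel_imp_lebesgue_measurable:
  "f \<in> borel_measurable borel \<Longrightarrow> f \<in> borel_measurable lebesgue"
  by (rule measurable_completion) simp

lemma square_integrable_borel:
  fixes f :: "'a::euclidean_space \<Rightarrow> complex"
  assumes [measurable]: "f \<in> borel_measurable borel"
  shows "square_integrable lebesgue f \<longleftrightarrow> integrable lborel (\<lambda>x. (cmod (f x))\<^sup>2)"
  using borel_imp_lebesgue_measurable[OF assms]
  by (simp add: square_integrable_def integrable_completion)

lemma norm_to_L2_borel:
  fixes f :: "'a::euclidean_space \<Rightarrow> complex"
  assumes "f \<in> borel_measurable borel" "square_integrable lebesgue f"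
  shows "(norm (to_L2 f))\<^sup>2 = (LINT x|lborel. (cmod (f x))\<^sup>2)"
    and "(\<integral>\<^sup>+x. ennreal ((cmod (f x))\<^sup>2) \<partial>lborel) = ennreal ((norm (to_L2 f))\<^sup>2)"
  using nn_integral_norm_to_L2[OF assms(2)] assms
  by (simp_all add: norm_to_L2 integral_completion nn_integral_completion)

lemma inner_to_L2:
  assumes "square_integrable lebesgue f" "square_integrable lebesgue g"
  shows "to_L2 f \<bullet> to_L2 g = (LINT x|lebesgue. f x \<bullet> g x)"
  using assms by (simp add: to_L2_def inner_L2.abs_eq L2_rel_def)

lemma to_L2_eq_iff:
  assumes "square_integrable lebesgue f" "square_integrable lebesgue g"
  shows "to_L2 f = to_L2 g \<longleftrightarrow> (AE x in lebesgue. f x = g x)"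
  using Quotient_rel[OF Quotient_L2, of f g] assms
  by (auto simp: to_L2_def L2_rel_def)

lemma square_integrable_cong_AE:
  assumes "square_integrable lebesgue f" "AE x in lebesgue. f x = g x" "g \<in> borel_measurable lebesgue"
  shows "square_integrable lebesgue g"
proof -
  have [measurable]: "f \<in> borel_measurable lebesgue" "g \<in> borel_measurable lebesgue"
    using assms by (auto simp: square_integrable_def)
  have "integrable lebesgue (\<lambda>x. (cmod (f x))\<^sup>2) \<longleftrightarrow> integrable lebesgue (\<lambda>x. (cmod (g x))\<^sup>2)"
    by (rule Bochner_Integration.integrable_cong_AE) (use assms(2) in auto)
  then show ?thesis using assms by (simp add: square_integrable_def)
qed

text \<open>
  Source of the Borel representatives that are used throughout. Borel functions stay measurable under
  composition with continuous maps, and Fubini's theorem for the product measure applies to them, whereas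
  Lebesgue measurable functions have neither property in general.
\<close>

lemma lebesgue_ex_borel:
  fixes f :: "'a::euclidean_space \<Rightarrow> complex"
  assumes [measurable]: "f \<in> borel_measurable lebesgue"
  obtains g where "g \<in> borel_measurable borel" "AE x in lborel. f x = g x"
proof -
  obtain a where a: "a \<in> borel_measurable lborel" "AE x in lborel. Re (f x) = a x"
    using completion_ex_borel_measurable_real[of "\<lambda>x. Re (f x)" lborel] by auto
  obtain b where b: "b \<in> borel_measurable lborel" "AE x in lborel. Im (f x) = b x"
    using completion_ex_borel_measurable_real[of "\<lambda>x. Im (f x)" lborel] by auto
  show ?thesis
  proof (rule that[of "\<lambda>x. Complex (a x) (b x)"])
    have "(\<lambda>x. complex_of_real (a x) + \<i> * complex_of_real (b x)) \<in> borel_measurable borel"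
      using a b by measurable
    then show "(\<lambda>x. Complex (a x) (b x)) \<in> borel_measurable borel" by (simp add: Complex_eq)
    show "AE x in lborel. f x = Complex (a x) (b x)"
      using a(2) b(2) by eventually_elim (simp add: complex_eq_iff)
  qed
qed

lemma L2_borel_rep:
  fixes F :: "'a::euclidean_space L2"
  obtains g where "g \<in> borel_measurable borel" "square_integrable lebesgue g" "to_L2 g = F"
    "AE x in lborel. rep_L2 F x = g x"
proof -
  have r: "square_integrable lebesgue (rep_L2 F)" by (rule square_integrable_rep_L2)
  obtain g where g: "g \<in> borel_measurable borel" "AE x in lborel. rep_L2 F x = g x"
    using lebesgue_ex_borel r by (auto simp: square_integrable_def)
  have ae: "AE x in lebesgue. rep_L2 F x = g x" using g(2) by (rule AE_completion)
  have s: "square_integrable lebesgue g"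
    using r ae borel_imp_lebesgue_measurable[OF g(1)] by (rule square_integrable_cong_AE)
  have "to_L2 g = F"
    using to_L2_eq_iff[OF r s] ae by (simp add: to_L2_rep_L2)
  with g s show ?thesis by (intro that)
qed

lemma L2_dominated_convergence:
  fixes s :: "nat \<Rightarrow> 'a::euclidean_space \<Rightarrow> complex"
  assumes [measurable]: "\<And>i. s i \<in> borel_measurable borel" "f \<in> borel_measurable borel"
    and w: "integrable lborel (\<lambda>x. (w x)\<^sup>2)"
    and bd: "\<And>i. AE x in lborel. norm (s i x) \<le> w x"
    and lim: "AE x in lborel. (\<lambda>i. s i x) \<longlonglongrightarrow> f x"
  shows "\<And>i. square_integrable lebesgue (s i)" "square_integrable lebesgue f" "(\<lambda>i. to_L2 (s i)) \<longlonglongrightarrow> to_L2 f"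
proof -
  have bf: "AE x in lborel. norm (f x) \<le> w x"
  proof -
    have "AE x in lborel. \<forall>i. norm (s i x) \<le> w x" using bd by (simp add: AE_all_countable)
    with lim show ?thesis
    proof eventually_elim
      case (elim x)
      show ?case by (rule LIMSEQ_le_const2[OF tendsto_norm[OF elim(1)]]) (use elim in auto)
    qed
  qed
  have sq: "square_integrable lebesgue g" if [measurable]: "g \<in> borel_measurable borel" and "AE x in lborel. norm (g x) \<le> w x" for g :: "'a \<Rightarrow> complex"
  proof -
    have "integrable lborel (\<lambda>x. (cmod (g x))\<^sup>2)"
    proof (rule Bochner_Integration.integrable_bound[OF w])
      show "AE x in lborel. norm ((cmod (g x))\<^sup>2) \<le> norm ((w x)\<^sup>2)"
        using that(2) by eventually_elim (auto intro: power_mono)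
    qed measurable
    then show ?thesis by (simp add: square_integrable_borel)
  qed
  show s: "square_integrable lebesgue (s i)" for i using bd by (intro sq) auto
  show f: "square_integrable lebesgue f" using bf by (intro sq) auto
  have "(\<lambda>i. \<integral>\<^sup>+x. ennreal ((cmod (s i x - f x))\<^sup>2) \<partial>lborel) \<longlonglongrightarrow> (\<integral>\<^sup>+x. 0 \<partial>(lborel :: 'a measure))"
  proof (rule nn_integral_dominated_convergence[where w="\<lambda>x. ennreal (4 * (w x)\<^sup>2)"])
    have "integrable lborel (\<lambda>x. 4 * (w x)\<^sup>2)" using w by simp
    then show "(\<integral>\<^sup>+x. ennreal (4 * (w x)\<^sup>2) \<partial>lborel) < \<infinity>"
      by (subst nn_integral_eq_integral) auto
    show "AE x in lborel. ennreal ((cmod (s i x - f x))\<^sup>2) \<le> ennreal (4 * (w x)\<^sup>2)" for i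
      using bd[of i] bf
    proof eventually_elim
      case (elim x)
      have "cmod (s i x - f x) \<le> 2 * w x"
        using norm_triangle_ineq4[of "s i x" "f x"] elim by simp
      from power_mono[OF this, of 2] show ?case by (simp add: power_mult_distrib ennreal_leI)
    qed
    show "AE x in lborel. (\<lambda>i. ennreal ((cmod (s i x - f x))\<^sup>2)) \<longlonglongrightarrow> 0"
      using lim
    proof eventually_elim
      case (elim x)
      have "(\<lambda>i. ennreal ((cmod (s i x - f x))\<^sup>2)) \<longlonglongrightarrow> ennreal ((cmod (f x - f x))\<^sup>2)"
        using elim by (intro tendsto_intros)
      then show ?case by simp
    qed
    have "(\<lambda>x. (w x)\<^sup>2) \<in> borel_measurable lborel" using w by auto
    then show "(\<lambda>x. ennreal (4 * (w x)\<^sup>2)) \<in> borel_measurable lborel" by measurable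
  qed auto
  then show "(\<lambda>i. to_L2 (s i)) \<longlonglongrightarrow> to_L2 f"
    by (intro to_L2_tendsto_nn s f) (simp add: nn_integral_completion)
qed

definition trunc :: "real \<Rightarrow> ('a::euclidean_space \<Rightarrow> complex) \<Rightarrow> 'a \<Rightarrow> complex" where
  "trunc R f x = indicator (cball 0 R) x *\<^sub>R f x"

lemma integrable_indicator_cball: "integrable lborel (indicator (cball (a::'a::euclidean_space) R) :: 'a \<Rightarrow> real)"
  using emeasure_bounded_finite[of "cball a R"] by (intro integrable_real_indicator) auto

lemma trunc_measurable [measurable]: "f \<in> borel_measurable borel \<Longrightarrow> trunc R f \<in> borel_measurable borel"
  unfolding trunc_def by (intro borel_measurable_scaleR borel_measurable_indicator) auto

lemma trunc_L2:
  fixes f :: "'a::euclidean_space \<Rightarrow> complex"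
  assumes f [measurable]: "f \<in> borel_measurable borel" and sq: "square_integrable lebesgue f"
  shows trunc_square_integrable: "square_integrable lebesgue (trunc R f)"
    and trunc_integrable: "integrable lborel (trunc R f)"
    and trunc_tendsto: "(\<lambda>R::nat. to_L2 (trunc R f)) \<longlonglongrightarrow> to_L2 f"
proof -
  have i: "integrable lborel (\<lambda>x. (cmod (f x))\<^sup>2)" using sq by (simp add: square_integrable_borel)
  show "square_integrable lebesgue (trunc R f)"
    unfolding square_integrable_borel[OF trunc_measurable[OF f]]
    by (rule Bochner_Integration.integrable_bound[OF i]) (auto simp: trunc_def indicator_def)
  show "integrable lborel (trunc R f)"
  proof (rule Bochner_Integration.integrable_bound)
    show "integrable lborel (\<lambda>x. indicator (cball 0 R) x + (cmod (f x))\<^sup>2)"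
      using i by (intro Bochner_Integration.integrable_add integrable_indicator_cball)
    have "r \<le> 1 + r\<^sup>2" for r :: real
      using zero_le_power2[of "r - 1/2"] by (simp add: power2_eq_square algebra_simps)
    then show "AE x in lborel. norm (trunc R f x) \<le> norm (indicator (cball 0 R) x + (cmod (f x))\<^sup>2)"
      by (intro AE_I2) (auto simp: trunc_def indicator_def)
  qed measurable
  show "(\<lambda>R::nat. to_L2 (trunc R f)) \<longlonglongrightarrow> to_L2 f"
  proof (rule L2_dominated_convergence(3)[OF _ f i])
    show "AE x in lborel. (\<lambda>R::nat. trunc R f x) \<longlonglongrightarrow> f x"
    proof (intro AE_I2 tendsto_eventually)
      fix x :: 'a
      obtain N :: nat where "norm x \<le> N" using real_arch_simple by blast
      then show "\<forall>\<^sub>F R::nat in sequentially. trunc R f x = f x"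
        by (intro eventually_sequentiallyI[of N]) (auto simp: trunc_def indicator_def)
    qed
  qed (auto simp: trunc_def indicator_def)
qed

text \<open>
  A function which is bounded and vanishes outside a ball is an almost everywhere limit of continuous
  functions. Clipping their values and multiplying by a continuous cut-off makes the convergence dominated.
\<close>

lemma bounded_continuous_dense_L2:
  "closure {to_L2 g | g :: 'a::euclidean_space \<Rightarrow> complex. continuous_on UNIV g \<and> integrable lborel g \<and> (\<exists>B. \<forall>x. norm (g x) \<le> B)
     \<and> square_integrable lebesgue g} = UNIV" (is "closure ?D = UNIV")
proof -
  have closed: "y \<in> closure ?D" if "\<And>n. x n \<in> closure ?D" "x \<longlonglongrightarrow> y" for x :: "nat \<Rightarrow> 'a L2" and y
    using closed_sequentially[OF closed_closure] that by blast
  have A: "to_L2 f \<in> closure ?D" if f [measurable]: "f \<in> borel_measurable borel" and sq: "square_integrable lebesgue f"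
    and bd: "\<And>x. norm (f x) \<le> R" and supp: "\<And>x. norm x > R \<Longrightarrow> f x = 0" and R: "R > 0" for f :: "'a \<Rightarrow> complex" and R
  proof -
    have "f measurable_on UNIV"
      using borel_imp_lebesgue_measurable[OF f] by (intro lebesgue_measurable_imp_measurable_on) auto
    then obtain N g where N: "negligible N" and g: "\<And>n. continuous_on UNIV (g n)"
      and lim: "\<And>x. x \<notin> N \<Longrightarrow> (\<lambda>n. g n x) \<longlonglongrightarrow> f x"
      by (auto simp: measurable_on_def)
    \<comment> \<open>The radial retraction onto the ball of radius R, and a cut-off equal to 1 on the same ball.\<close>
    define clip where "clip z = (R / max R (norm z)) *\<^sub>R z" for z :: complex
    define \<kappa> where "\<kappa> x = max 0 (min 1 (R + 1 - norm x))" for x :: 'a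
    define h where "h n x = \<kappa> x *\<^sub>R clip (g n x)" for n x
    have clip: "norm (clip z) \<le> R" for z
      using R by (auto simp: clip_def field_simps max_def)
    have clip_c: "continuous_on UNIV clip"
      unfolding clip_def using R by (intro continuous_intros) (auto simp: max_def)
    have h: "norm (h n x) \<le> indicator (cball 0 (R + 1)) x * R" for n x
    proof -
      have "\<bar>\<kappa> x\<bar> \<le> indicator (cball 0 (R + 1)) x" by (auto simp: \<kappa>_def indicator_def)
      then show ?thesis using clip[of "g n x"] unfolding h_def norm_scaleR by (intro mult_mono) auto
    qed
    have hc: "continuous_on UNIV (h n)" for n
      unfolding h_def \<kappa>_def by (intro continuous_intros continuous_on_compose2[OF clip_c g]) auto
    have hm [measurable]: "h n \<in> borel_measurable borel" for n
      using hc by (rule borel_measurable_continuous_onI)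
    have ind: "integrable lborel (\<lambda>x. indicator (cball (0::'a) (R + 1)) x * R)"
      by (intro integrable_mult_left integrable_indicator_cball)
    have w: "integrable lborel (\<lambda>x. (indicator (cball (0::'a) (R + 1)) x * R)\<^sup>2)"
      by (rule Bochner_Integration.integrable_bound[of _ "\<lambda>x. R * (indicator (cball (0::'a) (R + 1)) x * R)"])
        (use ind in \<open>auto simp: indicator_def power2_eq_square\<close>)
    have l: "AE x in lborel. (\<lambda>n. h n x) \<longlonglongrightarrow> f x"
    proof -
      have "AE x in lebesgue. x \<notin> N" using N by (intro AE_not_in) (simp add: negligible_iff_null_sets)
      then have "AE x in lborel. x \<notin> N" by (simp add: AE_completion_iff)
      then show ?thesis
      proof eventually_elim
        case (elim x)
        have "(\<lambda>n. h n x) \<longlonglongrightarrow> \<kappa> x *\<^sub>R clip (f x)"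
          unfolding h_def
          using continuous_on_tendsto_compose[OF clip_c lim[OF elim]] by (intro tendsto_intros) auto
        moreover have "clip (f x) = f x" using bd[of x] R by (simp add: clip_def max_def)
        moreover have "\<kappa> x *\<^sub>R f x = f x" using supp[of x] by (cases "norm x > R") (auto simp: \<kappa>_def)
        ultimately show ?case by simp
      qed
    qed
    note dc = L2_dominated_convergence[OF hm f w _ l]
    have "to_L2 (h n) \<in> closure ?D" for n
    proof (rule subsetD[OF closure_subset])
      have "integrable lborel (h n)"
        by (rule Bochner_Integration.integrable_bound[OF ind]) (use h R in auto)
      moreover have "\<exists>B. \<forall>x. norm (h n x) \<le> B"
        using h R by (intro exI[of _ R] allI) (rule order_trans[OF h], auto simp: indicator_def)
      ultimately show "to_L2 (h n) \<in> ?D" using hc dc(1) h by blast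
    qed
    then show ?thesis by (rule closed[OF _ dc(3)]) (use h in auto)
  qed
  have "F \<in> closure ?D" for F
  proof -
    obtain f where f [measurable]: "f \<in> borel_measurable borel" and sq: "square_integrable lebesgue f" and F: "to_L2 f = F"
      by (rule L2_borel_rep)
    have i: "integrable lborel (\<lambda>x. (cmod (f x))\<^sup>2)" using sq by (simp add: square_integrable_borel)
    define s where "s k x = (if norm x \<le> real (Suc k) \<and> norm (f x) \<le> real (Suc k) then f x else 0)" for k x
    have sm: "s k \<in> borel_measurable borel" for k unfolding s_def by measurable
    have l: "AE x in lborel. (\<lambda>k. s k x) \<longlonglongrightarrow> f x"
    proof (intro AE_I2 tendsto_eventually)
      fix x :: 'a
      obtain N :: nat where "max (norm x) (norm (f x)) \<le> N" using real_arch_simple by blast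
      then show "\<forall>\<^sub>F k in sequentially. s k x = f x"
        by (intro eventually_sequentiallyI[of N]) (auto simp: s_def)
    qed
    note dc = L2_dominated_convergence[OF sm f i _ l]
    have "to_L2 (s k) \<in> closure ?D" for k
      by (rule A[OF sm dc(1), where R="real (Suc k)"]) (auto simp: s_def)
    then show ?thesis unfolding F[symmetric] by (rule closed[OF _ dc(3)]) (auto simp: s_def)
  qed
  then show ?thesis by auto
qed

lemma ft_add: "integrable lborel f \<Longrightarrow> integrable lborel g \<Longrightarrow> ft (\<lambda>x. f x + g x) \<xi> = ft f \<xi> + ft g \<xi>"
  by (simp add: ft_def distrib_left integrable_cis_mult(2))

lemma ft_diff: "integrable lborel f \<Longrightarrow> integrable lborel g \<Longrightarrow> ft (\<lambda>x. f x - g x) \<xi> = ft f \<xi> - ft g \<xi>"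
  by (simp add: ft_def right_diff_distrib integrable_cis_mult(2))

lemma ft_scaleR: "ft (\<lambda>x. c *\<^sub>R f x) \<xi> = c *\<^sub>R ft f \<xi>"
  by (simp add: ft_def)

lemma ft_square_integrable:
  fixes f :: "'a::euclidean_space \<Rightarrow> complex"
  assumes f: "integrable lborel f" and sq: "square_integrable lebesgue f"
  shows "square_integrable lebesgue (ft f)"
    and norm_to_L2_ft_le: "norm (to_L2 (ft f)) \<le> sqrt ((2 * pi) ^ DIM('a)) * norm (to_L2 f)"
proof -
  have fm [measurable]: "f \<in> borel_measurable borel" "ft f \<in> borel_measurable borel"
    using f ft_measurable[OF f] by auto
  have "(\<integral>\<^sup>+\<xi>. ennreal ((cmod (ft f \<xi>))\<^sup>2) \<partial>lborel) \<le> ennreal ((2 * pi) ^ DIM('a)) * ennreal ((norm (to_L2 f))\<^sup>2)"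
    using ft_L2_le[OF f] norm_to_L2_borel(2)[OF fm(1) sq] by simp
  also have "\<dots> = ennreal ((2 * pi) ^ DIM('a) * (norm (to_L2 f))\<^sup>2)"
    by (rule ennreal_mult[symmetric]) auto
  finally have le: "(\<integral>\<^sup>+\<xi>. ennreal ((cmod (ft f \<xi>))\<^sup>2) \<partial>lborel) \<le> ennreal ((2 * pi) ^ DIM('a) * (norm (to_L2 f))\<^sup>2)" .
  show sf: "square_integrable lebesgue (ft f)"
  proof (rule square_integrableI_nn)
    show "(\<integral>\<^sup>+\<xi>. ennreal ((cmod (ft f \<xi>))\<^sup>2) \<partial>lebesgue) < \<infinity>"
      using le_less_trans[OF le ennreal_less_top] by (simp add: nn_integral_completion)
  qed (rule borel_imp_lebesgue_measurable[OF fm(2)])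
  have "(norm (to_L2 (ft f)))\<^sup>2 \<le> (2 * pi) ^ DIM('a) * (norm (to_L2 f))\<^sup>2"
    using le norm_to_L2_borel(2)[OF fm(2) sf] by (simp add: ennreal_le_iff)
  then have "sqrt ((norm (to_L2 (ft f)))\<^sup>2) \<le> sqrt ((2 * pi) ^ DIM('a) * (norm (to_L2 f))\<^sup>2)"
    by (rule real_sqrt_le_mono)
  then show "norm (to_L2 (ft f)) \<le> sqrt ((2 * pi) ^ DIM('a)) * norm (to_L2 f)"
    by (simp only: real_sqrt_mult real_sqrt_abs abs_norm_cancel)
qed

lemma to_L2_ft_diff:
  fixes f g :: "'a::euclidean_space \<Rightarrow> complex"
  assumes "integrable lborel f" "square_integrable lebesgue f" "integrable lborel g" "square_integrable lebesgue g"
  shows "to_L2 (ft f) - to_L2 (ft g) = to_L2 (ft (\<lambda>x. f x - g x))"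
    and norm_to_L2_ft_diff_le: "norm (to_L2 (ft f) - to_L2 (ft g)) \<le> sqrt ((2 * pi) ^ DIM('a)) * norm (to_L2 f - to_L2 g)"
proof -
  have "to_L2 (ft (\<lambda>x. f x - g x)) = to_L2 (\<lambda>\<xi>. ft f \<xi> - ft g \<xi>)"
    using assms ft_diff[of f g] by (intro arg_cong[where f=to_L2]) auto
  then show 1: "to_L2 (ft f) - to_L2 (ft g) = to_L2 (ft (\<lambda>x. f x - g x))"
    using assms by (simp add: to_L2_diff ft_square_integrable)
  show "norm (to_L2 (ft f) - to_L2 (ft g)) \<le> sqrt ((2 * pi) ^ DIM('a)) * norm (to_L2 f - to_L2 g)"
    unfolding 1 to_L2_diff[OF assms(2,4), symmetric]
    by (intro norm_to_L2_ft_le Bochner_Integration.integrable_diff square_integrable_diff assms)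
qed

text \<open>
  The transforms of the truncations form a Cauchy sequence by \<open>ft_L2_le\<close>, so the limit which defines
  \<open>fourier_L2\<close> exists, and it may be computed from any Borel representative.
\<close>

lemma fourier_L2_LIMSEQ:
  fixes g :: "'a::euclidean_space \<Rightarrow> complex"
  assumes g [measurable]: "g \<in> borel_measurable borel" and sq: "square_integrable lebesgue g"
  shows "(\<lambda>R::nat. to_L2 (ft (trunc R g))) \<longlonglongrightarrow> fourier_L2 (to_L2 g)"
proof -
  have gl [measurable]: "g \<in> borel_measurable lebesgue" using g by (rule borel_imp_lebesgue_measurable)
  have ae: "AE x in lebesgue. rep_L2 (to_L2 g) x = g x"
    using to_L2_eq_iff[OF square_integrable_rep_L2 sq, of "to_L2 g"] by (simp add: to_L2_rep_L2)
  have rl [measurable]: "rep_L2 (to_L2 g) \<in> borel_measurable lebesgue"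
    using square_integrable_rep_L2 by (auto simp: square_integrable_def)
  have eq: "(LINT x|lebesgue. indicator (cball 0 R) x *\<^sub>R (cis (- (x \<bullet> \<xi>)) * rep_L2 (to_L2 g) x)) = ft (trunc R g) \<xi>" for R \<xi>
  proof -
    have cm: "(\<lambda>x. cis (- (x \<bullet> \<xi>))) \<in> borel_measurable borel" by measurable
    have cm' [measurable]: "(\<lambda>x. cis (- (x \<bullet> \<xi>))) \<in> borel_measurable lebesgue"
      using cm by (rule borel_imp_lebesgue_measurable)
    have "(LINT x|lebesgue. indicator (cball 0 R) x *\<^sub>R (cis (- (x \<bullet> \<xi>)) * rep_L2 (to_L2 g) x))
      = (LINT x|lebesgue. cis (- (x \<bullet> \<xi>)) * trunc R g x)"
    proof (rule integral_cong_AE)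
      show "AE x in lebesgue. indicator (cball 0 R) x *\<^sub>R (cis (- (x \<bullet> \<xi>)) * rep_L2 (to_L2 g) x) = cis (- (x \<bullet> \<xi>)) * trunc R g x"
        using ae by eventually_elim (simp add: trunc_def)
      show "(\<lambda>x. indicator (cball 0 R) x *\<^sub>R (cis (- (x \<bullet> \<xi>)) * rep_L2 (to_L2 g) x)) \<in> borel_measurable lebesgue"
        by (intro borel_measurable_scaleR borel_measurable_indicator) auto
      show "(\<lambda>x. cis (- (x \<bullet> \<xi>)) * trunc R g x) \<in> borel_measurable lebesgue"
        unfolding trunc_def by (intro borel_measurable_times borel_measurable_scaleR borel_measurable_indicator cm' gl) auto
    qed
    also have "\<dots> = ft (trunc R g) \<xi>"
      unfolding ft_def by (rule integral_completion) (use cm in measurable)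
    finally show ?thesis .
  qed
  have "Cauchy (\<lambda>R::nat. to_L2 (ft (trunc R g)))"
  proof -
    let ?c = "sqrt ((2 * pi) ^ DIM('a))"
    have C: "Cauchy (\<lambda>R::nat. to_L2 (trunc R g))"
      using trunc_tendsto[OF g sq] by (auto intro: LIMSEQ_imp_Cauchy)
    have c: "?c > 0" by simp
    show ?thesis
    proof (rule metric_CauchyI)
      fix e :: real assume "e > 0"
      then have "e / ?c > 0" using c by (metis divide_pos_pos)
      then obtain M where M: "\<And>m n. m \<ge> M \<Longrightarrow> n \<ge> M \<Longrightarrow> norm (to_L2 (trunc (real m) g) - to_L2 (trunc (real n) g)) < e / ?c"
        using C[THEN metric_CauchyD] by (metis dist_norm)
      show "\<exists>M. \<forall>m\<ge>M. \<forall>n\<ge>M. dist (to_L2 (ft (trunc (real m) g))) (to_L2 (ft (trunc (real n) g))) < e"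
      proof (intro exI allI impI)
        fix m n assume "M \<le> m" "M \<le> n"
        have "dist (to_L2 (ft (trunc (real m) g))) (to_L2 (ft (trunc (real n) g))) \<le> ?c * norm (to_L2 (trunc (real m) g) - to_L2 (trunc (real n) g))"
          unfolding dist_norm by (intro norm_to_L2_ft_diff_le trunc_L2 g sq)
        also have "\<dots> < ?c * (e / ?c)"
          using M \<open>M \<le> m\<close> \<open>M \<le> n\<close> c by (intro mult_strict_left_mono) blast+
        finally show "dist (to_L2 (ft (trunc (real m) g))) (to_L2 (ft (trunc (real n) g))) < e" using c by simp
      qed
    qed
  qed
  then have "convergent (\<lambda>R::nat. to_L2 (ft (trunc R g)))" by (rule Cauchy_convergent)
  then show ?thesis unfolding fourier_L2_def eq convergent_LIMSEQ_iff by (simp add: eta_contract_eq)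
qed

lemma fourier_L2_to_L2:
  fixes g :: "'a::euclidean_space \<Rightarrow> complex"
  assumes g: "integrable lborel g" and sq: "square_integrable lebesgue g"
  shows "fourier_L2 (to_L2 g) = to_L2 (ft g)"
proof -
  have gm: "g \<in> borel_measurable borel" using g by auto
  have "(\<lambda>R::nat. sqrt ((2 * pi) ^ DIM('a)) * norm (to_L2 (trunc R g) - to_L2 g)) \<longlonglongrightarrow> sqrt ((2 * pi) ^ DIM('a)) * norm (to_L2 g - to_L2 g)"
    by (intro tendsto_intros trunc_tendsto gm sq)
  then have l: "(\<lambda>R::nat. sqrt ((2 * pi) ^ DIM('a)) * norm (to_L2 (trunc R g) - to_L2 g)) \<longlonglongrightarrow> 0" by simp
  have "(\<lambda>R::nat. to_L2 (ft (trunc R g)) - to_L2 (ft g)) \<longlonglongrightarrow> 0"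
    by (rule Lim_null_comparison[OF always_eventually l])
      (intro allI norm_to_L2_ft_diff_le trunc_L2 gm g sq)
  then have "(\<lambda>R::nat. to_L2 (ft (trunc R g))) \<longlonglongrightarrow> to_L2 (ft g)" by (simp add: LIM_zero_iff)
  with fourier_L2_LIMSEQ[OF gm sq] show ?thesis by (rule LIMSEQ_unique)
qed

lemma norm_fourier_L2_le: "norm (fourier_L2 (f :: 'a::euclidean_space L2)) \<le> sqrt ((2 * pi) ^ DIM('a)) * norm f"
proof -
  obtain g where g: "g \<in> borel_measurable borel" "square_integrable lebesgue g" "to_L2 g = f"
    by (rule L2_borel_rep)
  show ?thesis
    unfolding g(3)[symmetric]
  proof (rule LIMSEQ_le[OF tendsto_norm[OF fourier_L2_LIMSEQ] tendsto_mult[OF tendsto_const tendsto_norm[OF trunc_tendsto]]])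
    show "\<exists>N. \<forall>n\<ge>N. norm (to_L2 (ft (trunc (real n) g))) \<le> sqrt ((2 * pi) ^ DIM('a)) * norm (to_L2 (trunc (real n) g))"
      using g by (intro exI allI impI norm_to_L2_ft_le trunc_L2)
  qed (use g in auto)
qed

lemma bounded_linear_fourier_L2: "bounded_linear (fourier_L2 :: 'a::euclidean_space L2 \<Rightarrow> 'a L2)"
proof (rule bounded_linear_intro)
  fix f g :: "'a L2" and r :: real
  obtain f' where f: "f' \<in> borel_measurable borel" "square_integrable lebesgue f'" "to_L2 f' = f"
    by (rule L2_borel_rep)
  obtain g' where g: "g' \<in> borel_measurable borel" "square_integrable lebesgue g'" "to_L2 g' = g"
    by (rule L2_borel_rep)
  have "to_L2 (ft (trunc R (\<lambda>x. f' x + g' x))) = to_L2 (ft (trunc R f')) + to_L2 (ft (trunc R g'))" for R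
  proof -
    have eq: "trunc R (\<lambda>x. f' x + g' x) = (\<lambda>x. trunc R f' x + trunc R g' x)"
      by (simp add: trunc_def scaleR_add_right fun_eq_iff)
    have "ft (trunc R (\<lambda>x. f' x + g' x)) = (\<lambda>\<xi>. ft (trunc R f') \<xi> + ft (trunc R g') \<xi>)"
      unfolding eq using f g by (simp add: ft_add trunc_L2 fun_eq_iff)
    then show ?thesis using f g by (simp add: to_L2_add ft_square_integrable trunc_L2)
  qed
  then have "(\<lambda>R::nat. to_L2 (ft (trunc R (\<lambda>x. f' x + g' x)))) \<longlonglongrightarrow> fourier_L2 f + fourier_L2 g"
    using tendsto_add[OF fourier_L2_LIMSEQ[OF f(1,2)] fourier_L2_LIMSEQ[OF g(1,2)]] f g by simp
  moreover have "(\<lambda>R::nat. to_L2 (ft (trunc R (\<lambda>x. f' x + g' x)))) \<longlonglongrightarrow> fourier_L2 (f + g)"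
    using fourier_L2_LIMSEQ[of "\<lambda>x. f' x + g' x"] f g by (simp add: to_L2_add square_integrable_add)
  ultimately show "fourier_L2 (f + g) = fourier_L2 f + fourier_L2 g" by (rule LIMSEQ_unique[rotated])
  have "to_L2 (ft (trunc R (\<lambda>x. r *\<^sub>R f' x))) = r *\<^sub>R to_L2 (ft (trunc R f'))" for R
  proof -
    have eq: "trunc R (\<lambda>x. r *\<^sub>R f' x) = (\<lambda>x. r *\<^sub>R trunc R f' x)"
      by (simp add: trunc_def fun_eq_iff)
    have "ft (trunc R (\<lambda>x. r *\<^sub>R f' x)) = (\<lambda>\<xi>. r *\<^sub>R ft (trunc R f') \<xi>)"
      unfolding eq by (simp add: ft_scaleR fun_eq_iff)
    then show ?thesis using f by (simp add: to_L2_scaleR ft_square_integrable trunc_L2)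
  qed
  then have "(\<lambda>R::nat. to_L2 (ft (trunc R (\<lambda>x. r *\<^sub>R f' x)))) \<longlonglongrightarrow> r *\<^sub>R fourier_L2 f"
    using tendsto_scaleR[OF tendsto_const fourier_L2_LIMSEQ[OF f(1,2)]] f by simp
  moreover have "(\<lambda>R::nat. to_L2 (ft (trunc R (\<lambda>x. r *\<^sub>R f' x)))) \<longlonglongrightarrow> fourier_L2 (r *\<^sub>R f)"
    using fourier_L2_LIMSEQ[of "\<lambda>x. r *\<^sub>R f' x"] f by (simp add: to_L2_scaleR square_integrable_scaleR)
  ultimately show "fourier_L2 (r *\<^sub>R f) = r *\<^sub>R fourier_L2 f" by (rule LIMSEQ_unique[rotated])
  show "norm (fourier_L2 f) \<le> norm f * sqrt ((2 * pi) ^ DIM('a))"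
    using norm_fourier_L2_le[of f] by (simp only: mult.commute)
qed

text \<open>
  Both sides are continuous in \<open>f\<close>, and they agree on the dense set of bounded, continuous, integrable
  functions.
\<close>

theorem norm_fourier_L2: "norm (fourier_L2 (f :: 'a::euclidean_space L2)) = sqrt ((2 * pi) ^ DIM('a)) * norm f"
proof -
  let ?D = "{to_L2 g | g :: 'a \<Rightarrow> complex. continuous_on UNIV g \<and> integrable lborel g \<and> (\<exists>B. \<forall>x. norm (g x) \<le> B)
     \<and> square_integrable lebesgue g}"
  have "closed {f :: 'a L2. norm (fourier_L2 f) = sqrt ((2 * pi) ^ DIM('a)) * norm f}"
    by (intro closed_Collect_eq continuous_intros linear_continuous_on bounded_linear_fourier_L2)
  moreover have "?D \<subseteq> {f. norm (fourier_L2 f) = sqrt ((2 * pi) ^ DIM('a)) * norm f}"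
  proof safe
    fix g :: "'a \<Rightarrow> complex" and B assume g: "continuous_on UNIV g" "integrable lborel g" "\<forall>x. norm (g x) \<le> B" "square_integrable lebesgue g"
    have gm: "g \<in> borel_measurable borel" using g by auto
    have "ennreal ((norm (to_L2 (ft g)))\<^sup>2) = ennreal ((2 * pi) ^ DIM('a)) * ennreal ((norm (to_L2 g))\<^sup>2)"
      using ft_Plancherel_bounded_continuous[OF g(2,1), of B] g
      by (simp only: norm_to_L2_borel(2)[OF ft_measurable ft_square_integrable(1)] norm_to_L2_borel(2)[OF gm])
    also have "\<dots> = ennreal ((2 * pi) ^ DIM('a) * (norm (to_L2 g))\<^sup>2)"
      by (rule ennreal_mult[symmetric]) auto
    finally have "(norm (to_L2 (ft g)))\<^sup>2 = (2 * pi) ^ DIM('a) * (norm (to_L2 g))\<^sup>2"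
      by (subst (asm) ennreal_inj) auto
    then have "sqrt ((norm (to_L2 (ft g)))\<^sup>2) = sqrt ((2 * pi) ^ DIM('a) * (norm (to_L2 g))\<^sup>2)"
      by (simp only:)
    then show "norm (fourier_L2 (to_L2 g)) = sqrt ((2 * pi) ^ DIM('a)) * norm (to_L2 g)"
      using g by (simp only: real_sqrt_mult real_sqrt_abs abs_norm_cancel fourier_L2_to_L2)
  qed
  ultimately have "closure ?D \<subseteq> {f. norm (fourier_L2 f) = sqrt ((2 * pi) ^ DIM('a)) * norm f}"
    by (intro closure_minimal)
  then show ?thesis using bounded_continuous_dense_L2 by blast
qed

lemma inner_to_L2_borel:
  fixes f g :: "'a::euclidean_space \<Rightarrow> complex"
  assumes [measurable]: "f \<in> borel_measurable borel" "g \<in> borel_measurable borel"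
    and "square_integrable lebesgue f" "square_integrable lebesgue g"
  shows "to_L2 f \<bullet> to_L2 g = (LINT x|lborel. f x \<bullet> g x)"
  using assms by (simp add: inner_to_L2 integral_completion)

lemma complex_inner_Re: "z \<bullet> w = Re (z * cnj w)"
  by (simp add: inner_complex_def)

definition cnj_L2 :: "'a::euclidean_space L2 \<Rightarrow> 'a L2" where
  "cnj_L2 f = to_L2 (\<lambda>x. cnj (rep_L2 f x))"

lemma square_integrable_cnj: "square_integrable lebesgue f \<Longrightarrow> square_integrable lebesgue (\<lambda>x. cnj (f x))"
  using measurable_comp[of f lebesgue borel cnj borel] by (auto simp: square_integrable_def o_def)

lemma cnj_L2_to_L2:
  assumes "square_integrable lebesgue f"
  shows "cnj_L2 (to_L2 f) = to_L2 (\<lambda>x. cnj (f x))"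
proof -
  have "AE x in lebesgue. rep_L2 (to_L2 f) x = f x"
    using to_L2_eq_iff[OF square_integrable_rep_L2 assms, of "to_L2 f"] by (simp add: to_L2_rep_L2)
  then show ?thesis
    unfolding cnj_L2_def
    by (subst to_L2_eq_iff) (auto intro!: square_integrable_cnj square_integrable_rep_L2 assms)
qed

lemma cnj_L2_cnj_L2 [simp]: "cnj_L2 (cnj_L2 f) = f"
proof -
  obtain g where g: "g \<in> borel_measurable borel" "square_integrable lebesgue g" "to_L2 g = f"
    by (rule L2_borel_rep)
  then show ?thesis by (auto simp: cnj_L2_to_L2 square_integrable_cnj)
qed

lemma bounded_linear_cnj_L2: "bounded_linear (cnj_L2 :: 'a::euclidean_space L2 \<Rightarrow> 'a L2)"
proof (rule bounded_linear_intro[where K=1])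
  fix f g :: "'a L2" and r :: real
  obtain f' where f: "f' \<in> borel_measurable borel" "square_integrable lebesgue f'" "to_L2 f' = f"
    by (rule L2_borel_rep)
  obtain g' where g: "g' \<in> borel_measurable borel" "square_integrable lebesgue g'" "to_L2 g' = g"
    by (rule L2_borel_rep)
  have "cnj_L2 (to_L2 (\<lambda>x. f' x + g' x)) = cnj_L2 (to_L2 f') + cnj_L2 (to_L2 g')"
    unfolding cnj_L2_to_L2[OF f(2)] cnj_L2_to_L2[OF g(2)] cnj_L2_to_L2[OF square_integrable_add[OF f(2) g(2)]] complex_cnj_add
    by (intro to_L2_add square_integrable_cnj f g)
  then show "cnj_L2 (f + g) = cnj_L2 f + cnj_L2 g" by (simp only: to_L2_add[OF f(2) g(2)] f(3) g(3))
  have "cnj_L2 (to_L2 (\<lambda>x. r *\<^sub>R f' x)) = r *\<^sub>R cnj_L2 (to_L2 f')"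
    unfolding cnj_L2_to_L2[OF f(2)] cnj_L2_to_L2[OF square_integrable_scaleR[OF f(2)]]
    by (subst to_L2_scaleR[symmetric]) (use f in \<open>auto intro: square_integrable_cnj\<close>)
  then show "cnj_L2 (r *\<^sub>R f) = r *\<^sub>R cnj_L2 f" by (simp only: to_L2_scaleR[OF f(2)] f(3))
  have "norm (cnj_L2 (to_L2 f')) = norm (to_L2 f')"
    unfolding cnj_L2_to_L2[OF f(2)] norm_to_L2[OF f(2)] norm_to_L2[OF square_integrable_cnj[OF f(2)]] by simp
  then show "norm (cnj_L2 f) \<le> norm f * 1" using f(3) by simp
qed

text \<open>
  The adjoint of \<open>fourier_L2\<close>. An isometry \<open>\<Phi>\<close> up to a factor satisfies \<open>\<Phi>\<^sup>* \<Phi> = c\<close>, and because the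
  adjoint is the conjugate of \<open>\<Phi>\<close> by complex conjugation, also \<open>\<Phi> \<Phi>\<^sup>* = c\<close>. Thus \<open>\<Phi>\<close> is bijective, with
  inverse \<open>\<Phi>\<^sup>* / c\<close>.
\<close>

definition fourier_adj :: "'a::euclidean_space L2 \<Rightarrow> 'a L2" where
  "fourier_adj g = cnj_L2 (fourier_L2 (cnj_L2 g))"

lemma bounded_linear_fourier_adj: "bounded_linear (fourier_adj :: 'a::euclidean_space L2 \<Rightarrow> 'a L2)"
  unfolding fourier_adj_def
  by (intro bounded_linear_compose[OF bounded_linear_cnj_L2] bounded_linear_compose[OF bounded_linear_fourier_L2] bounded_linear_cnj_L2)

lemma inner_ft:
  fixes u v :: "'a::euclidean_space \<Rightarrow> complex"
  assumes u: "integrable lborel u" "square_integrable lebesgue u" and v: "integrable lborel v" "square_integrable lebesgue v"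
  shows "fourier_L2 (to_L2 u) \<bullet> to_L2 v = to_L2 u \<bullet> fourier_adj (to_L2 v)"
proof -
  have m [measurable]: "u \<in> borel_measurable borel" "v \<in> borel_measurable borel"
    using u v by auto
  have cv: "integrable lborel (\<lambda>x. cnj (v x))" "square_integrable lebesgue (\<lambda>x. cnj (v x))"
    using v by (auto intro: square_integrable_cnj)
  note fm [measurable] = ft_measurable[OF u(1)] ft_measurable[OF cv(1)]
  have int: "integrable lborel (\<lambda>x. ft a x * b x)" if a: "integrable lborel a" and b: "integrable lborel b"
    for a b :: "'a \<Rightarrow> complex"
  proof (rule Bochner_Integration.integrable_bound)
    show "integrable lborel (\<lambda>x. (LINT x|lborel. norm (a x)) * norm (b x))" using b by simp
    show "AE x in lborel. norm (ft a x * b x) \<le> norm ((LINT x|lborel. norm (a x)) * norm (b x))"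
      using norm_ft_le[OF a] by (intro AE_I2) (auto simp: norm_mult intro!: mult_right_mono)
    show "(\<lambda>x. ft a x * b x) \<in> borel_measurable lborel"
      using b ft_measurable[OF a] by measurable
  qed
  have "fourier_L2 (to_L2 u) \<bullet> to_L2 v = (LINT x|lborel. Re (ft u x * cnj (v x)))"
    using u v by (simp add: fourier_L2_to_L2 inner_to_L2_borel ft_square_integrable complex_inner_Re[abs_def] del: times_complex.simps(1))
  also have "\<dots> = Re (LINT x|lborel. ft u x * cnj (v x))"
    by (rule integral_Re[OF int[OF u(1) cv(1)]])
  also have "(LINT x|lborel. ft u x * cnj (v x)) = (LINT x|lborel. u x * ft (\<lambda>x. cnj (v x)) x)"
    using bounded_kernel_Fubini[OF u(1) cv(1) fourier_kernel_measurable(1)] by (simp add: ft_def inner_commute)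
  also have "Re \<dots> = (LINT x|lborel. Re (u x * ft (\<lambda>x. cnj (v x)) x))"
    using int[OF cv(1) u(1)] by (intro integral_Re[symmetric]) (simp add: mult.commute)
  also have "\<dots> = to_L2 u \<bullet> to_L2 (\<lambda>x. cnj (ft (\<lambda>x. cnj (v x)) x))"
    using u cv by (subst inner_to_L2_borel) (auto simp: ft_square_integrable square_integrable_cnj complex_inner_Re simp del: times_complex.simps(1))
  also have "\<dots> = to_L2 u \<bullet> fourier_adj (to_L2 v)"
    using v cv by (simp add: fourier_adj_def cnj_L2_to_L2 fourier_L2_to_L2 ft_square_integrable)
  finally show ?thesis .
qed

lemma inner_fourier_L2: "fourier_L2 f \<bullet> g = f \<bullet> fourier_adj g"
proof -
  obtain f' where f: "f' \<in> borel_measurable borel" "square_integrable lebesgue f'" "to_L2 f' = f"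
    by (rule L2_borel_rep)
  obtain g' where g: "g' \<in> borel_measurable borel" "square_integrable lebesgue g'" "to_L2 g' = g"
    by (rule L2_borel_rep)
  have "(\<lambda>R::nat. fourier_L2 (to_L2 (trunc R f')) \<bullet> to_L2 (trunc R g')) \<longlonglongrightarrow> fourier_L2 (to_L2 f') \<bullet> to_L2 g'"
    by (intro tendsto_inner bounded_linear.tendsto[OF bounded_linear_fourier_L2] trunc_tendsto f g)
  moreover have "(\<lambda>R::nat. to_L2 (trunc R f') \<bullet> fourier_adj (to_L2 (trunc R g'))) \<longlonglongrightarrow> to_L2 f' \<bullet> fourier_adj (to_L2 g')"
    by (intro tendsto_inner bounded_linear.tendsto[OF bounded_linear_fourier_adj] trunc_tendsto f g)
  moreover have "\<And>R. fourier_L2 (to_L2 (trunc R f')) \<bullet> to_L2 (trunc R g') = to_L2 (trunc R f') \<bullet> fourier_adj (to_L2 (trunc R g'))"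
    by (intro inner_ft trunc_L2 f g)
  ultimately have "fourier_L2 (to_L2 f') \<bullet> to_L2 g' = to_L2 f' \<bullet> fourier_adj (to_L2 g')"
    by (simp only: LIMSEQ_unique)
  then show ?thesis unfolding f(3) g(3) .
qed

text \<open>
  The square of the factor by which \<open>fourier_L2\<close> changes norms.
\<close>

definition fourier_const :: "'a::euclidean_space itself \<Rightarrow> real" where
  "fourier_const _ = (2 * pi) ^ DIM('a)"

lemma fourier_const_pos [simp]: "fourier_const a > 0" "fourier_const a \<noteq> 0" "fourier_const a \<ge> 0"
  by (simp_all add: fourier_const_def)

lemma norm_fourier_L2_const: "norm (fourier_L2 (f :: 'a::euclidean_space L2)) = sqrt (fourier_const TYPE('a)) * norm f"
  unfolding fourier_const_def by (rule norm_fourier_L2)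

lemma inner_fourier_L2_fourier_L2: "fourier_L2 f \<bullet> fourier_L2 g = fourier_const TYPE('a) * (f \<bullet> (g :: 'a::euclidean_space L2))"
proof -
  interpret bounded_linear "fourier_L2 :: 'a L2 \<Rightarrow> 'a L2" by (rule bounded_linear_fourier_L2)
  have n: "(norm (fourier_L2 h))\<^sup>2 = fourier_const TYPE('a) * (norm h)\<^sup>2" for h :: "'a L2"
    unfolding norm_fourier_L2 power_mult_distrib fourier_const_def by (subst real_sqrt_pow2) auto
  have p: "h \<bullet> k = ((norm (h + k))\<^sup>2 - (norm (h - k))\<^sup>2) / 4" for h k :: "'a L2"
    by (simp add: power2_norm_eq_inner inner_add_left inner_add_right inner_diff_left inner_diff_right inner_commute)
  show ?thesis
    unfolding p add[symmetric] diff[symmetric] n by (simp only: right_diff_distrib[symmetric] times_divide_eq_right)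
qed

lemma fourier_adj_fourier_L2: "fourier_adj (fourier_L2 f) = fourier_const TYPE('a) *\<^sub>R (f :: 'a::euclidean_space L2)"
proof -
  have "(fourier_adj (fourier_L2 f) - fourier_const TYPE('a) *\<^sub>R f) \<bullet> g = 0" for g
    using inner_fourier_L2[of g "fourier_L2 f"] inner_fourier_L2_fourier_L2[of g f]
    unfolding inner_commute[of _ g] inner_diff_right inner_scaleR_right by simp
  then have "fourier_adj (fourier_L2 f) - fourier_const TYPE('a) *\<^sub>R f = 0"
    by (metis inner_eq_zero_iff)
  then show ?thesis by simp
qed

lemma fourier_L2_fourier_adj: "fourier_L2 (fourier_adj f) = fourier_const TYPE('a) *\<^sub>R (f :: 'a::euclidean_space L2)"
proof -
  have "cnj_L2 (fourier_L2 (fourier_adj f)) = fourier_adj (fourier_L2 (cnj_L2 f))"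
    by (simp add: fourier_adj_def)
  also have "\<dots> = cnj_L2 (fourier_const TYPE('a) *\<^sub>R f)"
    unfolding fourier_adj_fourier_L2 linear_scale[OF bounded_linear.linear[OF bounded_linear_cnj_L2]] ..
  finally show ?thesis by (metis cnj_L2_cnj_L2)
qed

lemma inv_fourier_L2: "inv fourier_L2 (f :: 'a::euclidean_space L2) = (1 / fourier_const TYPE('a)) *\<^sub>R fourier_adj f"
  and fourier_L2_inv: "fourier_L2 (inv fourier_L2 f) = f"
  and inv_fourier_L2_fourier_L2: "inv fourier_L2 (fourier_L2 f) = f"
proof -
  have c: "fourier_const TYPE('a) \<noteq> 0" by simp
  have 1: "fourier_L2 ((1 / fourier_const TYPE('a)) *\<^sub>R fourier_adj f) = f"
    unfolding linear_scale[OF bounded_linear.linear[OF bounded_linear_fourier_L2]] fourier_L2_fourier_adj using c by simp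
  have inj: "inj (fourier_L2 :: 'a L2 \<Rightarrow> 'a L2)"
  proof (rule injI)
    fix f g :: "'a L2" assume "fourier_L2 f = fourier_L2 g"
    then have "fourier_const TYPE('a) *\<^sub>R f = fourier_const TYPE('a) *\<^sub>R g" by (metis fourier_adj_fourier_L2)
    then show "f = g" using c by simp
  qed
  show "inv fourier_L2 f = (1 / fourier_const TYPE('a)) *\<^sub>R fourier_adj f"
    using inj 1 by (rule inv_f_eq)
  then show "fourier_L2 (inv fourier_L2 f) = f" using 1 by simp
  show "inv fourier_L2 (fourier_L2 f) = f" using inj by simp
qed

lemma bounded_linear_inv_fourier_L2: "bounded_linear (inv fourier_L2 :: 'a::euclidean_space L2 \<Rightarrow> 'a L2)"
  unfolding inv_fourier_L2[abs_def]
  by (rule bounded_linear_compose[OF bounded_linear_scaleR_right bounded_linear_fourier_adj])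

lemma inv_fourier_L2_to_L2:
  fixes g :: "'a::euclidean_space \<Rightarrow> complex"
  assumes g: "integrable lborel g" "square_integrable lebesgue g"
  shows "inv fourier_L2 (to_L2 g) = to_L2 (\<lambda>x. (1 / fourier_const TYPE('a)) *\<^sub>R (LINT \<xi>|lborel. cis (x \<bullet> \<xi>) * g \<xi>))"
    and "square_integrable lebesgue (\<lambda>x. (1 / fourier_const TYPE('a)) *\<^sub>R (LINT \<xi>|lborel. cis (x \<bullet> \<xi>) * g \<xi>))"
proof -
  have cv: "integrable lborel (\<lambda>x. cnj (g x))" "square_integrable lebesgue (\<lambda>x. cnj (g x))"
    using g by (auto intro: square_integrable_cnj)
  have eq: "cnj (ft (\<lambda>x. cnj (g x)) x) = (LINT \<xi>|lborel. cis (x \<bullet> \<xi>) * g \<xi>)" for x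
    by (simp add: cnj_ft inner_commute)
  have sq: "square_integrable lebesgue (\<lambda>x. LINT \<xi>|lborel. cis (x \<bullet> \<xi>) * g \<xi>)"
    using square_integrable_cnj[OF ft_square_integrable(1)[OF cv]] by (simp add: eq)
  then show "square_integrable lebesgue (\<lambda>x. (1 / fourier_const TYPE('a)) *\<^sub>R (LINT \<xi>|lborel. cis (x \<bullet> \<xi>) * g \<xi>))"
    by (rule square_integrable_scaleR)
  have "fourier_adj (to_L2 g) = to_L2 (\<lambda>x. LINT \<xi>|lborel. cis (x \<bullet> \<xi>) * g \<xi>)"
    using g cv by (simp add: fourier_adj_def cnj_L2_to_L2 fourier_L2_to_L2 ft_square_integrable eq)
  then show "inv fourier_L2 (to_L2 g) = to_L2 (\<lambda>x. (1 / fourier_const TYPE('a)) *\<^sub>R (LINT \<xi>|lborel. cis (x \<bullet> \<xi>) * g \<xi>))"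
    by (simp only: inv_fourier_L2 to_L2_scaleR[OF sq])
qed

section \<open>Multiplication operators and the semigroup\<close>

text \<open>
  A bounded factor \<open>m\<close> makes this independent of the representative.
\<close>

definition mul_L2 :: "('a::euclidean_space \<Rightarrow> real) \<Rightarrow> 'a L2 \<Rightarrow> 'a L2" where
  "mul_L2 m f = to_L2 (\<lambda>x. m x *\<^sub>R rep_L2 f x)"

lemma square_integrable_mul:
  fixes m :: "'a::euclidean_space \<Rightarrow> real"
  assumes [measurable]: "m \<in> borel_measurable lebesgue" and bd: "\<And>x. \<bar>m x\<bar> \<le> B" and f: "square_integrable lebesgue f"
  shows "square_integrable lebesgue (\<lambda>x. m x *\<^sub>R f x)"
proof -
  have [measurable]: "f \<in> borel_measurable lebesgue" and i: "integrable lebesgue (\<lambda>x. (cmod (f x))\<^sup>2)"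
    using f by (auto simp: square_integrable_def)
  have "integrable lebesgue (\<lambda>x. (cmod (m x *\<^sub>R f x))\<^sup>2)"
  proof (rule Bochner_Integration.integrable_bound)
    show "integrable lebesgue (\<lambda>x. B\<^sup>2 * (cmod (f x))\<^sup>2)" using i by simp
    have "(m x)\<^sup>2 \<le> B\<^sup>2" for x using bd[of x] abs_le_square_iff by fastforce
    then show "AE x in lebesgue. norm ((cmod (m x *\<^sub>R f x))\<^sup>2) \<le> norm (B\<^sup>2 * (cmod (f x))\<^sup>2)"
      by (intro AE_I2) (auto simp: power_mult_distrib intro: mult_right_mono)
  qed measurable
  then show ?thesis by (simp add: square_integrable_def)
qed

lemma mul_L2_to_L2:
  assumes "m \<in> borel_measurable lebesgue" "\<And>x. \<bar>m x\<bar> \<le> B" "square_integrable lebesgue f"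
  shows "mul_L2 m (to_L2 f) = to_L2 (\<lambda>x. m x *\<^sub>R f x)"
proof -
  have "AE x in lebesgue. rep_L2 (to_L2 f) x = f x"
    using to_L2_eq_iff[OF square_integrable_rep_L2 assms(3), of "to_L2 f"] by (simp add: to_L2_rep_L2)
  then show ?thesis
    unfolding mul_L2_def
    by (subst to_L2_eq_iff) (auto intro!: square_integrable_mul[OF assms(1,2)] square_integrable_rep_L2 assms)
qed

lemma mul_L2_mul_L2:
  assumes "m \<in> borel_measurable lebesgue" "\<And>x. \<bar>m x\<bar> \<le> B" "k \<in> borel_measurable lebesgue" "\<And>x. \<bar>k x\<bar> \<le> C"
  shows "mul_L2 m (mul_L2 k f) = mul_L2 (\<lambda>x. m x * k x) f"
  unfolding mul_L2_def[of k]
  by (subst mul_L2_to_L2[OF assms(1,2)]) (auto intro!: square_integrable_mul[OF assms(3,4)] square_integrable_rep_L2 simp: mul_L2_def)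

lemma mul_L2_bounded:
  fixes m :: "'a::euclidean_space \<Rightarrow> real"
  assumes m [measurable]: "m \<in> borel_measurable lebesgue" and bd: "\<And>x. \<bar>m x\<bar> \<le> B"
  shows norm_mul_L2_le: "norm (mul_L2 m f) \<le> B * norm f"
    and bounded_linear_mul_L2: "bounded_linear (mul_L2 m)"
    and inner_mul_L2: "mul_L2 m f \<bullet> g = f \<bullet> mul_L2 m g"
proof -
  have B: "B \<ge> 0" using bd[of 0] by linarith
  show n: "norm (mul_L2 m f) \<le> B * norm f" for f
  proof -
    let ?f = "rep_L2 f"
    have f: "square_integrable lebesgue ?f" by (rule square_integrable_rep_L2)
    have "norm (mul_L2 m f) = sqrt (LINT x|lebesgue. (cmod (m x *\<^sub>R ?f x))\<^sup>2)"
      unfolding mul_L2_def by (rule norm_to_L2[OF square_integrable_mul[OF m bd f]])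
    also have "\<dots> \<le> sqrt (LINT x|lebesgue. B\<^sup>2 * (cmod (?f x))\<^sup>2)"
    proof (intro real_sqrt_le_mono integral_mono)
      show "integrable lebesgue (\<lambda>x. (cmod (m x *\<^sub>R ?f x))\<^sup>2)"
        using square_integrable_mul[OF m bd f] by (simp add: square_integrable_def)
      show "integrable lebesgue (\<lambda>x. B\<^sup>2 * (cmod (?f x))\<^sup>2)" using f by (simp add: square_integrable_def)
      have "(m x)\<^sup>2 \<le> B\<^sup>2" for x using bd[of x] abs_le_square_iff by fastforce
      then show "(cmod (m x *\<^sub>R ?f x))\<^sup>2 \<le> B\<^sup>2 * (cmod (?f x))\<^sup>2" for x
        by (auto simp: power_mult_distrib intro: mult_right_mono)
    qed
    also have "\<dots> = B * norm f"
      using B norm_to_L2[OF f] by (simp add: real_sqrt_mult to_L2_rep_L2)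
    finally show ?thesis .
  qed
  show "bounded_linear (mul_L2 m)"
  proof (rule bounded_linear_intro)
    fix f g :: "'a L2" and r :: real
    have f: "square_integrable lebesgue (rep_L2 f)" and g: "square_integrable lebesgue (rep_L2 g)"
      by (rule square_integrable_rep_L2)+
    have "mul_L2 m (to_L2 (\<lambda>x. rep_L2 f x + rep_L2 g x)) = mul_L2 m f + mul_L2 m g"
      unfolding mul_L2_to_L2[OF m bd square_integrable_add[OF f g]] scaleR_add_right mul_L2_def[of m f] mul_L2_def[of m g]
      by (intro to_L2_add square_integrable_mul[OF m bd] f g)
    then show "mul_L2 m (f + g) = mul_L2 m f + mul_L2 m g"
      by (simp only: to_L2_add[OF f g] to_L2_rep_L2)
    have "mul_L2 m (to_L2 (\<lambda>x. r *\<^sub>R rep_L2 f x)) = r *\<^sub>R mul_L2 m f"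
      unfolding mul_L2_to_L2[OF m bd square_integrable_scaleR[OF f]] scaleR_left_commute[of "m _" r] mul_L2_def[of m f]
      by (intro to_L2_scaleR square_integrable_mul[OF m bd] f)
    then show "mul_L2 m (r *\<^sub>R f) = r *\<^sub>R mul_L2 m f"
      by (simp only: to_L2_scaleR[OF f] to_L2_rep_L2)
    show "norm (mul_L2 m f) \<le> norm f * B" using n[of f] by (simp add: mult.commute)
  qed
  have f: "square_integrable lebesgue (rep_L2 f)" and g: "square_integrable lebesgue (rep_L2 g)"
    by (rule square_integrable_rep_L2)+
  have "to_L2 (\<lambda>x. m x *\<^sub>R rep_L2 f x) \<bullet> to_L2 (rep_L2 g) = to_L2 (rep_L2 f) \<bullet> to_L2 (\<lambda>x. m x *\<^sub>R rep_L2 g x)"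
    by (simp add: inner_to_L2 square_integrable_mul[OF m bd] f g)
  then show "mul_L2 m f \<bullet> g = f \<bullet> mul_L2 m g"
    by (simp add: mul_L2_def to_L2_rep_L2)
qed

lemma fourier_multiplier_eq: "fourier_multiplier m f = inv fourier_L2 (mul_L2 m (fourier_L2 f))"
  by (simp add: fourier_multiplier_def mul_L2_def)

lemma inner_inv_fourier_L2: "inv fourier_L2 f \<bullet> (g :: 'a::euclidean_space L2) = (1 / fourier_const TYPE('a)) * (f \<bullet> fourier_L2 g)"
  using inner_fourier_L2_fourier_L2[of "inv fourier_L2 f" g] by (simp add: fourier_L2_inv field_simps)

lemma norm_inv_fourier_L2: "norm (inv fourier_L2 (f :: 'a::euclidean_space L2)) = norm f / sqrt (fourier_const TYPE('a))"
  using norm_fourier_L2_const[of "inv fourier_L2 f"] by (simp add: fourier_L2_inv)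

context
  fixes m :: "'a::euclidean_space \<Rightarrow> real" and B :: real
  assumes m: "m \<in> borel_measurable lebesgue" and bd: "\<And>x. \<bar>m x\<bar> \<le> B"
begin

lemma bounded_linear_fourier_multiplier: "bounded_linear (fourier_multiplier m)"
  unfolding fourier_multiplier_eq[abs_def]
  by (intro bounded_linear_compose[OF bounded_linear_inv_fourier_L2] bounded_linear_compose[OF bounded_linear_mul_L2[OF m bd]] bounded_linear_fourier_L2)

lemma norm_fourier_multiplier_le: "norm (fourier_multiplier m f) \<le> B * norm f"
proof -
  have "norm (fourier_multiplier m f) \<le> B * norm (fourier_L2 f) / sqrt (fourier_const TYPE('a))"
    unfolding fourier_multiplier_eq norm_inv_fourier_L2 by (intro divide_right_mono norm_mul_L2_le[OF m bd]) simp
  then show ?thesis by (simp add: norm_fourier_L2_const)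
qed

lemma inner_fourier_multiplier: "fourier_multiplier m f \<bullet> g = f \<bullet> fourier_multiplier m g"
  using inner_mul_L2[OF m bd, of "fourier_L2 f" "fourier_L2 g"]
  by (simp add: fourier_multiplier_eq inner_inv_fourier_L2 inner_commute[of f])
    (simp add: inner_commute)

end

text \<open>
  The lower bound \<open>- c0\<close> of the symbol gives \<open>exp (t c0)\<close> as a bound for the norm of the semigroup at
  time \<open>t\<close>.
\<close>

locale symbol =
  fixes F :: "real \<Rightarrow> real" and c0 :: real
  assumes F_cont: "continuous_on {0..} F" and F_lower: "\<And>r. r \<ge> 0 \<Longrightarrow> - c0 \<le> F r" and c0: "c0 \<ge> 0"
begin

lemma symbol_continuous: "continuous_on UNIV (\<lambda>\<xi>::'a::euclidean_space. F (norm \<xi>))"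
  by (rule continuous_on_compose2[OF F_cont]) (auto intro: continuous_intros)

lemma symbol_measurable [measurable]: "(\<lambda>\<xi>::'a::euclidean_space. F (norm \<xi>)) \<in> borel_measurable borel"
  using symbol_continuous by (rule borel_measurable_continuous_onI)

lemma exp_symbol_le: "t \<ge> 0 \<Longrightarrow> t \<le> T \<Longrightarrow> \<bar>exp (- t * F (norm \<xi>))\<bar> \<le> exp (T * c0)"
proof -
  assume "t \<ge> 0" "t \<le> T"
  then have "- (t * F (norm \<xi>)) \<le> t * c0"
    using F_lower[of "norm \<xi>"] mult_left_mono[of "- F (norm \<xi>)" c0 t] by simp
  also have "\<dots> \<le> T * c0" using \<open>t \<le> T\<close> c0 by (simp add: mult_right_mono)
  finally show ?thesis by simp
qed

lemma exp_symbol_measurable: "(\<lambda>\<xi>::'a::euclidean_space. exp (- t * F (norm \<xi>))) \<in> borel_measurable lebesgue"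
  by (intro borel_imp_lebesgue_measurable) measurable

abbreviation S :: "real \<Rightarrow> 'a::euclidean_space L2 \<Rightarrow> 'a L2" where
  "S \<equiv> diffusion_semigroup F"

lemma bounded_linear_S: "t \<ge> 0 \<Longrightarrow> bounded_linear (S t :: 'a::euclidean_space L2 \<Rightarrow> 'a L2)"
  unfolding diffusion_semigroup_def
  by (rule bounded_linear_fourier_multiplier[OF exp_symbol_measurable exp_symbol_le[of t t]]) auto

lemma norm_S_le: "0 \<le> t \<Longrightarrow> t \<le> T \<Longrightarrow> norm (S t f) \<le> exp (T * c0) * norm f"
  unfolding diffusion_semigroup_def
  by (rule norm_fourier_multiplier_le[OF exp_symbol_measurable exp_symbol_le]) auto

lemma inner_S: "t \<ge> 0 \<Longrightarrow> S t f \<bullet> g = f \<bullet> S t g"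
  unfolding diffusion_semigroup_def
  by (rule inner_fourier_multiplier[OF exp_symbol_measurable exp_symbol_le[of t t]]) auto

lemma S_add: "s \<ge> 0 \<Longrightarrow> t \<ge> 0 \<Longrightarrow> S (s + t) f = S s (S t f)"
  unfolding diffusion_semigroup_def fourier_multiplier_eq fourier_L2_inv
  by (subst mul_L2_mul_L2[OF exp_symbol_measurable exp_symbol_le[of s s] exp_symbol_measurable exp_symbol_le[of t t]])
    (auto simp: exp_add[symmetric] algebra_simps)

lemma fourier_S: "fourier_L2 (S t f) = mul_L2 (\<lambda>\<xi>. exp (- t * F (norm \<xi>))) (fourier_L2 f)"
  by (simp add: diffusion_semigroup_def fourier_multiplier_eq fourier_L2_inv)

lemma S_continuous: "continuous_on {0..} (\<lambda>t. S t (f :: 'a::euclidean_space L2))"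
proof -
  obtain g where g [measurable]: "g \<in> borel_measurable borel" and sq: "square_integrable lebesgue g" and gf: "to_L2 g = fourier_L2 f"
    by (rule L2_borel_rep)
  have i: "integrable lborel (\<lambda>x. (cmod (g x))\<^sup>2)" using sq by (simp add: square_integrable_borel)
  have eq: "S t f = inv fourier_L2 (to_L2 (\<lambda>\<xi>. exp (- t * F (norm \<xi>)) *\<^sub>R g \<xi>))" if "t \<ge> 0" for t
    unfolding diffusion_semigroup_def fourier_multiplier_eq gf[symmetric]
    by (subst mul_L2_to_L2[OF exp_symbol_measurable exp_symbol_le[of t t]]) (use that sq in auto)
  show ?thesis
  proof (rule continuous_on_sequentiallyI)
    fix u :: "nat \<Rightarrow> real" and a assume u: "\<forall>n. u n \<in> {0..}" "a \<in> {0..}" "u \<longlonglongrightarrow> a"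
    obtain T where T: "\<And>n. u n \<le> T" "T \<ge> 0"
    proof -
      have "bounded (range u)" using u(3) by (rule convergent_imp_bounded)
      then obtain T where "\<And>n. norm (u n) \<le> T" by (auto simp: bounded_iff)
      then show ?thesis using that[of T] u(1) by (metis abs_le_D1 norm_ge_zero order_trans real_norm_def)
    qed
    have "(\<lambda>n. to_L2 (\<lambda>\<xi>. exp (- u n * F (norm \<xi>)) *\<^sub>R g \<xi>)) \<longlonglongrightarrow> to_L2 (\<lambda>\<xi>. exp (- a * F (norm \<xi>)) *\<^sub>R g \<xi>)"
    proof (rule L2_dominated_convergence(3))
      show "integrable lborel (\<lambda>x. (exp (T * c0) * cmod (g x))\<^sup>2)" using i by (simp add: power_mult_distrib)
      show "AE \<xi> in lborel. cmod (exp (- u n * F (norm \<xi>)) *\<^sub>R g \<xi>) \<le> exp (T * c0) * cmod (g \<xi>)" for n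
        unfolding norm_scaleR real_norm_def
        using u(1) T by (intro AE_I2 mult_right_mono exp_symbol_le) auto
      show "AE \<xi> in lborel. (\<lambda>n. exp (- u n * F (norm \<xi>)) *\<^sub>R g \<xi>) \<longlonglongrightarrow> exp (- a * F (norm \<xi>)) *\<^sub>R g \<xi>"
        by (intro AE_I2 tendsto_intros u)
    qed measurable
    then have "(\<lambda>n. inv fourier_L2 (to_L2 (\<lambda>\<xi>. exp (- u n * F (norm \<xi>)) *\<^sub>R g \<xi>))) \<longlonglongrightarrow> inv fourier_L2 (to_L2 (\<lambda>\<xi>. exp (- a * F (norm \<xi>)) *\<^sub>R g \<xi>))"
      by (rule bounded_linear.tendsto[OF bounded_linear_inv_fourier_L2])
    then show "(\<lambda>n. S (u n) f) \<longlonglongrightarrow> S a f" using u by (simp add: eq)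
  qed
qed

end

section \<open>Quasi-analyticity and towers of derivatives\<close>

text \<open>
  Successive derivatives are carried along as a sequence of functions. Limits, rescalings and convolutions
  of smooth functions are then defined for all orders at once, and every differentiability condition is
  part of the sequence.
\<close>

definition tower :: "real \<Rightarrow> real \<Rightarrow> (nat \<Rightarrow> real \<Rightarrow> complex) \<Rightarrow> bool" where
  "tower a b \<phi> \<longleftrightarrow> (\<forall>k. \<forall>x\<in>{a..b}. (\<phi> k has_vector_derivative \<phi> (Suc k) x) (at x within {a..b}))"

text \<open>
  Quasi-analyticity for towers. The arbitrary constant \<open>C\<close> makes the notion insensitive to constant
  factors in the bounds.
\<close>

definition flat_unique :: "(nat \<Rightarrow> real) \<Rightarrow> bool" where
  "flat_unique P \<longleftrightarrow> (\<forall>a b \<phi> C. a < b \<longrightarrow> tower a b \<phi> \<longrightarrow> (\<forall>k. \<forall>x\<in>{a..b}. cmod (\<phi> k x) \<le> C * P k) \<longrightarrow>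
     (\<exists>x0\<in>{a..b}. \<forall>k. \<phi> k x0 = 0) \<longrightarrow> (\<forall>x\<in>{a..b}. \<phi> 0 x = 0))"

lemma towerD: "tower a b \<phi> \<Longrightarrow> x \<in> {a..b} \<Longrightarrow> (\<phi> k has_vector_derivative \<phi> (Suc k) x) (at x within {a..b})"
  by (auto simp: tower_def)

lemma tower_continuous: "tower a b \<phi> \<Longrightarrow> continuous_on {a..b} (\<phi> k)"
  unfolding continuous_on_eq_continuous_within
  by (auto intro: has_vector_derivative_continuous towerD)

lemma tower_subset: "tower a b \<phi> \<Longrightarrow> a \<le> c \<Longrightarrow> d \<le> b \<Longrightarrow> tower c d \<phi>"
  unfolding tower_def by (force intro: has_vector_derivative_within_subset)

lemma tower_affine:
  assumes "tower a b \<phi>" and "\<And>x. x \<in> {c..d} \<Longrightarrow> s * x + t \<in> {a..b}"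
  shows "tower c d (\<lambda>k x. s ^ k *\<^sub>R \<phi> k (s * x + t))"
  unfolding tower_def
proof (intro allI ballI)
  fix k x assume x: "x \<in> {c..d}"
  have "(\<phi> k has_vector_derivative \<phi> (Suc k) (s * x + t)) (at (s * x + t) within (\<lambda>x. s * x + t) ` {c..d})"
    using towerD[OF assms(1), of "s * x + t" k] assms(2) x by (blast intro: has_vector_derivative_within_subset)
  moreover have "((\<lambda>x. s * x + t) has_vector_derivative s) (at x within {c..d})"
    by (auto intro!: derivative_eq_intros simp: has_real_derivative_iff_has_vector_derivative[symmetric])
  ultimately have "((\<phi> k \<circ> (\<lambda>x. s * x + t)) has_vector_derivative s *\<^sub>R \<phi> (Suc k) (s * x + t)) (at x within {c..d})"
    by (intro vector_diff_chain_within)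
  from has_vector_derivative_scaleR[OF _ this, of "\<lambda>_. s ^ k" 0]
  show "((\<lambda>x. s ^ k *\<^sub>R \<phi> k (s * x + t)) has_vector_derivative s ^ Suc k *\<^sub>R \<phi> (Suc k) (s * x + t)) (at x within {c..d})"
    by (simp add: o_def mult.commute)
qed

lemma tower_eq_0:
  assumes "tower a b \<phi>" "a < b" "\<And>x. x \<in> {a..b} \<Longrightarrow> \<phi> 0 x = 0"
  shows "x \<in> {a..b} \<Longrightarrow> \<phi> k x = 0"
proof (induction k arbitrary: x)
  case (Suc k)
  have "(\<phi> k has_vector_derivative \<phi> (Suc k) x) (at x within {a..b})"
    using assms(1) Suc.prems by (rule towerD)
  moreover have "(\<phi> k has_vector_derivative 0) (at x within {a..b})"
    by (rule has_vector_derivative_transform[OF Suc.prems _ has_vector_derivative_const[of 0]]) (use Suc.IH in auto)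
  ultimately show ?case
    using vector_derivative_unique_within_closed_interval[of a b x] assms(2) Suc.prems by auto
qed (use assms in auto)

lemma tower_deriv_within:
  assumes "tower a b \<phi>" "a < b"
  shows "x \<in> {a..b} \<Longrightarrow> deriv_within k {a..b} (\<phi> 0) x = \<phi> k x"
proof (induction k arbitrary: x)
  case (Suc k)
  have "(\<phi> k has_vector_derivative \<phi> (Suc k) x) (at x within {a..b})"
    using assms(1) Suc.prems by (rule towerD)
  then have "(deriv_within k {a..b} (\<phi> 0) has_vector_derivative \<phi> (Suc k) x) (at x within {a..b})"
    by (rule has_vector_derivative_transform[OF Suc.prems, rotated]) (use Suc.IH in auto)
  then show ?case
    using vector_derivative_within_cbox[of a b x] assms(2) Suc.prems by auto
qed auto

lemma flat_uniqueD:
  assumes "flat_unique P" "tower a b \<phi>" "\<And>k x. x \<in> {a..b} \<Longrightarrow> cmod (\<phi> k x) \<le> C * P k" "x0 \<in> {a..b}" "\<And>k. \<phi> k x0 = 0" "x \<in> {a..b}"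
  shows "\<phi> 0 x = 0"
proof (cases "a < b")
  case True
  then show ?thesis using assms unfolding flat_unique_def by blast
next
  case False
  then have "x = x0" using assms(4,6) by simp
  then show ?thesis using assms(5) by simp
qed

lemma quasi_analytic_flat_unique:
  assumes "quasi_analytic M"
  shows "flat_unique M"
  unfolding flat_unique_def
proof (intro allI impI ballI)
  fix a b \<phi> C x
  assume ab: "a < (b::real)" and t: "tower a b \<phi>" and bd: "\<forall>k. \<forall>x\<in>{a..b}. cmod (\<phi> k x) \<le> C * M k"
    and fl: "\<exists>x0\<in>{a..b}. \<forall>k. \<phi> k x0 = 0" and x: "x \<in> {a..b}"
  have M: "M k > 0" for k using assms by (auto simp: quasi_analytic_def)
  define K where "K = max C 1"
  have K: "K > 0" by (simp add: K_def)
  define \<psi> where "\<psi> k x = (1 / K) *\<^sub>R \<phi> k x" for k x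
  have t': "tower a b \<psi>"
    using t unfolding tower_def \<psi>_def by (auto intro!: derivative_eq_intros)
  have "cmod (\<psi> k x) \<le> M k" if "x \<in> {a..b}" for k x
  proof -
    have "cmod (\<phi> k x) \<le> C * M k" using bd that by blast
    also have "\<dots> \<le> K * M k" using M[of k] by (intro mult_right_mono) (auto simp: K_def)
    finally show ?thesis using K by (simp add: \<psi>_def field_simps)
  qed
  then have "\<psi> 0 \<in> denjoy_carleman_class M a b"
    unfolding denjoy_carleman_class_def
  proof (intro CollectI conjI allI ballI)
    fix k x assume x: "x \<in> {a..b}"
    have "(deriv_within k {a..b} (\<psi> 0) has_vector_derivative \<psi> (Suc k) x) (at x within {a..b})"
      by (rule has_vector_derivative_transform[OF x _ towerD[OF t' x]]) (simp add: tower_deriv_within[OF t' ab])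
    then show "deriv_within k {a..b} (\<psi> 0) differentiable (at x within {a..b})"
      by (rule differentiableI_vector)
  qed (simp add: tower_deriv_within[OF t' ab])
  moreover have "\<exists>x0\<in>{a..b}. \<forall>k. deriv_within k {a..b} (\<psi> 0) x0 = 0"
    using fl by (auto simp: tower_deriv_within[OF t' ab] \<psi>_def)
  ultimately have "\<psi> 0 x = 0" using assms ab x unfolding quasi_analytic_def by blast
  then show "\<phi> 0 x = 0" using K by (simp add: \<psi>_def)
qed

lemma flat_unique_mono:
  assumes "flat_unique Q" "\<And>k. P k \<le> B * Q k" "\<And>k. P k \<ge> 0"
  shows "flat_unique P"
  unfolding flat_unique_def
proof (intro allI impI ballI)
  fix a b \<phi> C x
  assume ab: "a < (b::real)" and t: "tower a b \<phi>" and bd: "\<forall>k. \<forall>x\<in>{a..b}. cmod (\<phi> k x) \<le> C * P k"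
    and fl: "\<exists>x0\<in>{a..b}. \<forall>k. \<phi> k x0 = 0" and x: "x \<in> {a..b}"
  have "cmod (\<phi> k y) \<le> (\<bar>C\<bar> * B) * Q k" if "y \<in> {a..b}" for k y
  proof -
    have "cmod (\<phi> k y) \<le> C * P k" using bd that by blast
    also have "\<dots> \<le> \<bar>C\<bar> * P k" using assms(3)[of k] by (intro mult_right_mono) auto
    also have "\<dots> \<le> \<bar>C\<bar> * (B * Q k)" using assms(2)[of k] by (intro mult_left_mono) auto
    finally show ?thesis by simp
  qed
  then show "\<phi> 0 x = 0" using flat_uniqueD[OF assms(1) t] fl x by blast
qed

text \<open>
  Rescaling the variable by \<open>A\<close> multiplies the \<open>k\<close>-th derivative by \<open>A\<^sup>k\<close>.
\<close>

lemma flat_unique_geometric: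
  assumes Q: "flat_unique Q" and A: "A > 0"
  shows "flat_unique (\<lambda>k. A ^ k * Q k)"
  unfolding flat_unique_def
proof (intro allI impI ballI)
  fix a b \<phi> C x
  assume ab: "a < (b::real)" and t: "tower a b \<phi>" and bd: "\<forall>k. \<forall>x\<in>{a..b}. cmod (\<phi> k x) \<le> C * (A ^ k * Q k)"
    and fl: "\<exists>x0\<in>{a..b}. \<forall>k. \<phi> k x0 = 0" and x: "x \<in> {a..b}"
  from fl obtain x0 where x0: "x0 \<in> {a..b}" "\<And>k. \<phi> k x0 = 0" by blast
  have sub: "(1 / A) * y + 0 \<in> {a..b}" if "y \<in> {A * a..A * b}" for y
    using that A by (auto simp: field_simps)
  define \<psi> where "\<psi> k x = (1 / A) ^ k *\<^sub>R \<phi> k ((1 / A) * x + 0)" for k x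
  have t': "tower (A * a) (A * b) \<psi>"
    unfolding \<psi>_def by (rule tower_affine[OF t sub])
  have "\<psi> 0 (A * x) = 0"
  proof (rule flat_uniqueD[OF Q t'])
    show "cmod (\<psi> k y) \<le> C * Q k" if y: "y \<in> {A * a..A * b}" for k y
    proof -
      have "cmod (\<phi> k ((1 / A) * y + 0)) \<le> C * (A ^ k * Q k)" using bd sub[OF y] by blast
      then show ?thesis using A by (simp add: \<psi>_def field_simps)
    qed
    show "A * x0 \<in> {A * a..A * b}" "A * x \<in> {A * a..A * b}" using x0(1) x A by auto
    show "\<psi> k (A * x0) = 0" for k using x0(2) A by (simp add: \<psi>_def)
  qed
  then show "\<phi> 0 x = 0" using A by (simp add: \<psi>_def)
qed

text \<open>
  The primitive of a flat function which vanishes at the point of flatness is flat, and its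
  \<open>Suc k\<close>-th derivative is the \<open>k\<close>-th derivative of the function.
\<close>

lemma flat_unique_shift:
  assumes Q: "flat_unique Q" and pos: "\<And>k. Q k > 0"
  shows "flat_unique (\<lambda>k. Q (Suc k))"
  unfolding flat_unique_def
proof (intro allI impI ballI)
  fix a b \<phi> C x
  assume ab: "a < (b::real)" and t: "tower a b \<phi>" and bd: "\<forall>k. \<forall>x\<in>{a..b}. cmod (\<phi> k x) \<le> C * Q (Suc k)"
    and fl: "\<exists>x0\<in>{a..b}. \<forall>k. \<phi> k x0 = 0" and x: "x \<in> {a..b}"
  from fl obtain x0 where x0: "x0 \<in> {a..b}" "\<And>k. \<phi> k x0 = 0" by blast
  define I where "I x = integral {a..x} (\<phi> 0) - integral {a..x0} (\<phi> 0)" for x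
  have I: "(I has_vector_derivative \<phi> 0 x) (at x within {a..b})" if "x \<in> {a..b}" for x
    unfolding I_def using integral_has_vector_derivative[OF tower_continuous[OF t] that]
    by (auto intro!: derivative_eq_intros)
  define \<psi> where "\<psi> k = (case k of 0 \<Rightarrow> I | Suc j \<Rightarrow> \<phi> j)" for k
  have t': "tower a b \<psi>"
    unfolding tower_def \<psi>_def using I towerD[OF t] by (auto split: nat.split)
  have "continuous_on {a..b} I"
    using tower_continuous[OF t', of 0] by (simp add: \<psi>_def)
  then have "bounded (I ` {a..b})" by (intro compact_imp_bounded compact_continuous_image) auto
  then obtain K where K: "\<And>x. x \<in> {a..b} \<Longrightarrow> cmod (I x) \<le> K" by (metis bounded_iff imageI)
  have K0: "K \<ge> 0" using K[OF x0(1)] norm_ge_zero order_trans by blast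
  \<comment> \<open>The maximum with K / Q 0 accommodates the bound K for the primitive itself.\<close>
  define D where "D = max \<bar>C\<bar> (K / Q 0)"
  have "\<psi> k x = 0" if "x \<in> {a..b}" for k x
  proof (rule tower_eq_0[OF t' ab _ that])
    fix x assume x: "x \<in> {a..b}"
    show "\<psi> 0 x = 0"
    proof (rule flat_uniqueD[OF Q t' _ x0(1) _ x])
      show "cmod (\<psi> k y) \<le> D * Q k" if y: "y \<in> {a..b}" for k y
      proof (cases k)
        case 0
        have "cmod (I y) \<le> (K / Q 0) * Q 0" using K[OF y] pos[of 0] by simp
        also have "\<dots> \<le> D * Q 0" using pos[of 0] by (intro mult_right_mono) (auto simp: D_def)
        finally show ?thesis using 0 by (simp add: \<psi>_def)
      next
        case (Suc j)
        have "cmod (\<phi> j y) \<le> C * Q (Suc j)" using bd y by blast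
        also have "\<dots> \<le> D * Q (Suc j)" using pos[of "Suc j"] by (intro mult_right_mono) (auto simp: D_def)
        finally show ?thesis using Suc by (simp add: \<psi>_def)
      qed
      show "\<psi> k x0 = 0" for k using x0(2) by (auto simp: \<psi>_def I_def split: nat.split)
    qed
  qed
  from this[OF x, of 1] show "\<phi> 0 x = 0" by (simp add: \<psi>_def)
qed

text \<open>
  It suffices to treat functions on \<open>{0..b}\<close> which are flat at the left end point, and to show that they vanish
  on the left half. The midpoint is then again a point of flatness, so halving the remaining
  interval repeatedly reaches everything to the right, and reflection reaches the left.
\<close>

lemma flat_unique_one_sidedI:
  assumes half: "\<And>b \<phi> C x. b > 0 \<Longrightarrow> tower 0 b \<phi> \<Longrightarrow> (\<And>k x. x \<in> {0..b} \<Longrightarrow> cmod (\<phi> k x) \<le> C * P k) \<Longrightarrow>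
    (\<And>k. \<phi> k 0 = 0) \<Longrightarrow> x \<in> {0..b/2} \<Longrightarrow> \<phi> 0 x = 0"
  shows "flat_unique P"
proof -
  have step: "\<phi> 0 x = 0" if t: "tower c b \<phi>" and bd: "\<And>k x. x \<in> {c..b} \<Longrightarrow> cmod (\<phi> k x) \<le> C * P k" and cb: "c < b"
    and fl: "\<And>k. \<phi> k c = 0" and x: "x \<in> {c..c + (b - c) / 2}" for c b \<phi> C x
  proof -
    have sub: "1 * y + c \<in> {c..b}" if "y \<in> {0..b - c}" for y using that by auto
    have x': "x - c \<in> {0..(b - c) / 2}" using x by (simp only: atLeastAtMost_iff) linarith
    have "(\<lambda>k x. 1 ^ k *\<^sub>R \<phi> k (1 * x + c)) 0 (x - c) = 0"
    proof (rule half[OF _ tower_affine[OF t sub] _ _ x'])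
      show "cmod (1 ^ k *\<^sub>R \<phi> k (1 * y + c)) \<le> C * P k" if "y \<in> {0..b - c}" for k y
        using bd[of "1 * y + c" k] that by simp
    qed (use cb fl in auto)
    then show ?thesis by simp
  qed
  have right: "\<phi> 0 x = 0" if t: "tower a b \<phi>" and bd: "\<And>k x. x \<in> {a..b} \<Longrightarrow> cmod (\<phi> k x) \<le> C * P k" and ab: "a < b"
    and fl: "\<And>k. \<phi> k a = 0" and x: "x \<in> {a..b}" for a b \<phi> C x
  proof -
    define c where "c n = b - (b - a) / 2 ^ n" for n :: nat
    have c: "a \<le> c n" "c n < b" for n
    proof -
      have "(b - a) / 2 ^ n \<le> (b - a) / 1" using ab by (intro divide_left_mono) auto
      then show "a \<le> c n" by (simp add: c_def)
    qed (use ab in \<open>simp add: c_def\<close>)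
    have z: "\<forall>y\<in>{a..c n}. \<phi> 0 y = 0" for n
    proof (induction n)
      case 0
      then show ?case using fl by (auto simp: c_def)
    next
      case (Suc n)
      have fl': "\<phi> k (c n) = 0" for k
      proof (cases "a < c n")
        case True
        have "tower a (c n) \<phi>" using t c[of n] by (intro tower_subset[OF t]) auto
        then show ?thesis by (rule tower_eq_0) (use True Suc.IH in auto)
      next
        case False
        then have "c n = a" using c[of n] by simp
        then show ?thesis using fl by simp
      qed
      have "\<phi> 0 y = 0" if "y \<in> {c n..c n + (b - c n) / 2}" for y
        by (rule step[OF tower_subset[OF t] _ _ fl' that, where C=C]) (use c[of n] bd in auto)
      moreover have "c n + (b - c n) / 2 = c (Suc n)" by (simp add: c_def field_simps)
      ultimately show ?case using Suc.IH by (metis atLeastAtMost_iff nle_le)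
    qed
    have lt: "\<phi> 0 y = 0" if y: "y \<in> {a..<b}" for y
    proof -
      obtain n where "(1/2::real) ^ n < (b - y) / (b - a)"
        using real_arch_pow_inv[of "(b - y) / (b - a)" "1/2"] y by auto
      then have "(b - a) / 2 ^ n < b - y" using ab by (simp add: field_simps power_divide)
      then have "y \<le> c n" by (simp add: c_def)
      then show ?thesis using z[of n] y by auto
    qed
    show ?thesis
    proof (cases "x = b")
      case True
      have "(\<phi> 0 \<longlongrightarrow> \<phi> 0 b) (at b within {a..b})"
        using tower_continuous[OF t, of 0] ab by (auto simp: continuous_on_def)
      then have "(\<phi> 0 \<longlongrightarrow> \<phi> 0 b) (at_left b)"
        using ab by (simp add: at_within_Icc_at_left)
      moreover have "eventually (\<lambda>y. \<phi> 0 y = 0) (at_left b)"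
        using eventually_at_left_real[OF ab] by eventually_elim (use lt in auto)
      then have "(\<phi> 0 \<longlongrightarrow> 0) (at_left b)" by (rule tendsto_eventually)
      ultimately have "\<phi> 0 b = 0" by (intro tendsto_unique[of "at_left b"]) auto
      then show ?thesis using True by simp
    qed (use lt x in auto)
  qed
  show ?thesis
    unfolding flat_unique_def
  proof (intro allI impI ballI)
    fix a b \<phi> C x
    assume ab: "a < (b::real)" and t: "tower a b \<phi>" and bd: "\<forall>k. \<forall>x\<in>{a..b}. cmod (\<phi> k x) \<le> C * P k"
      and fl: "\<exists>x0\<in>{a..b}. \<forall>k. \<phi> k x0 = 0" and x: "x \<in> {a..b}"
    from fl obtain x0 where x0: "x0 \<in> {a..b}" "\<And>k. \<phi> k x0 = 0" by blast
    consider "x = x0" | "x0 < x" | "x < x0" by linarith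
    then show "\<phi> 0 x = 0"
    proof cases
      case 1
      then show ?thesis using x0 by simp
    next
      case 2
      show ?thesis
      proof (rule right)
        show "tower x0 b \<phi>" using x0 by (intro tower_subset[OF t]) auto
        show "cmod (\<phi> k y) \<le> C * P k" if "y \<in> {x0..b}" for k y
        proof -
          have "y \<in> {a..b}" using that x0(1) by simp
          then show ?thesis using bd by blast
        qed
        show "x0 < b" "x \<in> {x0..b}" using 2 x by simp_all
        show "\<phi> k x0 = 0" for k by (rule x0(2))
      qed
    next
      case 3
      have sub: "(-1) * y + 0 \<in> {a..b}" if "y \<in> {- x0..- a}" for y using that x0 by auto
      define \<psi> where "\<psi> k x = (-1) ^ k *\<^sub>R \<phi> k ((-1) * x + 0)" for k x
      have "\<psi> 0 (- x) = 0"
      proof (rule right)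
        show "tower (- x0) (- a) \<psi>" unfolding \<psi>_def by (rule tower_affine[OF t sub])
        show "cmod (\<psi> k y) \<le> C * P k" if "y \<in> {- x0..- a}" for k y
        proof -
          have "cmod (\<psi> k y) = cmod (\<phi> k ((-1) * y + 0))"
            by (simp add: \<psi>_def)
          also have "\<dots> \<le> C * P k" using bd sub[OF that] by blast
          finally show ?thesis .
        qed
        show "- x0 < - a" "- x \<in> {- x0..- a}" using 3 x by auto
        show "\<psi> k (- x0) = 0" for k using x0(2)[of k] by (simp add: \<psi>_def)
      qed
      then show ?thesis by (simp add: \<psi>_def)
    qed
  qed
qed

section \<open>Quasi-analyticity and convolution squares\<close>

text \<open>
  Mikusinski's argument. For \<open>\<tau> > 0\<close>, the functions \<open>1 - exp (- exp (n (u - \<tau>)))\<close> converge to the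
  indicator of \<open>u > \<tau>\<close> as \<open>n\<close> tends to infinity. Expanding the outer exponential in its power series expresses
  their integrals against \<open>g\<close> by the integrals of \<open>exp (n k u) g(u)\<close> with coefficients \<open>exp (- n k \<tau>) / k!\<close>. As the
  integrals are bounded by \<open>C\<close>, the total is at most \<open>C (exp (exp (- n \<tau>)) - 1)\<close>, which tends to 0. So the integral
  of \<open>g\<close> over \<open>{\<tau>..T}\<close> vanishes for every \<open>\<tau>\<close>.
\<close>

lemma bounded_exponential_moments_zero:
  fixes g :: "real \<Rightarrow> complex"
  assumes g: "continuous_on {0..T} g" and T: "T > 0"
    and bd: "\<And>n::nat. cmod (LINT u|lborel. exp (real n * u) *\<^sub>R (indicator {0..T} u *\<^sub>R g u)) \<le> C"
  shows "u \<in> {0..T} \<Longrightarrow> g u = 0"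
proof -
  define g0 where "g0 u = indicator {0..T} u *\<^sub>R g u" for u
  have m [measurable]: "g0 \<in> borel_measurable borel"
    unfolding g0_def by (rule borel_measurable_continuous_on_indicator) (use g in auto)
  have i: "integrable lborel g0"
    using borel_integrable_compact[of "{0..T}" g] g by (simp add: g0_def[abs_def] if_distrib indicator_def cong: if_cong)
  have supp: "g0 u = 0" if "u \<notin> {0..T}" for u using that by (simp add: g0_def)
  define I where "I n = (LINT u|lborel. exp (real n * u) *\<^sub>R g0 u)" for n :: nat
  have I: "cmod (I n) \<le> C" for n using bd[of n] by (simp add: I_def g0_def)
  have C: "C \<ge> 0" using I[of 0] norm_ge_zero order_trans by blast
  have tail: "(LINT u|lborel. indicator {\<tau><..} u *\<^sub>R g0 u) = 0" if \<tau>: "\<tau> > 0" for \<tau>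
  proof -
    define J where "J n = (LINT u|lborel. (1 - exp (- exp (real n * (u - \<tau>)))) *\<^sub>R g0 u)" for n :: nat
    have "J \<longlonglongrightarrow> (LINT u|lborel. indicator {\<tau><..} u *\<^sub>R g0 u)"
      unfolding J_def
    proof (rule integral_dominated_convergence[where w="\<lambda>u. cmod (g0 u)"])
      show "AE u in lborel. (\<lambda>n. (1 - exp (- exp (real n * (u - \<tau>)))) *\<^sub>R g0 u) \<longlonglongrightarrow> indicator {\<tau><..} u *\<^sub>R g0 u"
        using AE_lborel_singleton[of \<tau>]
      proof eventually_elim
        case (elim u)
        have "(\<lambda>n. 1 - exp (- exp (real n * (u - \<tau>)))) \<longlonglongrightarrow> indicator {\<tau><..} u"
        proof (cases "u > \<tau>")
          case True
          then have "(\<lambda>n. 1 - exp (- exp (real n * (u - \<tau>)))) \<longlonglongrightarrow> 1" by real_asymp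
          then show ?thesis using True by simp
        next
          case False
          define d where "d = \<tau> - u"
          have "d > 0" using False elim by (simp add: d_def)
          then have "(\<lambda>n. 1 - exp (- exp (- (real n * d)))) \<longlonglongrightarrow> 0" by real_asymp
          moreover have "real n * (u - \<tau>) = - (real n * d)" for n by (simp add: d_def algebra_simps)
          ultimately show ?thesis using False by simp
        qed
        then show ?case by (intro tendsto_intros)
      qed
      show "AE u in lborel. cmod ((1 - exp (- exp (real n * (u - \<tau>)))) *\<^sub>R g0 u) \<le> cmod (g0 u)" for n
        by (intro AE_I2) (auto intro!: mult_left_le_one_le)
      show "integrable lborel (\<lambda>u. cmod (g0 u))" using i by simp
    qed measurable
    moreover have "J \<longlonglongrightarrow> 0"
    proof (rule Lim_null_comparison)
      show "(\<lambda>n. C * (exp (exp (- (real n * \<tau>))) - 1)) \<longlonglongrightarrow> 0"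
        using \<tau> by real_asymp
      show "\<forall>\<^sub>F n in sequentially. cmod (J n) \<le> C * (exp (exp (- (real n * \<tau>))) - 1)"
      proof (intro always_eventually allI)
        fix n :: nat
        \<comment> \<open>The terms of the exponential series; the term of order 0 cancels against the 1.\<close>
        define f where "f k u = (- ((- exp (real n * (u - \<tau>))) ^ Suc k / fact (Suc k))) *\<^sub>R g0 u" for k u
        define z where "z = exp (- (real n * \<tau>))"
        have s1: "(\<lambda>k. x ^ Suc k / fact (Suc k)) sums (exp x - 1)" for x :: real
        proof -
          have "(\<lambda>k. x ^ k / fact k) sums exp x"
            using exp_converges[of x] by (simp add: divide_inverse mult.commute scaleR_conv_of_real)
          then show ?thesis by (subst sums_Suc_iff) simp
        qed
        have fs: "(\<lambda>k. f k u) sums ((1 - exp (- exp (real n * (u - \<tau>)))) *\<^sub>R g0 u)" for u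
          unfolding f_def using sums_minus[OF s1[of "- exp (real n * (u - \<tau>))"]] by (intro sums_scaleR_left) simp
        have fb: "cmod (f k u) \<le> (exp (real n * T) ^ Suc k / fact (Suc k)) * cmod (g0 u)" for k u
        proof (cases "u \<in> {0..T}")
          case True
          have "real n * (u - \<tau>) \<le> real n * T" using True \<tau> by (intro mult_left_mono) auto
          then have "exp (real n * (u - \<tau>)) ^ Suc k \<le> exp (real n * T) ^ Suc k" by (intro power_mono) auto
          then show ?thesis unfolding f_def norm_scaleR
            by (intro mult_right_mono) (auto simp: power_abs divide_right_mono abs_mult)
        qed (simp add: f_def supp)
        have fm [measurable]: "f k \<in> borel_measurable borel" for k unfolding f_def by measurable
        have fi: "integrable lborel (f k)" for k
        proof (rule Bochner_Integration.integrable_bound)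
          show "integrable lborel (\<lambda>u. (exp (real n * T) ^ Suc k / fact (Suc k)) * cmod (g0 u))" using i by simp
          show "AE u in lborel. cmod (f k u) \<le> norm ((exp (real n * T) ^ Suc k / fact (Suc k)) * cmod (g0 u))"
            using order_trans[OF fb abs_ge_self] by (intro AE_I2) (simp only: real_norm_def)
        qed measurable
        have sm: "summable (\<lambda>k. x ^ Suc k / fact (Suc k))" for x :: real using s1 by (rule sums_summable)
        have "(\<lambda>k. LINT u|lborel. f k u) sums (LINT u|lborel. (\<Sum>k. f k u))"
        proof (rule sums_integral[OF fi])
          show "AE u in lborel. summable (\<lambda>k. cmod (f k u))"
            by (intro AE_I2 summable_comparison_test'[OF summable_mult2[OF sm], where N=0]) (use fb in auto)
          show "summable (\<lambda>k. LINT u|lborel. cmod (f k u))"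
          proof (rule summable_comparison_test'[OF summable_mult2[OF sm[of "exp (real n * T)"], of "LINT u|lborel. cmod (g0 u)"], where N=0])
            fix k
            have "(LINT u|lborel. cmod (f k u)) \<le> (LINT u|lborel. (exp (real n * T) ^ Suc k / fact (Suc k)) * cmod (g0 u))"
              by (intro integral_mono integrable_norm fi fb integrable_mult_right i)
            then show "norm (LINT u|lborel. cmod (f k u)) \<le> exp (real n * T) ^ Suc k / fact (Suc k) * (LINT u|lborel. cmod (g0 u))"
              by simp
          qed
        qed
        also have "(LINT u|lborel. (\<Sum>k. f k u)) = J n"
          unfolding J_def using fs by (simp add: sums_iff)
        finally have Js: "(\<lambda>k. LINT u|lborel. f k u) sums J n" .
        have fk: "cmod (LINT u|lborel. f k u) \<le> C * (z ^ Suc k / fact (Suc k))" for k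
        proof -
          have "f k u = (- ((- z) ^ Suc k / fact (Suc k))) *\<^sub>R (exp (real (n * Suc k) * u) *\<^sub>R g0 u)" for u
          proof -
            have "- exp (real n * (u - \<tau>)) = (- z) * exp (real n * u)"
              by (simp add: z_def exp_add[symmetric] algebra_simps)
            then have "(- exp (real n * (u - \<tau>))) ^ Suc k = (- z) ^ Suc k * exp (real n * u) ^ Suc k"
              by (simp only: power_mult_distrib)
            also have "exp (real n * u) ^ Suc k = exp (real (n * Suc k) * u)"
              by (simp only: exp_of_nat_mult[symmetric] of_nat_mult mult_ac)
            finally show ?thesis by (simp add: f_def del: power_Suc fact_Suc of_nat_Suc mult_Suc_right)
          qed
          then have "(LINT u|lborel. f k u) = (- ((- z) ^ Suc k / fact (Suc k))) *\<^sub>R I (n * Suc k)"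
            by (simp only: integral_scaleR_right I_def)
          then have "cmod (LINT u|lborel. f k u) = (z ^ Suc k / fact (Suc k)) * cmod (I (n * Suc k))"
            by (simp add: z_def power_abs abs_mult del: power_Suc fact_Suc mult_Suc_right)
          also have "\<dots> \<le> (z ^ Suc k / fact (Suc k)) * C"
            by (intro mult_left_mono I) (simp add: z_def)
          finally show ?thesis by (simp only: mult.commute)
        qed
        have zs: "(\<lambda>k. C * (z ^ Suc k / fact (Suc k))) sums (C * (exp z - 1))"
          by (intro sums_mult s1)
        show "cmod (J n) \<le> C * (exp (exp (- (real n * \<tau>))) - 1)"
          using norm_sums_le[OF Js zs fk] by (simp only: z_def)
      qed
    qed
    ultimately show ?thesis by (rule LIMSEQ_unique)
  qed
  have int0: "integral {0..x} g = integral {0..T} g" if x: "x \<in> {0<..<T}" for x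
  proof -
    have "(LINT u|lborel. indicator {x<..} u *\<^sub>R g0 u) = (LINT u:{x<..T}|lborel. g u)"
      unfolding set_lebesgue_integral_def using x
      by (intro Bochner_Integration.integral_cong refl) (auto simp: g0_def indicator_def)
    also have "\<dots> = integral {x<..T} g"
    proof (rule set_borel_integral_eq_integral(2))
      have "integrable lborel (\<lambda>u. indicator {x<..} u *\<^sub>R g0 u)"
        by (rule integrable_mult_indicator) (use i in auto)
      also have "(\<lambda>u. indicator {x<..} u *\<^sub>R g0 u) = (\<lambda>u. indicator {x<..T} u *\<^sub>R g u)"
        using x by (auto simp: g0_def indicator_def fun_eq_iff)
      finally show "set_integrable lborel {x<..T} g" by (simp add: set_integrable_def)
    qed
    also have "integral {x<..T} g = integral {x..T} g"
    proof (rule integral_spike_set)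
      show "negligible {u \<in> {x<..T} - {x..T}. g u \<noteq> 0}" by (rule negligible_subset[of "{x}"]) auto
      show "negligible {u \<in> {x..T} - {x<..T}. g u \<noteq> 0}" by (rule negligible_subset[of "{x}"]) auto
    qed
    finally have "integral {x..T} g = 0" using tail[of x] x by simp
    moreover have "integral {0..x} g + integral {x..T} g = integral {0..T} g"
      using x by (intro Henstock_Kurzweil_Integration.integral_combine integrable_continuous_real g) auto
    ultimately show ?thesis by simp
  qed
  have z: "g x = 0" if x: "x \<in> {0<..<T}" for x
  proof -
    have "((\<lambda>x. integral {0..x} g) has_vector_derivative g x) (at x within {0..T})"
      using x by (intro integral_has_vector_derivative g) auto
    then have "((\<lambda>x. integral {0..x} g) has_vector_derivative g x) (at x within {0<..<T})"
      by (rule has_vector_derivative_within_subset) auto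
    then have "((\<lambda>x. integral {0..x} g) has_vector_derivative g x) (at x)"
      unfolding at_within_open[OF x open_greaterThanLessThan] .
    moreover have "((\<lambda>x. integral {0..x} g) has_vector_derivative 0) (at x)"
    proof (rule has_vector_derivative_transform_within_open)
      show "((\<lambda>x. integral {0..T} g) has_vector_derivative 0) (at x)" by (rule has_vector_derivative_const)
      show "x \<in> {0<..<T}" by (rule x)
      show "integral {0..T} g = integral {0..y} g" if "y \<in> {0<..<T}" for y
        by (rule int0[OF that, symmetric])
    qed simp
    ultimately show ?thesis by (rule vector_derivative_unique_at)
  qed
  assume "u \<in> {0..T}"
  moreover have "closure {0<..<T} = {0..T}" using T by simp
  ultimately show "g u = 0"
    using continuous_constant_on_closure[of "{0<..<T}" g 0 u, OF _ z] g by (simp only:)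
qed

text \<open>
  The special case of Titchmarsh's convolution theorem in which both factors are equal. Put \<open>T = b/2\<close> and
  \<open>a(u) = e(T - u)\<close> on \<open>{-T..T}\<close>. By hypothesis the convolution square of \<open>a\<close> vanishes on the positive half-line.
  Its exponential moment of order \<open>n \<ge> 0\<close>, the square of that of \<open>a\<close>, is therefore bounded independently of
  \<open>n\<close>. The part of the moment of \<open>a\<close> over negative \<open>u\<close> is bounded as well, and so is the part
  over \<open>{0..T}\<close>. Now \<open>bounded_exponential_moments_zero\<close> shows that \<open>a\<close> vanishes there.
\<close>

lemma Titchmarsh_square:
  fixes e :: "real \<Rightarrow> complex"
  assumes b: "b > 0" and cont: "continuous_on {..b} e" and neg: "\<And>x. x \<le> 0 \<Longrightarrow> e x = 0"
    and conv: "\<And>x. x \<in> {0..b} \<Longrightarrow> integral {0..b} (\<lambda>y. e (x - y) * e y) = 0"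
    and x: "x \<in> {0..b/2}"
  shows "e x = 0"
proof -
  define T where "T = b / 2"
  have T: "T > 0" "b = 2 * T" using b by (auto simp: T_def)
  define a where "a u = indicator {-T..T} u *\<^sub>R e (T - u)" for u
  have ce: "continuous_on {-T..T} (\<lambda>u. e (T - u))"
    by (rule continuous_on_compose2[OF cont]) (auto intro!: continuous_intros simp: T)
  have am [measurable]: "a \<in> borel_measurable borel"
    unfolding a_def by (rule borel_measurable_continuous_on_indicator) (use ce in auto)
  have "bounded ((\<lambda>u. e (T - u)) ` {-T..T})"
    by (intro compact_imp_bounded compact_continuous_image ce) auto
  then obtain K where K: "\<And>u. u \<in> {-T..T} \<Longrightarrow> cmod (e (T - u)) \<le> K" "K > 0"
    by (metis bounded_pos imageI)
  have aK: "cmod (a u) \<le> indicator {-T..T} u * K" for u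
    using K by (auto simp: a_def indicator_def)
  have aK': "cmod (a u) \<le> K" for u
    using K by (auto simp: a_def indicator_def)
  have ind0: "integrable lborel (indicat_real {p..q})" for p q :: real
    using emeasure_bounded_finite[of "{p..q}"] by (intro integrable_real_indicator) auto
  then have indi: "integrable lborel (\<lambda>u. indicator {p..q} u * (k::real))" for p q k :: real
    by (intro integrable_mult_left)
  have ai: "integrable lborel (\<lambda>u. exp (r * u) *\<^sub>R a u)" for r
  proof (rule Bochner_Integration.integrable_bound[OF indi[of "-T" T "exp (\<bar>r\<bar> * T) * K"]])
    have "exp (r * u) \<le> exp (\<bar>r\<bar> * T)" if "u \<in> {-T..T}" for u
    proof -
      have "r * u \<le> \<bar>r * u\<bar>" by simp
      also have "\<dots> \<le> \<bar>r\<bar> * T" using that by (auto simp: abs_mult intro!: mult_left_mono)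
      finally show ?thesis by simp
    qed
    then have "exp (r * u) * cmod (e (T - u)) \<le> exp (\<bar>r\<bar> * T) * K" if "u \<in> {-T..T}" for u
      using K that by (intro mult_mono) auto
    then show "AE u in lborel. cmod (exp (r * u) *\<^sub>R a u) \<le> norm (indicator {-T..T} u * (exp (\<bar>r\<bar> * T) * K))"
      using K by (intro AE_I2) (auto simp: a_def indicator_def)
  qed measurable
  \<comment> \<open>The convolution square of a, supported in {-b..b}.\<close>
  define c where "c s = (LINT u|lborel. a u * a (s - u))" for s
  have c_pos: "c s = 0" if s: "s \<ge> 0" for s
  proof -
    have "c s = (LINT x|lborel. a (T - x) * a (s - (T - x)))"
      using lborel_integral_real_affine[of "-1" "\<lambda>u. a u * a (s - u)" T] by (simp add: c_def)
    also have "\<dots> = (LINT x|lborel. indicator {0..b} x *\<^sub>R (e (b - s - x) * e x))"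
    proof (intro Bochner_Integration.integral_cong refl)
      fix x
      show "a (T - x) * a (s - (T - x)) = indicator {0..b} x *\<^sub>R (e (b - s - x) * e x)"
      proof (cases "x \<in> {0..b}")
        case True
        then have 1: "a (T - x) = e x" by (simp add: a_def T)
        have 2: "a (s - (T - x)) = e (b - s - x)"
        proof (cases "x \<le> b - s")
          case True
          then have "s - (T - x) \<in> {-T..T}" using s \<open>x \<in> {0..b}\<close> T by auto
          moreover have "T - (s - (T - x)) = b - s - x" using T by simp
          ultimately show ?thesis by (simp only: a_def indicator_simps scaleR_one)
        next
          case False
          then have "e (b - s - x) = 0" by (intro neg) simp
          moreover have "s - (T - x) \<notin> {-T..T}" using False T by auto
          ultimately show ?thesis by (simp add: a_def)
        qed
        show ?thesis using True by (simp only: 1 2 indicator_simps mult.commute scaleR_one)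
      next
        case False
        then have "T - x \<notin> {-T..T}" using T by auto
        then show ?thesis using False by (simp add: a_def)
      qed
    qed
    also have "\<dots> = 0"
    proof (cases "s \<le> b")
      case True
      have co: "continuous_on {0..b} (\<lambda>x. e (b - s - x) * e x)"
        by (intro continuous_on_mult continuous_on_compose2[OF cont] continuous_on_subset[OF cont])
          (use s in \<open>auto intro!: continuous_intros\<close>)
      have "set_integrable lborel {0..b} (\<lambda>x. e (b - s - x) * e x)"
        unfolding set_integrable_def using borel_integrable_compact[OF _ co]
        by (auto simp: indicator_def if_distrib cong: if_cong)
      from set_borel_integral_eq_integral(2)[OF this] conv[of "b - s"]
      show ?thesis using True s by (simp add: set_lebesgue_integral_def)
    next
      case False
      have "indicator {0..b} x *\<^sub>R (e (b - s - x) * e x) = 0" for x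
        using False neg[of "b - s - x"] by (auto simp: indicator_def)
      then show ?thesis by (simp only: Bochner_Integration.integral_zero)
    qed
    finally show ?thesis .
  qed
  have cb: "cmod (exp (real n * s) *\<^sub>R c s) \<le> indicator {-b..0} s * (b * K\<^sup>2)" for s and n :: nat
  proof (cases "s \<in> {-b..<0}")
    case True
    have "cmod (c s) \<le> (LINT u|lborel. indicator {-T..T} u * K\<^sup>2)"
      unfolding c_def
    proof (rule order_trans[OF integral_norm_bound integral_mono])
      show le: "cmod (a u * a (s - u)) \<le> indicator {-T..T} u * K\<^sup>2" for u
        using mult_mono[OF aK[of u] aK'[of "s - u"]] K by (simp add: norm_mult power2_eq_square mult.assoc)
      show "integrable lborel (\<lambda>u. cmod (a u * a (s - u)))"
        by (rule Bochner_Integration.integrable_bound[OF indi[of "-T" T "K\<^sup>2"]]) (use le in auto)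
      show "integrable lborel (\<lambda>u. indicator {-T..T} u * K\<^sup>2)" by (rule indi)
    qed
    also have "\<dots> = b * K\<^sup>2" using T by simp
    finally have "exp (real n * s) * cmod (c s) \<le> 1 * (b * K\<^sup>2)"
      using True by (intro mult_mono) (auto simp: mult_nonneg_nonpos)
    then show ?thesis using True by simp
  next
    case False
    have "c s = 0"
    proof (cases "s \<ge> 0")
      case False
      then have "s < - b" using \<open>s \<notin> {-b..<0}\<close> by auto
      then have "a u * a (s - u) = 0" for u using T by (auto simp: a_def indicator_def)
      then show ?thesis by (simp only: c_def Bochner_Integration.integral_zero)
    qed (rule c_pos)
    then show ?thesis using b by simp
  qed
  have sq: "(cmod (LINT u|lborel. exp (real n * u) *\<^sub>R a u))\<^sup>2 \<le> b * (b * K\<^sup>2)" for n :: nat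
  proof -
    let ?I = "LINT u|lborel. exp (real n * u) *\<^sub>R a u"
    have "?I * ?I = (LINT u|lborel. (exp (real n * u) *\<^sub>R a u) * ?I)"
      by (subst integral_mult_left_zero) simp
    also have "\<dots> = (LINT u|lborel. LINT s|lborel. exp (real n * s) *\<^sub>R (a u * a (s - u)))"
    proof (intro Bochner_Integration.integral_cong refl)
      fix u
      have "?I = (LINT s|lborel. exp (real n * (s - u)) *\<^sub>R a (s - u))"
        using lborel_integral_real_affine[of 1 "\<lambda>v. exp (real n * v) *\<^sub>R a v" "-u"] by simp
      also have "(exp (real n * u) *\<^sub>R a u) * \<dots> = (LINT s|lborel. (exp (real n * u) *\<^sub>R a u) * (exp (real n * (s - u)) *\<^sub>R a (s - u)))"
        by (rule integral_mult_right_zero[symmetric])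
      also have "\<dots> = (LINT s|lborel. exp (real n * s) *\<^sub>R (a u * a (s - u)))"
        by (intro Bochner_Integration.integral_cong refl) (simp add: exp_add[symmetric] algebra_simps)
      finally show "(exp (real n * u) *\<^sub>R a u) * ?I = \<dots>" .
    qed
    also have "\<dots> = (LINT s|lborel. LINT u|lborel. exp (real n * s) *\<^sub>R (a u * a (s - u)))"
    proof (rule lborel_pair.Fubini_integral[symmetric])
      have e1: "integrable lborel (\<lambda>x. LINT y|lborel. norm (case (x, y) of (u, s) \<Rightarrow> indicator {-T..T} u * (indicator {-b..b} s * (exp (n * b) * K\<^sup>2))))"
        using indi[of "-b" b "exp (n * b) * K\<^sup>2"] by (simp add: abs_mult ind0)
      have e2: "AE x in lborel. integrable lborel (\<lambda>y. case (x, y) of (u, s) \<Rightarrow> indicator {-T..T} u * (indicator {-b..b} s * (exp (n * b) * K\<^sup>2)))"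
        using indi[of "-b" b "exp (n * b) * K\<^sup>2"] by simp
      have "integrable (lborel \<Otimes>\<^sub>M lborel) (\<lambda>(u, s). indicator {-T..T} u * (indicator {-b..b} s * (exp (n * b) * K\<^sup>2)))"
        by (rule lborel_pair.Fubini_integrable[OF _ e1 e2]) measurable
      then show "integrable (lborel \<Otimes>\<^sub>M lborel) (\<lambda>(u, s). exp (real n * s) *\<^sub>R (a u * a (s - u)))"
      proof (rule Bochner_Integration.integrable_bound)
        have "cmod (exp (real n * s) *\<^sub>R (a u * a (s - u))) \<le> indicator {-T..T} u * (indicator {-b..b} s * (exp (n * b) * K\<^sup>2))" for u s
        proof (cases "u \<in> {-T..T} \<and> s \<in> {-b..b}")
          case True
          then have "exp (real n * s) \<le> exp (n * b)" by (auto intro: mult_left_mono)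
          moreover have "cmod (a u * a (s - u)) \<le> K\<^sup>2"
            using mult_mono[OF aK'[of u] aK'[of "s - u"]] K by (simp add: norm_mult power2_eq_square)
          ultimately have "exp (real n * s) * cmod (a u * a (s - u)) \<le> exp (n * b) * K\<^sup>2" by (intro mult_mono) auto
          then show ?thesis using True by simp
        next
          case False
          have eq: "a u * a (s - u) = 0" using False T by (auto simp: a_def indicator_def)
          show ?thesis unfolding eq using K by simp
        qed
        then show "AE x in lborel \<Otimes>\<^sub>M lborel. norm (case x of (u, s) \<Rightarrow> exp (real n * s) *\<^sub>R (a u * a (s - u))) \<le> norm (case x of (u, s) \<Rightarrow> indicator {-T..T} u * (indicator {-b..b} s * (exp (n * b) * K\<^sup>2)))"
          by (intro AE_I2) (auto intro: order_trans[OF _ abs_ge_self] simp only: prod.case split_paired_all real_norm_def)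
      qed measurable
    qed
    also have "\<dots> = (LINT s|lborel. exp (real n * s) *\<^sub>R c s)"
      by (simp add: c_def)
    finally have "cmod (?I * ?I) \<le> (LINT s|lborel. cmod (exp (real n * s) *\<^sub>R c s))"
      using integral_norm_bound by metis
    also have "\<dots> \<le> (LINT s|lborel. indicator {-b..0} s * (b * K\<^sup>2))"
    proof (rule integral_mono[OF _ indi cb])
      have [measurable]: "c \<in> borel_measurable borel" unfolding c_def by measurable
      show "integrable lborel (\<lambda>s. cmod (exp (real n * s) *\<^sub>R c s))"
        by (rule Bochner_Integration.integrable_bound[OF indi[of "-b" 0 "b * K\<^sup>2"]]) (use cb in \<open>auto simp del: norm_scaleR intro: order_trans[OF _ abs_ge_self]\<close>)
    qed
    also have "\<dots> = b * (b * K\<^sup>2)" using b by simp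
    finally show ?thesis by (simp add: norm_mult power2_eq_square)
  qed
  have bd: "cmod (LINT u|lborel. exp (real n * u) *\<^sub>R (indicator {0..T} u *\<^sub>R e (T - u))) \<le> sqrt (b * (b * K\<^sup>2)) + T * K" for n :: nat
  proof -
    have s: "(\<lambda>u. indicator S u *\<^sub>R (exp (real n * u) *\<^sub>R a u)) \<in> borel_measurable borel"
      "integrable lborel (\<lambda>u. indicator S u *\<^sub>R (exp (real n * u) *\<^sub>R a u))" if "S \<in> sets borel" for S
      using that integrable_mult_indicator[OF _ ai[of "real n"], of S] by auto
    have "(LINT u|lborel. exp (real n * u) *\<^sub>R a u) = (LINT u|lborel. indicator {-T..<0} u *\<^sub>R (exp (real n * u) *\<^sub>R a u) + indicator {0..T} u *\<^sub>R (exp (real n * u) *\<^sub>R a u))"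
      by (intro Bochner_Integration.integral_cong refl) (use T in \<open>auto simp: a_def indicator_def\<close>)
    also have "\<dots> = (LINT u|lborel. indicator {-T..<0} u *\<^sub>R (exp (real n * u) *\<^sub>R a u)) + (LINT u|lborel. indicator {0..T} u *\<^sub>R (exp (real n * u) *\<^sub>R a u))"
      by (intro Bochner_Integration.integral_add s) auto
    also have "(\<lambda>u. indicator {0..T} u *\<^sub>R (exp (real n * u) *\<^sub>R a u)) = (\<lambda>u. exp (real n * u) *\<^sub>R (indicator {0..T} u *\<^sub>R e (T - u)))"
      using T by (auto simp: a_def indicator_def fun_eq_iff)
    finally have "(LINT u|lborel. exp (real n * u) *\<^sub>R (indicator {0..T} u *\<^sub>R e (T - u)))
      = (LINT u|lborel. exp (real n * u) *\<^sub>R a u) - (LINT u|lborel. indicator {-T..<0} u *\<^sub>R (exp (real n * u) *\<^sub>R a u))"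
      by simp
    then have "cmod (LINT u|lborel. exp (real n * u) *\<^sub>R (indicator {0..T} u *\<^sub>R e (T - u)))
      \<le> cmod (LINT u|lborel. exp (real n * u) *\<^sub>R a u) + cmod (LINT u|lborel. indicator {-T..<0} u *\<^sub>R (exp (real n * u) *\<^sub>R a u))"
      by (simp only: norm_triangle_ineq4)
    also have "cmod (LINT u|lborel. exp (real n * u) *\<^sub>R a u) \<le> sqrt (b * (b * K\<^sup>2))"
      using sq by (rule real_le_rsqrt)
    also have "cmod (LINT u|lborel. indicator {-T..<0} u *\<^sub>R (exp (real n * u) *\<^sub>R a u)) \<le> (LINT u|lborel. indicator {-T..0} u * K)"
    proof (rule order_trans[OF integral_norm_bound integral_mono[OF integrable_norm indi]])
      show "cmod (indicator {-T..<0} u *\<^sub>R (exp (real n * u) *\<^sub>R a u)) \<le> indicator {-T..0} u * K" for u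
        using mult_mono[OF _ aK'[of u], of "exp (real n * u)" 1] K by (auto simp: indicator_def mult_nonneg_nonpos)
    qed (rule s, simp)
    also have "\<dots> = T * K" using T by simp
    finally show ?thesis by simp
  qed
  have "e (T - (T - x)) = 0"
    by (rule bounded_exponential_moments_zero[OF continuous_on_subset[OF ce] T(1) bd]) (use x T in auto)
  then show ?thesis by simp
qed

text \<open>
  Extend a function which is flat at 0 by zero to the left. The \<open>n\<close>-th derivative of its convolution square
  is the convolution of its derivatives of orders \<open>n div 2\<close> and \<open>n - n div 2\<close>, so the convolution square
  is flat at 0 and of class \<open>Q\<close>. It vanishes, and \<open>Titchmarsh_square\<close> applies.
\<close>

lemma flat_unique_halving:
  assumes Q: "flat_unique Q" and Qpos: "\<And>n. Q n > 0" and P: "\<And>n. P n \<ge> 0"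
    and PQ: "\<And>n. n \<ge> N \<Longrightarrow> P (n div 2) * P (n - n div 2) \<le> B * Q n"
  shows "flat_unique P"
proof (rule flat_unique_one_sidedI)
  fix b \<phi> C x
  assume b: "(b::real) > 0" and t: "tower 0 b \<phi>" and bd: "\<And>k x. x \<in> {0..b} \<Longrightarrow> cmod (\<phi> k x) \<le> C * P k"
    and fl: "\<And>k. \<phi> k 0 = 0" and x: "x \<in> {0..b/2}"
  define e where "e k x = (if x \<in> {..0} then 0 else \<phi> k x)" for k x
  have e_der: "(e k has_vector_derivative e (Suc k) x) (at x within {..b})" if "x \<le> b" for k x
  proof -
    have cl: "closure {..0::real} = {..0}" "closure {0..b} = {0..b}" by auto
    have "((\<lambda>x. if x \<in> {..0} then 0 else \<phi> k x) has_vector_derivative (if x \<in> {..0} then 0 else \<phi> (Suc k) x)) (at x within {..b})"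
    proof (rule has_vector_derivative_If_within_closures)
      show "x \<in> {..0} \<union> {0..b}" "{..b} = {..0} \<union> {0..b}" using that b by auto
      have "{0..b} \<union> (closure {..0} \<inter> closure {0..b}) = {0..b}" using b by auto
      then show "(\<phi> k has_vector_derivative \<phi> (Suc k) x) (at x within {0..b} \<union> (closure {..0} \<inter> closure {0..b}))"
        if "x \<in> {0..b} \<union> (closure {..0} \<inter> closure {0..b})"
        using that towerD[OF t, of x k] by simp
    qed (use fl in auto)
    then show ?thesis by (simp only: e_def[abs_def])
  qed
  have e_cont: "continuous_on {..b} (e k)" for k
    unfolding continuous_on_eq_continuous_within
    using e_der by (auto intro: has_vector_derivative_continuous)
  have e_cont': "continuous_on {0..b} (e k)" for k
    using e_cont by (rule continuous_on_subset) auto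
  have e_shift: "continuous_on {0..b} (\<lambda>y. e k (x - y))" if "x \<le> b" for k x
    by (rule continuous_on_compose2[OF e_cont]) (use that in \<open>auto intro!: continuous_intros\<close>)
  \<comment> \<open>The convolution of the derivatives of orders i and j; all derivatives may be moved between the factors.\<close>
  define G where "G i j x = integral {0..b} (\<lambda>y. e i (x - y) * e j y)" for i j x
  have int: "(\<lambda>y. e i (x - y) * e j y) integrable_on {p..q}" if "x \<le> b" "0 \<le> p" "q \<le> b" for i j x p q
    by (rule integrable_subinterval_real[OF integrable_continuous_real[OF continuous_on_mult[OF e_shift e_cont']], of x]) (use that in auto)
  have G_der: "(G i j has_vector_derivative G (Suc i) j x) (at x within {0..b})" if x: "x \<in> {0..b}" for i j x
  proof -
    have "((\<lambda>x. integral (cbox 0 b) (\<lambda>y. e i (x - y) * e j y)) has_vector_derivative integral (cbox 0 b) (\<lambda>y. e (Suc i) (x - y) * e j y)) (at x within {0..b})"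
    proof (rule leibniz_rule_vector_derivative)
      fix x y :: real assume xy: "x \<in> {0..b}" "y \<in> cbox 0 b"
      have "(e i has_vector_derivative e (Suc i) (x - y)) (at (x - y) within (\<lambda>x. x - y) ` {0..b})"
        by (rule has_vector_derivative_within_subset[OF e_der]) (use xy in auto)
      moreover have "((\<lambda>x. x - y) has_vector_derivative 1) (at x within {0..b})"
        by (auto intro!: derivative_eq_intros simp: has_real_derivative_iff_has_vector_derivative[symmetric])
      ultimately have "((e i \<circ> (\<lambda>x. x - y)) has_vector_derivative 1 *\<^sub>R e (Suc i) (x - y)) (at x within {0..b})"
        by (intro vector_diff_chain_within)
      then have "((\<lambda>x. e i (x - y)) has_vector_derivative e (Suc i) (x - y)) (at x within {0..b})"
        by (simp add: o_def)
      then show "((\<lambda>x. e i (x - y) * e j y) has_vector_derivative e (Suc i) (x - y) * e j y) (at x within {0..b})"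
        by (rule has_vector_derivative_mult_left)
    next
      show "(\<lambda>y. e i (x - y) * e j y) integrable_on cbox 0 b" if "x \<in> {0..b}" for x
        using int[of x 0 b i j] that by simp
      show "continuous_on ({0..b} \<times> cbox 0 b) (\<lambda>(x, y). e (Suc i) (x - y) * e j y)"
        unfolding case_prod_unfold
        by (intro continuous_on_mult continuous_on_compose2[OF e_cont] continuous_on_compose2[OF e_cont'])
          (auto intro!: continuous_intros)
    qed (use x in auto)
    then show ?thesis unfolding G_def by simp
  qed
  have G_sym: "G i j x = G j i x" if x: "x \<in> {0..b}" for i j x
  proof -
    have restrict: "G i j x = integral {0..x} (\<lambda>y. e i (x - y) * e j y)" for i j
    proof -
      have "integral {x..b} (\<lambda>y. e i (x - y) * e j y) = integral {x..b} (\<lambda>y. 0)"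
        by (rule integral_cong) (auto simp: e_def)
      moreover have "integral {0..x} (\<lambda>y. e i (x - y) * e j y) + integral {x..b} (\<lambda>y. e i (x - y) * e j y) = integral {0..b} (\<lambda>y. e i (x - y) * e j y)"
        using x int[of x 0 b i j] by (intro Henstock_Kurzweil_Integration.integral_combine) auto
      ultimately show ?thesis by (simp add: G_def)
    qed
    have "integral {0..x} (\<lambda>y. e i (x - y) * e j y) = integral {-x..0} ((\<lambda>y. e i (x - y) * e j y) \<circ> (+) x)"
      using integral_shift_Icc_real[of "-x" 0 "\<lambda>y. e i (x - y) * e j y" x] by simp
    also have "\<dots> = integral {-x..-0} (\<lambda>z. (\<lambda>y. e j (x - y) * e i y) (- z))"
      by (simp add: o_def mult.commute)
    also have "\<dots> = integral {0..x} (\<lambda>y. e j (x - y) * e i y)"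
      by (rule Henstock_Kurzweil_Integration.integral_reflect_real)
    finally show ?thesis by (simp only: restrict)
  qed
  have G_shift: "G (Suc i) j x = G i (Suc j) x" if x: "x \<in> {0..b}" for i j x
  proof -
    have "(G i j has_vector_derivative G (Suc j) i x) (at x within {0..b})"
      by (rule has_vector_derivative_transform[OF x _ G_der[OF x]]) (rule G_sym)
    then have "G (Suc i) j x = G (Suc j) i x"
      using vector_derivative_unique_within_closed_interval[of 0 b x "G i j"] b x G_der[OF x, of i j] by auto
    then show ?thesis using G_sym[OF x] by simp
  qed
  have G_split: "G (i + j) 0 x = G i j x" if x: "x \<in> {0..b}" for i j x
  proof (induction j arbitrary: i)
    case (Suc j)
    have "G (i + Suc j) 0 x = G (Suc i) j x" using Suc[of "Suc i"] by simp
    then show ?case using G_shift[OF x] by simp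
  qed simp
  have tG: "tower 0 b (\<lambda>n. G n 0)"
    unfolding tower_def using G_der by blast
  have eb: "cmod (e k y) \<le> \<bar>C\<bar> * P k" if "y \<le> b" for k y
  proof (cases "y \<le> 0")
    case False
    then have "cmod (\<phi> k y) \<le> C * P k" using bd that by auto
    also have "\<dots> \<le> \<bar>C\<bar> * P k" using P[of k] by (intro mult_right_mono) auto
    finally show ?thesis using False by (simp add: e_def)
  qed (use P in \<open>simp add: e_def\<close>)
  have Gb: "cmod (G i j x) \<le> (\<bar>C\<bar> * P i) * (\<bar>C\<bar> * P j) * b" if x: "x \<in> {0..b}" for i j x
  proof -
    have "cmod (G i j x) \<le> (\<bar>C\<bar> * P i) * (\<bar>C\<bar> * P j) * (b - 0)"
      unfolding G_def
      by (rule integral_bound) (use x b P eb in \<open>auto intro!: continuous_on_mult e_shift e_cont' simp: norm_mult intro: mult_mono\<close>)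
    then show ?thesis by simp
  qed
  \<comment> \<open>The finite sum takes care of the orders below N, for which the hypothesis gives no bound.\<close>
  define D where "D = (\<Sum>n<N. C\<^sup>2 * b * \<bar>P (n div 2) * P (n - n div 2)\<bar> / Q n) + C\<^sup>2 * b * \<bar>B\<bar>"
  have GD: "cmod (G n 0 x) \<le> D * Q n" if x: "x \<in> {0..b}" for n x
  proof -
    have "cmod (G n 0 x) = cmod (G (n div 2) (n - n div 2) x)"
      using G_split[OF x, of "n div 2" "n - n div 2"] by simp
    also have "\<dots> \<le> C\<^sup>2 * b * (P (n div 2) * P (n - n div 2))"
    proof -
      have eq: "C\<^sup>2 = \<bar>C\<bar> * \<bar>C\<bar>" by (simp add: power2_eq_square flip: abs_mult)
      show ?thesis unfolding eq using Gb[OF x, of "n div 2" "n - n div 2"] by (simp only: mult_ac)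
    qed
    also have "\<dots> \<le> D * Q n"
    proof (cases "n < N")
      case True
      have "C\<^sup>2 * b * \<bar>P (n div 2) * P (n - n div 2)\<bar> / Q n \<le> (\<Sum>n<N. C\<^sup>2 * b * \<bar>P (n div 2) * P (n - n div 2)\<bar> / Q n)"
        by (rule member_le_sum) (use True b Qpos in \<open>auto intro!: divide_nonneg_pos mult_nonneg_nonneg\<close>)
      also have "\<dots> \<le> D" using b by (simp add: D_def)
      finally have "C\<^sup>2 * b * \<bar>P (n div 2) * P (n - n div 2)\<bar> \<le> D * Q n"
        using Qpos[of n] by (simp add: divide_le_eq)
      then show ?thesis using P by simp
    next
      case False
      have "C\<^sup>2 * b * (P (n div 2) * P (n - n div 2)) \<le> C\<^sup>2 * b * (\<bar>B\<bar> * Q n)"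
        using PQ[of n] False b Qpos[of n] by (intro mult_left_mono) (auto intro: order_trans mult_right_mono)
      also have "\<dots> \<le> D * Q n"
      proof -
        have "C\<^sup>2 * b * \<bar>B\<bar> \<le> D" using b Qpos by (auto simp: D_def intro!: sum_nonneg divide_nonneg_pos)
        then show ?thesis using mult_right_mono[of "C\<^sup>2 * b * \<bar>B\<bar>" D "Q n"] Qpos[of n] by (simp add: mult_ac)
      qed
      finally show ?thesis .
    qed
    finally show ?thesis .
  qed
  have G0: "G 0 0 y = 0" if "y \<in> {0..b}" for y
  proof (rule flat_uniqueD[OF Q tG GD _ _ that])
    show "0 \<in> {0..b}" using b by simp
    show "G n 0 0 = 0" for n
    proof -
      have "G n 0 0 = integral {0..b} (\<lambda>y. 0)"
        unfolding G_def by (rule integral_cong) (auto simp: e_def)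
      then show ?thesis by simp
    qed
  qed
  have "e 0 x = 0"
    by (rule Titchmarsh_square[OF b e_cont _ _ x]) (use G0 in \<open>auto simp: G_def e_def[of 0]\<close>)
  then show "\<phi> 0 x = 0" using x fl[of 0] by (auto simp: e_def split: if_splits)
qed

section \<open>The moment sequences\<close>

definition moment :: "(real \<Rightarrow> real) \<Rightarrow> real \<Rightarrow> nat \<Rightarrow> real" where
  "moment F t k = (SUP r\<in>{0..}. r ^ k * exp (- t * F r))"

locale moment_symbol =
  fixes F :: "real \<Rightarrow> real" and c0 :: real
  assumes F_lower: "\<And>r. r \<ge> 0 \<Longrightarrow> - c0 \<le> F r" and c0: "c0 \<ge> 0"
    and bdd1: "\<And>k. bdd_above ((\<lambda>r. r ^ k * exp (- F r)) ` {0..})"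
begin

lemma moment_upper:
  assumes "bdd_above ((\<lambda>r. r ^ n * exp (- t * F r)) ` {0..})" "r \<ge> 0"
  shows "r ^ n * exp (- t * F r) \<le> moment F t n"
  unfolding moment_def by (rule cSUP_upper2[OF assms(1), of r]) (use assms(2) in auto)

text \<open>
  Log-convexity in the form \<open>r\<^sup>k exp (- s F) = (r\<^sup>n exp (- t F))\<^bsup>k/n\<^esup> exp (- (s - t k/n) F)\<close>, where the
  last exponential is bounded because its coefficient \<open>s - t k/n\<close> is nonnegative.
\<close>

lemma moment_interpolation:
  assumes bdd: "bdd_above ((\<lambda>r. r ^ n * exp (- t * F r)) ` {0..})" and r: "r \<ge> 0" and n: "n > 0"
    and t: "t > 0" and kn: "k * t \<le> n * s" and k: "k \<le> n"
  shows "r ^ k * exp (- s * F r) \<le> moment F t n powr (k / n) * exp (s * c0)"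
proof -
  have s: "s \<ge> 0"
  proof (rule ccontr)
    assume "\<not> s \<ge> 0"
    then have "n * s < 0" using n by (simp add: mult_pos_neg)
    moreover have "k * t \<ge> 0" using t by simp
    ultimately show False using kn by linarith
  qed
  have d: "s - k / n * t \<ge> 0" using kn n by (simp add: field_simps)
  show ?thesis
  proof (cases "r = 0")
    case True
    have "moment F t n > 0"
      using moment_upper[OF bdd, of 1] by (auto intro: less_le_trans[of _ "exp (- t * F 1)"])
    moreover have "s * (- F 0) \<le> s * c0" using F_lower[of 0] s by (intro mult_left_mono) auto
    ultimately show ?thesis using True n by (cases "k = 0") (auto simp: zero_power)
  next
    case False
  have "exp (- s * F r) = exp (- (k / n * t) * F r) * exp (- (s - k / n * t) * F r)"
    by (simp add: exp_add[symmetric] algebra_simps)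
  moreover have "exp (- (s - k / n * t) * F r) \<le> exp (s * c0)"
  proof -
    have "(s - k / n * t) * (- F r) \<le> (s - k / n * t) * c0"
      using F_lower[OF r] d by (intro mult_left_mono) auto
    also have "\<dots> \<le> s * c0" using c0 t by (intro mult_right_mono) auto
    finally show ?thesis unfolding exp_le_cancel_iff by (simp only: mult_minus_left mult_minus_right)
  qed
  moreover have "r ^ k * exp (- (k / n * t) * F r) = (r ^ n * exp (- t * F r)) powr (k / n)"
  proof -
    have "r ^ k = (r ^ n) powr (k / n)"
      using r n False by (simp add: powr_realpow[symmetric] powr_powr)
    moreover have "exp (- (k / n * t) * F r) = exp (- t * F r) powr (k / n)"
      by (simp add: powr_def algebra_simps)
    ultimately show ?thesis using r by (simp only: powr_mult zero_le_power exp_ge_zero)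
  qed
  moreover have "(r ^ n * exp (- t * F r)) powr (k / n) \<le> moment F t n powr (k / n)"
    using moment_upper[OF bdd r] r by (intro powr_mono2) auto
  ultimately have "r ^ k * exp (- s * F r) = (r ^ n * exp (- t * F r)) powr (k / n) * exp (- (s - k / n * t) * F r)"
    by (metis mult.assoc)
  also have "\<dots> \<le> moment F t n powr (k / n) * exp (s * c0)"
    by (intro mult_mono) (use \<open>exp (- (s - k / n * t) * F r) \<le> exp (s * c0)\<close> \<open>(r ^ n * exp (- t * F r)) powr (k / n) \<le> moment F t n powr (k / n)\<close> in auto)
  finally show ?thesis .
  qed
qed

text \<open>
  Moments at small times are bounded by powers of moments of sufficiently high order at time 1.
\<close>

lemma bdd_moment:
  assumes t: "t > 0"
  shows "bdd_above ((\<lambda>r. r ^ k * exp (- t * F r)) ` {0..})"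
proof -
  obtain n :: nat where n: "max (k / t) (max k 1) \<le> n" using real_arch_simple by blast
  have n': "n > 0" "real k * 1 \<le> real n * t" "k \<le> n" using n t by (auto simp: field_simps)
  have b: "bdd_above ((\<lambda>r. r ^ n * exp (- 1 * F r)) ` {0..})" using bdd1[of n] by simp
  show ?thesis
    using moment_interpolation[OF b _ n'(1) _ n'(2,3)] by (intro bdd_aboveI2[of _ _ "moment F 1 n powr (k / n) * exp (t * c0)"]) auto
qed

lemma moment_pos: "t > 0 \<Longrightarrow> moment F t k > 0"
  using moment_upper[OF bdd_moment, of t 1 k] by (auto intro: less_le_trans[of _ "exp (- t * F 1)"])

lemma moment_leI: "(\<And>r. r \<ge> 0 \<Longrightarrow> r ^ k * exp (- t * F r) \<le> B) \<Longrightarrow> moment F t k \<le> B"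
  unfolding moment_def by (rule cSUP_least) auto

text \<open>
  With \<open>i + j = n\<close> and \<open>i\<close>, \<open>j\<close> at most \<open>(n + 1)/2\<close>, interpolation bounds the two moments at time \<open>s\<close> by powers
  of \<open>moment F t n\<close> with exponents \<open>i/n\<close> and \<open>j/n\<close>, which sum to 1. The condition \<open>t / 2 < s\<close> makes the
  interpolation possible for large \<open>n\<close>.
\<close>

lemma flat_unique_moment_half:
  assumes fu: "flat_unique (moment F t)" and t: "t > 0" and s: "t / 2 < s" "s \<le> t"
  shows "flat_unique (moment F s)"
proof -
  have s0: "s > 0" using t s by linarith
  obtain N :: nat where N: "max (t / (2 * s - t)) 1 \<le> N" using real_arch_simple by blast
  have N1: "N \<ge> 1" "t / (2 * s - t) \<le> N" using N by auto
  show ?thesis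
  proof (rule flat_unique_halving[OF fu moment_pos[OF t] less_imp_le[OF moment_pos[OF s0]], where N=N])
    fix n assume n: "n \<ge> N"
    have n0: "n > 0" using n N1 by simp
    have "t / (2 * s - t) \<le> n" using N1(2) n by linarith
    then have key: "t \<le> n * (2 * s - t)" using s by (simp add: field_simps)
    have le: "moment F s k \<le> moment F t n powr (k / n) * exp (s * c0)" if k: "2 * k \<le> n + 1" "k \<le> n" for k
    proof (rule moment_leI)
      fix r :: real assume r: "r \<ge> 0"
      have "2 * (real k * t) = real (2 * k) * t" by simp
      also have "\<dots> \<le> real (n + 1) * t" using k t by (intro mult_right_mono) linarith+
      also have "\<dots> \<le> 2 * (real n * s)" using key by (simp add: algebra_simps)
      finally have "real k * t \<le> real n * s" by simp
      then show "r ^ k * exp (- s * F r) \<le> moment F t n powr (k / n) * exp (s * c0)"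
        by (intro moment_interpolation[OF bdd_moment[OF t]] r n0 t k)
    qed
    define i where "i = n div 2"
    define j where "j = n - n div 2"
    have ij: "i + j = n" "2 * i \<le> n + 1" "2 * j \<le> n + 1" "i \<le> n" "j \<le> n" by (auto simp: i_def j_def)
    have "moment F s i * moment F s j \<le> (moment F t n powr (i / n) * exp (s * c0)) * (moment F t n powr (j / n) * exp (s * c0))"
      using moment_pos[OF s0] ij by (intro mult_mono le) (auto intro: less_imp_le)
    also have "\<dots> = exp (s * c0) ^ 2 * moment F t n powr (i / n + j / n)"
      by (simp add: powr_add power2_eq_square)
    also have "i / n + j / n = 1" using n0 ij(1) by (simp add: add_divide_distrib[symmetric] flip: of_nat_add)
    finally show "moment F s (n div 2) * moment F s (n - n div 2) \<le> exp (s * c0) ^ 2 * moment F t n"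
      using moment_pos[OF t, of n] by (simp add: i_def j_def)
  qed
qed

text \<open>
  For \<open>t \<ge> 1\<close> the moments at time \<open>t\<close> are dominated by those at time 1. Smaller times are reached by steps of
  ratio \<open>2/3\<close>, each of which is an instance of \<open>flat_unique_moment_half\<close>.
\<close>

lemma flat_unique_moment:
  assumes "flat_unique (moment F 1)" and t: "t > 0"
  shows "flat_unique (moment F t)"
proof (cases "t \<ge> 1")
  case True
  show ?thesis
  proof (rule flat_unique_mono[OF assms(1), where B="exp ((t - 1) * c0)"])
    show "moment F t k \<le> exp ((t - 1) * c0) * moment F 1 k" for k
    proof (rule moment_leI)
      fix r :: real assume r: "r \<ge> 0"
      have "exp (- t * F r) = exp (- (t - 1) * F r) * exp (- 1 * F r)" by (simp add: exp_add[symmetric] algebra_simps)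
      then have "r ^ k * exp (- t * F r) = exp (- (t - 1) * F r) * (r ^ k * exp (- 1 * F r))" by simp
      also have "\<dots> \<le> exp ((t - 1) * c0) * moment F 1 k"
      proof (rule mult_mono)
        show "exp (- (t - 1) * F r) \<le> exp ((t - 1) * c0)"
          using mult_left_mono[OF F_lower[OF r], of "t - 1"] True unfolding exp_le_cancel_iff mult_minus_left mult_minus_right by simp
        show "r ^ k * exp (- 1 * F r) \<le> moment F 1 k" by (rule moment_upper[OF bdd_moment r]) simp
      qed (use r in auto)
      finally show "r ^ k * exp (- t * F r) \<le> exp ((t - 1) * c0) * moment F 1 k" .
    qed
  qed (use moment_pos[OF t] in \<open>auto intro: less_imp_le\<close>)
next
  case False
  have "flat_unique (moment F s)" if "s \<le> 1" "(2/3) ^ n \<le> s" for s and n :: nat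
    using that
  proof (induction n arbitrary: s)
    case 0
    then show ?case using assms(1) by simp
  next
    case (Suc n)
    define t where "t = min 1 (3/2 * s)"
    have p: "(2/3::real) ^ Suc n > 0" by simp
    have s: "s > 0" using Suc.prems p by linarith
    have "(2/3) ^ n \<le> t" using Suc.prems by (auto simp: t_def power_le_one)
    then have "flat_unique (moment F t)" by (intro Suc.IH) (auto simp: t_def)
    then show ?case by (rule flat_unique_moment_half) (use s Suc.prems in \<open>auto simp: t_def min_def\<close>)
  qed
  moreover obtain n where "(2/3::real) ^ n < t" using real_arch_pow_inv[OF t, of "2/3"] by auto
  ultimately show ?thesis using False by (meson less_imp_le not_le)
qed

end

section \<open>A one-dimensional inequality by compactness\<close>

text \<open>
  Rolle's theorem produces zeros of the next derivative between the zeros, which accumulate at the same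
  point. It needs real values, hence the real functional \<open>l\<close>.
\<close>

lemma tower_linear_flat_at_limpt:
  fixes l :: "complex \<Rightarrow> real"
  assumes t: "tower a b \<phi>" and l: "bounded_linear l" and lim: "x0 islimpt {x\<in>{a..b}. l (\<phi> 0 x) = 0}"
  shows "x0 islimpt {x\<in>{a..b}. l (\<phi> k x) = 0} \<and> x0 \<in> {a..b} \<and> l (\<phi> k x0) = 0"
proof -
  have cont: "continuous_on {a..b} (\<lambda>x. l (\<phi> k x))" for k
    using tower_continuous[OF t] by (intro bounded_linear.continuous_on[OF l])
  have closed: "closed {x\<in>{a..b}. l (\<phi> k x) = 0}" for k
    using continuous_closed_preimage_constant[OF cont closed_atLeastAtMost, of k 0] by simp
  have mem: "x0 \<in> {a..b} \<and> l (\<phi> k x0) = 0" if "x0 islimpt {x\<in>{a..b}. l (\<phi> k x) = 0}" for k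
    using closed_limpt[of "{x\<in>{a..b}. l (\<phi> k x) = 0}"] closed[of k] that by blast
  have der: "((\<lambda>x. l (\<phi> k x)) has_derivative (\<lambda>h. h * l (\<phi> (Suc k) x))) (at x)" if "a < x" "x < b" for k x
  proof -
    have "((\<lambda>x. l (\<phi> k x)) has_vector_derivative l (\<phi> (Suc k) x)) (at x within {a..b})"
      using that by (intro bounded_linear.has_vector_derivative[OF l] towerD[OF t]) auto
    then have "((\<lambda>x. l (\<phi> k x)) has_vector_derivative l (\<phi> (Suc k) x)) (at x)"
      unfolding at_within_Icc_at[OF that] .
    then show ?thesis by (simp add: has_vector_derivative_def)
  qed
  have "x0 islimpt {x\<in>{a..b}. l (\<phi> k x) = 0}" for k
  proof (induction k)
    case (Suc k)
    note x0 = mem[OF Suc.IH]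
    show ?case
      unfolding islimpt_approachable
    proof (intro allI impI)
      fix e :: real assume "e > 0"
      then obtain z where z: "z \<in> {a..b}" "l (\<phi> k z) = 0" "z \<noteq> x0" "dist z x0 < e"
        using Suc.IH unfolding islimpt_approachable by blast
      define p where "p = min z x0"
      define q where "q = max z x0"
      have pq: "p < q" "l (\<phi> k p) = l (\<phi> k q)" "p \<in> {a..b}" "q \<in> {a..b}"
        using z x0 by (auto simp: p_def q_def min_def max_def)
      have "\<exists>y. p < y \<and> y < q \<and> (\<lambda>h. h * l (\<phi> (Suc k) y)) = (\<lambda>v. 0)"
        by (rule Rolle_deriv[OF pq(1,2) continuous_on_subset[OF cont] der]) (use pq in auto)
      then obtain y where y: "p < y" "y < q" "(\<lambda>h. h * l (\<phi> (Suc k) y)) = (\<lambda>v. 0)" by blast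
      from fun_cong[OF y(3), of 1] have "l (\<phi> (Suc k) y) = 0" by simp
      moreover have "y \<in> {a..b}" "y \<noteq> x0" "dist y x0 < e"
        using y(1,2) pq(3,4) z(4) by (auto simp: p_def q_def dist_real_def min_def max_def split: if_splits)
      ultimately show "\<exists>y\<in>{x \<in> {a..b}. l (\<phi> (Suc k) x) = 0}. y \<noteq> x0 \<and> dist y x0 < e" by blast
    qed
  qed (use lim in simp)
  then show ?thesis using mem by blast
qed

lemma tower_flat_at_limpt:
  assumes t: "tower a b \<phi>" and lim: "x0 islimpt {x\<in>{a..b}. \<phi> 0 x = 0}"
  shows "\<phi> k x0 = 0"
proof -
  have "x0 islimpt {x\<in>{a..b}. Re (\<phi> 0 x) = 0}" "x0 islimpt {x\<in>{a..b}. Im (\<phi> 0 x) = 0}"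
    by (rule islimpt_subset[OF lim]; auto)+
  with tower_linear_flat_at_limpt[OF t bounded_linear_Re, of x0 k] tower_linear_flat_at_limpt[OF t bounded_linear_Im, of x0 k]
  show ?thesis by (simp add: complex_eq_iff)
qed

text \<open>
  The one-dimensional Sobolev inequality: compare \<open>|\<phi> k|\<^sup>2\<close> at \<open>x\<close> with its mean value, using that its
  derivative is at most \<open>|\<phi> k|\<^sup>2 + |\<phi> (Suc k)|\<^sup>2\<close> in absolute value.
\<close>

lemma tower_sup_bound:
  assumes t: "tower 0 L \<phi>" and L: "L > 0" and x: "x \<in> {0..L}"
  shows "(cmod (\<phi> k x))\<^sup>2 \<le> (1 / L + 1) * integral {0..L} (\<lambda>y. (cmod (\<phi> k y))\<^sup>2) + integral {0..L} (\<lambda>y. (cmod (\<phi> (Suc k) y))\<^sup>2)"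
proof -
  define f where "f y = (cmod (\<phi> k y))\<^sup>2" for y
  define h where "h y = (cmod (\<phi> k y))\<^sup>2 + (cmod (\<phi> (Suc k) y))\<^sup>2" for y
  have cf: "continuous_on {0..L} (\<lambda>y. (cmod (\<phi> j y))\<^sup>2)" for j
    by (intro continuous_intros tower_continuous[OF t])
  have ch: "continuous_on {0..L} h" unfolding h_def by (intro continuous_on_add cf)
  let ?A = "integral {0..L} h"
  have der: "(f has_vector_derivative 2 * (\<phi> k y \<bullet> \<phi> (Suc k) y)) (at y within {0..L})" if "y \<in> {0..L}" for y
  proof -
    have "((\<lambda>y. \<phi> k y \<bullet> \<phi> k y) has_vector_derivative (\<phi> k y \<bullet> \<phi> (Suc k) y + \<phi> (Suc k) y \<bullet> \<phi> k y)) (at y within {0..L})"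
      by (rule bounded_bilinear.has_vector_derivative[OF bounded_bilinear_inner towerD[OF t that] towerD[OF t that]])
    then show ?thesis by (simp add: f_def[abs_def] power2_norm_eq_inner inner_commute)
  qed
  have hb: "norm (2 * (\<phi> k y \<bullet> \<phi> (Suc k) y)) \<le> h y" for y
  proof -
    have "\<bar>\<phi> k y \<bullet> \<phi> (Suc k) y\<bar> \<le> cmod (\<phi> k y) * cmod (\<phi> (Suc k) y)" by (rule Cauchy_Schwarz_ineq2)
    then show ?thesis
      using sum_squares_bound[of "cmod (\<phi> k y)" "cmod (\<phi> (Suc k) y)"] by (simp add: h_def abs_mult)
  qed
  have diff: "\<bar>f q - f p\<bar> \<le> ?A" if "p \<in> {0..L}" "q \<in> {0..L}" "p \<le> q" for p q
  proof -
    have 1: "((\<lambda>y. 2 * (\<phi> k y \<bullet> \<phi> (Suc k) y)) has_integral (f q - f p)) {p..q}"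
      by (rule fundamental_theorem_of_calculus[OF that(3) has_vector_derivative_within_subset[OF der]]) (use that in auto)
    have hi: "h integrable_on {p..q}"
      using that by (intro integrable_continuous_real continuous_on_subset[OF ch]) auto
    have "norm (integral {p..q} (\<lambda>y. 2 * (\<phi> k y \<bullet> \<phi> (Suc k) y))) \<le> integral {p..q} h"
      using has_integral_integrable[OF 1] hi hb by (rule Henstock_Kurzweil_Integration.integral_norm_bound_integral)
    also have "\<dots> \<le> ?A"
      using that by (intro integral_subset_le hi integrable_continuous_real ch) (auto simp: h_def)
    finally show ?thesis using integral_unique[OF 1] by simp
  qed
  have le: "f x \<le> f y + ?A" if "y \<in> {0..L}" for y
    using diff[OF x that] diff[OF that x] by (cases "x \<le> y") auto
  have "integral {0..L} (\<lambda>y. f x) \<le> integral {0..L} (\<lambda>y. f y + ?A)"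
    by (intro integral_le le integrable_continuous_real continuous_intros) (use cf in \<open>auto simp: f_def[abs_def]\<close>)
  also have "\<dots> = integral {0..L} f + L * ?A"
    using L cf[of k] by (subst Henstock_Kurzweil_Integration.integral_add) (auto intro!: integrable_continuous_real simp: f_def[abs_def])
  finally have "L * f x \<le> integral {0..L} f + L * ?A" using L by simp
  moreover have "?A = integral {0..L} f + integral {0..L} (\<lambda>y. (cmod (\<phi> (Suc k) y))\<^sup>2)"
    unfolding h_def f_def[abs_def] by (intro Henstock_Kurzweil_Integration.integral_add integrable_continuous_real cf)
  moreover have "L * ((1 / L + 1) * I + J) = I + L * (I + J)" for I J
    using L by (simp add: field_simps)
  ultimately have "L * f x \<le> L * ((1 / L + 1) * integral {0..L} f + integral {0..L} (\<lambda>y. (cmod (\<phi> (Suc k) y))\<^sup>2))"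
    by simp
  then show ?thesis using L by (simp add: f_def[abs_def])
qed

lemma tower_FTC:
  assumes "tower 0 L \<phi>" "x \<in> {0..L}"
  shows "\<phi> k x = \<phi> k 0 + integral {0..x} (\<phi> (Suc k))"
proof -
  have "(\<phi> (Suc k) has_integral (\<phi> k x - \<phi> k 0)) {0..x}"
    by (rule fundamental_theorem_of_calculus[OF _ has_vector_derivative_within_subset[OF towerD[OF assms(1)]]]) (use assms in auto)
  then show ?thesis by (simp add: integral_unique)
qed

lemma tower_Lipschitz:
  assumes t: "tower 0 L \<phi>" and xy: "x \<in> {0..L}" "y \<in> {0..L}" and bd: "\<And>z. z \<in> {0..L} \<Longrightarrow> cmod (\<phi> (Suc k) z) \<le> B"
  shows "cmod (\<phi> k x - \<phi> k y) \<le> B * \<bar>x - y\<bar>"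
proof -
  have "cmod (\<phi> k x - \<phi> k y) \<le> B * norm (x - y)"
  proof (rule differentiable_bound[of "{0..L}" "\<phi> k" "\<lambda>x h. h *\<^sub>R \<phi> (Suc k) x"])
    show "(\<phi> k has_derivative (\<lambda>h. h *\<^sub>R \<phi> (Suc k) z)) (at z within {0..L})" if "z \<in> {0..L}" for z
      using towerD[OF t that] by (simp add: has_vector_derivative_def)
    show "onorm (\<lambda>h. h *\<^sub>R \<phi> (Suc k) z) \<le> B" if "z \<in> {0..L}" for z
      by (rule onorm_le) (use bd[OF that] in \<open>auto simp: mult.commute[of B] intro: mult_left_mono\<close>)
  qed (use xy in auto)
  then show ?thesis by simp
qed

text \<open>
  A diagonal sequence converges at all rational points for all orders. The bound for the next derivative
  gives equicontinuity, hence convergence everywhere, and passing to the limit in the fundamental theorem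
  of calculus shows that the limits are again successive derivatives.
\<close>

lemma tower_compactness:
  assumes t: "\<And>j::nat. tower 0 L (\<psi> j)" and L: "L > 0" and bd: "\<And>j k x. x \<in> {0..L} \<Longrightarrow> cmod (\<psi> j k x) \<le> K k" and K: "\<And>k. K k > 0"
  obtains r \<Psi> where "strict_mono r" "tower 0 L \<Psi>" "\<And>k x. x \<in> {0..L} \<Longrightarrow> (\<lambda>j. \<psi> (r j) k x) \<longlonglongrightarrow> \<Psi> k x"
proof -
  define f where "f j p = (1 / K (fst p)) *\<^sub>R \<psi> j (fst p) (snd p)" for j and p :: "nat \<times> real"
  have "cmod (f j p) \<le> 1" if "p \<in> UNIV \<times> (\<rat> \<inter> {0..L})" for j p
    using bd[of "snd p" j "fst p"] K[of "fst p"] that by (auto simp: f_def)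
  moreover have "countable ((UNIV :: nat set) \<times> (\<rat> \<inter> {0..L}))"
    by (intro countable_SIGMA countable_Int1 countable_rat) auto
  ultimately obtain r where r: "strict_mono r" and conv: "\<And>p. p \<in> UNIV \<times> (\<rat> \<inter> {0..L}) \<Longrightarrow> \<exists>l. (\<lambda>j. f (r j) p) \<longlonglongrightarrow> l"
    using function_convergent_subsequence[of "UNIV \<times> (\<rat> \<inter> {0..L})" f 1] by blast
  have qc: "Cauchy (\<lambda>j. \<psi> (r j) k q)" if q: "q \<in> \<rat>" "q \<in> {0..L}" for k q
  proof -
    obtain l where "(\<lambda>j. f (r j) (k, q)) \<longlonglongrightarrow> l" using conv[of "(k, q)"] q by blast
    then have "(\<lambda>j. K k *\<^sub>R f (r j) (k, q)) \<longlonglongrightarrow> K k *\<^sub>R l" by (intro tendsto_intros)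
    then show ?thesis using K[of k] by (auto simp: f_def intro: LIMSEQ_imp_Cauchy)
  qed
  have "Cauchy (\<lambda>j. \<psi> (r j) k x)" if x: "x \<in> {0..L}" for k x
  proof (rule metric_CauchyI)
    fix e :: real assume e: "e > 0"
    define d where "d = e / (3 * K (Suc k))"
    have d: "d > 0" using e K[of "Suc k"] by (simp add: d_def)
    obtain q where q: "q \<in> \<rat>" "q \<in> {0..L}" "\<bar>x - q\<bar> < d"
    proof -
      have "max 0 (x - d) < min L (x + d)" using x d L by auto
      then obtain q where "q \<in> \<rat>" "max 0 (x - d) < q" "q < min L (x + d)" using Rats_dense_in_real by blast
      then show ?thesis by (intro that[of q]) auto
    qed
    obtain M where M: "\<And>m n. m \<ge> M \<Longrightarrow> n \<ge> M \<Longrightarrow> dist (\<psi> (r m) k q) (\<psi> (r n) k q) < e / 3"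
      using metric_CauchyD[OF qc[OF q(1,2)], of "e / 3" k] e by auto
    have Lip: "cmod (\<psi> j k x - \<psi> j k q) < e / 3" for j
    proof -
      have "cmod (\<psi> j k x - \<psi> j k q) \<le> K (Suc k) * \<bar>x - q\<bar>"
        by (rule tower_Lipschitz[OF t x q(2) bd])
      also have "\<dots> < K (Suc k) * d" using q(3) K by (intro mult_strict_left_mono)
      also have "\<dots> = e / 3" using K[of "Suc k"] by (simp add: d_def)
      finally show ?thesis .
    qed
    show "\<exists>M. \<forall>m\<ge>M. \<forall>n\<ge>M. dist (\<psi> (r m) k x) (\<psi> (r n) k x) < e"
    proof (intro exI allI impI)
      fix m n assume mn: "M \<le> m" "M \<le> n"
      have "dist (\<psi> (r m) k x) (\<psi> (r n) k x) \<le> dist (\<psi> (r m) k x) (\<psi> (r m) k q) + dist (\<psi> (r m) k q) (\<psi> (r n) k q) + dist (\<psi> (r n) k q) (\<psi> (r n) k x)"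
        by metric
      also have "\<dots> < e / 3 + e / 3 + e / 3"
        using Lip[of "r m"] Lip[of "r n"] M[OF mn] by (intro add_strict_mono) (auto simp: dist_norm norm_minus_commute)
      finally show "dist (\<psi> (r m) k x) (\<psi> (r n) k x) < e" by simp
    qed
  qed
  then have ptw: "(\<lambda>j. \<psi> (r j) k x) \<longlonglongrightarrow> lim (\<lambda>j. \<psi> (r j) k x)" if "x \<in> {0..L}" for k x
    using that Cauchy_convergent convergent_LIMSEQ_iff by blast
  define \<Psi> where "\<Psi> k x = lim (\<lambda>j. \<psi> (r j) k x)" for k x
  have lim: "(\<lambda>j. \<psi> (r j) k x) \<longlonglongrightarrow> \<Psi> k x" if "x \<in> {0..L}" for k x
    using ptw[OF that] by (simp add: \<Psi>_def)
  have cont: "continuous_on {0..L} (\<Psi> k)" for k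
  proof (rule continuous_on_subset[OF lipschitz_on_continuous_on subset_refl])
    show "(K (Suc k))-lipschitz_on {0..L} (\<Psi> k)"
    proof (rule lipschitz_onI)
      fix x y assume xy: "x \<in> {0..L}" "y \<in> {0..L}"
      show "dist (\<Psi> k x) (\<Psi> k y) \<le> K (Suc k) * dist x y"
        using tower_Lipschitz[OF t xy bd]
        by (intro LIMSEQ_le_const2[OF tendsto_dist[OF lim[OF xy(1)] lim[OF xy(2)]]]) (auto simp: dist_norm)
    qed (use K in \<open>auto intro: less_imp_le\<close>)
  qed
  have FTC: "\<Psi> k x = \<Psi> k 0 + integral {0..x} (\<Psi> (Suc k))" if x: "x \<in> {0..L}" for k x
  proof -
    have "(\<lambda>j. integral {0..x} (\<psi> (r j) (Suc k))) \<longlonglongrightarrow> integral {0..x} (\<Psi> (Suc k))"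
    proof (rule dominated_convergence(2)[where h="\<lambda>_. K (Suc k)"])
      show "\<psi> (r j) (Suc k) integrable_on {0..x}" for j
        using x by (intro integrable_continuous_real continuous_on_subset[OF tower_continuous[OF t]]) auto
    qed (use x bd lim in auto)
    then have "(\<lambda>j. \<psi> (r j) k 0 + integral {0..x} (\<psi> (r j) (Suc k))) \<longlonglongrightarrow> \<Psi> k 0 + integral {0..x} (\<Psi> (Suc k))"
      using L by (intro tendsto_add lim) auto
    then have "(\<lambda>j. \<psi> (r j) k x) \<longlonglongrightarrow> \<Psi> k 0 + integral {0..x} (\<Psi> (Suc k))"
      using tower_FTC[OF t x, of _ k] by simp
    with lim[OF x] show ?thesis by (rule LIMSEQ_unique)
  qed
  have "tower 0 L \<Psi>"
    unfolding tower_def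
  proof (intro allI ballI)
    fix k x assume x: "x \<in> {0..L}"
    have "((\<lambda>x. integral {0..x} (\<Psi> (Suc k))) has_vector_derivative \<Psi> (Suc k) x) (at x within {0..L})"
      using cont x by (rule integral_has_vector_derivative)
    then have "((\<lambda>x. \<Psi> k 0 + integral {0..x} (\<Psi> (Suc k))) has_vector_derivative \<Psi> (Suc k) x) (at x within {0..L})"
      by (auto intro!: derivative_eq_intros)
    then show "(\<Psi> k has_vector_derivative \<Psi> (Suc k) x) (at x within {0..L})"
      by (rule has_vector_derivative_transform[OF x, rotated]) (rule FTC)
  qed
  then show ?thesis using r lim by (intro that)
qed

lemma set_integral_Icc_continuous:
  fixes f :: "real \<Rightarrow> real"
  assumes "continuous_on {0..L} f"
  shows "set_integrable lborel {0..L} f" "(LINT x:{0..L}|lborel. f x) = integral {0..L} f"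
proof -
  show "set_integrable lborel {0..L} f"
    unfolding set_integrable_def using borel_integrable_compact[OF _ assms]
    by (auto simp: indicator_def if_distrib cong: if_cong)
  then show "(LINT x:{0..L}|lborel. f x) = integral {0..L} f"
    by (rule set_borel_integral_eq_integral)
qed

lemma set_integrable_Int_Icc:
  fixes f :: "real \<Rightarrow> real"
  assumes "continuous_on {0..L} f" "E \<in> sets borel"
  shows "set_integrable lborel (E \<inter> {0..L}) f"
  by (rule set_integrable_subset[OF set_integral_Icc_continuous(1)[OF assms(1)]]) (use assms in auto)

lemma emeasure_Int_Icc_finite: "E \<in> sets borel \<Longrightarrow> emeasure lborel (E \<inter> {0..L::real}) < \<infinity>"
  by (rule emeasure_bounded_finite) auto

text \<open>
  The set where \<open>f \<le> 1/m\<close> has measure below \<open>\<gamma>/2\<close> for large \<open>m\<close>, because these sets decrease to the finite set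
  of zeros. So \<open>f > 1/m\<close> on a part of \<open>E\<close> of measure at least \<open>\<gamma>/2\<close>.
\<close>

lemma nonvanishing_lower_bound:
  fixes f :: "real \<Rightarrow> real"
  assumes f: "continuous_on {0..L} f" and nn: "\<And>x. f x \<ge> 0" and fin: "finite {x\<in>{0..L}. f x = 0}" and \<gamma>: "\<gamma> > 0"
  obtains c where "c > 0" "\<And>E. E \<in> sets borel \<Longrightarrow> \<gamma> \<le> measure lborel (E \<inter> {0..L}) \<Longrightarrow> c \<le> (LINT x:(E \<inter> {0..L})|lborel. f x)"
proof -
  define A where "A m = {x\<in>{0..L}. f x \<in> {..1 / Suc m}}" for m :: nat
  have A_closed: "closed (A m)" for m
    using continuous_closed_preimage[OF f, of "{..1 / Suc m}"] by (simp add: A_def vimage_def Int_def)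
  have A_sets: "A m \<in> sets lborel" for m using A_closed[of m] by auto
  have A_fin: "emeasure lborel (A m) \<noteq> \<infinity>" for m
    using emeasure_bounded_finite[of "A m"] bounded_subset[of "{0..L}" "A m"] by (force simp: A_def)
  have fin': "emeasure lborel Y < \<infinity>" if "Y \<subseteq> {0..L}" for Y
    by (rule emeasure_bounded_finite[OF bounded_subset[OF _ that]]) simp
  have "(\<lambda>m. measure lborel (A m)) \<longlonglongrightarrow> measure lborel (\<Inter>m. A m)"
  proof (rule Lim_measure_decseq)
    show "range A \<subseteq> sets lborel" using A_sets by auto
    have "1 / real (Suc (Suc m)) \<le> 1 / real (Suc m)" for m by (simp add: field_simps)
    then show "decseq A" by (intro decseq_SucI) (auto simp: A_def intro: order_trans)
  qed (use A_fin in auto)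
  moreover have "(\<Inter>m. A m) = {x\<in>{0..L}. f x = 0}"
  proof -
    have "f x = 0" if "\<And>m. f x \<le> 1 / Suc m" for x
    proof (rule ccontr)
      assume "f x \<noteq> 0"
      then obtain m where "1 / Suc m < f x" using nn[of x] nat_approx_posE[of "f x"] by (metis less_eq_real_def)
      then show False using that[of m] by simp
    qed
    then show ?thesis by (auto simp: A_def)
  qed
  moreover have "measure lborel {x\<in>{0..L}. f x = 0} = 0"
    using fin by (simp add: finite_imp_null_set_lborel null_setsD1 measure_def)
  ultimately have "(\<lambda>m. measure lborel (A m)) \<longlonglongrightarrow> 0" by simp
  then have "\<forall>\<^sub>F m in sequentially. measure lborel (A m) < \<gamma> / 2"
    using \<gamma> by (intro order_tendstoD) auto
  then obtain m where m: "measure lborel (A m) < \<gamma> / 2" by (auto simp: eventually_sequentially)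
  show ?thesis
  proof (rule that[of "1 / Suc m * (\<gamma> / 2)"])
    show "1 / Suc m * (\<gamma> / 2) > 0" using \<gamma> by simp
    fix E assume E: "E \<in> sets borel" and mE: "\<gamma> \<le> measure lborel (E \<inter> {0..L})"
    let ?X = "E \<inter> {0..L}"
    have X: "?X \<in> sets lborel" "emeasure lborel ?X \<noteq> \<infinity>" using E emeasure_Int_Icc_finite[OF E, of L] by auto
    have "measure lborel ?X \<le> measure lborel (?X - A m) + measure lborel (A m)"
    proof -
      have "measure lborel ?X \<le> measure lborel ((?X - A m) \<union> A m)"
      proof (rule measure_mono_fmeasurable)
        have "?X - A m \<union> A m \<subseteq> {0..L}" unfolding A_def by blast
        from fin'[OF this] show "?X - A m \<union> A m \<in> fmeasurable lborel"
          using X(1) A_sets[of m] by (intro fmeasurableI sets.Un sets.Diff)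
      qed (use X(1) in auto)
      also have "\<dots> \<le> measure lborel (?X - A m) + measure lborel (A m)"
        by (rule measure_Un_le) (use X A_sets in auto)
      finally show ?thesis .
    qed
    then have big: "measure lborel (?X - A m) \<ge> \<gamma> / 2" using m mE by simp
    have "1 / Suc m * (\<gamma> / 2) \<le> 1 / Suc m * measure lborel (?X - A m)"
      using big by (intro mult_left_mono) auto
    also have "\<dots> = (LINT x|lborel. indicator (?X - A m) x * (1 / Suc m))"
      using X A_sets[of m] by simp
    also have "\<dots> \<le> (LINT x:?X|lborel. f x)"
      unfolding set_lebesgue_integral_def
    proof (rule integral_mono)
      show "integrable lborel (\<lambda>x. indicator ?X x *\<^sub>R f x)"
        using set_integrable_Int_Icc[OF f E] by (simp add: set_integrable_def)
      have "emeasure lborel (?X - A m) \<le> emeasure lborel ?X" using X by (intro emeasure_mono) auto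
      then have "emeasure lborel (?X - A m) < \<infinity>" using X(2) by (simp add: less_top top_unique le_less_trans)
      then have "integrable lborel (indicat_real (?X - A m))"
        using X A_sets[of m] by (intro integrable_real_indicator) auto
      then show "integrable lborel (\<lambda>x. indicator (?X - A m) x * (1 / real (Suc m)))"
        by (rule integrable_mult_left)
      show "indicator (?X - A m) x * (1 / real (Suc m)) \<le> indicator ?X x *\<^sub>R f x" for x
        using nn[of x] by (auto simp: indicator_def A_def)
    qed
    finally show "1 / Suc m * (\<gamma> / 2) \<le> (LINT x:?X|lborel. f x)" .
  qed
qed

text \<open>
  If no constant works, choose a counterexample for \<open>C = 1, 2, ...\<close> and divide it by its value at 0. The
  term with \<open>\<epsilon>\<close> bounds the normalised functions in the class of \<open>B\<close>, uniformly over the sequence, so a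
  subsequence converges. The limit has absolute value 1 at 0. If it had only finitely many zeros, the
  integrals of its square over the sets \<open>E\<close> would be bounded below, although they tend to 0 along the
  sequence. So it has an accumulation point of zeros, where it is flat, and it vanishes identically. The constant is uniform
  in \<open>E\<close>, of which only the measure enters.
\<close>

lemma one_dimensional_inequality:
  assumes fu: "flat_unique (\<lambda>k. B k + B (Suc k))" and B: "\<And>k. B k > 0" and L: "L > 0" and \<gamma>: "\<gamma> > 0" and \<epsilon>: "\<epsilon> > 0"
  shows "\<exists>C\<ge>0. \<forall>\<phi> E S. tower 0 L \<phi> \<longrightarrow> E \<in> sets borel \<longrightarrow> \<gamma> \<le> measure lborel (E \<inter> {0..L}) \<longrightarrow> 0 \<le> S \<longrightarrow>
     (\<forall>k. (LINT x:{0..L}|lborel. (cmod (\<phi> k x))\<^sup>2) \<le> S * (B k)\<^sup>2) \<longrightarrow>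
     (cmod (\<phi> 0 0))\<^sup>2 \<le> C * (LINT x:(E \<inter> {0..L})|lborel. (cmod (\<phi> 0 x))\<^sup>2) + \<epsilon> * S"
proof (rule ccontr)
  assume neg: "\<not> ?thesis"
  have "\<exists>\<phi> E S. tower 0 L \<phi> \<and> E \<in> sets borel \<and> \<gamma> \<le> measure lborel (E \<inter> {0..L}) \<and> 0 \<le> S \<and>
     (\<forall>k. (LINT x:{0..L}|lborel. (cmod (\<phi> k x))\<^sup>2) \<le> S * (B k)\<^sup>2) \<and>
     (cmod (\<phi> 0 0))\<^sup>2 > real (Suc j) * (LINT x:(E \<inter> {0..L})|lborel. (cmod (\<phi> 0 x))\<^sup>2) + \<epsilon> * S" for j
    using neg by (metis not_le of_nat_0_le_iff)
  then obtain \<phi> E S where t: "\<And>j. tower 0 L (\<phi> j)" and E: "\<And>j. E j \<in> sets borel" "\<And>j. \<gamma> \<le> measure lborel (E j \<inter> {0..L})"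
    and S: "\<And>j. 0 \<le> S j" "\<And>j k. (LINT x:{0..L}|lborel. (cmod (\<phi> j k x))\<^sup>2) \<le> S j * (B k)\<^sup>2"
    and big: "\<And>j. (cmod (\<phi> j 0 0))\<^sup>2 > real (Suc j) * (LINT x:(E j \<inter> {0..L})|lborel. (cmod (\<phi> j 0 x))\<^sup>2) + \<epsilon> * S j"
    by metis
  have sqc: "continuous_on {0..L} (\<lambda>x. (cmod (\<phi> j k x))\<^sup>2)" for j k
    by (intro continuous_intros tower_continuous[OF t])
  have I0: "0 \<le> (LINT x:(E j \<inter> {0..L})|lborel. (cmod (\<phi> j 0 x))\<^sup>2)" for j
    unfolding set_lebesgue_integral_def by (rule integral_nonneg_AE) auto
  define d where "d j = cmod (\<phi> j 0 0)" for j
  have d2: "(d j)\<^sup>2 > \<epsilon> * S j" "(d j)\<^sup>2 > real (Suc j) * (LINT x:(E j \<inter> {0..L})|lborel. (cmod (\<phi> j 0 x))\<^sup>2)" for j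
  proof -
    have "0 \<le> real (Suc j) * (LINT x:(E j \<inter> {0..L})|lborel. (cmod (\<phi> j 0 x))\<^sup>2)" "0 \<le> \<epsilon> * S j"
      using I0[of j] S(1)[of j] \<epsilon> by auto
    then show "(d j)\<^sup>2 > \<epsilon> * S j" "(d j)\<^sup>2 > real (Suc j) * (LINT x:(E j \<inter> {0..L})|lborel. (cmod (\<phi> j 0 x))\<^sup>2)"
      using big[of j] by (auto simp: d_def)
  qed
  have d0: "d j > 0" for j
  proof -
    have "0 \<le> \<epsilon> * S j" using \<epsilon> S(1)[of j] by simp
    then have "(d j)\<^sup>2 > 0" using d2(1)[of j] by linarith
    then show ?thesis by (simp add: d_def)
  qed
  define \<psi> where "\<psi> j k x = (1 / d j) *\<^sub>R \<phi> j k x" for j k x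
  have t': "tower 0 L (\<psi> j)" for j
    using t[of j] unfolding tower_def \<psi>_def by (auto intro!: derivative_eq_intros)
  have nrm: "(cmod (\<psi> j k x))\<^sup>2 = (1 / (d j)\<^sup>2) * (cmod (\<phi> j k x))\<^sup>2" for j k x
    by (simp add: \<psi>_def power_mult_distrib power_divide)
  have small: "integral {0..L} (\<lambda>x. (cmod (\<psi> j k x))\<^sup>2) \<le> (1 / \<epsilon>) * (B k)\<^sup>2" for j k
  proof -
    have "integral {0..L} (\<lambda>x. (cmod (\<psi> j k x))\<^sup>2) = (1 / (d j)\<^sup>2) * integral {0..L} (\<lambda>x. (cmod (\<phi> j k x))\<^sup>2)"
      unfolding nrm by (rule Henstock_Kurzweil_Integration.integral_mult_right)
    also have "\<dots> \<le> (1 / (d j)\<^sup>2) * (S j * (B k)\<^sup>2)"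
      using S(2)[of j k] set_integral_Icc_continuous(2)[OF sqc, of j k] by (intro mult_left_mono) auto
    also have "\<dots> \<le> (1 / \<epsilon>) * (B k)\<^sup>2"
    proof -
      have "S j / (d j)\<^sup>2 \<le> 1 / \<epsilon>" using d2(1)[of j] d0[of j] \<epsilon> by (simp add: field_simps)
      then show ?thesis using mult_right_mono[of "S j / (d j)\<^sup>2" "1 / \<epsilon>" "(B k)\<^sup>2"] by simp
    qed
    finally show ?thesis .
  qed
  define K0 where "K0 = sqrt ((1 / \<epsilon>) * (1 / L + 1))"
  have K0: "K0 > 0" "K0\<^sup>2 = (1 / \<epsilon>) * (1 / L + 1)"
  proof -
    have "(1 / \<epsilon>) * (1 / L + 1) > 0" using \<epsilon> L by (intro mult_pos_pos add_pos_pos) auto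
    then show "K0 > 0" "K0\<^sup>2 = (1 / \<epsilon>) * (1 / L + 1)" by (simp_all add: K0_def)
  qed
  \<comment> \<open>The supremum of the k-th derivative is controlled by two consecutive integrals, hence the sequence B k + B (Suc k).\<close>
  have sup: "cmod (\<psi> j k x) \<le> K0 * (B k + B (Suc k))" if x: "x \<in> {0..L}" for j k x
  proof (rule power2_le_imp_le)
    have "(cmod (\<psi> j k x))\<^sup>2 \<le> (1 / L + 1) * ((1 / \<epsilon>) * (B k)\<^sup>2) + (1 / \<epsilon>) * (B (Suc k))\<^sup>2"
      using L by (intro order_trans[OF tower_sup_bound[OF t' L x]] add_mono mult_left_mono small) auto
    also have "\<dots> \<le> K0\<^sup>2 * ((B k)\<^sup>2 + (B (Suc k))\<^sup>2)"
      unfolding K0(2) using \<epsilon> L by (simp add: field_simps)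
    also have "\<dots> \<le> K0\<^sup>2 * (B k + B (Suc k))\<^sup>2"
      using B[of k] B[of "Suc k"] by (intro mult_left_mono) (auto simp: power2_sum)
    finally show "(cmod (\<psi> j k x))\<^sup>2 \<le> (K0 * (B k + B (Suc k)))\<^sup>2" by (simp only: power_mult_distrib)
    show "0 \<le> K0 * (B k + B (Suc k))" using K0(1) B[of k] B[of "Suc k"] by simp
  qed
  have Kp: "K0 * (B k + B (Suc k)) > 0" for k
    using K0(1) B[of k] B[of "Suc k"] by (intro mult_pos_pos add_pos_pos)
  obtain r \<Psi> where r: "strict_mono r" and T: "tower 0 L \<Psi>" and lim: "\<And>k x. x \<in> {0..L} \<Longrightarrow> (\<lambda>j. \<psi> (r j) k x) \<longlonglongrightarrow> \<Psi> k x"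
    using tower_compactness[where \<psi>=\<psi>, OF t' L sup Kp] by blast
  have supP: "cmod (\<Psi> k x) \<le> K0 * (B k + B (Suc k))" if x: "x \<in> {0..L}" for k x
    using sup[OF x] by (intro LIMSEQ_le_const2[OF tendsto_norm[OF lim[OF x]]]) auto
  have one: "cmod (\<Psi> 0 0) = 1"
  proof (rule LIMSEQ_unique[OF tendsto_norm[OF lim]])
    have "cmod (\<psi> (r j) 0 0) = 1" for j using d0[of "r j"] by (simp add: \<psi>_def d_def)
    then show "(\<lambda>j. cmod (\<psi> (r j) 0 0)) \<longlonglongrightarrow> 1" by simp
  qed (use L in auto)
  have Pc: "continuous_on {0..L} (\<lambda>x. (cmod (\<Psi> 0 x))\<^sup>2)"
    by (intro continuous_intros tower_continuous[OF T])
  have pc: "continuous_on {0..L} (\<lambda>x. (cmod (\<psi> j 0 x))\<^sup>2)" for j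
    by (intro continuous_intros tower_continuous[OF t'])
  have dc: "continuous_on {0..L} (\<lambda>x. (cmod (\<Psi> 0 x - \<psi> j 0 x))\<^sup>2)" for j
    by (intro continuous_intros tower_continuous[OF t'] tower_continuous[OF T])
  have "infinite {x\<in>{0..L}. \<Psi> 0 x = 0}"
  proof
    assume "finite {x\<in>{0..L}. \<Psi> 0 x = 0}"
    then have fin: "finite {x\<in>{0..L}. (cmod (\<Psi> 0 x))\<^sup>2 = 0}" by simp
    obtain c where c: "c > 0" and low: "\<And>E. E \<in> sets borel \<Longrightarrow> \<gamma> \<le> measure lborel (E \<inter> {0..L}) \<Longrightarrow> c \<le> (LINT x:(E \<inter> {0..L})|lborel. (cmod (\<Psi> 0 x))\<^sup>2)"
      using nonvanishing_lower_bound[OF Pc zero_le_power2 fin \<gamma>] by blast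
    have up: "c \<le> 2 / real (Suc (r j)) + 2 * integral {0..L} (\<lambda>x. (cmod (\<Psi> 0 x - \<psi> (r j) 0 x))\<^sup>2)" for j
    proof -
      let ?X = "E (r j) \<inter> {0..L}"
      have i1: "set_integrable lborel ?X (\<lambda>x. (cmod (\<psi> (r j) 0 x))\<^sup>2)" "set_integrable lborel ?X (\<lambda>x. (cmod (\<Psi> 0 x - \<psi> (r j) 0 x))\<^sup>2)"
        "set_integrable lborel ?X (\<lambda>x. (cmod (\<Psi> 0 x))\<^sup>2)"
        by (intro set_integrable_Int_Icc pc dc Pc E)+
      have i1': "set_integrable lborel ?X (\<lambda>x. 2 * (cmod (\<psi> (r j) 0 x))\<^sup>2)" "set_integrable lborel ?X (\<lambda>x. 2 * (cmod (\<Psi> 0 x - \<psi> (r j) 0 x))\<^sup>2)"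
        using i1 by simp_all
      note i2 = set_integral_add(1)[OF i1']
      have "c \<le> (LINT x:?X|lborel. (cmod (\<Psi> 0 x))\<^sup>2)" by (intro low E)
      also have "\<dots> \<le> (LINT x:?X|lborel. 2 * (cmod (\<psi> (r j) 0 x))\<^sup>2 + 2 * (cmod (\<Psi> 0 x - \<psi> (r j) 0 x))\<^sup>2)"
      proof (rule set_integral_mono)
        show "(cmod (\<Psi> 0 x))\<^sup>2 \<le> 2 * (cmod (\<psi> (r j) 0 x))\<^sup>2 + 2 * (cmod (\<Psi> 0 x - \<psi> (r j) 0 x))\<^sup>2" for x
        proof -
          have "cmod (\<Psi> 0 x) \<le> cmod (\<psi> (r j) 0 x) + cmod (\<Psi> 0 x - \<psi> (r j) 0 x)"
            using norm_triangle_ineq[of "\<psi> (r j) 0 x" "\<Psi> 0 x - \<psi> (r j) 0 x"] by simp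
          then have "(cmod (\<Psi> 0 x))\<^sup>2 \<le> (cmod (\<psi> (r j) 0 x) + cmod (\<Psi> 0 x - \<psi> (r j) 0 x))\<^sup>2" by (intro power_mono) auto
          also have "\<dots> \<le> 2 * (cmod (\<psi> (r j) 0 x))\<^sup>2 + 2 * (cmod (\<Psi> 0 x - \<psi> (r j) 0 x))\<^sup>2"
            using sum_squares_bound[of "cmod (\<psi> (r j) 0 x)" "cmod (\<Psi> 0 x - \<psi> (r j) 0 x)"] by (simp add: power2_sum)
          finally show ?thesis .
        qed
      qed (rule i1(3) i2)+
      also have "\<dots> = 2 * (LINT x:?X|lborel. (cmod (\<psi> (r j) 0 x))\<^sup>2) + 2 * (LINT x:?X|lborel. (cmod (\<Psi> 0 x - \<psi> (r j) 0 x))\<^sup>2)"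
        by (simp add: set_integral_add(2)[OF i1'])
      finally have split: "c \<le> 2 * (LINT x:?X|lborel. (cmod (\<psi> (r j) 0 x))\<^sup>2) + 2 * (LINT x:?X|lborel. (cmod (\<Psi> 0 x - \<psi> (r j) 0 x))\<^sup>2)" .
      have "(LINT x:?X|lborel. (cmod (\<psi> (r j) 0 x))\<^sup>2) = (1 / (d (r j))\<^sup>2) * (LINT x:?X|lborel. (cmod (\<phi> (r j) 0 x))\<^sup>2)"
        unfolding nrm by (rule set_integral_mult_right)
      also have "\<dots> \<le> 1 / real (Suc (r j))"
        using d2(2)[of "r j"] d0[of "r j"] by (simp add: field_simps)
      finally have 1: "(LINT x:?X|lborel. (cmod (\<psi> (r j) 0 x))\<^sup>2) \<le> 1 / real (Suc (r j))" .
      have "(LINT x:?X|lborel. (cmod (\<Psi> 0 x - \<psi> (r j) 0 x))\<^sup>2) \<le> (LINT x:{0..L}|lborel. (cmod (\<Psi> 0 x - \<psi> (r j) 0 x))\<^sup>2)"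
        unfolding set_lebesgue_integral_def
        using i1(2) set_integral_Icc_continuous(1)[OF dc[of "r j"]]
        by (intro integral_mono) (auto simp: set_integrable_def indicator_def)
      also have "\<dots> = integral {0..L} (\<lambda>x. (cmod (\<Psi> 0 x - \<psi> (r j) 0 x))\<^sup>2)"
        by (rule set_integral_Icc_continuous(2)[OF dc])
      finally show ?thesis using split 1 by simp
    qed
    have "(\<lambda>j. integral {0..L} (\<lambda>x. (cmod (\<Psi> 0 x - \<psi> (r j) 0 x))\<^sup>2)) \<longlonglongrightarrow> integral {0..L} (\<lambda>x. 0)"
    proof (rule dominated_convergence(2)[where h="\<lambda>_. (2 * (K0 * (B 0 + B (Suc 0))))\<^sup>2"])
      show "(\<lambda>x. (cmod (\<Psi> 0 x - \<psi> (r j) 0 x))\<^sup>2) integrable_on {0..L}" for j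
        by (intro integrable_continuous_real dc)
      show "norm ((cmod (\<Psi> 0 x - \<psi> (r j) 0 x))\<^sup>2) \<le> (2 * (K0 * (B 0 + B (Suc 0))))\<^sup>2" if "x \<in> {0..L}" for j x
      proof -
        have "cmod (\<Psi> 0 x - \<psi> (r j) 0 x) \<le> 2 * (K0 * (B 0 + B (Suc 0)))"
          using norm_triangle_ineq4[of "\<Psi> 0 x" "\<psi> (r j) 0 x"] supP[OF that, of 0] sup[OF that, of "r j" 0] by simp
        then have "(cmod (\<Psi> 0 x - \<psi> (r j) 0 x))\<^sup>2 \<le> (2 * (K0 * (B 0 + B (Suc 0))))\<^sup>2" by (intro power_mono) auto
        then show ?thesis by (simp only: real_norm_def abs_power2)
      qed
      show "(\<lambda>j. (cmod (\<Psi> 0 x - \<psi> (r j) 0 x))\<^sup>2) \<longlonglongrightarrow> 0" if "x \<in> {0..L}" for x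
        using tendsto_power[OF tendsto_norm[OF tendsto_diff[OF tendsto_const lim[OF that]]], of "\<Psi> 0 x" 0 2] by simp
    qed auto
    moreover have "(\<lambda>j. 2 / real (Suc (r j))) \<longlonglongrightarrow> 0"
    proof -
      have "(\<lambda>j. 2 / real (Suc j)) \<longlonglongrightarrow> 0" by real_asymp
      from LIMSEQ_subseq_LIMSEQ[OF this r] show ?thesis by (simp add: o_def)
    qed
    ultimately have "(\<lambda>j. 2 / real (Suc (r j)) + 2 * integral {0..L} (\<lambda>x. (cmod (\<Psi> 0 x - \<psi> (r j) 0 x))\<^sup>2)) \<longlonglongrightarrow> 0 + 2 * integral {0..L} (\<lambda>x. 0)"
      by (intro tendsto_intros)
    then have "c \<le> 0 + 2 * integral {0..L} (\<lambda>x. 0)"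
      using up by (intro LIMSEQ_le_const) auto
    then show False using c by simp
  qed
  then have "\<exists>x0\<in>{0..L}. x0 islimpt {x\<in>{0..L}. \<Psi> 0 x = 0}"
    by (intro Heine_Borel_imp_Bolzano_Weierstrass) auto
  then obtain x0 where x0: "x0 \<in> {0..L}" "x0 islimpt {x\<in>{0..L}. \<Psi> 0 x = 0}" by blast
  have "\<Psi> 0 0 = 0"
    by (rule flat_uniqueD[OF fu T supP x0(1) tower_flat_at_limpt[OF T x0(2)]]) (use L in auto)
  then show False using one by simp
qed

section \<open>Derivatives of a smoothed function along the axes\<close>

text \<open>
  The inverse Fourier transform as an absolutely convergent integral.
\<close>

definition ift :: "('a::euclidean_space \<Rightarrow> complex) \<Rightarrow> 'a \<Rightarrow> complex" where
  "ift f x = (1 / fourier_const TYPE('a)) *\<^sub>R (LINT \<xi>|lborel. cis (x \<bullet> \<xi>) * f \<xi>)"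

lemma ift_measurable:
  fixes f :: "'a::euclidean_space \<Rightarrow> complex"
  assumes f: "integrable lborel f"
  shows "ift f \<in> borel_measurable borel"
proof -
  have "(\<lambda>x. LINT \<xi>|lborel. cis (x \<bullet> \<xi>) * f \<xi>) \<in> borel_measurable borel"
    using bounded_kernel_measurable[OF f fourier_kernel_measurable(2)] by (simp add: inner_commute)
  then show ?thesis unfolding ift_def[abs_def] by measurable
qed

lemma has_vector_derivative_iff_quotient:
  fixes f :: "real \<Rightarrow> 'b::real_normed_vector"
  shows "(f has_vector_derivative D) (at s) \<longleftrightarrow> ((\<lambda>h. (f (s + h) - f s) /\<^sub>R h) \<longlongrightarrow> D) (at 0)"
proof -
  have "norm (p - u *\<^sub>R q) / norm u = norm (p /\<^sub>R u - q)" if "u \<noteq> 0" for p q :: 'b and u :: real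
  proof -
    have "p /\<^sub>R u - q = (p - u *\<^sub>R q) /\<^sub>R u" using that by (simp add: scaleR_diff_right)
    then show ?thesis by (simp add: divide_inverse_commute)
  qed
  then have "\<forall>\<^sub>F h in at 0. norm (f (s + h) - f s - h *\<^sub>R D) / norm h = norm ((f (s + h) - f s) /\<^sub>R h - D)"
    unfolding eventually_at_filter by (intro always_eventually) blast
  from tendsto_cong[OF this, of 0] show ?thesis
    unfolding has_vector_derivative_def has_derivative_at tendsto_norm_zero_iff
    by (simp add: bounded_linear_scaleR_left LIM_zero_iff)
qed

lemma ift_has_vector_derivative:
  fixes f :: "'a::euclidean_space \<Rightarrow> complex"
  assumes f: "integrable lborel f" and g: "integrable lborel (\<lambda>\<xi>. \<i> * complex_of_real (\<xi> \<bullet> b) * f \<xi>)"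
  shows "((\<lambda>s. ift f (x + s *\<^sub>R b)) has_vector_derivative ift (\<lambda>\<xi>. \<i> * complex_of_real (\<xi> \<bullet> b) * f \<xi>) (x + s *\<^sub>R b)) (at s)"
proof -
  let ?V = "\<lambda>s. LINT \<xi>|lborel. cis ((x + s *\<^sub>R b) \<bullet> \<xi>) * f \<xi>"
  let ?g = "\<lambda>\<xi>. \<i> * complex_of_real (\<xi> \<bullet> b) * f \<xi>"
  let ?D = "LINT \<xi>|lborel. cis ((x + s *\<^sub>R b) \<bullet> \<xi>) * ?g \<xi>"
  have [measurable]: "f \<in> borel_measurable borel" using f by auto
  have int: "integrable lborel (\<lambda>\<xi>. cis (y \<bullet> \<xi>) * f \<xi>)" for y
    using integrable_cis_mult(1)[OF f, of y] by (simp add: inner_commute)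
  have der: "((\<lambda>h. cis (h * \<theta>)) has_vector_derivative \<theta> *\<^sub>R (\<i> * cis (h * \<theta>))) (at h within A)" for \<theta> h A
  proof -
    have "((\<lambda>h. h * \<theta>) has_vector_derivative \<theta>) (at h within A)"
      by (auto intro!: derivative_eq_intros simp: has_real_derivative_iff_has_vector_derivative[symmetric])
    from vector_diff_chain_within[OF this has_vector_derivative_iexp] show ?thesis
      by (simp add: o_def cis_conv_exp)
  qed
  have cis_lip: "cmod (cis (h * \<theta>) - 1) \<le> \<bar>h\<bar> * \<bar>\<theta>\<bar>" for h \<theta> :: real
  proof -
    have "cis (h * \<theta>) - 1 = exp (\<i> * of_real (h * \<theta>)) - (\<Sum>k\<le>0. (\<i> * of_real (h * \<theta>)) ^ k / fact k)"
      by (simp add: cis_conv_exp)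
    also have "cmod \<dots> \<le> \<bar>h * \<theta>\<bar> ^ Suc 0 / fact (Suc 0)"
      by (rule iexp_approx1)
    finally show ?thesis by (simp add: abs_mult)
  qed
  have lim: "((\<lambda>h. (?V (s + h) - ?V s) /\<^sub>R h) \<longlongrightarrow> ?D) (at 0)"
    unfolding tendsto_at_iff_sequentially
  proof (intro allI impI)
    fix h :: "nat \<Rightarrow> real" assume h: "\<forall>i. h i \<in> UNIV - {0}" "h \<longlonglongrightarrow> 0"
    have eq: "(?V (s + h i) - ?V s) /\<^sub>R h i = (LINT \<xi>|lborel. cis ((x + s *\<^sub>R b) \<bullet> \<xi>) * (((cis (h i * (\<xi> \<bullet> b)) - 1) /\<^sub>R h i) * f \<xi>))" for i
    proof -
      have "?V (s + h i) - ?V s = (LINT \<xi>|lborel. cis ((x + (s + h i) *\<^sub>R b) \<bullet> \<xi>) * f \<xi> - cis ((x + s *\<^sub>R b) \<bullet> \<xi>) * f \<xi>)"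
        by (rule Bochner_Integration.integral_diff[symmetric, OF int int])
      also have "\<dots> = (LINT \<xi>|lborel. cis ((x + s *\<^sub>R b) \<bullet> \<xi>) * ((cis (h i * (\<xi> \<bullet> b)) - 1) * f \<xi>))"
      proof (intro Bochner_Integration.integral_cong refl)
        fix \<xi>
        have "cis ((x + (s + h i) *\<^sub>R b) \<bullet> \<xi>) = cis ((x + s *\<^sub>R b) \<bullet> \<xi>) * cis (h i * (\<xi> \<bullet> b))"
          by (simp add: cis_mult inner_add_left algebra_simps inner_commute)
        then show "cis ((x + (s + h i) *\<^sub>R b) \<bullet> \<xi>) * f \<xi> - cis ((x + s *\<^sub>R b) \<bullet> \<xi>) * f \<xi> = cis ((x + s *\<^sub>R b) \<bullet> \<xi>) * ((cis (h i * (\<xi> \<bullet> b)) - 1) * f \<xi>)"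
          by (simp add: algebra_simps)
      qed
      finally show ?thesis by (simp add: scaleR_conv_of_real mult_ac flip: integral_mult_right_zero)
    qed
    have "(\<lambda>i. LINT \<xi>|lborel. cis ((x + s *\<^sub>R b) \<bullet> \<xi>) * (((cis (h i * (\<xi> \<bullet> b)) - 1) /\<^sub>R h i) * f \<xi>)) \<longlonglongrightarrow> ?D"
    proof (rule integral_dominated_convergence[where w="\<lambda>\<xi>. cmod (?g \<xi>)"])
      show "integrable lborel (\<lambda>\<xi>. cmod (?g \<xi>))" using g by (rule integrable_norm)
      show "AE \<xi> in lborel. cmod (cis ((x + s *\<^sub>R b) \<bullet> \<xi>) * (((cis (h i * (\<xi> \<bullet> b)) - 1) /\<^sub>R h i) * f \<xi>)) \<le> cmod (?g \<xi>)" for i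
      proof (intro AE_I2)
        fix \<xi>
        have "cmod ((cis (h i * (\<xi> \<bullet> b)) - 1) /\<^sub>R h i) \<le> \<bar>\<xi> \<bullet> b\<bar>"
        proof -
          have "cmod ((cis (h i * (\<xi> \<bullet> b)) - 1) /\<^sub>R h i) = cmod (cis (h i * (\<xi> \<bullet> b)) - 1) / \<bar>h i\<bar>"
            by (simp add: divide_inverse_commute)
          then show ?thesis using cis_lip[of "h i" "\<xi> \<bullet> b"] h(1) by (simp add: divide_le_eq mult.commute)
        qed
        then show "cmod (cis ((x + s *\<^sub>R b) \<bullet> \<xi>) * (((cis (h i * (\<xi> \<bullet> b)) - 1) /\<^sub>R h i) * f \<xi>)) \<le> cmod (?g \<xi>)"
          by (simp only: norm_mult norm_cis norm_ii norm_of_real mult_1_left) (intro mult_right_mono, auto)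
      qed
      show "AE \<xi> in lborel. (\<lambda>i. cis ((x + s *\<^sub>R b) \<bullet> \<xi>) * (((cis (h i * (\<xi> \<bullet> b)) - 1) /\<^sub>R h i) * f \<xi>)) \<longlonglongrightarrow> cis ((x + s *\<^sub>R b) \<bullet> \<xi>) * ?g \<xi>"
      proof (intro AE_I2 tendsto_intros)
        fix \<xi>
        have "((\<lambda>u. (cis ((0 + u) * (\<xi> \<bullet> b)) - cis (0 * (\<xi> \<bullet> b))) /\<^sub>R u) \<longlongrightarrow> (\<xi> \<bullet> b) *\<^sub>R (\<i> * cis (0 * (\<xi> \<bullet> b)))) (at 0)"
          using der[of "\<xi> \<bullet> b" 0 UNIV] unfolding has_vector_derivative_iff_quotient .
        then have "(\<lambda>i. (cis (h i * (\<xi> \<bullet> b)) - 1) /\<^sub>R h i) \<longlonglongrightarrow> (\<xi> \<bullet> b) *\<^sub>R \<i>"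
          using h unfolding tendsto_at_iff_sequentially by (auto simp: o_def)
        then show "(\<lambda>i. (cis (h i * (\<xi> \<bullet> b)) - 1) /\<^sub>R h i) \<longlonglongrightarrow> \<i> * complex_of_real (\<xi> \<bullet> b)"
          by (simp add: scaleR_conv_of_real mult.commute)
      qed
    qed measurable
    then show "((\<lambda>h. (?V (s + h) - ?V s) /\<^sub>R h) \<circ> h) \<longlonglongrightarrow> ?D" by (simp add: o_def eq)
  qed
  have "(?V has_vector_derivative ?D) (at s)"
    unfolding has_vector_derivative_iff_quotient by (rule lim)
  from bounded_linear.has_vector_derivative[OF bounded_linear_scaleR_right this]
  show ?thesis unfolding ift_def .
qed

text \<open>
  The function \<open>w\<close> has derivatives of all orders along \<open>b\<close>, and that of order \<open>k\<close> has norm at most \<open>M k * N\<close>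
  in \<open>L\<^sup>2\<close>. The functions are defined everywhere, so that they may be restricted to lines.
\<close>

definition tower_bounded :: "(nat \<Rightarrow> real) \<Rightarrow> real \<Rightarrow> 'a::euclidean_space \<Rightarrow> ('a \<Rightarrow> complex) \<Rightarrow> bool" where
  "tower_bounded M N b w \<longleftrightarrow> (\<exists>W. W 0 = w \<and> (\<forall>k. W k \<in> borel_measurable borel) \<and>
       (\<forall>k x s. ((\<lambda>s. W k (x + s *\<^sub>R b)) has_vector_derivative W (Suc k) (x + s *\<^sub>R b)) (at s)) \<and>
       (\<forall>k. (\<integral>\<^sup>+x. ennreal ((cmod (W k x))\<^sup>2) \<partial>lborel) \<le> ennreal ((M k * N)\<^sup>2)))"

locale rapid_symbol = symbol F c0 + moment_symbol F c0 for F c0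
begin

text \<open>
  The function is bounded by a constant times the product of the factors \<open>1 / (1 + (\<xi> \<bullet> b)\<^sup>2)\<close>, with a
  constant given by the moments of orders \<open>2k\<close> and \<open>2k + 2n\<close> at time \<open>2t\<close>, \<open>n\<close> the dimension.
\<close>

lemma weight_integrable:
  assumes t: "t > 0"
  shows "integrable lborel (\<lambda>\<xi>::'a::euclidean_space. (norm \<xi> ^ k * exp (- t * F (norm \<xi>)))\<^sup>2)"
proof -
  let ?n = "DIM('a)"
  define C where "C = 2 ^ ?n * (moment F (2 * t) (2 * k) + moment F (2 * t) (2 * k + 2 * ?n))"
  have "set_integrable lborel (einterval (-\<infinity>) \<infinity>) (\<lambda>x. inverse (1 + x\<^sup>2))"
    by (rule integrable_inverse_1_plus_square)
  then have i1: "integrable lborel (\<lambda>x::real. inverse (1 + x\<^sup>2))"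
    by (simp add: set_integrable_def einterval_def)
  have i2: "integrable lborel (\<lambda>x. complex_of_real (inverse (1 + x\<^sup>2)))"
    using i1 by (rule integrable_bounded_linear[OF bounded_linear_of_real])
  have "integrable lborel (\<lambda>\<xi>::'a. \<Prod>b\<in>Basis. complex_of_real (inverse (1 + (\<xi> \<bullet> b)\<^sup>2)))"
    using integral_prod_Basis(1)[of "\<lambda>_ x. complex_of_real (inverse (1 + x\<^sup>2))"] i2 by simp
  from integrable_Re[OF this] have "integrable lborel (\<lambda>\<xi>::'a. \<Prod>b\<in>Basis. inverse (1 + (\<xi> \<bullet> b)\<^sup>2))"
    by (simp only: of_real_prod[symmetric] Re_complex_of_real)
  then have i3: "integrable lborel (\<lambda>\<xi>::'a. C * (\<Prod>b\<in>Basis. inverse (1 + (\<xi> \<bullet> b)\<^sup>2)))"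
    by simp
  show ?thesis
  proof (rule Bochner_Integration.integrable_bound[OF i3])
    show "AE \<xi>::'a in lborel. norm ((norm \<xi> ^ k * exp (- t * F (norm \<xi>)))\<^sup>2) \<le> norm (C * (\<Prod>b\<in>Basis. inverse (1 + (\<xi> \<bullet> b)\<^sup>2)))"
    proof (intro AE_I2)
      fix \<xi> :: 'a
      let ?r = "norm \<xi>"
      let ?p = "(?r ^ k * exp (- t * F ?r))\<^sup>2"
      have p: "?p = ?r ^ (2 * k) * exp (- (2 * t) * F ?r)"
        by (simp add: power_mult_distrib power_mult[symmetric] mult.commute exp_of_nat_mult[symmetric])
      have prod: "(\<Prod>b\<in>(Basis::'a set). 1 + (\<xi> \<bullet> b)\<^sup>2) \<le> (1 + ?r\<^sup>2) ^ ?n"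
      proof -
        have "(\<xi> \<bullet> b)\<^sup>2 \<le> ?r\<^sup>2" if "b \<in> Basis" for b :: 'a
          using Basis_le_norm[OF that, of \<xi>] by (simp add: abs_le_square_iff[symmetric])
        then have "(\<Prod>b\<in>(Basis::'a set). 1 + (\<xi> \<bullet> b)\<^sup>2) \<le> (\<Prod>b\<in>(Basis::'a set). 1 + ?r\<^sup>2)"
          by (intro prod_mono) auto
        then show ?thesis by simp
      qed
      have pos: "(\<Prod>b\<in>(Basis::'a set). 1 + (\<xi> \<bullet> b)\<^sup>2) > 0"
        by (intro prod_pos) (auto intro: add_pos_nonneg)
      have pw: "(1 + ?r\<^sup>2) ^ ?n \<le> 2 ^ ?n * (1 + ?r ^ (2 * ?n))"
      proof -
        have "(1 + ?r\<^sup>2) ^ ?n \<le> (2 * max 1 (?r\<^sup>2)) ^ ?n" by (intro power_mono) auto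
        also have "\<dots> = 2 ^ ?n * max 1 (?r\<^sup>2) ^ ?n" by (rule power_mult_distrib)
        also have "max 1 (?r\<^sup>2) ^ ?n \<le> 1 + ?r ^ (2 * ?n)"
          by (auto simp: max_def power_mult)
        finally show ?thesis by simp
      qed
      have "?p * (\<Prod>b\<in>(Basis::'a set). 1 + (\<xi> \<bullet> b)\<^sup>2) \<le> ?p * (2 ^ ?n * (1 + ?r ^ (2 * ?n)))"
        by (intro mult_left_mono order_trans[OF prod pw]) auto
      also have "\<dots> = 2 ^ ?n * (?r ^ (2 * k) * exp (- (2 * t) * F ?r) + ?r ^ (2 * k + 2 * ?n) * exp (- (2 * t) * F ?r))"
        unfolding p by (simp add: algebra_simps power_add)
      also have "\<dots> \<le> C"
        unfolding C_def using t by (intro mult_left_mono add_mono moment_upper bdd_moment) auto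
      finally have "?p \<le> C * inverse (\<Prod>b\<in>(Basis::'a set). 1 + (\<xi> \<bullet> b)\<^sup>2)"
        using pos by (simp add: field_simps)
      also have "\<dots> = C * (\<Prod>b\<in>(Basis::'a set). inverse (1 + (\<xi> \<bullet> b)\<^sup>2))"
        using prod_inversef[of "\<lambda>b. 1 + (\<xi> \<bullet> b)\<^sup>2" "Basis::'a set"] by (simp add: o_def)
      finally show "norm ?p \<le> norm (C * (\<Prod>b\<in>Basis. inverse (1 + (\<xi> \<bullet> b)\<^sup>2)))" by simp
    qed
  qed measurable
qed

text \<open>
  On the Fourier side a derivative along \<open>b\<close> is multiplication by \<open>\<i> (\<xi> \<bullet> b)\<close>. The product of
  \<open>(\<i> (\<xi> \<bullet> b))\<^sup>k exp (- t F(|\<xi>|))\<close> with the transform of \<open>z\<close> is square-integrable with the stated bound. It is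
  absolutely integrable, as a product of two square-integrable functions, so its inverse transform is given
  pointwise by an integral which may be differentiated.
\<close>

lemma S_pointwise_tower:
  fixes z :: "'a::euclidean_space L2"
  assumes t: "t > 0"
  obtains w :: "'a \<Rightarrow> complex" where "w \<in> borel_measurable borel" "square_integrable lebesgue w" "to_L2 w = S t z"
    "\<And>b. b \<in> Basis \<Longrightarrow> tower_bounded (moment F t) (norm z) b w"
proof -
  obtain u where u [measurable]: "u \<in> borel_measurable borel" and sq: "square_integrable lebesgue u" and uz: "to_L2 u = fourier_L2 z"
    by (rule L2_borel_rep)
  have ui: "integrable lborel (\<lambda>x. (cmod (u x))\<^sup>2)" using sq by (simp add: square_integrable_borel)
  define g where "g b k \<xi> = (\<i> * complex_of_real (\<xi> \<bullet> b)) ^ k * (exp (- t * F (norm \<xi>)) *\<^sub>R u \<xi>)" for b k and \<xi> :: 'a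
  have gm [measurable]: "g b k \<in> borel_measurable borel" for b k unfolding g_def by measurable
  have gb: "cmod (g b k \<xi>) \<le> norm \<xi> ^ k * exp (- t * F (norm \<xi>)) * cmod (u \<xi>)" if "b \<in> Basis" for b k \<xi>
  proof -
    have "\<bar>\<xi> \<bullet> b\<bar> ^ k \<le> norm \<xi> ^ k" using Basis_le_norm[OF that, of \<xi>] by (intro power_mono) auto
    then show ?thesis by (simp add: g_def norm_mult norm_power mult_right_mono)
  qed
  have gM: "cmod (g b k \<xi>) \<le> moment F t k * cmod (u \<xi>)" if "b \<in> Basis" for b k \<xi>
    by (intro order_trans[OF gb[OF that]] mult_right_mono moment_upper bdd_moment t norm_ge_zero)
  have gi: "integrable lborel (g b k)" if "b \<in> Basis" for b k
  proof (rule Bochner_Integration.integrable_bound[OF Bochner_Integration.integrable_add[OF weight_integrable[OF t, of k] ui]])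
    have "p * q \<le> p\<^sup>2 + q\<^sup>2" if "p \<ge> 0" "q \<ge> 0" for p q :: real
    proof -
      have "0 \<le> p * q" using that by simp
      then show ?thesis using sum_squares_bound[of p q] by linarith
    qed
    then have "cmod (g b k \<xi>) \<le> (norm \<xi> ^ k * exp (- t * F (norm \<xi>)))\<^sup>2 + (cmod (u \<xi>))\<^sup>2" for \<xi>
      by (intro order_trans[OF gb[OF that]]) auto
    then show "AE \<xi> in lborel. norm (g b k \<xi>) \<le> norm ((norm \<xi> ^ k * exp (- t * F (norm \<xi>)))\<^sup>2 + (cmod (u \<xi>))\<^sup>2)"
      by (intro AE_I2) (simp add: order_trans[OF _ abs_ge_self])
  qed measurable
  have gs: "square_integrable lebesgue (g b k)" if "b \<in> Basis" for b k
    unfolding square_integrable_borel[OF gm]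
  proof (rule Bochner_Integration.integrable_bound)
    show "integrable lborel (\<lambda>x. (moment F t k)\<^sup>2 * (cmod (u x))\<^sup>2)" using ui by simp
    show "AE x in lborel. norm ((cmod (g b k x))\<^sup>2) \<le> norm ((moment F t k)\<^sup>2 * (cmod (u x))\<^sup>2)"
      using power_mono[OF gM[OF that, of k], where n=2] by (intro AE_I2) (simp add: power_mult_distrib)
  qed measurable
  have gn: "norm (to_L2 (g b k)) \<le> moment F t k * norm (fourier_L2 z)" if "b \<in> Basis" for b k
  proof (rule power2_le_imp_le)
    have "(norm (to_L2 (g b k)))\<^sup>2 = (LINT x|lborel. (cmod (g b k x))\<^sup>2)"
      by (rule norm_to_L2_borel(1)[OF gm gs[OF that]])
    also have "\<dots> \<le> (LINT x|lborel. (moment F t k)\<^sup>2 * (cmod (u x))\<^sup>2)"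
    proof (rule integral_mono)
      show "integrable lborel (\<lambda>x. (cmod (g b k x))\<^sup>2)" using gs[OF that] by (simp add: square_integrable_borel)
      show "(cmod (g b k x))\<^sup>2 \<le> (moment F t k)\<^sup>2 * (cmod (u x))\<^sup>2" for x
        using power_mono[OF gM[OF that, of k x], where n=2] by (simp add: power_mult_distrib)
    qed (use ui in simp)
    also have "\<dots> = (moment F t k * norm (fourier_L2 z))\<^sup>2"
      using norm_to_L2_borel(1)[OF u sq] uz by (simp add: power_mult_distrib)
    finally show "(norm (to_L2 (g b k)))\<^sup>2 \<le> (moment F t k * norm (fourier_L2 z))\<^sup>2" .
    show "0 \<le> moment F t k * norm (fourier_L2 z)" using moment_pos[OF t, of k] by simp
  qed
  have inv: "inv fourier_L2 (to_L2 (g b k)) = to_L2 (ift (g b k))" "square_integrable lebesgue (ift (g b k))" if "b \<in> Basis" for b k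
    using inv_fourier_L2_to_L2[OF gi[OF that] gs[OF that]] by (simp_all add: ift_def[abs_def])
  obtain b0 :: 'a where b0: "b0 \<in> Basis" using nonempty_Basis by blast
  have g0: "g b 0 = (\<lambda>\<xi>. exp (- t * F (norm \<xi>)) *\<^sub>R u \<xi>)" for b by (simp add: g_def fun_eq_iff)
  define w where "w = ift (\<lambda>\<xi>. exp (- t * F (norm \<xi>)) *\<^sub>R u \<xi>)"
  have w0: "w = ift (g b 0)" for b by (simp add: w_def g0)
  show ?thesis
  proof (rule that)
    show "w \<in> borel_measurable borel" unfolding w0[of b0] by (rule ift_measurable[OF gi[OF b0]])
    show "square_integrable lebesgue w" unfolding w0[of b0] by (rule inv[OF b0])
    have "to_L2 (g b0 0) = mul_L2 (\<lambda>\<xi>. exp (- t * F (norm \<xi>))) (fourier_L2 z)"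
      unfolding g0 uz[symmetric] by (rule mul_L2_to_L2[symmetric, OF exp_symbol_measurable exp_symbol_le[of t t] sq]) (use t in auto)
    then show "to_L2 w = S t z"
      using inv(1)[OF b0, of 0] by (simp add: w0[of b0] diffusion_semigroup_def fourier_multiplier_eq)
    fix b :: 'a assume b: "b \<in> Basis"
    show "tower_bounded (moment F t) (norm z) b w"
      unfolding tower_bounded_def
    proof (intro exI[of _ "\<lambda>k. ift (g b k)"] conjI allI)
      show "ift (g b 0) = w" by (rule w0[symmetric])
      show m: "ift (g b k) \<in> borel_measurable borel" for k by (rule ift_measurable[OF gi[OF b]])
      have gS: "(\<lambda>\<xi>. \<i> * complex_of_real (\<xi> \<bullet> b) * g b k \<xi>) = g b (Suc k)" for k
        by (simp add: g_def fun_eq_iff mult_ac)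
      show "((\<lambda>s. ift (g b k) (x + s *\<^sub>R b)) has_vector_derivative ift (g b (Suc k)) (x + s *\<^sub>R b)) (at s)" for k x s
        using ift_has_vector_derivative[OF gi[OF b], of b k x s] gi[OF b, of "Suc k"] by (simp only: gS)
      show "(\<integral>\<^sup>+x. ennreal ((cmod (ift (g b k) x))\<^sup>2) \<partial>lborel) \<le> ennreal ((moment F t k * norm z)\<^sup>2)" for k
      proof -
        have "norm (to_L2 (ift (g b k))) \<le> moment F t k * norm z"
          using gn[OF b, of k] unfolding inv(1)[OF b, symmetric] norm_inv_fourier_L2 norm_fourier_L2_const
          by (simp add: divide_le_eq mult_ac)
        then show ?thesis
          unfolding norm_to_L2_borel(2)[OF m inv(2)[OF b]] by (intro ennreal_leI power_mono) auto
      qed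
    qed
  qed
qed

end

section \<open>Integrals over segments\<close>

definition seg_integral :: "real \<Rightarrow> 'a::euclidean_space \<Rightarrow> ('a \<Rightarrow> ennreal) \<Rightarrow> 'a \<Rightarrow> ennreal" where
  "seg_integral L b f x = (\<integral>\<^sup>+s. indicator {0..L} s * f (x + s *\<^sub>R b) \<partial>lborel)"

text \<open>
  The starting points \<open>x\<close> whose segment of length \<open>L\<close> in direction \<open>b\<close> meets \<open>E\<close> in length at least \<open>\<gamma>\<close>.
\<close>

definition enlarge :: "real \<Rightarrow> real \<Rightarrow> 'a::euclidean_space \<Rightarrow> 'a set \<Rightarrow> 'a set" where
  "enlarge L \<gamma> b E = {x. ennreal \<gamma> \<le> seg_integral L b (indicator E) x}"

lemma seg_integral_measurable [measurable]:
  assumes [measurable]: "f \<in> borel_measurable borel"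
  shows "seg_integral L b f \<in> borel_measurable borel"
  unfolding seg_integral_def by measurable

lemma enlarge_borel [measurable]: "E \<in> sets borel \<Longrightarrow> enlarge L \<gamma> b E \<in> sets borel"
proof -
  assume [measurable]: "E \<in> sets borel"
  have "{x \<in> space borel. ennreal \<gamma> \<le> seg_integral L b (indicator E) x} \<in> sets borel" by measurable
  then show ?thesis by (simp add: enlarge_def)
qed

lemma nn_integral_seg_integral:
  fixes f :: "'a::euclidean_space \<Rightarrow> ennreal"
  assumes [measurable]: "f \<in> borel_measurable borel"
  shows "(\<integral>\<^sup>+x. seg_integral L b f x \<partial>lborel) = ennreal L * (\<integral>\<^sup>+x. f x \<partial>lborel)"
proof -
  have "(\<integral>\<^sup>+x. seg_integral L b f x \<partial>lborel) = (\<integral>\<^sup>+s. \<integral>\<^sup>+x. indicator {0..L} s * f (x + s *\<^sub>R b) \<partial>lborel \<partial>lborel)"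
    unfolding seg_integral_def by (rule lborel_pair.Fubini'[symmetric]) measurable
  also have "\<dots> = (\<integral>\<^sup>+s. indicator {0..L} s * (\<integral>\<^sup>+x. f x \<partial>lborel) \<partial>lborel)"
    using nn_integral_lborel_translate[of f "_ *\<^sub>R b"]
    by (intro nn_integral_cong) (simp add: nn_integral_cmult add.commute)
  also have "\<dots> = ennreal L * (\<integral>\<^sup>+x. f x \<partial>lborel)"
    by (simp add: nn_integral_multc emeasure_lborel_Icc_eq ennreal_neg)
  finally show ?thesis .
qed

lemma seg_integral_mono: "(\<And>x. f x \<le> g x) \<Longrightarrow> seg_integral L b f x \<le> seg_integral L b g x"
  unfolding seg_integral_def by (intro nn_integral_mono mult_left_mono) auto

lemma seg_integral_affine:
  assumes [measurable]: "f \<in> borel_measurable borel"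
  shows "seg_integral L b (\<lambda>x. c + d * f x) x = c * ennreal L + d * seg_integral L b f x"
proof -
  have "seg_integral L b (\<lambda>x. c + d * f x) x = (\<integral>\<^sup>+s. c * indicator {0..L} s + d * (indicator {0..L} s * f (x + s *\<^sub>R b)) \<partial>lborel)"
    unfolding seg_integral_def by (simp add: algebra_simps)
  also have "\<dots> = (\<integral>\<^sup>+s. c * indicator {0..L} s \<partial>lborel) + (\<integral>\<^sup>+s. d * (indicator {0..L} s * f (x + s *\<^sub>R b)) \<partial>lborel)"
    by (rule nn_integral_add) auto
  also have "\<dots> = c * ennreal L + d * seg_integral L b f x"
    by (simp add: nn_integral_cmult seg_integral_def nn_integral_cmult_indicator emeasure_lborel_Icc_eq ennreal_neg)
  finally show ?thesis .
qed

definition seg_integrals :: "real \<Rightarrow> 'a::euclidean_space list \<Rightarrow> ('a \<Rightarrow> ennreal) \<Rightarrow> 'a \<Rightarrow> ennreal" where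
  "seg_integrals L bs f = foldl (\<lambda>f b. seg_integral L b f) f bs"

definition enlarges :: "real \<Rightarrow> real \<Rightarrow> 'a::euclidean_space list \<Rightarrow> 'a set \<Rightarrow> 'a set" where
  "enlarges L \<gamma> bs E = foldl (\<lambda>E b. enlarge L \<gamma> b E) E bs"

lemma seg_integrals_simps [simp]: "seg_integrals L [] f = f" "seg_integrals L (bs @ [b]) f = seg_integral L b (seg_integrals L bs f)"
  by (simp_all add: seg_integrals_def)

lemma enlarges_simps [simp]: "enlarges L \<gamma> [] E = E" "enlarges L \<gamma> (bs @ [b]) E = enlarge L \<gamma> b (enlarges L \<gamma> bs E)"
  by (simp_all add: enlarges_def)

lemma enlarges_borel [measurable]: "E \<in> sets borel \<Longrightarrow> enlarges L \<gamma> bs E \<in> sets borel"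
  by (induction bs rule: rev_induct) auto

lemma seg_integrals_measurable [measurable]: "f \<in> borel_measurable borel \<Longrightarrow> seg_integrals L bs f \<in> borel_measurable borel"
  by (induction bs rule: rev_induct) auto

lemma seg_integral_indicator_le:
  assumes "L > 0"
  shows "seg_integral L b (indicator E) x \<le> ennreal \<gamma> + ennreal L * indicator (enlarge L \<gamma> b E) x"
proof (cases "x \<in> enlarge L \<gamma> b E")
  case True
  have "seg_integral L b (indicator E) x \<le> (\<integral>\<^sup>+s. indicator {0..L} s \<partial>lborel)"
    unfolding seg_integral_def by (intro nn_integral_mono) (auto simp: indicator_def)
  also have "\<dots> = ennreal L" using assms by simp
  finally show ?thesis using True by (simp add: add_increasing)
next
  case False
  then show ?thesis by (auto simp: enlarge_def)
qed

text \<open>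
  By induction: away from the enlarged set every integration costs at most \<open>\<gamma>\<close>, weighted by
  the lengths of the other segments.
\<close>

lemma seg_integrals_indicator_le:
  fixes L \<gamma> :: real
  assumes L: "L > 0" and \<gamma>: "\<gamma> \<ge> 0" and E: "E \<in> sets borel"
  shows "seg_integrals L bs (indicator E) x \<le> ennreal (length bs * \<gamma> * L ^ (length bs - 1)) + ennreal (L ^ length bs) * indicator (enlarges L \<gamma> bs E) x"
proof (induction bs arbitrary: x rule: rev_induct)
  case (snoc b bs)
  let ?m = "length bs"
  have "seg_integrals L (bs @ [b]) (indicator E) x \<le> seg_integral L b (\<lambda>x. ennreal (?m * \<gamma> * L ^ (?m - 1)) + ennreal (L ^ ?m) * indicator (enlarges L \<gamma> bs E) x) x"
    using snoc.IH by (simp add: seg_integral_mono)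
  also have "\<dots> = ennreal (?m * \<gamma> * L ^ (?m - 1)) * ennreal L + ennreal (L ^ ?m) * seg_integral L b (indicator (enlarges L \<gamma> bs E)) x"
    using E by (intro seg_integral_affine borel_measurable_indicator enlarges_borel)
  also have "\<dots> \<le> ennreal (?m * \<gamma> * L ^ (?m - 1)) * ennreal L + ennreal (L ^ ?m) * (ennreal \<gamma> + ennreal L * indicator (enlarge L \<gamma> b (enlarges L \<gamma> bs E)) x)"
    by (intro add_mono mult_left_mono seg_integral_indicator_le L) auto
  also have "\<dots> = (ennreal (?m * \<gamma> * L ^ (?m - 1)) * ennreal L + ennreal (L ^ ?m) * ennreal \<gamma>) + ennreal (L ^ ?m) * ennreal L * indicator (enlarge L \<gamma> b (enlarges L \<gamma> bs E)) x"
    by (simp add: distrib_left add.assoc mult.assoc)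
  also have "ennreal (?m * \<gamma> * L ^ (?m - 1)) * ennreal L + ennreal (L ^ ?m) * ennreal \<gamma> = ennreal (Suc ?m * \<gamma> * L ^ ?m)"
  proof -
    have "?m * \<gamma> * L ^ (?m - 1) * L + L ^ ?m * \<gamma> = Suc ?m * \<gamma> * L ^ ?m"
      by (cases ?m) (auto simp: algebra_simps)
    then show ?thesis using L \<gamma> by (simp add: ennreal_mult[symmetric] del: of_nat_Suc flip: ennreal_plus)
  qed
  also have "ennreal (L ^ ?m) * ennreal L = ennreal (L ^ Suc ?m)"
    using L by (simp add: ennreal_mult[symmetric] mult.commute)
  finally show ?case by simp
qed (simp add: indicator_def)

lemma seg_integrals_eq_product:
  fixes bs :: "'a::euclidean_space list"
  assumes f [measurable]: "f \<in> borel_measurable borel" and "distinct bs" "set bs \<subseteq> Basis"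
  shows "seg_integrals L bs f x = (\<integral>\<^sup>+u. (\<Prod>b\<in>set bs. indicator {0..L} (u b)) * f (x + (\<Sum>b\<in>set bs. u b *\<^sub>R b)) \<partial>(Pi\<^sub>M (set bs) (\<lambda>_. lborel)))"
  using assms(2,3)
proof (induction bs arbitrary: x rule: rev_induct)
  case Nil
  interpret product_sigma_finite "\<lambda>_::'a. lborel :: real measure" ..
  show ?case by (simp add: PiM_empty nn_integral_count_space_finite)
next
  case (snoc b bs)
  interpret product_sigma_finite "\<lambda>_::'a. lborel :: real measure" ..
  have b: "b \<notin> set bs" "distinct bs" "set bs \<subseteq> Basis" using snoc.prems by auto
  have "(\<integral>\<^sup>+u. (\<Prod>b\<in>insert b (set bs). indicator {0..L} (u b)) * f (x + (\<Sum>b\<in>insert b (set bs). u b *\<^sub>R b)) \<partial>(Pi\<^sub>M (insert b (set bs)) (\<lambda>_. lborel)))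
    = (\<integral>\<^sup>+s. \<integral>\<^sup>+u. (\<Prod>c\<in>insert b (set bs). indicator {0..L} ((u(b := s)) c)) * f (x + (\<Sum>c\<in>insert b (set bs). (u(b := s)) c *\<^sub>R c)) \<partial>(Pi\<^sub>M (set bs) (\<lambda>_. lborel)) \<partial>lborel)"
    using b by (intro product_nn_integral_insert_rev) measurable
  also have "\<dots> = (\<integral>\<^sup>+s. indicator {0..L} s * seg_integrals L bs f (x + s *\<^sub>R b) \<partial>lborel)"
  proof (intro nn_integral_cong)
    fix s :: real
    have 1: "(\<Prod>c\<in>set bs. indicator {0..L} (if c = b then s else u c)) = (\<Prod>c\<in>set bs. indicator {0..L} (u c) :: ennreal)" for u :: "'a \<Rightarrow> real"
      using b(1) by (intro prod.cong) auto
    have 2: "(\<Sum>c\<in>set bs. (if c = b then s else u c) *\<^sub>R c) = (\<Sum>c\<in>set bs. u c *\<^sub>R c)" for u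
      using b(1) by (intro sum.cong) auto
    have "(\<integral>\<^sup>+u. (\<Prod>c\<in>insert b (set bs). indicator {0..L} ((u(b := s)) c)) * f (x + (\<Sum>c\<in>insert b (set bs). (u(b := s)) c *\<^sub>R c)) \<partial>(Pi\<^sub>M (set bs) (\<lambda>_. lborel)))
      = (\<integral>\<^sup>+u. indicator {0..L} s * ((\<Prod>c\<in>set bs. indicator {0..L} (u c)) * f (x + s *\<^sub>R b + (\<Sum>c\<in>set bs. u c *\<^sub>R c))) \<partial>(Pi\<^sub>M (set bs) (\<lambda>_. lborel)))"
      using b(1) by (simp add: 1 2 add.assoc mult.assoc)
    also have "\<dots> = indicator {0..L} s * seg_integrals L bs f (x + s *\<^sub>R b)"
      unfolding snoc.IH[OF b(2,3)] by (rule nn_integral_cmult) measurable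
    finally show "(\<integral>\<^sup>+u. (\<Prod>c\<in>insert b (set bs). indicator {0..L} ((u(b := s)) c)) * f (x + (\<Sum>c\<in>insert b (set bs). (u(b := s)) c *\<^sub>R c)) \<partial>(Pi\<^sub>M (set bs) (\<lambda>_. lborel)))
      = indicator {0..L} s * seg_integrals L bs f (x + s *\<^sub>R b)" .
  qed
  finally show ?case by (simp add: seg_integral_def)
qed

text \<open>
  By Fubini's theorem, integration along all the coordinate directions in turn is integration over a cube.
\<close>

lemma seg_integrals_Basis:
  fixes f :: "'a::euclidean_space \<Rightarrow> ennreal"
  assumes f [measurable]: "f \<in> borel_measurable borel" and bs: "distinct bs" "set bs = Basis"
  shows "seg_integrals L bs f x = (\<integral>\<^sup>+y. indicator {y. \<forall>b\<in>Basis. y \<bullet> b \<in> {0..L}} y * f (x + y) \<partial>lborel)"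
proof -
  let ?Q = "{y::'a. \<forall>b\<in>Basis. y \<bullet> b \<in> {0..L}}"
  have "?Q = cbox 0 (\<Sum>b\<in>Basis. L *\<^sub>R b)" by (auto simp: mem_box inner_sum_left inner_Basis if_distrib cong: if_cong)
  then have [measurable]: "?Q \<in> sets borel" by simp
  have ind: "indicator ?Q (\<Sum>b\<in>Basis. u b *\<^sub>R b) = (\<Prod>b\<in>Basis. indicator {0..L} (u b) :: ennreal)" for u :: "'a \<Rightarrow> real"
  proof -
    have "(\<Sum>c\<in>Basis. u c *\<^sub>R c) \<bullet> b = u b" if "b \<in> Basis" for b :: 'a
      using that by (simp add: inner_sum_left inner_Basis if_distrib cong: if_cong)
    then have "(\<Sum>c\<in>Basis. u c *\<^sub>R c) \<in> ?Q \<longleftrightarrow> (\<forall>b\<in>Basis. u b \<in> {0..L})" by auto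
    then show ?thesis by (auto simp: indicator_def)
  qed
  have "(\<integral>\<^sup>+y. indicator ?Q y * f (x + y) \<partial>lborel) = (\<integral>\<^sup>+u. indicator ?Q (\<Sum>b\<in>Basis. u b *\<^sub>R b) * f (x + (\<Sum>b\<in>Basis. u b *\<^sub>R b)) \<partial>(Pi\<^sub>M Basis (\<lambda>_. lborel)))"
    unfolding lborel_eq[where 'a='a] by (subst nn_integral_distr) measurable
  then show ?thesis
    unfolding seg_integrals_eq_product[OF f bs(1) eq_refl[OF bs(2)]] bs(2) by (simp only: ind)
qed

text \<open>
  Thickness says that the integral of the indicator of \<open>E\<close> over every cube of side \<open>L\<close> is at least \<open>\<gamma> L\<^sup>n\<close>. With threshold
  \<open>\<gamma> L / (2n)\<close>, a point outside the iterated enlargement would have an integral of at most half of that by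
  \<open>seg_integrals_indicator_le\<close>.
\<close>

lemma enlarges_thick_eq_UNIV:
  fixes E :: "'a::euclidean_space set"
  assumes L: "L > 0" and \<gamma>: "\<gamma> > 0" and E: "E \<in> sets borel" and bs: "distinct bs" "set bs = Basis"
    and thick: "\<And>x. ennreal (\<gamma> * L ^ DIM('a)) \<le> (\<integral>\<^sup>+y. indicator {y. \<forall>b\<in>Basis. y \<bullet> b \<in> {0..L}} y * indicator E (x + y) \<partial>lborel)"
  shows "enlarges L (\<gamma> * L / (2 * DIM('a))) bs E = UNIV"
proof -
  let ?n = "DIM('a)"
  have len: "length bs = ?n" using bs distinct_card by metis
  have n: "?n > 0" by simp
  have "x \<in> enlarges L (\<gamma> * L / (2 * ?n)) bs E" for x
  proof (rule ccontr)
    assume x: "x \<notin> enlarges L (\<gamma> * L / (2 * ?n)) bs E"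
    have "ennreal (\<gamma> * L ^ ?n) \<le> seg_integrals L bs (indicator E) x"
      using thick[of x] E by (subst seg_integrals_Basis[OF _ bs]) auto
    also have "\<dots> \<le> ennreal (?n * (\<gamma> * L / (2 * ?n)) * L ^ (?n - 1))"
      using seg_integrals_indicator_le[OF L _ E, of "\<gamma> * L / (2 * ?n)" bs x] x \<gamma> L by (simp add: len)
    also have "?n * (\<gamma> * L / (2 * ?n)) * L ^ (?n - 1) = \<gamma> * L ^ ?n / 2"
      using n by (simp add: power_eq_if)
    finally have "\<gamma> * L ^ ?n \<le> \<gamma> * L ^ ?n / 2" using \<gamma> L by (subst (asm) ennreal_le_iff) auto
    moreover have "\<gamma> * L ^ ?n > 0" using \<gamma> L by simp
    ultimately show False by simp
  qed
  then show ?thesis by auto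
qed

section \<open>The uncertainty principle\<close>

lemma ennreal_le_suminf: "f k \<le> suminf f" for f :: "nat \<Rightarrow> ennreal"
  using sum_le_suminf[of f "{k}"] by simp

lemma nn_integral_continuous_Icc:
  fixes g :: "real \<Rightarrow> real"
  assumes g: "continuous_on {0..L} g" and nn: "\<And>s. g s \<ge> 0" and A: "A \<in> sets borel"
  shows "(\<integral>\<^sup>+s. indicator {0..L} s * (indicator A s * ennreal (g s)) \<partial>lborel) = ennreal (LINT s:(A \<inter> {0..L})|lborel. g s)"
proof -
  have "(\<integral>\<^sup>+s. indicator {0..L} s * (indicator A s * ennreal (g s)) \<partial>lborel) = (\<integral>\<^sup>+s. ennreal (indicator (A \<inter> {0..L}) s *\<^sub>R g s) \<partial>lborel)"
    by (intro nn_integral_cong) (auto simp: indicator_def)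
  also have "\<dots> = ennreal (LINT s|lborel. indicator (A \<inter> {0..L}) s *\<^sub>R g s)"
    using set_integrable_Int_Icc[OF g A] nn by (intro nn_integral_eq_integral) (auto simp: set_integrable_def)
  finally show ?thesis by (simp add: set_lebesgue_integral_def)
qed

text \<open>
  An extended nonnegative number, so that masses can be compared without integrability conditions.
\<close>

definition mass :: "'a::euclidean_space set \<Rightarrow> ('a \<Rightarrow> complex) \<Rightarrow> ennreal" where
  "mass E w = (\<integral>\<^sup>+x. indicator E x * ennreal ((cmod (w x))\<^sup>2) \<partial>lborel)"

text \<open>
  Apply \<open>one_dimensional_inequality\<close> on the segment starting at \<open>x\<close>, for all \<open>x\<close> in the enlarged set, and
  integrate over \<open>x\<close>. Its size parameter must bound all derivatives on the segment at once. The integral over the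
  segment of \<open>D = \<Sum>k. |W k|\<^sup>2 / (B k)\<^sup>2\<close> with \<open>B k = 2\<^sup>k M k\<close> does this, and the geometric weights make
  \<open>D\<close> integrable with integral at most \<open>4/3 * N\<^sup>2\<close>.
\<close>

lemma enlarge_step:
  fixes b :: "'a::euclidean_space"
  assumes fu: "flat_unique M" and M: "\<And>k. M k > 0" and MS: "\<And>k. M k \<le> K * M (Suc k)"
    and L: "L > 0" and \<gamma>: "\<gamma> > 0" and \<epsilon>: "\<epsilon> > 0"
  shows "\<exists>C\<ge>0. \<forall>w N E. tower_bounded M N b w \<longrightarrow> E \<in> sets borel \<longrightarrow>
     mass (enlarge L \<gamma> b E) w \<le> ennreal C * mass E w + ennreal (\<epsilon> * N\<^sup>2)"
proof -
  define B where "B k = 2 ^ k * M k" for k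
  have B: "B k > 0" for k using M by (simp add: B_def)
  have fuB: "flat_unique (\<lambda>k. B k + B (Suc k))"
  proof (rule flat_unique_mono)
    show "flat_unique (\<lambda>k. 2 ^ k * M (Suc k))"
      by (intro flat_unique_geometric flat_unique_shift fu M) simp
    show "B k + B (Suc k) \<le> (\<bar>K\<bar> + 2) * (2 ^ k * M (Suc k))" for k
    proof -
      have "M k \<le> \<bar>K\<bar> * M (Suc k)"
        using order_trans[OF MS mult_right_mono[OF abs_ge_self less_imp_le[OF M]]] .
      then have "2 ^ k * M k \<le> 2 ^ k * (\<bar>K\<bar> * M (Suc k))" by (intro mult_left_mono) auto
      then show ?thesis by (simp add: B_def algebra_simps)
    qed
    show "B k + B (Suc k) \<ge> 0" for k using B[of k] B[of "Suc k"] by simp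
  qed
  \<comment> \<open>Chosen so that \<delta> times L times 4/3, from the segment and the geometric series, is \<epsilon>.\<close>
  define \<delta> where "\<delta> = \<epsilon> * 3 / (4 * L)"
  have \<delta>: "\<delta> > 0" using \<epsilon> L by (simp add: \<delta>_def)
  obtain C where C: "C \<ge> 0" and one: "\<And>\<phi> E S. tower 0 L \<phi> \<Longrightarrow> E \<in> sets borel \<Longrightarrow> \<gamma> \<le> measure lborel (E \<inter> {0..L}) \<Longrightarrow> 0 \<le> S \<Longrightarrow>
     (\<And>k. (LINT x:{0..L}|lborel. (cmod (\<phi> k x))\<^sup>2) \<le> S * (B k)\<^sup>2) \<Longrightarrow>
     (cmod (\<phi> 0 0))\<^sup>2 \<le> C * (LINT x:(E \<inter> {0..L})|lborel. (cmod (\<phi> 0 x))\<^sup>2) + \<delta> * S"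
    using one_dimensional_inequality[OF fuB B L \<gamma> \<delta>] by blast
  show ?thesis
  proof (intro exI[of _ "C * L"] conjI allI impI)
    show "0 \<le> C * L" using C L by simp
    fix w :: "'a \<Rightarrow> complex" and N :: real and E :: "'a set"
    assume tb: "tower_bounded M N b w" and E: "E \<in> sets borel"
    obtain W where W0: "W 0 = w" and Wm [measurable]: "\<And>k. W k \<in> borel_measurable borel"
      and Wd: "\<And>k x s. ((\<lambda>s. W k (x + s *\<^sub>R b)) has_vector_derivative W (Suc k) (x + s *\<^sub>R b)) (at s)"
      and Wn: "\<And>k. (\<integral>\<^sup>+x. ennreal ((cmod (W k x))\<^sup>2) \<partial>lborel) \<le> ennreal ((M k * N)\<^sup>2)"
      using tb unfolding tower_bounded_def by blast
    have [measurable]: "w \<in> borel_measurable borel" using Wm[of 0] W0 by simp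
    note E [measurable]
    define D where "D y = (\<Sum>k. ennreal ((cmod (W k y))\<^sup>2 / (B k)\<^sup>2))" for y
    have Dm [measurable]: "D \<in> borel_measurable borel" unfolding D_def by measurable
    let ?h = "\<lambda>y. indicator E y * ennreal ((cmod (w y))\<^sup>2)"
    have ptw: "indicator (enlarge L \<gamma> b E) x * ennreal ((cmod (w x))\<^sup>2) \<le> ennreal C * seg_integral L b ?h x + ennreal \<delta> * seg_integral L b D x" for x
    \<comment> \<open>Outside the enlargement the left-hand side is 0, and if the integral of D over the segment is infinite so is the right-hand side.\<close>
    proof (cases "x \<in> enlarge L \<gamma> b E \<and> seg_integral L b D x \<noteq> \<infinity>")
      case False
      then show ?thesis using \<delta> by (auto simp: ennreal_mult_top)
    next
      case True
      define S where "S = enn2real (seg_integral L b D x)"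
      have S: "S \<ge> 0" "ennreal S = seg_integral L b D x" using True by (auto simp: S_def ennreal_enn2real_if)
      define \<phi> where "\<phi> k s = W k (x + s *\<^sub>R b)" for k s
      have t: "tower 0 L \<phi>"
        unfolding tower_def \<phi>_def by (intro allI ballI, rule has_vector_derivative_at_within, rule Wd)
      have c: "continuous_on {0..L} (\<lambda>s. (cmod (\<phi> k s))\<^sup>2)" for k
        by (intro continuous_intros tower_continuous[OF t])
      define E' where "E' = {s. x + s *\<^sub>R b \<in> E}"
      have E': "E' \<in> sets borel"
      proof -
        have "(\<lambda>s::real. x + s *\<^sub>R b) \<in> borel \<rightarrow>\<^sub>M borel"
          by (intro borel_measurable_continuous_onI continuous_intros)
        from measurable_sets[OF this E] show ?thesis by (simp add: E'_def vimage_def)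
      qed
      have "ennreal \<gamma> \<le> seg_integral L b (indicator E) x" using True by (simp add: enlarge_def)
      also have "\<dots> = (\<integral>\<^sup>+s. indicator (E' \<inter> {0..L}) s \<partial>lborel)"
        unfolding seg_integral_def by (intro nn_integral_cong) (auto simp: indicator_def E'_def)
      also have "\<dots> = emeasure lborel (E' \<inter> {0..L})" using E' by (intro nn_integral_indicator) auto
      also have "\<dots> = ennreal (measure lborel (E' \<inter> {0..L}))"
        using emeasure_Int_Icc_finite[OF E', of L] by (intro emeasure_eq_ennreal_measure) auto
      finally have \<gamma>': "\<gamma> \<le> measure lborel (E' \<inter> {0..L})" by (simp add: ennreal_le_iff)
      have bnd: "(LINT s:{0..L}|lborel. (cmod (\<phi> k s))\<^sup>2) \<le> S * (B k)\<^sup>2" for k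
      proof -
        have cB: "continuous_on {0..L} (\<lambda>s. (cmod (\<phi> k s))\<^sup>2 / (B k)\<^sup>2)"
          by (rule continuous_on_divide[OF c continuous_on_const]) (use B[of k] in auto)
        have "ennreal (LINT s:(UNIV \<inter> {0..L})|lborel. (cmod (\<phi> k s))\<^sup>2 / (B k)\<^sup>2) = (\<integral>\<^sup>+s. indicator {0..L} s * (indicator UNIV s * ennreal ((cmod (\<phi> k s))\<^sup>2 / (B k)\<^sup>2)) \<partial>lborel)"
          by (rule nn_integral_continuous_Icc[OF cB, symmetric]) auto
        also have "\<dots> \<le> seg_integral L b D x"
          unfolding seg_integral_def
        proof (intro nn_integral_mono mult_left_mono)
          fix s
          have "ennreal ((cmod (\<phi> k s))\<^sup>2 / (B k)\<^sup>2) \<le> D (x + s *\<^sub>R b)"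
            unfolding D_def \<phi>_def by (rule ennreal_le_suminf)
          then show "indicator UNIV s * ennreal ((cmod (\<phi> k s))\<^sup>2 / (B k)\<^sup>2) \<le> D (x + s *\<^sub>R b)"
            by (simp only: indicator_simps UNIV_I mult_1_left)
        qed simp
        also have "\<dots> = ennreal S" by (rule S(2)[symmetric])
        finally have "(LINT s:{0..L}|lborel. (cmod (\<phi> k s))\<^sup>2 / (B k)\<^sup>2) \<le> S"
          using S(1) by (simp add: ennreal_le_iff)
        then have "(LINT s:{0..L}|lborel. (cmod (\<phi> k s))\<^sup>2) / (B k)\<^sup>2 \<le> S" by simp
        then show ?thesis using B[of k] by (simp add: divide_le_eq)
      qed
      have "(cmod (w x))\<^sup>2 \<le> C * (LINT s:(E' \<inter> {0..L})|lborel. (cmod (\<phi> 0 s))\<^sup>2) + \<delta> * S"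
        using one[OF t E' \<gamma>' S(1) bnd] by (simp add: \<phi>_def W0)
      then have "ennreal ((cmod (w x))\<^sup>2) \<le> ennreal (C * (LINT s:(E' \<inter> {0..L})|lborel. (cmod (\<phi> 0 s))\<^sup>2) + \<delta> * S)"
        by (rule ennreal_leI)
      also have "\<dots> = ennreal C * ennreal (LINT s:(E' \<inter> {0..L})|lborel. (cmod (\<phi> 0 s))\<^sup>2) + ennreal \<delta> * seg_integral L b D x"
      proof -
        have "0 \<le> (LINT s:(E' \<inter> {0..L})|lborel. (cmod (\<phi> 0 s))\<^sup>2)"
          unfolding set_lebesgue_integral_def by (rule integral_nonneg_AE) auto
        then show ?thesis using C \<delta> S(1) by (simp add: ennreal_mult S(2)[symmetric])
      qed
      also have "ennreal (LINT s:(E' \<inter> {0..L})|lborel. (cmod (\<phi> 0 s))\<^sup>2) = seg_integral L b ?h x"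
        using nn_integral_continuous_Icc[OF c _ E', of 0]
        by (simp add: seg_integral_def E'_def \<phi>_def W0 indicator_def)
      finally show ?thesis using True by simp
    qed
    have "mass (enlarge L \<gamma> b E) w \<le> (\<integral>\<^sup>+x. ennreal C * seg_integral L b ?h x + ennreal \<delta> * seg_integral L b D x \<partial>lborel)"
      unfolding mass_def by (intro nn_integral_mono ptw)
    also have "\<dots> = ennreal C * (ennreal L * mass E w) + ennreal \<delta> * (ennreal L * (\<integral>\<^sup>+x. D x \<partial>lborel))"
      by (simp add: nn_integral_add nn_integral_cmult nn_integral_seg_integral mass_def)
    also have "\<dots> \<le> ennreal (C * L) * mass E w + ennreal (\<epsilon> * N\<^sup>2)"
    proof (intro add_mono)
      show "ennreal C * (ennreal L * mass E w) \<le> ennreal (C * L) * mass E w"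
        using C L by (simp add: ennreal_mult mult.assoc)
      have "(\<integral>\<^sup>+x. D x \<partial>lborel) = (\<Sum>k. \<integral>\<^sup>+x. ennreal ((cmod (W k x))\<^sup>2 / (B k)\<^sup>2) \<partial>lborel)"
        unfolding D_def by (rule nn_integral_suminf) measurable
      also have "\<dots> \<le> (\<Sum>k. ennreal (N\<^sup>2 * (1 / 4) ^ k))"
      proof (rule suminf_le)
        fix k
        have "(\<integral>\<^sup>+x. ennreal ((cmod (W k x))\<^sup>2 / (B k)\<^sup>2) \<partial>lborel) = ennreal (1 / (B k)\<^sup>2) * (\<integral>\<^sup>+x. ennreal ((cmod (W k x))\<^sup>2) \<partial>lborel)"
          by (subst nn_integral_cmult[symmetric]) (auto simp: ennreal_mult[symmetric])
        also have "\<dots> \<le> ennreal (1 / (B k)\<^sup>2) * ennreal ((M k * N)\<^sup>2)"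
          by (intro mult_left_mono Wn) simp
        also have "\<dots> = ennreal (1 / (B k)\<^sup>2 * (M k * N)\<^sup>2)" by (rule ennreal_mult[symmetric]) auto
        also have "1 / (B k)\<^sup>2 * (M k * N)\<^sup>2 = N\<^sup>2 * (1 / 4) ^ k"
        proof -
          have "((2::real) ^ k)\<^sup>2 = 4 ^ k" by (simp add: power2_eq_square flip: power_mult_distrib)
          then show ?thesis using M[of k] by (simp add: B_def power_mult_distrib power_divide field_simps)
        qed
        finally show "(\<integral>\<^sup>+x. ennreal ((cmod (W k x))\<^sup>2 / (B k)\<^sup>2) \<partial>lborel) \<le> ennreal (N\<^sup>2 * (1 / 4) ^ k)" .
      qed auto
      also have "\<dots> = ennreal (N\<^sup>2 * (4 / 3))"
      proof (rule suminf_ennreal_eq)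
        show "(\<lambda>k. N\<^sup>2 * (1 / 4) ^ k) sums (N\<^sup>2 * (4 / 3))"
          using sums_mult[OF geometric_sums[of "1/4::real"], of "N\<^sup>2"] by simp
      qed simp
      finally have "ennreal \<delta> * (ennreal L * (\<integral>\<^sup>+x. D x \<partial>lborel)) \<le> ennreal \<delta> * (ennreal L * ennreal (N\<^sup>2 * (4 / 3)))"
        by (intro mult_left_mono) auto
      also have "\<dots> = ennreal (\<delta> * (L * (N\<^sup>2 * (4 / 3))))"
        by (simp only: ennreal_mult'[OF less_imp_le[OF \<delta>]] ennreal_mult'[OF less_imp_le[OF L]])
      also have "\<delta> * (L * (N\<^sup>2 * (4 / 3))) = \<epsilon> * N\<^sup>2" using L by (simp add: \<delta>_def)
      finally show "ennreal \<delta> * (ennreal L * (\<integral>\<^sup>+x. D x \<partial>lborel)) \<le> ennreal (\<epsilon> * N\<^sup>2)" .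
    qed
    finally show "mass (enlarge L \<gamma> b E) w \<le> ennreal (C * L) * mass E w + ennreal (\<epsilon> * N\<^sup>2)" .
  qed
qed

lemma enlarges_step:
  fixes bs :: "'a::euclidean_space list"
  assumes fu: "flat_unique M" and M: "\<And>k. M k > 0" and MS: "\<And>k. M k \<le> K * M (Suc k)"
    and L: "L > 0" and \<gamma>: "\<gamma> > 0" and \<epsilon>: "\<epsilon> > 0"
  shows "\<exists>C\<ge>0. \<forall>w N E. (\<forall>b\<in>set bs. tower_bounded M N b w) \<longrightarrow> E \<in> sets borel \<longrightarrow>
     mass (enlarges L \<gamma> bs E) w \<le> ennreal C * mass E w + ennreal (\<epsilon> * N\<^sup>2)"
  using \<epsilon>
proof (induction bs arbitrary: \<epsilon> rule: rev_induct)
  case Nil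
  show ?case by (intro exI[of _ 1]) (auto intro: add_increasing2)
next
  case (snoc b bs)
  obtain C1 where C1: "C1 \<ge> 0" and s1: "\<And>w N E. tower_bounded M N b w \<Longrightarrow> E \<in> sets borel \<Longrightarrow>
     mass (enlarge L \<gamma> b E) w \<le> ennreal C1 * mass E w + ennreal (\<epsilon> / 2 * N\<^sup>2)"
    using enlarge_step[OF fu M MS L \<gamma>, of "\<epsilon> / 2" b] snoc.prems by auto
  obtain C0 where C0: "C0 \<ge> 0" and s0: "\<And>w N E. (\<forall>b\<in>set bs. tower_bounded M N b w) \<Longrightarrow> E \<in> sets borel \<Longrightarrow>
     mass (enlarges L \<gamma> bs E) w \<le> ennreal C0 * mass E w + ennreal (\<epsilon> / (2 * (C1 + 1)) * N\<^sup>2)"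
    using snoc.IH[of "\<epsilon> / (2 * (C1 + 1))"] snoc.prems C1 by auto
  show ?case
  proof (intro exI[of _ "C1 * C0"] conjI allI impI)
    show "0 \<le> C1 * C0" using C0 C1 by simp
    fix w :: "'a \<Rightarrow> complex" and N :: real and E :: "'a set" assume tb: "\<forall>c\<in>set (bs @ [b]). tower_bounded M N c w" and E: "E \<in> sets borel"
    have "mass (enlarges L \<gamma> (bs @ [b]) E) w \<le> ennreal C1 * mass (enlarges L \<gamma> bs E) w + ennreal (\<epsilon> / 2 * N\<^sup>2)"
      unfolding enlarges_simps by (rule s1) (use tb E in auto)
    also have "\<dots> \<le> ennreal C1 * (ennreal C0 * mass E w + ennreal (\<epsilon> / (2 * (C1 + 1)) * N\<^sup>2)) + ennreal (\<epsilon> / 2 * N\<^sup>2)"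
      using tb E by (intro add_mono mult_left_mono s0) auto
    also have "\<dots> = ennreal (C1 * C0) * mass E w + (ennreal (C1 * (\<epsilon> / (2 * (C1 + 1)) * N\<^sup>2)) + ennreal (\<epsilon> / 2 * N\<^sup>2))"
      unfolding distrib_left ennreal_mult'[OF C1] by (simp only: mult.assoc add.assoc)
    also have "ennreal (C1 * (\<epsilon> / (2 * (C1 + 1)) * N\<^sup>2)) + ennreal (\<epsilon> / 2 * N\<^sup>2) \<le> ennreal (\<epsilon> * N\<^sup>2)"
    proof -
      have "C1 * (\<epsilon> / (2 * (C1 + 1))) \<le> \<epsilon> / 2" using C1 snoc.prems by (simp add: field_simps)
      then have "C1 * (\<epsilon> / (2 * (C1 + 1))) * N\<^sup>2 \<le> \<epsilon> / 2 * N\<^sup>2" by (intro mult_right_mono) auto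
      moreover have "C1 * (\<epsilon> / (2 * (C1 + 1)) * N\<^sup>2) = C1 * (\<epsilon> / (2 * (C1 + 1))) * N\<^sup>2" by (simp only: mult.assoc)
      moreover have "\<epsilon> / 2 * N\<^sup>2 + \<epsilon> / 2 * N\<^sup>2 = \<epsilon> * N\<^sup>2" by simp
      ultimately have "C1 * (\<epsilon> / (2 * (C1 + 1)) * N\<^sup>2) + \<epsilon> / 2 * N\<^sup>2 \<le> \<epsilon> * N\<^sup>2" by linarith
      moreover have "0 \<le> C1 * (\<epsilon> / (2 * (C1 + 1)) * N\<^sup>2)" "0 \<le> \<epsilon> / 2 * N\<^sup>2" using C1 snoc.prems by auto
      ultimately show ?thesis by (simp add: ennreal_leI flip: ennreal_plus)
    qed
    finally show "mass (enlarges L \<gamma> (bs @ [b]) E) w \<le> ennreal (C1 * C0) * mass E w + ennreal (\<epsilon> * N\<^sup>2)"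
      by (simp add: add_left_mono)
  qed
qed

context rapid_symbol
begin

text \<open>
  Split according to \<open>r \<le> 1\<close> or \<open>r > 1\<close>; all moments are bounded below by \<open>exp (- t F(1))\<close>.
\<close>

lemma moment_Suc_bound:
  assumes t: "t > 0"
  shows "\<exists>K. \<forall>k. moment F t k \<le> K * moment F t (Suc k)"
proof -
  define c where "c = exp (- t * F 1)"
  have c: "c > 0" "c \<le> moment F t k" for k
    using moment_upper[OF bdd_moment[OF t], of 1 k] by (simp_all add: c_def)
  have "moment F t k \<le> (moment F t 0 / c + 1) * moment F t (Suc k)" for k
  proof (rule moment_leI)
    fix r :: real assume r: "r \<ge> 0"
    have "r ^ k \<le> 1 + r ^ Suc k"
    proof (cases "r \<le> 1")
      case True
      then have "r ^ k \<le> 1" using r by (intro power_le_one)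
      then show ?thesis using r by (simp add: add_increasing2)
    next
      case False
      then have "r ^ k * 1 \<le> r ^ k * r" using r by (intro mult_left_mono) auto
      then show ?thesis by (simp add: mult.commute)
    qed
    then have "r ^ k * exp (- t * F r) \<le> (1 + r ^ Suc k) * exp (- t * F r)" by (intro mult_right_mono) auto
    also have "\<dots> = r ^ 0 * exp (- t * F r) + r ^ Suc k * exp (- t * F r)" by (simp add: algebra_simps)
    also have "\<dots> \<le> moment F t 0 + moment F t (Suc k)"
      by (intro add_mono moment_upper bdd_moment t r)
    also have "moment F t 0 \<le> moment F t 0 / c * moment F t (Suc k)"
      using c(1) c(2)[of "Suc k"] moment_pos[OF t, of 0] by (simp add: divide_le_eq le_divide_eq mult_left_mono)
    finally show "r ^ k * exp (- t * F r) \<le> (moment F t 0 / c + 1) * moment F t (Suc k)" by (simp add: distrib_right)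
  qed
  then show ?thesis by blast
qed

text \<open>
  Replace \<open>\<omega>\<close> by a Borel set that agrees with it up to a null set. The iterated enlargement of this set along all the
  axes is the whole space, so the chain of estimates for the mass of \<open>S t z\<close> ends with its full norm.
\<close>

lemma uncertainty_principle:
  fixes \<omega> :: "'a::euclidean_space set"
  assumes fu: "flat_unique (moment F 1)" and t: "t > 0" and L: "L > 0" and \<gamma>: "\<gamma> > 0" and \<omega>: "\<omega> \<in> sets lebesgue"
    and thick: "\<And>x. \<gamma> * L ^ DIM('a) \<le> measure lebesgue (\<omega> \<inter> (+) x ` {y. \<forall>b\<in>Basis. y \<bullet> b \<in> {0..L}})"
    and \<epsilon>: "\<epsilon> > 0"
  shows "\<exists>C\<ge>0. \<forall>z :: 'a L2. (norm (S t z))\<^sup>2 \<le> C * (norm (mul_L2 (indicator \<omega>) (S t z)))\<^sup>2 + \<epsilon> * (norm z)\<^sup>2"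
proof -
  let ?Q = "{y::'a. \<forall>b\<in>Basis. y \<bullet> b \<in> {0..L}}"
  have "?Q = cbox 0 (\<Sum>b\<in>Basis. L *\<^sub>R b)" by (auto simp: mem_box inner_sum_left inner_Basis if_distrib cong: if_cong)
  then have Q: "?Q \<in> sets borel" "bounded ?Q" by simp_all
  obtain E N N' where E: "E \<in> sets borel" and dec: "\<omega> = E \<union> N" "N \<subseteq> N'" "N' \<in> null_sets lborel"
    using \<omega> by (rule sets_completionE) auto
  have aeN: "AE x in lborel. x \<notin> N'" using dec(3) by (rule AE_not_in)
  then have ae: "AE x in lborel. x \<in> \<omega> \<longleftrightarrow> x \<in> E"
    by eventually_elim (use dec in auto)
  have thick': "ennreal (\<gamma> * L ^ DIM('a)) \<le> (\<integral>\<^sup>+y. indicator ?Q y * indicator E (x + y) \<partial>lborel)" for x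
  proof -
    let ?A = "\<omega> \<inter> (+) x ` ?Q"
    let ?B = "E \<inter> (+) x ` ?Q"
    have xQ: "(+) x ` ?Q = (\<lambda>y. y - x) -` ?Q" 
    proof (intro set_eqI iffI)
      fix y assume "y \<in> (\<lambda>y. y - x) -` ?Q"
      then show "y \<in> (+) x ` ?Q" by (intro image_eqI[of _ _ "y - x"]) auto
    qed auto
    have "(\<lambda>y. y - x) \<in> borel \<rightarrow>\<^sub>M borel" by measurable
    from measurable_sets[OF this Q(1)] have xQm: "(+) x ` ?Q \<in> sets borel" by (simp only: xQ space_borel Int_UNIV_right)
    have A: "?A \<in> sets lebesgue" using \<omega> xQm by auto
    have "emeasure lebesgue ?A = emeasure lebesgue ?B"
    proof (rule emeasure_eq_AE)
      show "AE y in lebesgue. y \<in> ?A \<longleftrightarrow> y \<in> ?B" using AE_completion[OF ae] by eventually_elim simp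
      show "?B \<in> sets lebesgue" using E xQm by auto
    qed (rule A)
    also have "\<dots> = emeasure lborel ?B"
    proof -
      have "?B \<in> sets lborel" using E xQm by auto
      then show ?thesis by simp
    qed
    finally have eq: "emeasure lebesgue ?A = emeasure lborel ?B" .
    have "emeasure lborel ?B < \<infinity>"
      by (rule emeasure_bounded_finite[OF bounded_subset[OF bounded_translation[OF Q(2)]]]) auto
    then have "ennreal (measure lebesgue ?A) = emeasure lborel ?B"
      using eq by (simp add: measure_def)
    then have "ennreal (\<gamma> * L ^ DIM('a)) \<le> emeasure lborel ?B"
      using ennreal_leI[OF thick[of x]] by (simp only:)
    also have "\<dots> = (\<integral>\<^sup>+y. indicator ?B y \<partial>lborel)" using E xQm by simp
    also have "\<dots> = (\<integral>\<^sup>+y. indicator ?B (x + y) \<partial>lborel)"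
      using E xQm by (intro nn_integral_lborel_translate[symmetric]) auto
    also have "\<dots> = (\<integral>\<^sup>+y. indicator ?Q y * indicator E (x + y) \<partial>lborel)"
      unfolding xQ by (intro nn_integral_cong) (auto simp: indicator_def)
    finally show ?thesis .
  qed
  obtain bs :: "'a list" where bs: "distinct bs" "set bs = Basis"
    using finite_distinct_list[OF finite_Basis] by blast
  let ?\<gamma> = "\<gamma> * L / (2 * DIM('a))"
  have univ: "enlarges L ?\<gamma> bs E = UNIV"
    by (rule enlarges_thick_eq_UNIV[OF L \<gamma> E bs thick'])
  obtain K where K: "\<And>k. moment F t k \<le> K * moment F t (Suc k)" using moment_Suc_bound[OF t] by blast
  have g': "?\<gamma> > 0" using \<gamma> L by simp
  obtain C where C: "C \<ge> 0" and step: "\<And>w N. (\<forall>b\<in>set bs. tower_bounded (moment F t) N b w) \<Longrightarrow>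
     mass (enlarges L ?\<gamma> bs E) w \<le> ennreal C * mass E w + ennreal (\<epsilon> * N\<^sup>2)"
    using enlarges_step[OF flat_unique_moment[OF fu t] moment_pos[OF t] K L g' \<epsilon>, of bs] E by blast
  show ?thesis
  proof (intro exI[of _ C] conjI allI)
    fix z :: "'a L2"
    obtain w where w [measurable]: "w \<in> borel_measurable borel" and sq: "square_integrable lebesgue w" and wz: "to_L2 w = S t z"
      and tw: "\<And>b. b \<in> Basis \<Longrightarrow> tower_bounded (moment F t) (norm z) b w"
      using S_pointwise_tower[OF t, of z] by blast
    have "mass UNIV w \<le> ennreal C * mass E w + ennreal (\<epsilon> * (norm z)\<^sup>2)"
      using step[of "norm z" w] tw bs unfolding univ by blast
    moreover have "mass UNIV w = ennreal ((norm (S t z))\<^sup>2)"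
      using norm_to_L2_borel(2)[OF w sq] by (simp add: mass_def wz)
    moreover have "mass E w = ennreal ((norm (mul_L2 (indicator \<omega>) (S t z)))\<^sup>2)"
    proof -
      have i: "indicat_real \<omega> \<in> borel_measurable lebesgue" using \<omega> by simp
      have b: "\<bar>indicat_real \<omega> x\<bar> \<le> 1" for x by (simp add: indicator_def)
      have "ennreal ((norm (mul_L2 (indicator \<omega>) (S t z)))\<^sup>2) = (\<integral>\<^sup>+x. ennreal ((cmod (indicator \<omega> x *\<^sub>R w x))\<^sup>2) \<partial>lborel)"
        unfolding wz[symmetric] mul_L2_to_L2[OF i b sq]
        using nn_integral_norm_to_L2[OF square_integrable_mul[OF i b sq]] by (simp add: nn_integral_completion)
      also have "\<dots> = mass E w"
        unfolding mass_def
        by (rule nn_integral_cong_AE) (use ae in eventually_elim, auto simp: indicator_def)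
      finally show ?thesis ..
    qed
    ultimately have "ennreal ((norm (S t z))\<^sup>2) \<le> ennreal (C * (norm (mul_L2 (indicator \<omega>) (S t z)))\<^sup>2 + \<epsilon> * (norm z)\<^sup>2)"
      using C \<epsilon> by (simp add: ennreal_mult)
    then show "(norm (S t z))\<^sup>2 \<le> C * (norm (mul_L2 (indicator \<omega>) (S t z)))\<^sup>2 + \<epsilon> * (norm z)\<^sup>2"
      using C \<epsilon> by (subst (asm) ennreal_le_iff) auto
  qed (rule C)
qed

end

section \<open>From the uncertainty principle to controls\<close>

lemma lebesgue_Times:
  fixes A :: "'a::euclidean_space set" and \<omega> :: "'b::euclidean_space set"
  assumes A: "A \<in> sets borel" and \<omega>: "\<omega> \<in> sets lebesgue"
  shows "A \<times> \<omega> \<in> sets lebesgue"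
proof -
  obtain E N N' where E: "E \<in> sets lborel" and dec: "\<omega> = E \<union> N" "N \<subseteq> N'" "N' \<in> null_sets lborel"
    using \<omega> by (rule sets_completionE) auto
  have N': "N' \<in> sets lborel" "emeasure lborel N' = 0" using dec(3) by auto
  have "emeasure (lborel \<Otimes>\<^sub>M lborel) ((UNIV :: 'a set) \<times> N') = emeasure lborel (UNIV :: 'a set) * emeasure lborel N'"
    by (intro lborel.emeasure_pair_measure_Times N') simp
  then have "emeasure lborel ((UNIV :: 'a set) \<times> N') = 0" by (simp add: N' lborel_prod)
  moreover have "(UNIV :: 'a set) \<times> N' \<in> sets lborel"
    using pair_measureI[of "UNIV :: 'a set" lborel N' lborel] N'(1) unfolding lborel_prod by (simp only: sets_lborel sets.top space_borel[symmetric])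
  ultimately have null: "(UNIV :: 'a set) \<times> N' \<in> null_sets lborel" by auto
  have "A \<times> N \<in> sets lebesgue"
    using null by (rule sets_completionI_sub) (use dec in auto)
  moreover have "A \<times> E \<in> sets lborel"
    using pair_measureI[of A lborel E lborel] A E unfolding lborel_prod by (simp only: sets_lborel)
  then have "A \<times> E \<in> sets lebesgue" by (rule sets_completionI_sets)
  moreover have "A \<times> \<omega> = A \<times> E \<union> A \<times> N" using dec by blast
  ultimately show ?thesis by auto
qed

text \<open>
  The Lax--Milgram lemma by iteration: \<open>y \<mapsto> y - \<tau> (A y + \<alpha> y - b)\<close> is a contraction for the value
  \<open>\<tau> = \<alpha>/\<Lambda>\<^sup>2\<close> which minimises the bound \<open>1 - 2 \<tau> \<alpha> + \<tau>\<^sup>2 \<Lambda>\<^sup>2\<close> for the square of its Lipschitz constant.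
\<close>

lemma coercive_solve:
  fixes A :: "'h::{real_inner,banach} \<Rightarrow> 'h"
  assumes A: "bounded_linear A" and pos: "\<And>x. A x \<bullet> x \<ge> 0" and \<alpha>: "\<alpha> > 0"
  shows "\<exists>y. A y + \<alpha> *\<^sub>R y = b"
proof -
  interpret bounded_linear A by fact
  obtain K where K: "K > 0" "\<And>x. norm (A x) \<le> norm x * K" using pos_bounded by blast
  define \<Lambda> where "\<Lambda> = K + \<alpha>"
  have \<Lambda>: "\<Lambda> > 0" "\<alpha> < \<Lambda>" using K \<alpha> by (auto simp: \<Lambda>_def)
  define \<tau> where "\<tau> = \<alpha> / \<Lambda>\<^sup>2"
  have \<tau>: "\<tau> > 0" using \<alpha> \<Lambda> by (simp add: \<tau>_def)
  define T where "T y = y - \<tau> *\<^sub>R (A y + \<alpha> *\<^sub>R y - b)" for y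
  define q where "q = 1 - \<alpha>\<^sup>2 / \<Lambda>\<^sup>2"
  have "\<alpha>\<^sup>2 < \<Lambda>\<^sup>2" using \<Lambda> \<alpha> by (intro power_strict_mono) auto
  then have q: "0 \<le> q" "q < 1" using \<alpha> \<Lambda> by (auto simp: q_def)
  have lip: "dist (T x) (T y) \<le> sqrt q * dist x y" for x y
  proof -
    define d where "d = x - y"
    have Td: "T x - T y = d - \<tau> *\<^sub>R (A d + \<alpha> *\<^sub>R d)"
      by (simp add: T_def d_def diff scaleR_diff_right scaleR_add_right algebra_simps)
    have nA: "norm (A d + \<alpha> *\<^sub>R d) \<le> \<Lambda> * norm d"
      using norm_triangle_ineq[of "A d" "\<alpha> *\<^sub>R d"] K(2)[of d] \<alpha> by (simp add: \<Lambda>_def algebra_simps)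
    have expand: "(norm (d - \<tau> *\<^sub>R e))\<^sup>2 = (norm d)\<^sup>2 - 2 * \<tau> * (e \<bullet> d) + \<tau>\<^sup>2 * (norm e)\<^sup>2" for e
      unfolding power2_norm_eq_inner inner_diff_left inner_diff_right inner_scaleR_left inner_scaleR_right inner_commute[of d e]
      by (simp add: power2_eq_square algebra_simps)
    have "(norm (T x - T y))\<^sup>2 = (norm d)\<^sup>2 - 2 * \<tau> * ((A d + \<alpha> *\<^sub>R d) \<bullet> d) + \<tau>\<^sup>2 * (norm (A d + \<alpha> *\<^sub>R d))\<^sup>2"
      unfolding Td by (rule expand)
    also have "\<dots> \<le> (norm d)\<^sup>2 - 2 * \<tau> * (\<alpha> * (norm d)\<^sup>2) + \<tau>\<^sup>2 * (\<Lambda> * norm d)\<^sup>2"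
    proof (intro add_mono diff_mono mult_left_mono power_mono nA)
      show "\<alpha> * (norm d)\<^sup>2 \<le> (A d + \<alpha> *\<^sub>R d) \<bullet> d"
        using pos[of d] by (simp add: inner_add_left power2_norm_eq_inner)
    qed (use \<tau> in auto)
    also have "\<dots> = q * (norm d)\<^sup>2"
      using \<Lambda> by (simp add: q_def \<tau>_def field_simps power2_eq_square)
    finally have "(norm (T x - T y))\<^sup>2 \<le> q * (norm d)\<^sup>2" .
    then have "sqrt ((norm (T x - T y))\<^sup>2) \<le> sqrt (q * (norm d)\<^sup>2)" by (rule real_sqrt_le_mono)
    then show ?thesis by (simp add: dist_norm real_sqrt_mult d_def)
  qed
  have "\<exists>!y. T y = y"
    by (rule banach_fix_type[where c="sqrt q"]) (use q lip in auto)
  then obtain y where "T y = y" by blast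
  then have "A y + \<alpha> *\<^sub>R y = b" using \<tau> by (simp add: T_def)
  then show ?thesis by blast
qed

lemma mul_indicator:
  fixes \<omega> :: "'a::euclidean_space set"
  assumes \<omega>: "\<omega> \<in> sets lebesgue"
  shows mul_indicator_idem: "mul_L2 (indicator \<omega>) (mul_L2 (indicator \<omega>) f) = mul_L2 (indicator \<omega>) f"
    and bounded_linear_mul_indicator: "bounded_linear (mul_L2 (indicator \<omega>))"
    and inner_mul_indicator: "mul_L2 (indicator \<omega>) f \<bullet> g = f \<bullet> mul_L2 (indicator \<omega>) g"
    and norm_mul_indicator_le: "norm (mul_L2 (indicator \<omega>) f) \<le> norm f"
    and inner_mul_indicator_self: "mul_L2 (indicator \<omega>) f \<bullet> f = (norm (mul_L2 (indicator \<omega>) f))\<^sup>2"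
proof -
  have m: "indicat_real \<omega> \<in> borel_measurable lebesgue" using \<omega> by simp
  have b: "\<bar>indicat_real \<omega> x\<bar> \<le> 1" for x by (simp add: indicator_def)
  have "(\<lambda>x. indicat_real \<omega> x * indicator \<omega> x) = indicator \<omega>" by (auto simp: indicator_def)
  then show idem: "mul_L2 (indicator \<omega>) (mul_L2 (indicator \<omega>) f) = mul_L2 (indicator \<omega>) f" for f :: "'a L2"
    using mul_L2_mul_L2[OF m b m b, of f] by simp
  show "bounded_linear (mul_L2 (indicator \<omega>))" by (rule bounded_linear_mul_L2[OF m b])
  show inn: "mul_L2 (indicator \<omega>) f \<bullet> g = f \<bullet> mul_L2 (indicator \<omega>) g" for f g :: "'a L2" by (rule inner_mul_L2[OF m b])
  show "norm (mul_L2 (indicator \<omega>) f) \<le> norm f" using norm_mul_L2_le[OF m b, of f] by simp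
  show "mul_L2 (indicator \<omega>) f \<bullet> f = (norm (mul_L2 (indicator \<omega>) f))\<^sup>2"
    using inn[of "mul_L2 (indicator \<omega>) f" f] by (simp add: power2_norm_eq_inner idem)
qed

lemma integrable_indicator_greaterThanLessThan: "integrable lborel (indicat_real {a<..<b::real})"
  using emeasure_lborel_Ioo[of a b] by (cases "a \<le> b") (auto intro!: integrable_real_indicator)

context symbol
begin

context
  fixes T t0 :: real
  assumes T: "T > 0" and t0: "t0 = T / 2"
begin

lemma S_integrable:
  fixes f :: "'a::euclidean_space L2"
  assumes "r \<ge> t0"
  shows "set_integrable lborel {0<..<t0} (\<lambda>s. S (r - s) f)"
proof -
  have "continuous_on {0..t0} (\<lambda>s. S (r - s) f)"
    by (rule continuous_on_compose2[OF S_continuous]) (use assms in \<open>auto intro!: continuous_intros\<close>)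
  then have "set_integrable lborel {0..t0} (\<lambda>s. S (r - s) f)"
    unfolding set_integrable_def using borel_integrable_compact[of "{0..t0}" "\<lambda>s. S (r - s) f"]
    by (simp add: indicator_scaleR_eq_if)
  then show ?thesis by (rule set_integrable_subset) auto
qed

text \<open>
  The effect at time \<open>r\<close> of the constant control \<open>f\<close> on the time interval from 0 to \<open>t0\<close>.
\<close>

definition steer :: "real \<Rightarrow> 'a::euclidean_space L2 \<Rightarrow> 'a L2" where
  "steer r f = (LINT s:{0<..<t0}|lborel. S (r - s) f)"

lemma inner_steer:
  "r \<ge> t0 \<Longrightarrow> steer r f \<bullet> g = (LINT s:{0<..<t0}|lborel. S (r - s) f \<bullet> g)"
  "r \<ge> t0 \<Longrightarrow> set_integrable lborel {0<..<t0} (\<lambda>s. S (r - s) f \<bullet> g)"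
proof -
  assume r: "r \<ge> t0"
  have i: "integrable lborel (\<lambda>s. indicator {0<..<t0} s *\<^sub>R S (r - s) f)"
    using S_integrable[OF r] by (simp add: set_integrable_def)
  show "steer r f \<bullet> g = (LINT s:{0<..<t0}|lborel. S (r - s) f \<bullet> g)"
    unfolding steer_def set_lebesgue_integral_def
    using integral_inner_left[OF i, of g] by simp
  show "set_integrable lborel {0<..<t0} (\<lambda>s. S (r - s) f \<bullet> g)"
    unfolding set_integrable_def using integrable_inner_left[OF i, of g] by simp
qed

lemma steer_self_adjoint: "r \<ge> t0 \<Longrightarrow> steer r f \<bullet> g = f \<bullet> steer r g"
  unfolding inner_commute[of f] inner_steer(1) set_lebesgue_integral_def
proof (intro Bochner_Integration.integral_cong refl)
  fix s assume "r \<ge> t0"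
  then have "S (r - s) f \<bullet> g = S (r - s) g \<bullet> f" if "s \<in> {0<..<t0}"
    using that by (subst inner_S) (auto simp: inner_commute)
  then show "indicat_real {0<..<t0} s *\<^sub>R (S (r - s) f \<bullet> g) = indicat_real {0<..<t0} s *\<^sub>R (S (r - s) g \<bullet> f)"
    by (auto simp: indicator_def)
qed

lemma bounded_linear_steer:
  assumes r: "r \<ge> t0"
  shows "bounded_linear (steer r :: 'a::euclidean_space L2 \<Rightarrow> 'a L2)"
proof (rule bounded_linear_intro)
  fix f g :: "'a L2" and c :: real
  have lin: "S (r - s) (f + g) = S (r - s) f + S (r - s) g" "S (r - s) (c *\<^sub>R f) = c *\<^sub>R S (r - s) f" if "s \<in> {0<..<t0}" for s
  proof -
    have "linear (S (r - s) :: 'a L2 \<Rightarrow> 'a L2)"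
      using that r by (intro bounded_linear.linear bounded_linear_S) auto
    then show "S (r - s) (f + g) = S (r - s) f + S (r - s) g" "S (r - s) (c *\<^sub>R f) = c *\<^sub>R S (r - s) f"
      by (auto simp: linear_add linear_scale)
  qed
  show "steer r (f + g) = steer r f + steer r g"
    unfolding steer_def set_integral_add(2)[OF S_integrable[OF r] S_integrable[OF r], symmetric]
    by (intro set_lebesgue_integral_cong) (auto simp: lin)
  show "steer r (c *\<^sub>R f) = c *\<^sub>R steer r f"
    unfolding steer_def set_integral_scaleR_right[symmetric]
    by (intro set_lebesgue_integral_cong) (auto simp: lin)
  show "norm (steer r f) \<le> norm f * (exp (r * c0) * t0)"
  proof -
    have "norm (steer r f) \<le> (LINT s:{0<..<t0}|lborel. norm (S (r - s) f))"
      unfolding steer_def by (rule set_integral_norm_bound[OF S_integrable[OF r]])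
    also have "\<dots> \<le> (LINT s:{0<..<t0}|lborel. exp (r * c0) * norm f)"
    proof (rule set_integral_mono)
      show "set_integrable lborel {0<..<t0} (\<lambda>s. norm (S (r - s) f))"
        by (rule set_integrable_norm[OF S_integrable[OF r]])
      show "set_integrable lborel {0<..<t0} (\<lambda>s. exp (r * c0) * norm f)"
        unfolding set_integrable_def by (intro integrable_scaleR_left integrable_indicator_greaterThanLessThan)
      show "norm (S (r - s) f) \<le> exp (r * c0) * norm f" if "s \<in> {0<..<t0}" for s
        using that r by (intro norm_S_le) auto
    qed
    also have "\<dots> = norm f * (exp (r * c0) * t0)"
      using T by (simp add: set_lebesgue_integral_def t0)
    finally show ?thesis .
  qed
qed

text \<open>
  The control stops at \<open>t0 = T / 2\<close>, so the state at time \<open>T\<close> has been smoothed for a further time \<open>t0\<close>. This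
  makes the uncertainty principle at time \<open>t0\<close> applicable to it.
\<close>

lemma steer_eq: "steer T f = S t0 (steer t0 (f :: 'a::euclidean_space L2))"
proof -
  have bl: "bounded_linear (S t0 :: 'a L2 \<Rightarrow> 'a L2)" using T t0 by (intro bounded_linear_S) simp
  have "S t0 (steer t0 f) = (LINT s|lborel. S t0 (indicator {0<..<t0} s *\<^sub>R S (t0 - s) f))"
    unfolding steer_def set_lebesgue_integral_def
    using S_integrable[of t0 f] by (intro integral_bounded_linear[OF bl, symmetric]) (simp add: set_integrable_def)
  also have "\<dots> = steer T f"
    unfolding steer_def set_lebesgue_integral_def
  proof (intro Bochner_Integration.integral_cong refl)
    fix s
    have "S t0 (S (t0 - s) f) = S (T - s) f" if "s \<in> {0<..<t0}"
      using S_add[of t0 "t0 - s" f] that T by (simp add: t0)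
    then show "S t0 (indicator {0<..<t0} s *\<^sub>R S (t0 - s) f) = indicator {0<..<t0} s *\<^sub>R S (T - s) f"
      using linear_0[OF bounded_linear.linear[OF bl]] by (auto simp: indicator_def)
  qed
  finally show ?thesis ..
qed

lemma steer_inner_ge:
  assumes "\<And>s. s \<in> {0<..<t0} \<Longrightarrow> c \<le> S (T - s) f \<bullet> g"
  shows "t0 * c \<le> steer T f \<bullet> g"
proof -
  have T0: "T \<ge> t0" "t0 > 0" using T t0 by auto
  have "t0 * c = (LINT s:{0<..<t0}|lborel. c)" using T0 by (simp add: set_lebesgue_integral_def)
  also have "\<dots> \<le> (LINT s:{0<..<t0}|lborel. S (T - s) f \<bullet> g)"
  proof (rule set_integral_mono)
    show "set_integrable lborel {0<..<t0} (\<lambda>s. c)"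
      unfolding set_integrable_def by (intro integrable_scaleR_left integrable_indicator_greaterThanLessThan)
    show "set_integrable lborel {0<..<t0} (\<lambda>s. S (T - s) f \<bullet> g)" by (rule inner_steer(2)[OF T0(1)])
  qed (rule assms)
  finally show ?thesis unfolding inner_steer(1)[OF T0(1)] .
qed

text \<open>
  The squared norm of \<open>steer T f\<close> is the double integral of \<open>S (T - s) f \<bullet> S (T - s') f\<close>. By self-adjointness the
  integrand is the squared norm of \<open>S m f\<close>, with \<open>m \<le> T\<close> the mean of \<open>T - s\<close> and \<open>T - s'\<close>, and \<open>S T f\<close> is
  the image of \<open>S m f\<close> under a bounded operator.
\<close>

lemma norm_S_le_steer: "(t0 * exp (- (T * c0)) * norm (S T f))\<^sup>2 \<le> (norm (steer T f))\<^sup>2"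
proof -
  define \<kappa> where "\<kappa> = (exp (- (T * c0)) * norm (S T f))\<^sup>2"
  have key: "\<kappa> \<le> S (T - s) f \<bullet> S (T - s') f" if s: "s \<in> {0<..<t0}" "s' \<in> {0<..<t0}" for s s'
  proof -
    define m where "m = ((T - s) + (T - s')) / 2"
    have m: "0 \<le> m" "m \<le> T" using s T t0 by (auto simp: m_def)
    have "S (T - s) f \<bullet> S (T - s') f = f \<bullet> S (T - s) (S (T - s') f)"
      using s t0 by (intro inner_S) auto
    also have "S (T - s) (S (T - s') f) = S (m + m) f"
      using s t0 S_add[of "T - s" "T - s'" f] by (simp add: m_def)
    also have "S (m + m) f = S m (S m f)" using m by (intro S_add)
    also have "f \<bullet> S m (S m f) = (norm (S m f))\<^sup>2" using m by (simp add: inner_S[symmetric] power2_norm_eq_inner)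
    finally have eq: "S (T - s) f \<bullet> S (T - s') f = (norm (S m f))\<^sup>2" .
    have "norm (S T f) = norm (S (T - m) (S m f))" using S_add[of "T - m" m f] m by simp
    also have "\<dots> \<le> exp (T * c0) * norm (S m f)" using m by (intro norm_S_le) auto
    finally have "exp (- (T * c0)) * norm (S T f) \<le> exp (- (T * c0)) * (exp (T * c0) * norm (S m f))"
      by (intro mult_left_mono) auto
    also have "\<dots> = norm (S m f)" by (simp add: mult.assoc[symmetric] exp_add[symmetric])
    finally show ?thesis unfolding \<kappa>_def eq by (intro power_mono) auto
  qed
  have "t0 * \<kappa> \<le> S (T - s) f \<bullet> steer T f" if "s \<in> {0<..<t0}" for s
    unfolding inner_commute[of "S (T - s) f"] using key[OF _ that] by (intro steer_inner_ge)
  then have "t0 * (t0 * \<kappa>) \<le> steer T f \<bullet> steer T f" by (rule steer_inner_ge)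
  then show ?thesis by (simp add: \<kappa>_def power_mult_distrib power2_norm_eq_inner[symmetric] power2_eq_square[of t0] mult_ac)
qed

lemma mild_solution_constant_control:
  fixes P :: "'a::euclidean_space L2"
  assumes \<omega>: "\<omega> \<in> sets lebesgue" and p: "p \<in> borel_measurable borel" "square_integrable lebesgue p" "to_L2 p = P"
  defines "h \<equiv> \<lambda>(s, x). indicator {0<..<t0} s *\<^sub>R p x"
  shows "mild_solution F \<omega> f0 h T = S T f0 + steer T (mul_L2 (indicator \<omega>) P)"
    and "square_integrable (lebesgue_on ({0<..<T} \<times> \<omega>)) h"
    and "(LINT t|lebesgue_on {0<..<T}. LINT x|lebesgue_on \<omega>. (cmod (h (t, x)))\<^sup>2) = t0 * (norm (mul_L2 (indicator \<omega>) P))\<^sup>2"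
proof -
  have m: "indicat_real \<omega> \<in> borel_measurable lebesgue" using \<omega> by simp
  have b: "\<bar>indicat_real \<omega> x\<bar> \<le> 1" for x by (simp add: indicator_def)
  have t0T: "t0 > 0" "t0 \<le> T" using T t0 by auto
  note mp = mul_L2_to_L2[OF m b p(2), unfolded p(3)]
  let ?P = "mul_L2 (indicator \<omega>) P"
  have zero: "to_L2 (\<lambda>x::'a. 0) = 0" using to_L2_scaleR[OF square_integrable_zero, of 0] by simp
  have H: "to_L2 (\<lambda>x. indicator \<omega> x *\<^sub>R h (s, x)) = indicator {0<..<t0} s *\<^sub>R ?P" for s
    by (auto simp: h_def indicator_def[of "{0<..<t0}"] mp zero)
  have S0: "S r (0 :: 'a L2) = 0" if "r \<ge> 0" for r
    using linear_0[OF bounded_linear.linear[OF bounded_linear_S[OF that]]] .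
  have "(LINT s|lebesgue_on {0<..<T}. S (T - s) (to_L2 (\<lambda>x. indicator \<omega> x *\<^sub>R h (s, x))))
      = (LINT s|lebesgue. indicator {0<..<T} s *\<^sub>R S (T - s) (indicator {0<..<t0} s *\<^sub>R ?P))"
    unfolding H by (rule integral_restrict_space) simp
  also have "\<dots> = (LINT s|lebesgue. indicator {0<..<t0} s *\<^sub>R S (T - s) ?P)"
    using t0T by (intro Bochner_Integration.integral_cong refl) (auto simp: indicator_def S0)
  also have "\<dots> = steer T ?P"
    unfolding steer_def set_lebesgue_integral_def
    using S_integrable[OF t0T(2), of ?P] by (intro integral_completion) (auto simp: set_integrable_def)
  finally show "mild_solution F \<omega> f0 h T = S T f0 + steer T ?P" by (simp add: mild_solution_def)
  have [measurable]: "p \<in> borel_measurable borel" by (rule p)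
  have pi: "integrable lborel (\<lambda>x. (cmod (p x))\<^sup>2)" using p by (simp add: square_integrable_borel)
  have hm: "h \<in> borel_measurable borel"
    unfolding h_def borel_prod[symmetric] by measurable
  have hi: "integrable lborel (\<lambda>z. (cmod (h z))\<^sup>2)"
  proof -
    have eq: "(cmod (h (s, x)))\<^sup>2 = indicator {0<..<t0} s * (cmod (p x))\<^sup>2" for s x
      by (simp add: h_def indicator_def)
    have fin: "integrable lborel (indicat_real {0<..<t0})" by (rule integrable_indicator_greaterThanLessThan)
    have hm2: "(\<lambda>z. (cmod (h z))\<^sup>2) \<in> borel_measurable (lborel \<Otimes>\<^sub>M lborel)"
      using hm by (simp add: lborel_prod)
    have e1: "integrable lborel (\<lambda>s. LINT x|lborel. norm ((cmod (h (s, x)))\<^sup>2))"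
      unfolding eq using fin by simp
    have e2: "AE s in lborel. integrable lborel (\<lambda>x. (cmod (h (s, x)))\<^sup>2)" unfolding eq using pi by simp
    show ?thesis using lborel_pair.Fubini_integrable[OF hm2 e1 e2] by (simp add: lborel_prod)
  qed
  have Q: "{0<..<T} \<times> \<omega> \<in> sets lebesgue" using \<omega> by (intro lebesgue_Times) auto
  show "square_integrable (lebesgue_on ({0<..<T} \<times> \<omega>)) h"
    unfolding square_integrable_def
  proof
    show "h \<in> borel_measurable (lebesgue_on ({0<..<T} \<times> \<omega>))"
      by (intro measurable_restrict_space1 borel_imp_lebesgue_measurable hm)
    have "integrable lebesgue (\<lambda>z. (cmod (h z))\<^sup>2)" using hi hm by (subst integrable_completion) auto
    from integrable_mult_indicator[OF Q this] show "integrable (lebesgue_on ({0<..<T} \<times> \<omega>)) (\<lambda>z. (cmod (h z))\<^sup>2)"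
      using Q by (subst integrable_restrict_space) simp_all
  qed
  have nP: "(LINT x|lebesgue_on \<omega>. (cmod (p x))\<^sup>2) = (norm ?P)\<^sup>2"
  proof -
    have "(norm ?P)\<^sup>2 = (LINT x|lebesgue. (cmod (indicator \<omega> x *\<^sub>R p x))\<^sup>2)"
      unfolding mp using norm_to_L2[OF square_integrable_mul[OF m b p(2)]] by simp
    also have "\<dots> = (LINT x|lebesgue. indicator \<omega> x *\<^sub>R (cmod (p x))\<^sup>2)"
      by (intro Bochner_Integration.integral_cong refl) (auto simp: indicator_def)
    also have "\<dots> = (LINT x|lebesgue_on \<omega>. (cmod (p x))\<^sup>2)"
      using \<omega> by (intro integral_restrict_space[symmetric]) simp
    finally show ?thesis ..
  qed
  have "(LINT x|lebesgue_on \<omega>. (cmod (h (t, x)))\<^sup>2) = indicator {0<..<t0} t * (norm ?P)\<^sup>2" for t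
    using nP by (auto simp: h_def indicator_def)
  then have "(LINT t|lebesgue_on {0<..<T}. LINT x|lebesgue_on \<omega>. (cmod (h (t, x)))\<^sup>2)
    = (LINT t|lebesgue. indicator {0<..<T} t *\<^sub>R (indicator {0<..<t0} t * (norm ?P)\<^sup>2))"
    by (simp only:) (rule integral_restrict_space, simp)
  also have "\<dots> = (LINT t|lebesgue. indicator {0<..<t0} t * (norm ?P)\<^sup>2)"
    using t0T by (intro Bochner_Integration.integral_cong refl) (auto simp: indicator_def)
  also have "\<dots> = t0 * (norm ?P)\<^sup>2" using t0T by simp
  finally show "(LINT t|lebesgue_on {0<..<T}. LINT x|lebesgue_on \<omega>. (cmod (h (t, x)))\<^sup>2) = t0 * (norm ?P)\<^sup>2" .
qed

text \<open>
  With \<open>K = steer T\<close> and \<open>R\<close> the restriction to \<open>\<omega>\<close>, the estimate in \<open>norm_S_le_steer\<close> and observability of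
  \<open>K y = S t0 (steer t0 y)\<close> give \<open>|S T y|\<^sup>2 \<le> C |R K y|\<^sup>2 + \<epsilon>\<^sup>2 |y|\<^sup>2\<close>. Solve \<open>K R K y + \<alpha> y = S T f0\<close> with
  \<open>\<alpha> = \<epsilon>\<^sup>2 / C\<close> and use the control \<open>- R K y\<close>, which leaves the final state \<open>\<alpha> y\<close>. Taking the inner product of
  the equation with \<open>y\<close> gives \<open>|R K y|\<^sup>2 + \<alpha> |y|\<^sup>2 = f0 \<bullet> S T y\<close>. By the estimate for \<open>S T y\<close> this number is
  at most \<open>C |f0|\<^sup>2\<close>, which bounds both the cost and the final state.
\<close>

lemma observability_imp_controllable:
  fixes \<omega> :: "'a::euclidean_space set"
  assumes \<omega>: "\<omega> \<in> sets lebesgue"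
    and obs: "\<And>\<epsilon>. \<epsilon> > 0 \<Longrightarrow> \<exists>C\<ge>0. \<forall>z :: 'a L2. (norm (S t0 z))\<^sup>2 \<le> C * (norm (mul_L2 (indicator \<omega>) (S t0 z)))\<^sup>2 + \<epsilon> * (norm z)\<^sup>2"
  shows "cost_uniformly_approx_null_controllable F \<omega> T"
  unfolding cost_uniformly_approx_null_controllable_def
proof (intro allI impI)
  fix \<epsilon> :: real assume \<epsilon>: "\<epsilon> > 0"
  have t0T: "t0 > 0" "t0 \<le> T" using T t0 by auto
  let ?R = "mul_L2 (indicator \<omega>) :: 'a L2 \<Rightarrow> 'a L2"
  let ?K = "steer T :: 'a L2 \<Rightarrow> 'a L2"
  note blK = bounded_linear_steer[OF t0T(2), where 'a='a]
  note blR = bounded_linear_mul_indicator[OF \<omega>]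
  define \<kappa> where "\<kappa> = (t0 * exp (- (T * c0)))\<^sup>2"
  have \<kappa>: "\<kappa> > 0" using t0T by (simp add: \<kappa>_def)
  obtain B where B: "B > 0" "\<And>y :: 'a L2. norm (steer t0 y) \<le> norm y * B"
    using bounded_linear.pos_bounded[OF bounded_linear_steer[OF order_refl, where 'a='a]] by blast
  \<comment> \<open>Compensates the lower bound of norm_S_le_steer and the norm of steer t0.\<close>
  define \<delta> where "\<delta> = \<epsilon>\<^sup>2 * \<kappa> / B\<^sup>2"
  have \<delta>: "\<delta> > 0" using \<epsilon> \<kappa> B by (simp add: \<delta>_def)
  obtain C0 where C0: "C0 \<ge> 0" and obs0: "\<And>z :: 'a L2. (norm (S t0 z))\<^sup>2 \<le> C0 * (norm (?R (S t0 z)))\<^sup>2 + \<delta> * (norm z)\<^sup>2"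
    using obs[OF \<delta>] by blast
  define C where "C = C0 / \<kappa> + 1"
  have C: "C > 0" using C0 \<kappa> by (simp add: C_def add_nonneg_pos)
  have obsT: "(norm (S T y))\<^sup>2 \<le> C * (norm (?R (?K y)))\<^sup>2 + \<epsilon>\<^sup>2 * (norm y)\<^sup>2" for y
  proof -
    have "\<kappa> * (norm (S T y))\<^sup>2 \<le> (norm (?K y))\<^sup>2"
      using norm_S_le_steer[of y] by (simp add: \<kappa>_def power_mult_distrib)
    also have "\<dots> \<le> C0 * (norm (?R (?K y)))\<^sup>2 + \<delta> * (norm (steer t0 y))\<^sup>2"
      unfolding steer_eq by (rule obs0)
    also have "\<dots> \<le> C0 * (norm (?R (?K y)))\<^sup>2 + \<delta> * (norm y * B)\<^sup>2"
      using \<delta> B by (intro add_left_mono mult_left_mono power_mono) auto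
    also have "\<delta> * (norm y * B)\<^sup>2 = \<kappa> * (\<epsilon>\<^sup>2 * (norm y)\<^sup>2)"
      using B by (simp add: \<delta>_def power_mult_distrib)
    finally have "(norm (S T y))\<^sup>2 \<le> C0 / \<kappa> * (norm (?R (?K y)))\<^sup>2 + \<epsilon>\<^sup>2 * (norm y)\<^sup>2"
      using \<kappa> by (simp add: field_simps)
    also have "\<dots> \<le> C * (norm (?R (?K y)))\<^sup>2 + \<epsilon>\<^sup>2 * (norm y)\<^sup>2"
      by (intro add_right_mono mult_right_mono) (auto simp: C_def)
    finally show ?thesis .
  qed
  define \<alpha> where "\<alpha> = \<epsilon>\<^sup>2 / C"
  have \<alpha>: "\<alpha> > 0" using \<epsilon> C by (simp add: \<alpha>_def)
  define A where "A y = ?K (?R (?K y))" for y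
  have blA: "bounded_linear A"
    unfolding A_def by (intro bounded_linear_compose[OF blK] bounded_linear_compose[OF blR] blK)
  have Apos: "A y \<bullet> y = (norm (?R (?K y)))\<^sup>2" for y
    unfolding A_def steer_self_adjoint[OF t0T(2)] by (rule inner_mul_indicator_self[OF \<omega>])
  show "\<exists>C>0. \<forall>f0::'a L2. \<exists>h. square_integrable (lebesgue_on ({0<..<T} \<times> \<omega>)) h \<and>
        norm (mild_solution F \<omega> f0 h T) \<le> \<epsilon> * norm f0 \<and>
        (LINT t|lebesgue_on {0<..<T}. LINT x|lebesgue_on \<omega>. (cmod (h (t, x)))\<^sup>2) \<le> C * (norm f0)\<^sup>2"
  proof (intro exI[of _ "t0 * C"] conjI allI)
    show "t0 * C > 0" using t0T C by simp
    fix f0 :: "'a L2"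
    obtain y where y: "A y + \<alpha> *\<^sub>R y = S T f0"
      using coercive_solve[OF blA _ \<alpha>] Apos by (metis zero_le_power2)
    define a where "a = (norm (?R (?K y)))\<^sup>2"
    define b where "b = \<alpha> * (norm y)\<^sup>2"
    have ab: "a \<ge> 0" "b \<ge> 0" using \<alpha> by (auto simp: a_def b_def)
    have "a + b = (A y + \<alpha> *\<^sub>R y) \<bullet> y"
      by (simp add: a_def b_def inner_add_left Apos power2_norm_eq_inner)
    also have "\<dots> = f0 \<bullet> S T y" unfolding y using T by (intro inner_S) simp
    also have "\<dots> \<le> norm f0 * norm (S T y)" by (rule norm_cauchy_schwarz)
    finally have "(a + b)\<^sup>2 \<le> (norm f0 * norm (S T y))\<^sup>2" using ab by (intro power_mono) auto
    also have "\<dots> \<le> (norm f0)\<^sup>2 * (C * a + \<epsilon>\<^sup>2 * (norm y)\<^sup>2)"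
      unfolding power_mult_distrib a_def by (intro mult_left_mono obsT) auto
    also have "\<epsilon>\<^sup>2 * (norm y)\<^sup>2 = C * b" using C by (simp add: b_def \<alpha>_def)
    finally have "(a + b) * (a + b) \<le> (C * (norm f0)\<^sup>2) * (a + b)" by (simp add: power2_eq_square algebra_simps)
    then have main: "a + b \<le> C * (norm f0)\<^sup>2"
      using ab C by (cases "a + b = 0") (auto simp: mult_le_cancel_right)
    obtain p where p: "p \<in> borel_measurable borel" "square_integrable lebesgue p" "to_L2 p = - ?R (?K y)"
      by (rule L2_borel_rep)
    define h where "h = (\<lambda>(s, x). indicator {0<..<t0} s *\<^sub>R p x)"
    note ctrl = mild_solution_constant_control[OF \<omega> p, folded h_def]
    have RR: "?R (- ?R (?K y)) = - ?R (?K y)"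
      using linear_neg[OF bounded_linear.linear[OF blR]] mul_indicator_idem[OF \<omega>] by simp
    have "mild_solution F \<omega> f0 h T = S T f0 - A y"
      using ctrl(1)[of f0] linear_neg[OF bounded_linear.linear[OF blK]] by (simp add: RR A_def)
    also have "\<dots> = \<alpha> *\<^sub>R y" using y by (metis add_diff_cancel_left')
    finally have fin: "mild_solution F \<omega> f0 h T = \<alpha> *\<^sub>R y" .
    show "\<exists>h. square_integrable (lebesgue_on ({0<..<T} \<times> \<omega>)) h \<and>
        norm (mild_solution F \<omega> f0 h T) \<le> \<epsilon> * norm f0 \<and>
        (LINT t|lebesgue_on {0<..<T}. LINT x|lebesgue_on \<omega>. (cmod (h (t, x)))\<^sup>2) \<le> t0 * C * (norm f0)\<^sup>2"
    proof (intro exI[of _ h] conjI)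
      show "square_integrable (lebesgue_on ({0<..<T} \<times> \<omega>)) h" by (rule ctrl(2))
      show "norm (mild_solution F \<omega> f0 h T) \<le> \<epsilon> * norm f0"
        unfolding fin
      proof (rule power2_le_imp_le)
        have "(norm (\<alpha> *\<^sub>R y))\<^sup>2 = \<alpha> * b" by (simp add: b_def power_mult_distrib power2_eq_square)
        also have "\<dots> \<le> \<alpha> * (C * (norm f0)\<^sup>2)" using main ab \<alpha> by (intro mult_left_mono) auto
        also have "\<dots> = (\<epsilon> * norm f0)\<^sup>2" using C by (simp add: \<alpha>_def power_mult_distrib)
        finally show "(norm (\<alpha> *\<^sub>R y))\<^sup>2 \<le> (\<epsilon> * norm f0)\<^sup>2" .
      qed (use \<epsilon> in simp)
      have "(LINT t|lebesgue_on {0<..<T}. LINT x|lebesgue_on \<omega>. (cmod (h (t, x)))\<^sup>2) = t0 * a"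
        using ctrl(3) by (simp add: RR a_def)
      also have "\<dots> \<le> t0 * (C * (norm f0)\<^sup>2)" using main ab t0T by (intro mult_left_mono) auto
      finally show "(LINT t|lebesgue_on {0<..<T}. LINT x|lebesgue_on \<omega>. (cmod (h (t, x)))\<^sup>2) \<le> t0 * C * (norm f0)\<^sup>2"
        by (simp add: mult.assoc)
    qed
  qed
qed

end

end

section \<open>Controllability forces thickness\<close>

lemma lebesgue_measurable_AE_eq:
  fixes f g :: "'a::euclidean_space \<Rightarrow> 'b::topological_space"
  assumes g: "g \<in> borel_measurable lebesgue" and eq: "AE x in lborel. f x = g x"
  shows "f \<in> borel_measurable lebesgue"
proof (rule measurableI)
  fix B :: "'b set" assume B: "B \<in> sets borel"
  obtain N where N0: "{x \<in> space lborel. f x \<noteq> g x} \<subseteq> N" "emeasure lborel N = 0" "N \<in> sets lborel"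
    using eq by (rule AE_E)
  then have N: "N \<in> null_sets lborel" "{x. f x \<noteq> g x} \<subseteq> N" by auto
  have NL: "N \<in> null_sets lebesgue" using N(1) by (rule null_sets_completionI)
  have "f -` B \<inter> N \<in> null_sets lebesgue" by (rule null_sets_completion_subset[OF _ NL]) auto
  moreover have "g -` B \<inter> space lebesgue - N \<in> sets lebesgue"
    using measurable_sets[OF g B] NL by auto
  moreover have "f -` B \<inter> space lebesgue = (g -` B \<inter> space lebesgue - N) \<union> (f -` B \<inter> N)"
    using N(2) by (auto; metis (mono_tags, lifting) mem_Collect_eq subsetD)
  ultimately show "f -` B \<inter> space lebesgue \<in> sets lebesgue" by (metis null_setsD2 sets.Un)
qed simp

text \<open>
  Lebesgue measure on a product is the completion of the product measure, so Fubini's theorem is applied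
  to a Borel function that agrees with \<open>H\<close> almost everywhere.
\<close>

lemma integrable_lebesgue_section:
  fixes H :: "'b::euclidean_space \<times> 'a::euclidean_space \<Rightarrow> real"
  assumes H: "integrable lebesgue H"
  shows "integrable lebesgue (\<lambda>s. LINT x|lebesgue. H (s, x))"
proof -
  have Hm: "H \<in> borel_measurable lebesgue" using H by simp
  obtain G where G: "G \<in> borel_measurable lborel" "AE z in lborel. H z = G z"
    using completion_ex_borel_measurable_real[OF Hm] by blast
  have GL: "G \<in> borel_measurable lebesgue" using G(1) by (intro borel_imp_lebesgue_measurable) simp
  have "integrable lebesgue G"
    using Bochner_Integration.integrable_cong_AE[OF Hm GL AE_completion[OF G(2)]] H by blast
  then have "integrable (lborel \<Otimes>\<^sub>M lborel) G"
    using G(1) by (simp add: integrable_completion lborel_prod)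
  then have int: "integrable lborel (\<lambda>s. LINT x|lborel. G (s, x))" by (rule lborel_pair.integrable_fst')
  have "AE z in lborel \<Otimes>\<^sub>M lborel. H z = G z" using G(2) by (simp only: lborel_prod)
  then have "AE s in lborel. AE x in lborel. H (s, x) = G (s, x)" by (rule lborel_pair.AE_pair)
  then have eq: "AE s in lborel. (LINT x|lebesgue. H (s, x)) = (LINT x|lborel. G (s, x))"
  proof (rule AE_mp, intro AE_I2 impI)
    fix s assume ae: "AE x in lborel. H (s, x) = G (s, x)"
    have Gs: "(\<lambda>x. G (s, x)) \<in> borel_measurable borel" using G(1) by simp measurable
    then have GsL: "(\<lambda>x. G (s, x)) \<in> borel_measurable lebesgue" by (rule borel_imp_lebesgue_measurable)
    have "(LINT x|lebesgue. H (s, x)) = (LINT x|lebesgue. G (s, x))"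
      by (rule Bochner_Integration.integral_cong_AE[OF lebesgue_measurable_AE_eq[OF GsL ae] GsL AE_completion[OF ae]])
    then show "(LINT x|lebesgue. H (s, x)) = (LINT x|lborel. G (s, x))"
      using Gs by (simp add: integral_completion)
  qed
  have intL: "integrable lebesgue (\<lambda>s. LINT x|lborel. G (s, x))"
    using int by (subst integrable_completion) auto
  have m: "(\<lambda>s. LINT x|lebesgue. H (s, x)) \<in> borel_measurable lebesgue"
    by (rule lebesgue_measurable_AE_eq[OF _ eq]) (use intL in auto)
  show ?thesis
    using Bochner_Integration.integrable_cong_AE[OF m borel_measurable_integrable[OF intL] AE_completion[OF eq]] intL by blast
qed

text \<open>
  Without integrability the integral which defines the cost would be 0 and would say nothing about the
  control.
\<close>

lemma integrable_control_cost:
  fixes h :: "real \<times> 'a::euclidean_space \<Rightarrow> complex"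
  assumes \<omega>: "\<omega> \<in> sets lebesgue" and h: "square_integrable (lebesgue_on ({0<..<T} \<times> \<omega>)) h"
  shows "integrable (lebesgue_on {0<..<T}) (\<lambda>s. LINT x|lebesgue_on \<omega>. (cmod (h (s, x)))\<^sup>2)"
proof -
  let ?Q = "{0<..<T} \<times> \<omega>"
  have Q: "?Q \<in> sets lebesgue" using \<omega> by (intro lebesgue_Times) auto
  have "integrable (lebesgue_on ?Q) (\<lambda>z. (cmod (h z))\<^sup>2)" using h by (simp add: square_integrable_def)
  then have "integrable lebesgue (\<lambda>z. indicator ?Q z *\<^sub>R (cmod (h z))\<^sup>2)"
    using Q by (subst (asm) integrable_restrict_space) simp_all
  then have i: "integrable lebesgue (\<lambda>s. LINT x|lebesgue. indicator ?Q (s, x) *\<^sub>R (cmod (h (s, x)))\<^sup>2)"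
    by (rule integrable_lebesgue_section)
  have eq: "(LINT x|lebesgue. indicator ?Q (s, x) *\<^sub>R (cmod (h (s, x)))\<^sup>2)
      = indicator {0<..<T} s *\<^sub>R (LINT x|lebesgue_on \<omega>. (cmod (h (s, x)))\<^sup>2)" for s
  proof -
    have "(LINT x|lebesgue. indicator ?Q (s, x) *\<^sub>R (cmod (h (s, x)))\<^sup>2)
        = (LINT x|lebesgue. indicator {0<..<T} s *\<^sub>R (indicator \<omega> x *\<^sub>R (cmod (h (s, x)))\<^sup>2))"
      by (intro Bochner_Integration.integral_cong refl) (auto simp: indicator_def)
    also have "\<dots> = indicator {0<..<T} s *\<^sub>R (LINT x|lebesgue. indicator \<omega> x *\<^sub>R (cmod (h (s, x)))\<^sup>2)"
      by (rule integral_scaleR_right)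
    also have "(LINT x|lebesgue. indicator \<omega> x *\<^sub>R (cmod (h (s, x)))\<^sup>2) = (LINT x|lebesgue_on \<omega>. (cmod (h (s, x)))\<^sup>2)"
      using \<omega> by (intro integral_restrict_space[symmetric]) simp
    finally show ?thesis .
  qed
  show ?thesis using i unfolding eq by (subst integrable_restrict_space) simp_all
qed

text \<open>
  If the slice is not square-integrable, \<open>to_L2\<close> is 0 and both claims are trivial. Hence they hold at every
  time and not only at almost every time.
\<close>

lemma control_slice:
  fixes u :: "'a::euclidean_space \<Rightarrow> complex"
  assumes \<omega>: "\<omega> \<in> sets lebesgue"
  defines "U \<equiv> to_L2 (\<lambda>x. indicator \<omega> x *\<^sub>R u x)"
  shows "mul_L2 (indicator \<omega>) U = U" and "(norm U)\<^sup>2 \<le> (LINT x|lebesgue_on \<omega>. (cmod (u x))\<^sup>2)"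
proof -
  have m: "indicat_real \<omega> \<in> borel_measurable lebesgue" using \<omega> by simp
  have b: "\<bar>indicat_real \<omega> x\<bar> \<le> 1" for x by (simp add: indicator_def)
  let ?v = "\<lambda>x. indicator \<omega> x *\<^sub>R u x"
  show "mul_L2 (indicator \<omega>) U = U"
  proof (cases "square_integrable lebesgue ?v")
    case True
    have "(\<lambda>x. indicator \<omega> x *\<^sub>R ?v x) = ?v" by (auto simp: indicator_def)
    then show ?thesis using mul_L2_to_L2[OF m b True] by (simp only: U_def)
  next
    case False
    then have "U = 0" by (simp add: U_def to_L2_def)
    then show ?thesis using linear_0[OF bounded_linear.linear[OF bounded_linear_mul_indicator[OF \<omega>]]] by simp
  qed
  have eq: "(LINT x|lebesgue_on \<omega>. (cmod (u x))\<^sup>2) = (LINT x|lebesgue. (cmod (?v x))\<^sup>2)"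
  proof -
    have "(LINT x|lebesgue_on \<omega>. (cmod (u x))\<^sup>2) = (LINT x|lebesgue. indicator \<omega> x *\<^sub>R (cmod (u x))\<^sup>2)"
      using \<omega> by (intro integral_restrict_space) simp
    also have "\<dots> = (LINT x|lebesgue. (cmod (?v x))\<^sup>2)"
      by (intro Bochner_Integration.integral_cong refl) (auto simp: indicator_def)
    finally show ?thesis .
  qed
  show "(norm U)\<^sup>2 \<le> (LINT x|lebesgue_on \<omega>. (cmod (u x))\<^sup>2)"
  proof (cases "square_integrable lebesgue ?v")
    case True
    then show ?thesis unfolding eq U_def norm_to_L2[OF True] by simp
  next
    case False
    then have "U = 0" by (simp add: U_def to_L2_def)
    then show ?thesis unfolding eq by simp
  qed
qed

context symbol
begin

lemma observation_integrable:
  fixes g :: "'a::euclidean_space L2" and R :: "'a L2 \<Rightarrow> 'a L2"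
  assumes R: "bounded_linear R"
  shows "integrable (lebesgue_on {0<..<T}) (\<lambda>s. (norm (R (S (T - s) g)))\<^sup>2)"
proof -
  have "continuous_on {0..T} (\<lambda>s. (norm (R (S (T - s) g)))\<^sup>2)"
    by (intro continuous_intros bounded_linear.continuous_on[OF R] continuous_on_compose2[OF S_continuous]) auto
  then have "integrable lborel (\<lambda>s. indicator {0..T} s *\<^sub>R (norm (R (S (T - s) g)))\<^sup>2)"
    using borel_integrable_compact[of "{0..T}" "\<lambda>s. (norm (R (S (T - s) g)))\<^sup>2"]
    by (simp add: indicator_scaleR_eq_if)
  then have "set_integrable lborel {0..T} (\<lambda>s. (norm (R (S (T - s) g)))\<^sup>2)" by (simp add: set_integrable_def)
  then have "set_integrable lborel {0<..<T} (\<lambda>s. (norm (R (S (T - s) g)))\<^sup>2)"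
    by (rule set_integrable_subset) auto
  then have "integrable lborel (\<lambda>s. indicator {0<..<T} s *\<^sub>R (norm (R (S (T - s) g)))\<^sup>2)" by (simp add: set_integrable_def)
  then have "integrable lebesgue (\<lambda>s. indicator {0<..<T} s *\<^sub>R (norm (R (S (T - s) g)))\<^sup>2)"
    by (subst integrable_completion) (auto dest: borel_measurable_integrable)
  then show ?thesis by (subst integrable_restrict_space) simp_all
qed

text \<open>
  Steer the initial state \<open>f0 = S T g\<close> and pair the final state with \<open>g\<close>. The free evolution contributes
  \<open>S T f0 \<bullet> g = |S T g|\<^sup>2\<close>. The control contributes the integral of \<open>h(s) \<bullet> R (S (T - s) g)\<close>, with \<open>R\<close> the
  restriction to \<open>\<omega>\<close>, which is estimated by the cost and the observation by means of
  \<open>a b \<le> a\<^sup>2 / (4 C) + C b\<^sup>2\<close>. The cost is at most \<open>C |f0|\<^sup>2\<close>, so its share is absorbed by the left-hand side.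
\<close>

lemma controllable_imp_observable:
  fixes \<omega> :: "'a::euclidean_space set"
  assumes T: "T > 0" and \<omega>: "\<omega> \<in> sets lebesgue" and ctrl: "cost_uniformly_approx_null_controllable F \<omega> T"
    and \<epsilon>: "\<epsilon> > 0"
  shows "\<exists>C>0. \<forall>g :: 'a L2. (norm (S T g))\<^sup>2 \<le>
    C * (LINT s|lebesgue_on {0<..<T}. (norm (mul_L2 (indicator \<omega>) (S (T - s) g)))\<^sup>2) + \<epsilon> * (norm g)\<^sup>2"
proof -
  let ?R = "mul_L2 (indicator \<omega>) :: 'a L2 \<Rightarrow> 'a L2"
  define \<delta> where "\<delta> = sqrt (\<epsilon> / 2)"
  have \<delta>: "\<delta> > 0" "\<delta>\<^sup>2 = \<epsilon> / 2" using \<epsilon> by (auto simp: \<delta>_def)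
  obtain C where C: "C > 0" and sol: "\<And>f0 :: 'a L2. \<exists>h. square_integrable (lebesgue_on ({0<..<T} \<times> \<omega>)) h \<and>
        norm (mild_solution F \<omega> f0 h T) \<le> \<delta> * norm f0 \<and>
        (LINT t|lebesgue_on {0<..<T}. LINT x|lebesgue_on \<omega>. (cmod (h (t, x)))\<^sup>2) \<le> C * (norm f0)\<^sup>2"
    using ctrl \<delta>(1) unfolding cost_uniformly_approx_null_controllable_def by metis
  show ?thesis
  proof (intro exI[of _ "2 * C"] conjI allI)
    show "2 * C > 0" using C by simp
    fix g :: "'a L2"
    let ?M = "lebesgue_on {0<..<T}"
    define k where "k s = (norm (?R (S (T - s) g)))\<^sup>2" for s
    have ki: "integrable ?M k"
      unfolding k_def by (rule observation_integrable[OF bounded_linear_mul_indicator[OF \<omega>]])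
    define f0 where "f0 = S T g"
    define N where "N = norm f0"
    obtain h where h: "square_integrable (lebesgue_on ({0<..<T} \<times> \<omega>)) h"
      and small: "norm (mild_solution F \<omega> f0 h T) \<le> \<delta> * N"
      and cost: "(LINT t|?M. LINT x|lebesgue_on \<omega>. (cmod (h (t, x)))\<^sup>2) \<le> C * N\<^sup>2"
      using sol[of f0] by (auto simp: N_def)
    define q where "q s = (LINT x|lebesgue_on \<omega>. (cmod (h (s, x)))\<^sup>2)" for s
    have qi: "integrable ?M q" unfolding q_def by (rule integrable_control_cost[OF \<omega> h])
    define U where "U s = to_L2 (\<lambda>x. indicator \<omega> x *\<^sub>R h (s, x))" for s
    have U: "?R (U s) = U s" "(norm (U s))\<^sup>2 \<le> q s" for s
      unfolding U_def q_def using control_slice[OF \<omega>, of "\<lambda>x. h (s, x)"] by auto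
    define I where "I = (LINT s|?M. S (T - s) (U s))"
    have pt: "\<bar>S (T - s) (U s) \<bullet> g\<bar> \<le> q s / (4 * C) + C * k s" if "s \<in> {0<..<T}" for s
    proof -
      have "S (T - s) (U s) \<bullet> g = ?R (U s) \<bullet> S (T - s) g" using that by (simp add: inner_S U)
      also have "\<dots> = U s \<bullet> ?R (S (T - s) g)" by (rule inner_mul_indicator[OF \<omega>])
      finally have "\<bar>S (T - s) (U s) \<bullet> g\<bar> \<le> norm (U s) * norm (?R (S (T - s) g))"
        using Cauchy_Schwarz_ineq2[of "U s" "?R (S (T - s) g)"] by simp
      moreover have "a * b \<le> a\<^sup>2 / (4 * C) + C * b\<^sup>2" for a b :: real
      proof -
        have "a\<^sup>2 / (4 * C) + C * b\<^sup>2 - a * b = (a - 2 * C * b)\<^sup>2 / (4 * C)"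
          using C by (simp add: power2_eq_square field_simps)
        moreover have "(a - 2 * C * b)\<^sup>2 / (4 * C) \<ge> 0" using C by simp
        ultimately show ?thesis by simp
      qed
      ultimately have "\<bar>S (T - s) (U s) \<bullet> g\<bar> \<le> (norm (U s))\<^sup>2 / (4 * C) + C * k s"
        unfolding k_def by (meson order_trans)
      also have "\<dots> \<le> q s / (4 * C) + C * k s"
        using U(2)[of s] C by (intro add_right_mono divide_right_mono) auto
      finally show ?thesis .
    qed
    have bi: "integrable ?M (\<lambda>s. q s / (4 * C) + C * k s)"
      using qi ki by (intro Bochner_Integration.integrable_add integrable_divide integrable_mult_right) auto
    have kpos: "(LINT s|?M. k s) \<ge> 0" by (intro Bochner_Integration.integral_nonneg) (simp add: k_def)
    have "\<bar>I \<bullet> g\<bar> \<le> N\<^sup>2 / 4 + C * (LINT s|?M. k s)"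
    proof (cases "integrable ?M (\<lambda>s. S (T - s) (U s))")
      \<comment> \<open>A Bochner integral that does not exist is 0, and then the control has no effect at all.\<close>
      case False
      then show ?thesis using kpos C by (simp add: I_def not_integrable_integral_eq)
    next
      case True
      have "\<bar>I \<bullet> g\<bar> = \<bar>LINT s|?M. S (T - s) (U s) \<bullet> g\<bar>"
        unfolding I_def integral_inner_left[OF True] ..
      also have "\<dots> \<le> (LINT s|?M. q s / (4 * C) + C * k s)"
      proof (rule order_trans[OF integral_abs_bound integral_mono[OF _ bi]])
        show "integrable ?M (\<lambda>s. \<bar>S (T - s) (U s) \<bullet> g\<bar>)"
          by (rule integrable_abs[OF integrable_inner_left[OF True]])
        show "\<bar>S (T - s) (U s) \<bullet> g\<bar> \<le> q s / (4 * C) + C * k s" if "s \<in> space ?M" for s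
          using pt[of s] that by simp
      qed
      also have "\<dots> = (LINT s|?M. q s) / (4 * C) + C * (LINT s|?M. k s)"
        using qi ki by simp
      also have "\<dots> \<le> (C * N\<^sup>2) / (4 * C) + C * (LINT s|?M. k s)"
        using cost C unfolding q_def by (intro add_right_mono divide_right_mono) auto
      also have "(C * N\<^sup>2) / (4 * C) = N\<^sup>2 / 4" using C by simp
      finally show ?thesis .
    qed
    moreover have "N\<^sup>2 = S T f0 \<bullet> g"
      using T inner_S[of T f0 g] by (simp add: N_def f0_def power2_norm_eq_inner)
    moreover have "S T f0 \<bullet> g = mild_solution F \<omega> f0 h T \<bullet> g - I \<bullet> g"
      by (simp add: mild_solution_def I_def U_def inner_add_left)
    moreover have "mild_solution F \<omega> f0 h T \<bullet> g \<le> N\<^sup>2 / 4 + \<delta>\<^sup>2 * (norm g)\<^sup>2"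
    proof -
      have "mild_solution F \<omega> f0 h T \<bullet> g \<le> norm (mild_solution F \<omega> f0 h T) * norm g" by (rule norm_cauchy_schwarz)
      also have "\<dots> \<le> (\<delta> * N) * norm g" using small by (intro mult_right_mono) auto
      also have "\<dots> \<le> N\<^sup>2 / 4 + \<delta>\<^sup>2 * (norm g)\<^sup>2"
        using zero_le_power2[of "N / 2 - \<delta> * norm g"] by (simp add: power2_eq_square algebra_simps)
      finally show ?thesis .
    qed
    ultimately have "N\<^sup>2 \<le> 2 * \<delta>\<^sup>2 * (norm g)\<^sup>2 + 2 * C * (LINT s|?M. k s)" by linarith
    then show "(norm (S T g))\<^sup>2 \<le> 2 * C * (LINT s|?M. (norm (?R (S (T - s) g)))\<^sup>2) + \<epsilon> * (norm g)\<^sup>2"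
      unfolding \<delta>(2) N_def f0_def k_def by simp
  qed
qed

end

lemma mul_indicator_outside_tendsto:
  fixes f :: "'a::euclidean_space L2"
  shows "(\<lambda>n::nat. mul_L2 (indicator (- cball 0 (real n))) f) \<longlonglongrightarrow> 0"
proof -
  obtain v where v: "v \<in> borel_measurable borel" "square_integrable lebesgue v" "to_L2 v = f"
    by (rule L2_borel_rep)
  have eq: "mul_L2 (indicator (- cball 0 (real n))) f = f - to_L2 (trunc (real n) v)" for n :: nat
  proof -
    have m: "indicat_real (- cball (0::'a) (real n)) \<in> borel_measurable lebesgue"
      by (intro borel_imp_lebesgue_measurable borel_measurable_indicator) auto
    have b: "\<bar>indicat_real (- cball (0::'a) (real n)) x\<bar> \<le> 1" for x by (simp add: indicator_def)
    have "(\<lambda>x. indicat_real (- cball 0 (real n)) x *\<^sub>R v x) = (\<lambda>x. v x - trunc (real n) v x)"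
      by (auto simp: trunc_def indicator_def)
    then show ?thesis
      unfolding v(3)[symmetric] mul_L2_to_L2[OF m b v(2)]
      using to_L2_diff[OF v(2) trunc_square_integrable[OF v(1,2), of "real n"]] by (simp only:)
  qed
  have "(\<lambda>n::nat. f - to_L2 (trunc (real n) v)) \<longlonglongrightarrow> f - f"
    unfolding v(3)[symmetric] by (intro tendsto_intros trunc_tendsto v)
  then show ?thesis by (simp add: eq)
qed

context symbol
begin

text \<open>
  The value at time \<open>s\<close> of the evolution which starts from \<open>packet 0\<close>, as a function on the space.
\<close>

definition wave :: "real \<Rightarrow> 'a::euclidean_space \<Rightarrow> complex" where
  "wave s = ift (\<lambda>\<xi>. complex_of_real (exp (- s * F (norm \<xi>)) * indicator (cball 0 1) \<xi>))"

text \<open>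
  The translate by \<open>a\<close> of the function whose Fourier transform is the indicator of the unit ball.
\<close>

definition packet :: "'a::euclidean_space \<Rightarrow> 'a L2" where
  "packet a = inv fourier_L2 (to_L2 (\<lambda>\<xi>. indicator (cball 0 1) \<xi> *\<^sub>R cis (- (a \<bullet> \<xi>))))"

lemma unit_cball_measurable [measurable]: "cball (0::'a::euclidean_space) 1 \<in> sets borel"
  by simp

lemma packet_symbol:
  fixes a :: "'a::euclidean_space"
  assumes s: "s \<ge> 0"
  defines "v \<equiv> \<lambda>\<xi>. exp (- s * F (norm \<xi>)) *\<^sub>R (indicator (cball 0 1) \<xi> *\<^sub>R cis (- (a \<bullet> \<xi>)))"
  shows "v \<in> borel_measurable borel" "integrable lborel v" "square_integrable lebesgue v"
    and "fourier_L2 (S s (packet a)) = to_L2 v"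
proof -
  let ?B = "exp (s * c0)"
  show vm [measurable]: "v \<in> borel_measurable borel" unfolding v_def by measurable
  have le: "cmod (v \<xi>) \<le> ?B * indicator (cball 0 1) \<xi>" for \<xi>
    using exp_symbol_le[OF s order_refl, of \<xi>] by (simp add: v_def indicator_def)
  have iB: "integrable lborel (\<lambda>\<xi>::'a. ?B * indicator (cball 0 1) \<xi>)"
    by (intro integrable_mult_right integrable_indicator_cball)
  show "integrable lborel v"
    by (rule Bochner_Integration.integrable_bound[OF iB]) (use le in \<open>auto intro!: AE_I2 order_trans[OF le]\<close>)
  have le2: "(cmod (v \<xi>))\<^sup>2 \<le> ?B * (?B * indicator (cball 0 1) \<xi>)" for \<xi>
    using power_mono[OF le[of \<xi>], of 2] by (cases "\<xi> \<in> cball 0 1") (simp_all add: power2_eq_square)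
  show "square_integrable lebesgue v"
    unfolding square_integrable_borel[OF vm]
    by (rule Bochner_Integration.integrable_bound[OF integrable_mult_right[OF iB, of ?B]])
      (use le2 in \<open>auto intro!: AE_I2 order_trans[OF le2]\<close>)
  let ?v0 = "\<lambda>\<xi>::'a. indicator (cball 0 1) \<xi> *\<^sub>R cis (- (a \<bullet> \<xi>))"
  have v0m [measurable]: "?v0 \<in> borel_measurable borel" by measurable
  have sq0: "square_integrable lebesgue ?v0"
    unfolding square_integrable_borel[OF v0m]
    by (rule Bochner_Integration.integrable_bound[OF integrable_indicator_cball[of 0 1]])
      (auto simp: indicator_def)
  show "fourier_L2 (S s (packet a)) = to_L2 v"
    unfolding fourier_S packet_def fourier_L2_inv v_def
    by (rule mul_L2_to_L2[OF exp_symbol_measurable exp_symbol_le[OF s order_refl] sq0])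
qed

text \<open>
  Fourier multipliers commute with translations. The symbol is cut off at the unit ball, so the inverse
  Fourier integral converges absolutely, whatever the growth of \<open>F\<close>.
\<close>

lemma S_packet:
  fixes a :: "'a::euclidean_space"
  assumes s: "s \<ge> 0"
  shows "S s (packet a) = to_L2 (\<lambda>x. wave s (x - a))" and "square_integrable lebesgue (\<lambda>x. wave s (x - a))"
proof -
  let ?v = "\<lambda>\<xi>. exp (- s * F (norm \<xi>)) *\<^sub>R (indicator (cball 0 1) \<xi> *\<^sub>R cis (- (a \<bullet> \<xi>)))"
  note v = packet_symbol[OF s, of a]
  have eq: "(\<lambda>x. (1 / fourier_const TYPE('a)) *\<^sub>R (LINT \<xi>|lborel. cis (x \<bullet> \<xi>) * ?v \<xi>)) = (\<lambda>x. wave s (x - a))"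
  proof
    fix x
    have "cis (x \<bullet> \<xi>) * ?v \<xi> = cis ((x - a) \<bullet> \<xi>) * complex_of_real (exp (- s * F (norm \<xi>)) * indicator (cball 0 1) \<xi>)" for \<xi>
    proof -
      have "cis ((x - a) \<bullet> \<xi>) = cis (x \<bullet> \<xi>) * cis (- (a \<bullet> \<xi>))" by (simp add: cis_mult inner_diff_left)
      then show ?thesis by (simp add: scaleR_conv_of_real mult_ac)
    qed
    then show "(1 / fourier_const TYPE('a)) *\<^sub>R (LINT \<xi>|lborel. cis (x \<bullet> \<xi>) * ?v \<xi>) = wave s (x - a)"
      unfolding wave_def ift_def by (simp only:)
  qed
  have "S s (packet a) = inv fourier_L2 (to_L2 ?v)"
    unfolding v(4)[symmetric] inv_fourier_L2_fourier_L2 ..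
  then show "S s (packet a) = to_L2 (\<lambda>x. wave s (x - a))"
    unfolding inv_fourier_L2_to_L2(1)[OF v(2,3)] eq .
  show "square_integrable lebesgue (\<lambda>x. wave s (x - a))"
    using inv_fourier_L2_to_L2(2)[OF v(2,3)] unfolding eq .
qed

lemma wave_measurable: "s \<ge> 0 \<Longrightarrow> (wave s :: 'a::euclidean_space \<Rightarrow> complex) \<in> borel_measurable borel"
  and norm_wave_le: "0 \<le> s \<Longrightarrow> s \<le> T \<Longrightarrow>
    cmod (wave s (x::'a)) \<le> exp (T * c0) * (LINT \<xi>|lborel. indicator (cball (0::'a) 1) \<xi>) / fourier_const TYPE('a)"
proof -
  let ?u = "\<lambda>s (\<xi>::'a). complex_of_real (exp (- s * F (norm \<xi>)) * indicator (cball 0 1) \<xi>)"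
  have um [measurable]: "?u s \<in> borel_measurable borel" for s by measurable
  have le: "cmod (?u s \<xi>) \<le> exp (T * c0) * indicator (cball 0 1) \<xi>" if "0 \<le> s" "s \<le> T" for s T \<xi>
    using exp_symbol_le[OF that, of \<xi>] by (simp add: indicator_def)
  have iB: "integrable lborel (\<lambda>\<xi>::'a. exp (T * c0) * indicator (cball 0 1) \<xi>)" for T
    by (intro integrable_mult_right integrable_indicator_cball)
  have ui: "integrable lborel (?u s)" if "s \<ge> 0" for s
  proof (rule Bochner_Integration.integrable_bound[OF iB[of s]])
    show "?u s \<in> borel_measurable lborel" using um by simp
    show "AE \<xi> in lborel. norm (?u s \<xi>) \<le> norm (exp (s * c0) * indicator (cball (0::'a) 1) \<xi>)"
      using le[OF that order_refl] by (intro AE_I2) (auto simp: indicator_def)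
  qed
  show "s \<ge> 0 \<Longrightarrow> (wave s :: 'a \<Rightarrow> complex) \<in> borel_measurable borel"
    unfolding wave_def by (intro ift_measurable ui)
  assume s: "0 \<le> s" "s \<le> T"
  have "cmod (LINT \<xi>|lborel. cis (x \<bullet> \<xi>) * ?u s \<xi>) \<le> (LINT \<xi>|lborel. cmod (?u s \<xi>))"
    by (rule norm_bounded_kernel_le[OF ui[OF s(1)]]) simp
  also have "\<dots> \<le> (LINT \<xi>|lborel. exp (T * c0) * indicator (cball (0::'a) 1) \<xi>)"
    by (rule integral_mono[OF integrable_norm[OF ui[OF s(1)]] iB le[OF s]])
  also have "\<dots> = exp (T * c0) * (LINT \<xi>|lborel. indicator (cball (0::'a) 1) \<xi>)"
    by (rule integral_mult_right_zero)
  finally show "cmod (wave s x) \<le> exp (T * c0) * (LINT \<xi>|lborel. indicator (cball (0::'a) 1) \<xi>) / fourier_const TYPE('a)"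
    unfolding wave_def ift_def by (simp add: divide_right_mono)
qed

lemma packet_norms:
  fixes a :: "'a::euclidean_space"
  shows norm_S_packet: "s \<ge> 0 \<Longrightarrow> norm (S s (packet a)) = norm (S s (packet (0::'a)))"
    and norm_packet: "norm (packet a) = norm (packet (0::'a))"
    and S_packet_nonzero: "s \<ge> 0 \<Longrightarrow> S s (packet a) \<noteq> 0"
proof -
  have n: "norm (inv fourier_L2 (to_L2 v)) = norm (inv fourier_L2 (to_L2 w))"
    if "square_integrable lebesgue v" "square_integrable lebesgue w" "\<And>\<xi>. cmod (v \<xi>) = cmod (w \<xi>)" for v w :: "'a \<Rightarrow> complex"
    unfolding norm_inv_fourier_L2 norm_to_L2[OF that(1)] norm_to_L2[OF that(2)] that(3) ..
  have inv: "S s (packet a) = inv fourier_L2 (to_L2 (\<lambda>\<xi>. exp (- s * F (norm \<xi>)) *\<^sub>R (indicator (cball 0 1) \<xi> *\<^sub>R cis (- (a \<bullet> \<xi>)))))"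
    if "s \<ge> 0" for s and a :: 'a
    unfolding packet_symbol(4)[OF that, symmetric] inv_fourier_L2_fourier_L2 ..
  show "norm (S s (packet a)) = norm (S s (packet (0::'a)))" if "s \<ge> 0"
    unfolding inv[OF that] by (rule n[OF packet_symbol(3)[OF that] packet_symbol(3)[OF that]]) simp
  have sq: "square_integrable lebesgue (\<lambda>\<xi>. indicator (cball 0 1) \<xi> *\<^sub>R cis (- (a \<bullet> \<xi>)))" for a :: 'a
    using packet_symbol(3)[OF order_refl, of a] by simp
  show "norm (packet a) = norm (packet (0::'a))"
    unfolding packet_def by (rule n[OF sq sq]) simp
  show "S s (packet a) \<noteq> 0" if s: "s \<ge> 0"
  proof
    let ?v = "\<lambda>\<xi>. exp (- s * F (norm \<xi>)) *\<^sub>R (indicator (cball 0 1) \<xi> *\<^sub>R cis (- (a \<bullet> \<xi>)))"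
    assume "S s (packet a) = 0"
    then have "to_L2 ?v = 0"
      using packet_symbol(4)[OF s, of a] linear_0[OF bounded_linear.linear[OF bounded_linear_fourier_L2]] by metis
    moreover have "to_L2 (\<lambda>x::'a. 0) = 0" using to_L2_scaleR[OF square_integrable_zero, of 0] by simp
    ultimately have "AE \<xi> in lebesgue. ?v \<xi> = 0"
      using to_L2_eq_iff[OF packet_symbol(3)[OF s, of a] square_integrable_zero] by metis
    then have "AE \<xi> in lebesgue. \<xi> \<notin> cball (0::'a) 1"
      by (rule AE_mp) (intro AE_I2, auto simp: indicator_def)
    then have "cball (0::'a) 1 \<in> null_sets lebesgue" by (subst AE_iff_null_sets) auto
    then have "measure lebesgue (cball (0::'a) 1) = 0" by (auto simp: measure_def)
    then show False using content_cball_pos[of 1 "0::'a"] by (simp add: measure_completion)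
  qed
qed

text \<open>
  Split \<open>\<omega>\<close> at the ball of radius \<open>R\<close> about \<open>a\<close>. Outside the ball \<open>\<omega>\<close> is dropped, and translation by \<open>a\<close>
  leads back to \<open>packet 0\<close>; inside, the pointwise bound \<open>K\<close> is used.
\<close>

lemma packet_observation_le:
  fixes a :: "'a::euclidean_space"
  assumes \<omega>: "\<omega> \<in> sets lebesgue" and s: "s \<ge> 0" and K: "\<And>x :: 'a. cmod (wave s x) \<le> K"
  shows "(norm (mul_L2 (indicator \<omega>) (S s (packet a))))\<^sup>2
    \<le> (norm (mul_L2 (indicator (- cball 0 R)) (S s (packet (0::'a)))))\<^sup>2 + K\<^sup>2 * measure lebesgue (\<omega> \<inter> cball a R)"
proof -
  let ?w = "wave s :: 'a \<Rightarrow> complex"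
  have wm [measurable]: "?w \<in> borel_measurable borel" by (rule wave_measurable[OF s])
  have m: "indicat_real \<omega> \<in> borel_measurable lebesgue" using \<omega> by simp
  have b: "\<bar>indicat_real A x\<bar> \<le> 1" for A and x :: 'a by (simp add: indicator_def)
  have mR: "indicat_real (- cball (0::'a) R) \<in> borel_measurable lebesgue"
    by (intro borel_imp_lebesgue_measurable borel_measurable_indicator) auto
  note sqa = S_packet(2)[OF s, of a]
  have sq0: "square_integrable lebesgue ?w" using S_packet(2)[OF s, of 0] by simp
  define H where "H x = (cmod (indicator (- cball 0 R) x *\<^sub>R ?w x))\<^sup>2" for x
  have Hm [measurable]: "H \<in> borel_measurable borel" unfolding H_def by measurable
  have "(norm (mul_L2 (indicator (- cball 0 R)) (S s (packet (0::'a)))))\<^sup>2 = (LINT x|lebesgue. H x)"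
  proof -
    have "S s (packet (0::'a)) = to_L2 ?w" using S_packet(1)[OF s, of "0::'a"] by simp
    then show ?thesis
      unfolding H_def using norm_to_L2[OF square_integrable_mul[OF mR b sq0]] mul_L2_to_L2[OF mR b sq0] by simp
  qed
  also have "\<dots> = (LINT x|lborel. H x)" by (rule integral_completion) simp
  also have "\<dots> = (LINT x|lborel. H (x - a))"
    using integral_lborel_affine[OF Hm, of 1 "- a"] by simp
  also have "\<dots> = (LINT x|lebesgue. H (x - a))" by (rule integral_completion[symmetric]) simp
  finally have tail: "(norm (mul_L2 (indicator (- cball 0 R)) (S s (packet (0::'a)))))\<^sup>2 = (LINT x|lebesgue. H (x - a))" .
  have lm: "\<omega> \<inter> cball a R \<in> lmeasurable"
    using fmeasurable_Int_fmeasurable[OF lmeasurable_cball \<omega>, of a R] by (simp add: Int_commute)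
  have Ki: "integrable lebesgue (\<lambda>x. K\<^sup>2 * indicator (\<omega> \<inter> cball a R) x)"
    using lm by (intro integrable_mult_right integrable_real_indicator) (auto simp: fmeasurable_def)
  have Hi: "integrable lebesgue (\<lambda>x. H (x - a))"
  proof (rule Bochner_Integration.integrable_bound)
    show "integrable lebesgue (\<lambda>x. (cmod (?w (x - a)))\<^sup>2)" using sqa by (simp add: square_integrable_def)
    show "(\<lambda>x. H (x - a)) \<in> borel_measurable lebesgue" by (intro borel_imp_lebesgue_measurable) measurable
  qed (auto simp: H_def indicator_def)
  have "(norm (mul_L2 (indicator \<omega>) (S s (packet a))))\<^sup>2 = (LINT x|lebesgue. (cmod (indicator \<omega> x *\<^sub>R ?w (x - a)))\<^sup>2)"
    unfolding S_packet(1)[OF s] mul_L2_to_L2[OF m b sqa] norm_to_L2[OF square_integrable_mul[OF m b sqa]] by simp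
  also have "\<dots> \<le> (LINT x|lebesgue. H (x - a) + K\<^sup>2 * indicator (\<omega> \<inter> cball a R) x)"
  proof (rule integral_mono)
    show "integrable lebesgue (\<lambda>x. (cmod (indicator \<omega> x *\<^sub>R ?w (x - a)))\<^sup>2)"
      using square_integrable_mul[OF m b sqa] by (simp add: square_integrable_def)
    show "integrable lebesgue (\<lambda>x. H (x - a) + K\<^sup>2 * indicator (\<omega> \<inter> cball a R) x)"
      by (rule Bochner_Integration.integrable_add[OF Hi Ki])
    fix x
    have "(cmod (?w (x - a)))\<^sup>2 \<le> K\<^sup>2" by (intro power_mono K) auto
    moreover have "x - a \<in> cball 0 R \<longleftrightarrow> x \<in> cball a R" by (simp add: dist_norm norm_minus_commute)
    ultimately show "(cmod (indicator \<omega> x *\<^sub>R ?w (x - a)))\<^sup>2 \<le> H (x - a) + K\<^sup>2 * indicator (\<omega> \<inter> cball a R) x"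
      by (auto simp: H_def indicator_def)
  qed
  also have "\<dots> = (LINT x|lebesgue. H (x - a)) + K\<^sup>2 * measure lebesgue (\<omega> \<inter> cball a R)"
    unfolding Bochner_Integration.integral_add[OF Hi Ki] integral_mult_right_zero by simp
  finally show ?thesis unfolding tail .
qed

text \<open>
  Apply observability to all packets. They have the same norm, and so have their evolutions, so the total observation
  is at least a positive constant. The share of the observation coming from outside the ball of radius
  \<open>R\<close> does not depend on \<open>a\<close> and tends to 0 as \<open>R\<close> tends to infinity, by dominated convergence in time. For a
  suitable \<open>R\<close> the remainder is at most a multiple of the measure of \<open>\<omega>\<close> in the ball.
\<close>

lemma controllable_imp_ball_lower_bound:
  fixes \<omega> :: "'a::euclidean_space set"
  assumes T: "T > 0" and \<omega>: "\<omega> \<in> sets lebesgue" and ctrl: "cost_uniformly_approx_null_controllable F \<omega> T"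
  shows "\<exists>R>0. \<exists>c>0. \<forall>a. c \<le> measure lebesgue (\<omega> \<inter> cball a R)"
proof -
  let ?M = "lebesgue_on {0<..<T}"
  let ?p = "packet (0::'a)"
  define N where "N = (norm (S T ?p))\<^sup>2"
  have N: "N > 0" using S_packet_nonzero[of T "0::'a"] T by (simp add: N_def)
  define P where "P = (norm ?p)\<^sup>2"
  have P: "P \<ge> 0" by (simp add: P_def)
  \<comment> \<open>The term with \<epsilon> takes away at most half of N.\<close>
  define \<epsilon> where "\<epsilon> = N / (2 * (P + 1))"
  have \<epsilon>: "\<epsilon> > 0" "\<epsilon> * P \<le> N / 2" using N P by (auto simp: \<epsilon>_def field_simps)
  obtain C where C: "C > 0" and obs: "\<And>g :: 'a L2. (norm (S T g))\<^sup>2 \<le>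
    C * (LINT s|?M. (norm (mul_L2 (indicator \<omega>) (S (T - s) g)))\<^sup>2) + \<epsilon> * (norm g)\<^sup>2"
    using controllable_imp_observable[OF T \<omega> ctrl \<epsilon>(1)] by blast
  define K where "K = exp (T * c0) * (LINT \<xi>|lborel. indicator (cball (0::'a) 1) \<xi>) / fourier_const TYPE('a)"
  have K: "cmod (wave s (x::'a)) \<le> K" if "0 \<le> s" "s \<le> T" for s x
    unfolding K_def by (rule norm_wave_le[OF that])
  have bR: "bounded_linear (mul_L2 (indicator A) :: 'a L2 \<Rightarrow> 'a L2)" if "A \<in> sets lebesgue" for A
    by (rule bounded_linear_mul_indicator[OF that])
  have out: "- cball (0::'a) r \<in> sets lebesgue" for r by simp
  define tail where "tail n s = (norm (mul_L2 (indicator (- cball 0 (real n))) (S (T - s) ?p)))\<^sup>2" for n :: nat and s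
  have ti: "integrable ?M (tail n)" for n unfolding tail_def by (rule observation_integrable[OF bR[OF out]])
  have "(\<lambda>n. LINT s|?M. tail n s) \<longlonglongrightarrow> (LINT s|?M. 0)"
  proof (rule integral_dominated_convergence)
    show "integrable ?M (\<lambda>s. (norm (S (T - s) ?p))\<^sup>2)"
      by (rule observation_integrable[OF bounded_linear_ident])
    show "AE s in ?M. (\<lambda>n. tail n s) \<longlonglongrightarrow> 0"
    proof (intro AE_I2)
      fix s
      have "(\<lambda>n. (norm (mul_L2 (indicator (- cball 0 (real n))) (S (T - s) ?p)))\<^sup>2) \<longlonglongrightarrow> (norm (0 :: 'a L2))\<^sup>2"
        by (intro tendsto_intros mul_indicator_outside_tendsto)
      then show "(\<lambda>n. tail n s) \<longlonglongrightarrow> 0" by (simp add: tail_def)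
    qed
    show "AE s in ?M. norm (tail n s) \<le> (norm (S (T - s) ?p))\<^sup>2" for n
      unfolding tail_def by (intro AE_I2) (simp add: power_mono norm_mul_indicator_le[OF out])
  qed (use ti in auto)
  then have "(\<lambda>n. LINT s|?M. tail n s) \<longlonglongrightarrow> 0" by simp
  moreover have "N / (4 * C) > 0" using N C by simp
  ultimately have "\<forall>\<^sub>F n in sequentially. (LINT s|?M. tail n s) < N / (4 * C)" by (rule order_tendstoD)
  then have "\<forall>\<^sub>F n in sequentially. (LINT s|?M. tail n s) < N / (4 * C) \<and> n \<ge> 1"
    using eventually_ge_at_top[of 1] by eventually_elim simp
  then obtain n where n: "(LINT s|?M. tail n s) < N / (4 * C)" "n \<ge> 1"
    by (auto simp: eventually_sequentially)
  show ?thesis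
  proof (rule exI[of _ "real n"], intro exI[of _ "N / (4 * C) / (T * (K\<^sup>2 + 1))"] conjI allI)
    show "real n > 0" using n by simp
    have KT: "T * (K\<^sup>2 + 1) > 0" using T by (simp add: add_nonneg_pos)
    show "N / (4 * C) / (T * (K\<^sup>2 + 1)) > 0" using N C KT by simp
    fix a :: 'a
    let ?\<mu> = "measure lebesgue (\<omega> \<inter> cball a (real n))"
    let ?k = "\<lambda>s. (norm (mul_L2 (indicator \<omega>) (S (T - s) (packet a))))\<^sup>2"
    have cK: "integrable ?M (\<lambda>s. K\<^sup>2 * ?\<mu>)"
      by (subst integrable_restrict_space)
        (auto simp: integrable_completion intro!: integrable_mult_left integrable_indicator_greaterThanLessThan)
    have "(LINT s|?M. ?k s) \<le> (LINT s|?M. tail n s + K\<^sup>2 * ?\<mu>)"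
    proof (rule integral_mono)
      show "integrable ?M ?k" by (rule observation_integrable[OF bR[OF \<omega>]])
      show "integrable ?M (\<lambda>s. tail n s + K\<^sup>2 * ?\<mu>)" by (rule Bochner_Integration.integrable_add[OF ti cK])
      fix s assume "s \<in> space ?M"
      then have s: "T - s \<ge> 0" "T - s \<le> T" by auto
      show "?k s \<le> tail n s + K\<^sup>2 * ?\<mu>"
        unfolding tail_def by (rule packet_observation_le[OF \<omega> s(1) K[OF s]])
    qed
    also have "\<dots> = (LINT s|?M. tail n s) + T * (K\<^sup>2 * ?\<mu>)"
    proof -
      have "(LINT s|?M. K\<^sup>2 * ?\<mu>) = (LINT s|lebesgue. indicator {0<..<T} s *\<^sub>R (K\<^sup>2 * ?\<mu>))"
        by (rule integral_restrict_space) simp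
      then show ?thesis using T Bochner_Integration.integral_add[OF ti cK] by simp
    qed
    also have "\<dots> \<le> N / (4 * C) + T * (K\<^sup>2 * ?\<mu>)" using n by simp
    finally have up: "(LINT s|?M. ?k s) \<le> N / (4 * C) + T * (K\<^sup>2 * ?\<mu>)" .
    have "N \<le> C * (LINT s|?M. ?k s) + \<epsilon> * P"
      using obs[of "packet a"] T by (simp add: N_def P_def norm_packet[of a] norm_S_packet[of T a])
    also have "\<dots> \<le> C * (N / (4 * C) + T * (K\<^sup>2 * ?\<mu>)) + N / 2"
      using up C \<epsilon>(2) by (intro add_mono mult_left_mono) auto
    finally have "N / (4 * C) \<le> T * (K\<^sup>2 * ?\<mu>)" using C by (simp add: field_simps)
    also have "\<dots> \<le> T * ((K\<^sup>2 + 1) * ?\<mu>)" using T by (intro mult_left_mono mult_right_mono) auto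
    finally have "N / (4 * C) \<le> ?\<mu> * (T * (K\<^sup>2 + 1))" by (simp only: mult_ac)
    then show "N / (4 * C) / (T * (K\<^sup>2 + 1)) \<le> ?\<mu>" by (simp only: pos_divide_le_eq[OF KT])
  qed
qed

end

section \<open>The characterisation by thickness\<close>

lemma cart_cube_Basis:
  "{y :: real ^ 'n. \<forall>i. y $ i \<in> {0..L}} = {y. \<forall>b\<in>Basis. y \<bullet> b \<in> {0..L}}"
  by (auto simp: Basis_vec_def cart_eq_inner_axis)

text \<open>
  A cube of side \<open>2R\<close> contains a ball of radius \<open>R\<close>. The minimum with 1/2 keeps \<open>\<gamma>\<close> below 1.
\<close>

lemma thickI_ball_lower_bound:
  fixes \<omega> :: "(real ^ 'n) set"
  assumes \<omega>: "\<omega> \<in> sets lebesgue" and R: "R > 0" and c: "c > 0" "\<And>a. c \<le> measure lebesgue (\<omega> \<inter> cball a R)"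
  shows "thick \<omega>"
proof -
  define L where "L = 2 * R"
  have L: "L > 0" using R by (simp add: L_def)
  define \<gamma> where "\<gamma> = min (1 / 2) (c / L ^ CARD('n))"
  have \<gamma>: "\<gamma> \<in> {0<..<1}" "\<gamma> * L ^ CARD('n) \<le> c"
    using L c(1) by (auto simp: \<gamma>_def min_def field_simps)
  have "c \<le> measure lebesgue (\<omega> \<inter> (+) x ` {y. \<forall>i. y $ i \<in> {0..L}})" for x :: "real ^ 'n"
  proof -
    have cube: "{y :: real ^ 'n. \<forall>i. y $ i \<in> {0..L}} = cbox 0 (\<chi> i. L)"
      by (auto simp: mem_box_cart)
    have m: "\<omega> \<inter> (+) x ` cbox 0 (\<chi> i. L) \<in> lmeasurable"
      using fmeasurable_Int_fmeasurable[OF _ \<omega>, of "(+) x ` cbox 0 (\<chi> i. L)"]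
      by (simp add: Int_commute cbox_translation[symmetric])
    have "cball (x + (\<chi> i. R)) R \<subseteq> (+) x ` cbox 0 (\<chi> i. L)"
    proof
      fix y assume y: "y \<in> cball (x + (\<chi> i. R)) R"
      have "\<bar>(x + (\<chi> i. R) - y) $ i\<bar> \<le> R" for i
        using component_le_norm_cart[of "x + (\<chi> i. R) - y" i] y by (simp add: dist_norm)
      then have "y - x \<in> cbox 0 (\<chi> i. L)"
        by (auto simp: mem_box_cart L_def abs_le_iff)
      then show "y \<in> (+) x ` cbox 0 (\<chi> i. L)" by (auto intro!: image_eqI[of _ _ "y - x"])
    qed
    then have "measure lebesgue (\<omega> \<inter> cball (x + (\<chi> i. R)) R) \<le> measure lebesgue (\<omega> \<inter> (+) x ` cbox 0 (\<chi> i. L))"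
      using \<omega> by (intro measure_mono_fmeasurable m) auto
    then show ?thesis unfolding cube using c(2)[of "x + (\<chi> i. R)"] by linarith
  qed
  then show ?thesis
    using \<gamma> L \<omega> unfolding thick_def thick_at_scale_def by (meson order_trans)
qed

theorem theorem2p6:
  fixes F :: "real \<Rightarrow> real" and \<omega> :: "(real ^ 'n) set"
  assumes "continuous_on {0..} F"
    and "bdd_below (F ` {0..})"
    and "\<omega> \<in> sets lebesgue"
    and "\<forall>k. bdd_above ((\<lambda>r. r ^ k * exp (- F r)) ` {0..})"
    and "quasi_analytic (\<lambda>k. SUP r\<in>{0..}. r ^ k * exp (- F r))"
  shows "\<forall>T>0. cost_uniformly_approx_null_controllable F \<omega> T \<longleftrightarrow> thick \<omega>"
proof (intro allI impI)
  fix T :: real assume T: "T > 0"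
  obtain m where m: "\<And>r. r \<ge> 0 \<Longrightarrow> m \<le> F r"
    using assms(2) by (auto simp: bdd_below_def)
  interpret rapid_symbol F "\<bar>m\<bar>"
  proof unfold_locales
    show "- \<bar>m\<bar> \<le> F r" if "r \<ge> 0" for r using m[OF that] by linarith
  qed (use assms in auto)
  have fu: "flat_unique (moment F 1)"
    using quasi_analytic_flat_unique[OF assms(5)] by (simp add: moment_def[abs_def])
  show "cost_uniformly_approx_null_controllable F \<omega> T \<longleftrightarrow> thick \<omega>"
  proof
    assume "cost_uniformly_approx_null_controllable F \<omega> T"
    from controllable_imp_ball_lower_bound[OF T assms(3) this]
    show "thick \<omega>" using thickI_ball_lower_bound[OF assms(3)] by blast
  next
    assume "thick \<omega>"
    then obtain \<gamma> L where \<gamma>: "\<gamma> > 0" and L: "L > 0" and th: "thick_at_scale \<gamma> L \<omega>"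
      by (auto simp: thick_def)
    have th': "\<gamma> * L ^ DIM(real ^ 'n) \<le> measure lebesgue (\<omega> \<inter> (+) x ` {y. \<forall>b\<in>Basis. y \<bullet> b \<in> {0..L}})" for x
      using th unfolding thick_at_scale_def cart_cube_Basis by simp
    have T2: "T / 2 > 0" using T by simp
    show "cost_uniformly_approx_null_controllable F \<omega> T"
      by (rule observability_imp_controllable[OF T refl assms(3) uncertainty_principle[OF fu T2 L \<gamma> assms(3) th']])
  qed
qed

end
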